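(* Let $0<q\le 1$ and $p-1<\alpha\le p_s^*-1$, and let $$\Lambda_1=\sup\{\lambda>0:\ \text{for each } u\in X_{+,q}\setminus\{0\},\ \phi_u(t)=I_\lambda(tu)\ \text{has two critical points in } (0,\infty)\}.$$ For all $\lambda\in(0,\Lambda_1)$, the problem $(P_\lambda)$ has at least two distinct (positive weak) solutions in $X_{+,q}$ when $\alpha<p_s^*-1$, and at least one (positive weak) solution in $X_{+,q}$ in the critical case $\alpha=p_s^*-1$.
   Context: Let $1<p<\infty$, $s\in(0,1)$, $n>sp$, $p_s^*=\frac{np}{n-sp}$, and let $\Omega\subset\mathbb{R}^n$ be a bounded domain with smooth boundary. Put $Q=\mathbb{R}^{2n}\setminus((\mathbb{R}^n\setminus\Omega)\times(\mathbb{R}^n\setminus\Omega))$. $X_0$ is the space of measurable $u:\mathbb{R}^n\to\mathbb{R}$ with $u|_\Omega\in L^p(\Omega)$, $u=0$ a.e. in $\mathbb{R}^n\setminus\Omega$ and $\|u\|:=\left(\int_Q\frac{|u(x)-u(y)|^p}{|x-y|^{n+sp}}\,dx\,dy\right)^{1/p}<\infty$; $\|\cdot\|$ is the norm on $X_0$. Let $G_q(x)=\frac{|x|^{1-q}}{1-q}$ if $0<q<1$ and $G_1(x)=\ln|x|$. Let $X_+=\{u\in X_0: u\ge 0\}$ and $X_{+,q}=\{u\in X_+: u\not\equiv 0,\ G_q(u)\in L^1(\Omega)\}$. For $\lambda>0$ define $I_\lambda:X_0\to(-\infty,\infty]$ by $I_\lambda(u)=\frac1p\|u\|^p-\lambda\int_\Omega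 G_q(u)\,dx-\frac{1}{\alpha+1}\int_\Omega|u|^{\alpha+1}\,dx$. For $u\in X_{+,q}$ the fiber map is $\phi_u:(0,\infty)\to\mathbb{R}$, $\phi_u(t)=I_\lambda(tu)$ (it depends on $\lambda$). $(P_\lambda)$ is the problem $(-\Delta_p)^su=\lambda u^{-q}+u^\alpha$, $u>0$ in $\Omega$, $u=0$ in $\mathbb{R}^n\setminus\Omega$. A positive weak solution of $(P_\lambda)$ is $u\in X_0$ with $u>0$ in $\Omega$ and, for all $\psi\in C_c^\infty(\Omega)$, $$\int_Q\frac{|u(x)-u(y)|^{p-2}(u(x)-u(y))(\psi(x)-\psi(y))}{|x-y|^{n+sp}}\,dx\,dy-\int_\Omega(\lambda u^{-q}+u^\alpha)\psi\,dx=0.$$ *)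

theory Defs
  imports "HOL-Analysis.Analysis"
begin

text \<open>Functions of class \<open>C\<^sup>k\<close> on an open set, by recursion on the first partial derivatives
  with respect to the standard orthonormal basis.\<close>

fun Ck_on :: "nat \<Rightarrow> 'a::euclidean_space set \<Rightarrow> ('a \<Rightarrow> real) \<Rightarrow> bool" where
  "Ck_on 0 S f \<longleftrightarrow> continuous_on S f"
| "Ck_on (Suc k) S f \<longleftrightarrow>
     f differentiable_on S \<and> (\<forall>i\<in>Basis. Ck_on k S (\<lambda>x. frechet_derivative f (at x) i))"

definition Cinf :: "('a::euclidean_space \<Rightarrow> real) \<Rightarrow> bool" where
  "Cinf f \<longleftrightarrow> (\<forall>k. Ck_on k UNIV f)"

definition test_functions :: "'a::euclidean_space set \<Rightarrow> ('a \<Rightarrow> real) set" where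
  "test_functions \<Omega> =
     {\<psi>. Cinf \<psi> \<and> compact (closure {x. \<psi> x \<noteq> 0}) \<and> closure {x. \<psi> x \<noteq> 0} \<subseteq> \<Omega>}"

text \<open>Near each boundary point, \<open>\<Omega>\<close> is the part of a ball lying strictly above the graph of a
  smooth function \<open>\<gamma>\<close> over the hyperplane orthogonal to some unit vector \<open>e\<close>. A function on that
  hyperplane is represented by its composition with the orthogonal projection, hence \<open>\<gamma>\<close> may be
  taken to be defined on the whole space.\<close>

definition smooth_boundary :: "'a::euclidean_space set \<Rightarrow> bool" where
  "smooth_boundary \<Omega> \<longleftrightarrow>
     (\<forall>z\<in>frontier \<Omega>. \<exists>r>0. \<exists>e \<gamma>. norm e = 1 \<and> Cinf \<gamma> \<and>
        \<Omega> \<inter> ball z r = {x \<in> ball z r. \<gamma> (x - (x \<bullet> e) *\<^sub>R e) < x \<bullet> e})"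

definition bounded_smooth_domain :: "'a::euclidean_space set \<Rightarrow> bool" where
  "bounded_smooth_domain \<Omega> \<longleftrightarrow>
     open \<Omega> \<and> connected \<Omega> \<and> \<Omega> \<noteq> {} \<and> bounded \<Omega> \<and> smooth_boundary \<Omega>"

definition crit_exp :: "nat \<Rightarrow> real \<Rightarrow> real \<Rightarrow> real" where
  "crit_exp n p s = real n * p / (real n - s * p)"

definition Qset :: "(real^'n) set \<Rightarrow> ((real^'n) \<times> (real^'n)) set" where
  "Qset \<Omega> = UNIV - (- \<Omega>) \<times> (- \<Omega>)"

text \<open>The \<open>p\<close>-th power of the norm of \<open>X\<^sub>0\<close>, possibly infinite. On the diagonal, a null set, the
  quotient is \<open>0 / 0 = 0\<close>.\<close>

definition energy :: "real \<Rightarrow> real \<Rightarrow> (real^'n) set \<Rightarrow> (real^'n \<Rightarrow> real) \<Rightarrow> ennreal" where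
  "energy p s \<Omega> u =
     (\<integral>\<^sup>+z\<in>Qset \<Omega>. ennreal (\<bar>u (fst z) - u (snd z)\<bar> powr p
          / norm (fst z - snd z) powr (real CARD('n) + s * p)) \<partial>lebesgue)"

text \<open>Elements of \<open>X\<^sub>0\<close> are functions, not classes of functions equal almost everywhere;
  accordingly signs and (in)equalities are always understood almost everywhere.\<close>

definition X0 :: "real \<Rightarrow> real \<Rightarrow> (real^'n) set \<Rightarrow> (real^'n \<Rightarrow> real) set" where
  "X0 p s \<Omega> =
     {u. u \<in> borel_measurable lebesgue \<and>
         set_integrable lebesgue \<Omega> (\<lambda>x. \<bar>u x\<bar> powr p) \<and>
         (AE x in lebesgue. x \<notin> \<Omega> \<longrightarrow> u x = 0) \<and>
         energy p s \<Omega> u < \<infinity>}"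

definition X0_norm :: "real \<Rightarrow> real \<Rightarrow> (real^'n) set \<Rightarrow> (real^'n \<Rightarrow> real) \<Rightarrow> real" where
  "X0_norm p s \<Omega> u = enn2real (energy p s \<Omega> u) powr (1 / p)"

text \<open>Extended-real valued because \<open>G\<^sub>1(0) = -\<infinity>\<close>, whereas \<open>ln 0 = 0\<close> in HOL.\<close>

definition G :: "real \<Rightarrow> real \<Rightarrow> ereal" where
  "G q x = (if q = 1 then (if x = 0 then -\<infinity> else ereal (ln \<bar>x\<bar>))
            else ereal (\<bar>x\<bar> powr (1 - q) / (1 - q)))"

text \<open>Lebesgue integral over \<open>A\<close> of an extended-real valued function: integral of the positive part
  minus integral of the negative part (\<open>e2ennreal\<close> sends negative numbers to 0).\<close>

definition ext_integral :: "'a::euclidean_space set \<Rightarrow> ('a \<Rightarrow> ereal) \<Rightarrow> ereal" where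
  "ext_integral A f =
     enn2ereal (\<integral>\<^sup>+x\<in>A. e2ennreal (f x) \<partial>lebesgue) -
     enn2ereal (\<integral>\<^sup>+x\<in>A. e2ennreal (- f x) \<partial>lebesgue)"

definition ext_L1 :: "'a::euclidean_space set \<Rightarrow> ('a \<Rightarrow> ereal) \<Rightarrow> bool" where
  "ext_L1 A f \<longleftrightarrow>
     (\<lambda>x. if x \<in> A then f x else 0) \<in> borel_measurable lebesgue \<and>
     (\<integral>\<^sup>+x\<in>A. e2ennreal \<bar>f x\<bar> \<partial>lebesgue) < \<infinity>"

definition Xplus :: "real \<Rightarrow> real \<Rightarrow> (real^'n) set \<Rightarrow> (real^'n \<Rightarrow> real) set" where
  "Xplus p s \<Omega> = {u \<in> X0 p s \<Omega>. AE x in lebesgue. 0 \<le> u x}"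

definition Xplusq :: "real \<Rightarrow> real \<Rightarrow> real \<Rightarrow> (real^'n) set \<Rightarrow> (real^'n \<Rightarrow> real) set" where
  "Xplusq p s q \<Omega> =
     {u \<in> Xplus p s \<Omega>. \<not> (AE x in lebesgue. u x = 0) \<and> ext_L1 \<Omega> (\<lambda>x. G q (u x))}"

text \<open>On \<open>X\<^sub>0\<close>, for \<open>\<alpha> + 1\<close> at most \<open>crit_exp\<close>, the last integral is finite, as is the integral of the positive part of \<open>G q (u x)\<close>,
  so that no \<open>\<infinity> - \<infinity>\<close> occurs and the value is never \<open>-\<infinity>\<close>.\<close>

definition I_fun ::
  "real \<Rightarrow> real \<Rightarrow> real \<Rightarrow> real \<Rightarrow> (real^'n) set \<Rightarrow> real \<Rightarrow> (real^'n \<Rightarrow> real) \<Rightarrow> ereal" where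
  "I_fun p s q \<alpha> \<Omega> lam u =
     ereal (1 / p * X0_norm p s \<Omega> u powr p)
     - ereal lam * ext_integral \<Omega> (\<lambda>x. G q (u x))
     - ereal (1 / (\<alpha> + 1)) * ext_integral \<Omega> (\<lambda>x. ereal (\<bar>u x\<bar> powr (\<alpha> + 1)))"

definition fiber_map ::
  "real \<Rightarrow> real \<Rightarrow> real \<Rightarrow> real \<Rightarrow> (real^'n) set \<Rightarrow> real \<Rightarrow> (real^'n \<Rightarrow> real) \<Rightarrow> real \<Rightarrow> real" where
  "fiber_map p s q \<alpha> \<Omega> lam u t = real_of_ereal (I_fun p s q \<alpha> \<Omega> lam (\<lambda>x. t * u x))"

definition critical_points :: "(real \<Rightarrow> real) \<Rightarrow> real set" where
  "critical_points f = {t. 0 < t \<and> (f has_real_derivative 0) (at t)}"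

text \<open>The supremum is taken in the extended reals, so it may be \<open>\<infinity>\<close>.\<close>

definition Lambda1 :: "real \<Rightarrow> real \<Rightarrow> real \<Rightarrow> real \<Rightarrow> (real^'n) set \<Rightarrow> ereal" where
  "Lambda1 p s q \<alpha> \<Omega> =
     Sup (ereal ` {lam. 0 < lam \<and>
       (\<forall>u\<in>Xplusq p s q \<Omega>. card (critical_points (fiber_map p s q \<alpha> \<Omega> lam u)) = 2)})"

text \<open>Integrability of both integrands is part of the definition, since non-integrable functions
  have Bochner integral 0.\<close>

definition positive_weak_solution ::
  "real \<Rightarrow> real \<Rightarrow> real \<Rightarrow> real \<Rightarrow> (real^'n) set \<Rightarrow> real \<Rightarrow> (real^'n \<Rightarrow> real) \<Rightarrow> bool" where
  "positive_weak_solution p s q \<alpha> \<Omega> lam u \<longleftrightarrow>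
     u \<in> X0 p s \<Omega> \<and>
     (AE x in lebesgue. x \<in> \<Omega> \<longrightarrow> 0 < u x) \<and>
     (\<forall>\<psi>\<in>test_functions \<Omega>.
        let A = (\<lambda>z. \<bar>u (fst z) - u (snd z)\<bar> powr (p - 2) * (u (fst z) - u (snd z))
                      * (\<psi> (fst z) - \<psi> (snd z))
                      / norm (fst z - snd z) powr (real CARD('n) + s * p));
            B = (\<lambda>x. (lam * u x powr (- q) + u x powr \<alpha>) * \<psi> x)
        in set_integrable lebesgue (Qset \<Omega>) A \<and>
           set_integrable lebesgue \<Omega> B \<and>
           (LINT z:Qset \<Omega>|lebesgue. A z) - (LINT x:\<Omega>|lebesgue. B x) = 0)"

end

theory Submission
  imports Defs "HOL-Library.Diagonal_Subsequence"
begin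

text \<open>On the cone of admissible functions, write \<open>E\<close>, \<open>b\<close>, \<open>c\<close> for the energy, the integral of \<open>u\<^bsup>1-q\<^esup>\<close> and that of \<open>u\<^bsup>\<alpha>+1\<^esup>\<close>;
  the fibre derivative at \<open>t\<close> is \<open>t\<^bsup>-q\<^esup> (E t\<^bsup>p-1+q\<^esup> - c t\<^bsup>\<alpha>+q\<^esup> - lam b)\<close>, whose bracket, apart from the constant, first increases and
  then decreases. If \<open>lam < \<Lambda>\<^sub>1\<close>, there is \<open>lam' > lam\<close> for which every fibre map has a critical point, so for
  \<open>lam\<close> every fibre map has exactly two, both nondegenerate. The functional is minimised over the functions on which the
  bracket is still increasing at \<open>t = 1\<close> (here the Brezis--Lieb lemma covers the critical exponent, since the strict inequality
  \<open>lam < lam'\<close> forbids minimising sequences from approaching the boundary of that set) and, for subcritical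
  \<open>\<alpha>\<close>, over the part of the Nehari set on which it is decreasing, by compactness. Each minimiser is stable under nonnegative
  perturbations followed by rescaling; Fatou's lemma turns this into a variational inequality, which yields positivity and, on
  testing with \<open>(u + \<epsilon> \<phi>)\<^sup>+\<close>, the weak equation. The two solutions differ in the sign of \<open>(p-1+q) E - (\<alpha>+q) c\<close>.
  Compactness follows from a weak-type Sobolev inequality, which suffices because only exponents strictly below the critical one
  are needed; finiteness of the critical integral comes from the fibre maps themselves, which would be constant if it were infinite.\<close>


subsection \<open>Powers of absolute values\<close>

text \<open>No best Sobolev constant enters the critical case. Along a minimising sequence the
  remainder \<open>v - u\<close> carries a limit energy \<open>A\<close> and a limit power
  \<open>C\<close>. If dropping it raised the functional, that is
  \<open>A / p < C / (\<alpha> + 1)\<close>, then adding its positive part back with a factor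
  \<open>\<tau> \<ge> 1\<close> would lead to the boundary of \<open>D\<close> without exceeding the
  infimum. On that boundary the bracket is at least \<open>lam' * b u\<close>, so the fibre map is
  still strictly increasing and values just inside \<open>D\<close> would undercut the infimum. Only
  upward perturbations occur, since the cone \<open>P\<close> is closed under enlarging a function
  but not under shrinking it.

  For \<open>q = 1\<close> the cone is not obviously inhabited: the distance to the complement
  belongs to it because boundary layers of width \<delta> have measure of order \<delta>. There the
  singular integral is only upper semicontinuous, which is the direction wanted by its minus sign in
  the functional.

  On the outer part of the Nehari set a perturbed minimiser leaves the set and must be rescaled
  back; this is why stability allows a factor near 1.\<close>

lemma powr_diff_le:
  fixes a b r :: real
  assumes "0 \<le> a" "a \<le> b" "1 \<le> r"
  shows "b powr r - a powr r \<le> r * b powr (r - 1) * (b - a)"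
proof (cases "a = b")
  case False
  hence ab: "a < b" using assms by simp
  have "\<exists>l z. a < z \<and> z < b \<and> DERIV (\<lambda>x. x powr r) z :> l \<and> b powr r - a powr r = (b - a) * l"
  proof (rule MVT[OF ab])
    show "continuous_on {a..b} (\<lambda>x. x powr r)"
      using assms by (intro continuous_on_powr') (auto intro!: continuous_intros)
    show "\<And>x. a < x \<Longrightarrow> x < b \<Longrightarrow> (\<lambda>x. x powr r) differentiable (at x)"
      using assms by (auto simp: real_differentiable_def intro!: exI has_real_derivative_powr)
  qed
  then obtain l z where z: "a < z" "z < b" "DERIV (\<lambda>x. x powr r) z :> l"
      "b powr r - a powr r = (b - a) * l" by blast
  have "l = r * z powr (r - 1)"
    using z assms by (intro DERIV_unique[OF z(3)] has_real_derivative_powr) auto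
  moreover have "z powr (r - 1) \<le> b powr (r - 1)"
    using z assms by (intro powr_mono2) auto
  ultimately have "l \<le> r * b powr (r - 1)"
    using assms by (simp add: mult_left_mono)
  thus ?thesis using z(4) ab by (simp add: mult.commute mult_left_mono)
qed auto

lemma abs_powr_diff_le:
  fixes x y r :: real
  assumes "1 \<le> r"
  shows "\<bar>\<bar>x + y\<bar> powr r - \<bar>x\<bar> powr r\<bar> \<le> r * (\<bar>x\<bar> + \<bar>y\<bar>) powr (r - 1) * \<bar>y\<bar>"
proof -
  have *: "v powr r - u powr r \<le> r * (\<bar>x\<bar> + \<bar>y\<bar>) powr (r - 1) * \<bar>y\<bar>" "u powr r \<le> v powr r"
    if "0 \<le> u" "u \<le> v" "v \<le> \<bar>x\<bar> + \<bar>y\<bar>" "v - u \<le> \<bar>y\<bar>" for u v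
  proof -
    have "r * v powr (r - 1) * (v - u) \<le> r * (\<bar>x\<bar> + \<bar>y\<bar>) powr (r - 1) * \<bar>y\<bar>"
      using that assms by (intro mult_mono mult_left_mono powr_mono2) auto
    thus "v powr r - u powr r \<le> r * (\<bar>x\<bar> + \<bar>y\<bar>) powr (r - 1) * \<bar>y\<bar>"
      using powr_diff_le[of u v r] that assms by linarith
    show "u powr r \<le> v powr r" using that assms by (intro powr_mono2) auto
  qed
  show ?thesis
  proof (cases "\<bar>x\<bar> \<le> \<bar>x + y\<bar>")
    case True
    have "\<bar>x + y\<bar> \<le> \<bar>x\<bar> + \<bar>y\<bar>" by linarith
    with *[of "\<bar>x\<bar>" "\<bar>x + y\<bar>"] True show ?thesis by force
  next
    case False
    have "\<bar>x\<bar> \<le> \<bar>x\<bar> + \<bar>y\<bar>" "\<bar>x\<bar> - \<bar>x + y\<bar> \<le> \<bar>y\<bar>" by linarith+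
    with *[of "\<bar>x + y\<bar>" "\<bar>x\<bar>"] False show ?thesis by force
  qed
qed

lemma powr_add_le:
  fixes a b r :: real
  assumes "0 \<le> a" "0 \<le> b" "0 \<le> r"
  shows "(a + b) powr r \<le> 2 powr r * (a powr r + b powr r)"
proof -
  have "(a + b) powr r \<le> (2 * max a b) powr r"
    using assms by (intro powr_mono2) auto
  also have "\<dots> = 2 powr r * (max a b) powr r" using assms by (simp add: powr_mult)
  also have "\<dots> \<le> 2 powr r * (a powr r + b powr r)"
    by (intro mult_left_mono) (auto simp: max_def)
  finally show ?thesis .
qed

lemma abs_add_powr_le:
  fixes a b r :: real
  assumes "0 \<le> r"
  shows "\<bar>a + b\<bar> powr r \<le> 2 powr r * (\<bar>a\<bar> powr r + \<bar>b\<bar> powr r)"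
proof -
  have "\<bar>a + b\<bar> powr r \<le> (\<bar>a\<bar> + \<bar>b\<bar>) powr r" using assms by (intro powr_mono2) auto
  thus ?thesis using powr_add_le[of "\<bar>a\<bar>" "\<bar>b\<bar>" r] assms by simp
qed

lemma powr_minus_one_mult:
  fixes a r :: real
  assumes "0 \<le> a" "0 < r"
  shows "a powr (r - 1) * a = a powr r"
proof (cases "a = 0")
  case False
  thus ?thesis using assms powr_add[of a "r - 1" 1] by simp
qed (use assms in auto)

text \<open>For \<open>\<bar>y\<bar> \<le> \<delta> * \<bar>x\<bar>\<close> the mean value bound is
  of size \<delta> times \<open>\<bar>x\<bar> powr r\<close>; otherwise \<open>\<bar>x\<bar>\<close>
  itself is bounded by a multiple of \<open>\<bar>y\<bar>\<close> and everything goes into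
  \<open>C\<close>. This is the pointwise input of the Brezis--Lieb lemma.\<close>

lemma abs_powr_diff_eps:
  fixes r \<epsilon> :: real
  assumes "1 \<le> r" "0 < \<epsilon>"
  obtains C where "0 \<le> C"
    "\<And>x y. \<bar>\<bar>x + y\<bar> powr r - \<bar>x\<bar> powr r\<bar> \<le> \<epsilon> * \<bar>x\<bar> powr r + C * \<bar>y\<bar> powr r"
proof -
  \<comment> \<open>With \<delta> at most 1 the base \<open>\<bar>x\<bar> + \<bar>y\<bar>\<close> is
    at most \<open>2 * \<bar>x\<bar>\<close>; the second bound turns the factor
    \<open>r * 2 powr (r - 1) * \<delta>\<close> into at most \<epsilon>.\<close>
  define \<delta> where "\<delta> = min 1 (\<epsilon> / (r * 2 powr (r - 1)))"
  have d: "0 < \<delta>" "\<delta> \<le> 1" "r * 2 powr (r - 1) * \<delta> \<le> \<epsilon>"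
    using assms by (auto simp: \<delta>_def field_simps min_def)
  define C where "C = 2 * (1 / \<delta> + 1) powr r"
  have "\<bar>\<bar>x + y\<bar> powr r - \<bar>x\<bar> powr r\<bar> \<le> \<epsilon> * \<bar>x\<bar> powr r + C * \<bar>y\<bar> powr r" for x y :: real
  proof (cases "\<bar>y\<bar> \<le> \<delta> * \<bar>x\<bar>")
    case True
    hence "\<bar>y\<bar> \<le> \<bar>x\<bar>" using d by (meson abs_ge_zero mult_left_le_one_le order_trans less_imp_le)
    hence "r * (\<bar>x\<bar> + \<bar>y\<bar>) powr (r - 1) * \<bar>y\<bar> \<le> r * (2 * \<bar>x\<bar>) powr (r - 1) * (\<delta> * \<bar>x\<bar>)"
      using True assms by (intro mult_mono powr_mono2) auto
    also have "\<dots> = (r * 2 powr (r - 1) * \<delta>) * (\<bar>x\<bar> powr (r - 1) * \<bar>x\<bar>)"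
      by (simp add: powr_mult)
    also have "\<bar>x\<bar> powr (r - 1) * \<bar>x\<bar> = \<bar>x\<bar> powr r"
      using assms by (intro powr_minus_one_mult) auto
    also have "(r * 2 powr (r - 1) * \<delta>) * \<bar>x\<bar> powr r \<le> \<epsilon> * \<bar>x\<bar> powr r"
      using d by (intro mult_right_mono) auto
    finally have "r * (\<bar>x\<bar> + \<bar>y\<bar>) powr (r - 1) * \<bar>y\<bar> \<le> \<epsilon> * \<bar>x\<bar> powr r" .
    moreover have "0 \<le> C * \<bar>y\<bar> powr r" by (simp add: C_def)
    ultimately show ?thesis using abs_powr_diff_le[OF assms(1), of x y] by linarith
  next
    case False
    hence x: "\<bar>x\<bar> \<le> (1 / \<delta>) * \<bar>y\<bar>" using d by (simp add: field_simps)
    have "\<bar>x + y\<bar> \<le> (1 / \<delta> + 1) * \<bar>y\<bar>" using x by (simp add: distrib_right)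
    moreover have "\<bar>x\<bar> \<le> (1 / \<delta> + 1) * \<bar>y\<bar>" using x by (simp add: distrib_right)
    ultimately have "\<bar>x + y\<bar> powr r \<le> ((1 / \<delta> + 1) * \<bar>y\<bar>) powr r"
        "\<bar>x\<bar> powr r \<le> ((1 / \<delta> + 1) * \<bar>y\<bar>) powr r"
      using assms by (auto intro!: powr_mono2)
    moreover have "((1 / \<delta> + 1) * \<bar>y\<bar>) powr r = (1 / \<delta> + 1) powr r * \<bar>y\<bar> powr r"
      using d by (simp add: powr_mult)
    moreover have "0 \<le> \<epsilon> * \<bar>x\<bar> powr r" using assms by simp
    moreover have "\<bar>\<bar>x + y\<bar> powr r - \<bar>x\<bar> powr r\<bar> \<le> \<bar>x + y\<bar> powr r + \<bar>x\<bar> powr r" 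
      by (smt (verit) powr_ge_zero)
    ultimately show ?thesis unfolding C_def by linarith
  qed
  moreover have "0 \<le> C" by (simp add: C_def)
  ultimately show ?thesis using that by blast
qed

text \<open>For \<open>r < 2\<close> the factor with exponent \<open>r - 2\<close> is singular at
  the origin, yet the formula survives there: its value is 0, and the quotient is of size
  \<open>\<bar>h\<bar> powr (r - 1)\<close>, which vanishes because \<open>r > 1\<close>.\<close>

lemma abs_powr_has_derivative:
  fixes x r :: real
  assumes "1 < r"
  shows "((\<lambda>z. \<bar>z\<bar> powr r) has_real_derivative r * (\<bar>x\<bar> powr (r - 2) * x)) (at x)"
proof (cases x "0::real" rule: linorder_cases)
  case greater
  have "((\<lambda>z. z powr r) has_real_derivative r * x powr (r - 1)) (at x)"
    using greater by (rule has_real_derivative_powr)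
  moreover have "x powr (r - 1) = x powr (r - 2) * x"
    using greater powr_add[of x "r - 2" 1] by simp
  moreover have "eventually (\<lambda>z. z > 0) (nhds x)"
    using greater by (intro eventually_nhds_in_open[of "{0<..}", simplified]) auto
  hence "eventually (\<lambda>z. \<bar>z\<bar> powr r = z powr r) (nhds x)" by eventually_elim simp
  ultimately show ?thesis using greater DERIV_cong_ev[OF refl, of "\<lambda>z. \<bar>z\<bar> powr r" "\<lambda>z. z powr r" x] by auto
next
  case less
  have "((\<lambda>z. (- z) powr r) has_real_derivative (r * (- x) powr (r - 1)) * (- 1)) (at x)"
    using less by (intro DERIV_chain'[of uminus] has_real_derivative_powr) (auto intro!: derivative_eq_intros)
  moreover have "(- x) powr (r - 1) = (- x) powr (r - 2) * (- x)"
    using less powr_add[of "- x" "r - 2" 1] by simp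
  moreover have "eventually (\<lambda>z. z < 0) (nhds x)"
    using less by (intro eventually_nhds_in_open[of "{..<0}", simplified]) auto
  hence "eventually (\<lambda>z. \<bar>z\<bar> powr r = (- z) powr r) (nhds x)" by eventually_elim simp
  ultimately show ?thesis using less DERIV_cong_ev[OF refl, of "\<lambda>z. \<bar>z\<bar> powr r" "\<lambda>z. (- z) powr r" x] by auto
next
  case equal
  have 1: "((\<lambda>h. \<bar>h\<bar> powr (r - 1)) \<longlongrightarrow> 0) (at (0::real))"
    using assms by (intro tendsto_eq_intros tendsto_powr') (auto intro!: tendsto_eq_intros)
  have 2: "norm (\<bar>h\<bar> powr r / h) \<le> \<bar>h\<bar> powr (r - 1)" for h :: real
    using assms by (cases "h = 0") (auto simp: powr_diff)
  have "((\<lambda>h. \<bar>h\<bar> powr r / h) \<longlongrightarrow> 0) (at (0::real))"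
    by (rule Lim_null_comparison[OF always_eventually[OF allI[OF 2]] 1])
  thus ?thesis unfolding equal DERIV_def using assms by simp
qed

lemma abs_powr_mult_abs:
  fixes a r :: real
  assumes "1 < r"
  shows "\<bar>a\<bar> powr (r - 2) * \<bar>a\<bar> = \<bar>a\<bar> powr (r - 1)" "\<bar>a\<bar> powr (r - 2) * a * a = \<bar>a\<bar> powr r"
proof -
  show *: "\<bar>a\<bar> powr (r - 2) * \<bar>a\<bar> = \<bar>a\<bar> powr (r - 1)"
    using assms powr_minus_one_mult[of "\<bar>a\<bar>" "r - 1"] by simp
  have "\<bar>a\<bar> powr (r - 2) * a * a = \<bar>a\<bar> powr (r - 2) * \<bar>a\<bar> * \<bar>a\<bar>"
    by (simp add: mult.assoc)
  also have "\<dots> = \<bar>a\<bar> powr r"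
    unfolding * using assms by (intro powr_minus_one_mult) auto
  finally show "\<bar>a\<bar> powr (r - 2) * a * a = \<bar>a\<bar> powr r" .
qed

text \<open>A crude substitute for Young's inequality: replace both factors by the larger
  one.\<close>

lemma abs_powr_prod_le:
  fixes a b r :: real
  assumes "1 < r"
  shows "\<bar>a\<bar> powr (r - 1) * \<bar>b\<bar> \<le> \<bar>a\<bar> powr r + \<bar>b\<bar> powr r"
proof -
  have "\<bar>a\<bar> powr (r - 1) * \<bar>b\<bar> \<le> (max \<bar>a\<bar> \<bar>b\<bar>) powr (r - 1) * max \<bar>a\<bar> \<bar>b\<bar>"
    using assms by (intro mult_mono powr_mono2) auto
  also have "\<dots> = (max \<bar>a\<bar> \<bar>b\<bar>) powr r" using assms by (intro powr_minus_one_mult) auto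
  also have "\<dots> \<le> \<bar>a\<bar> powr r + \<bar>b\<bar> powr r" by (auto simp: max_def)
  finally show ?thesis .
qed

subsection \<open>Convergence of integrals of powers\<close>

lemma integrable_powr_add:
  fixes f g :: "'a \<Rightarrow> real"
  assumes [measurable]: "f \<in> borel_measurable M" "g \<in> borel_measurable M"
    and "integrable M (\<lambda>x. \<bar>f x\<bar> powr r)" "integrable M (\<lambda>x. \<bar>g x\<bar> powr r)" "0 \<le> r"
  shows "integrable M (\<lambda>x. \<bar>f x + g x\<bar> powr r)"
proof (rule Bochner_Integration.integrable_bound)
  show "integrable M (\<lambda>x. 2 powr r * (\<bar>f x\<bar> powr r + \<bar>g x\<bar> powr r))"
    using assms by auto
  show "AE x in M. norm (\<bar>f x + g x\<bar> powr r) \<le> norm (2 powr r * (\<bar>f x\<bar> powr r + \<bar>g x\<bar> powr r))"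
    using abs_add_powr_le[OF assms(5)] by auto
qed auto

lemma integrable_powr_cmult:
  fixes f :: "'a \<Rightarrow> real"
  assumes "integrable M (\<lambda>x. \<bar>f x\<bar> powr r)"
  shows "integrable M (\<lambda>x. \<bar>t * f x\<bar> powr r)"
    and "(\<integral>x. \<bar>t * f x\<bar> powr r \<partial>M) = \<bar>t\<bar> powr r * (\<integral>x. \<bar>f x\<bar> powr r \<partial>M)"
  using assms by (auto simp: abs_mult powr_mult)

lemma Fatou_integral:
  fixes g :: "nat \<Rightarrow> 'a \<Rightarrow> real"
  assumes [measurable]: "h \<in> borel_measurable M" and int: "\<And>k. integrable M (g k)"
    and nonneg: "\<And>k. AE x in M. 0 \<le> g k x"
    and lim: "AE x in M. (\<lambda>k. g k x) \<longlonglongrightarrow> h x"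
    and bd: "\<And>k. (\<integral>x. g k x \<partial>M) \<le> K"
  shows "integrable M h" "(\<integral>x. h x \<partial>M) \<le> K"
proof -
  have K: "0 \<le> K" using bd[of 0] integral_nonneg_AE[OF nonneg[of 0]] by linarith
  note int[THEN borel_measurable_integrable, measurable]
  have nn: "AE x in M. \<forall>k. 0 \<le> g k x" using nonneg by (simp add: AE_all_countable)
  have Gn: "AE x in M. 0 \<le> h x"
    using nn lim by eventually_elim (auto intro: LIMSEQ_le_const)
  have "(\<integral>\<^sup>+x. ennreal (h x) \<partial>M) = (\<integral>\<^sup>+x. liminf (\<lambda>k. ennreal (g k x)) \<partial>M)"
    using lim by (intro nn_integral_cong_AE, eventually_elim)
      (auto intro!: lim_imp_Liminf[symmetric] tendsto_ennrealI)
  also have "\<dots> \<le> liminf (\<lambda>k. \<integral>\<^sup>+x. ennreal (g k x) \<partial>M)"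
    by (intro nn_integral_liminf) auto
  also have "\<dots> \<le> liminf (\<lambda>k. ennreal K)"
    using bd K nonneg int by (intro Liminf_mono always_eventually allI)
      (auto simp: nn_integral_eq_integral intro!: ennreal_leI)
  also have "\<dots> = ennreal K" by (simp add: Liminf_const)
  finally have le: "(\<integral>\<^sup>+x. ennreal (h x) \<partial>M) \<le> ennreal K" .
  show i: "integrable M h"
  proof (rule integrableI_bounded)
    have "(\<integral>\<^sup>+x. ennreal (norm (h x)) \<partial>M) = (\<integral>\<^sup>+x. ennreal (h x) \<partial>M)"
      using Gn by (intro nn_integral_cong_AE) (auto elim!: eventually_mono)
    thus "(\<integral>\<^sup>+x. ennreal (norm (h x)) \<partial>M) < \<infinity>" using le by (simp add: le_less_trans)
  qed auto
  show "(\<integral>x. h x \<partial>M) \<le> K"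
    using le nn_integral_eq_integral[OF i Gn] K by (simp add: ennreal_le_iff)
qed

text \<open>The uniform bound needed for Fatou holds with \<open>L + e\<close> after discarding
  finitely many terms; then \<open>e\<close> tends to 0.\<close>

lemma Fatou_integral_lim:
  fixes g :: "nat \<Rightarrow> 'a \<Rightarrow> real"
  assumes "h \<in> borel_measurable M" and int: "\<And>k. integrable M (g k)"
    and nonneg: "\<And>k. AE x in M. 0 \<le> g k x"
    and lim: "AE x in M. (\<lambda>k. g k x) \<longlonglongrightarrow> h x"
    and bd: "(\<lambda>k. \<integral>x. g k x \<partial>M) \<longlonglongrightarrow> L"
  shows "integrable M h" "(\<integral>x. h x \<partial>M) \<le> L"
proof -
  have *: "integrable M h \<and> (\<integral>x. h x \<partial>M) \<le> L + e" if "e > 0" for e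
  proof -
    have "eventually (\<lambda>k. (\<integral>x. g k x \<partial>M) < L + e) sequentially"
      using bd that by (intro order_tendstoD) auto
    then obtain N where N: "\<And>k. k \<ge> N \<Longrightarrow> (\<integral>x. g k x \<partial>M) < L + e"
      by (auto simp: eventually_sequentially)
    have l: "AE x in M. (\<lambda>k. g (k + N) x) \<longlonglongrightarrow> h x"
      using lim by eventually_elim (rule LIMSEQ_ignore_initial_segment)
    show ?thesis
      using Fatou_integral[OF assms(1) int[of "_ + N"] nonneg l, of "L + e"] N[of "_ + N"]
      by (auto simp: less_imp_le)
  qed
  show "integrable M h" using *[of 1] by simp
  show "(\<integral>x. h x \<partial>M) \<le> L"
  proof (rule field_le_epsilon)
    show "(\<integral>x. h x \<partial>M) \<le> L + e" if "0 < e" for e using *[OF that] by blast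
  qed
qed

lemma tendsto_abs_powr:
  fixes f :: "'a \<Rightarrow> real"
  assumes "(f \<longlongrightarrow> l) F" "0 < r"
  shows "((\<lambda>x. \<bar>f x\<bar> powr r) \<longlongrightarrow> \<bar>l\<bar> powr r) F"
  using assms by (intro tendsto_powr' tendsto_rabs tendsto_const) auto


text \<open>The defect \<open>F k\<close> need not be dominated, but its excess over
  \<open>\<epsilon> * \<bar>V k x\<bar> powr r\<close> is, by a multiple of
  \<open>\<bar>U x\<bar> powr r\<close>. The excess vanishes in the limit by dominated convergence
  and the rest costs at most \<open>\<epsilon> * K\<close>.\<close>

lemma brezis_lieb:
  fixes U :: "'a \<Rightarrow> real" and V :: "nat \<Rightarrow> 'a \<Rightarrow> real"
  assumes r: "1 \<le> r" and [measurable]: "U \<in> borel_measurable M" "\<And>k. V k \<in> borel_measurable M"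
    and U: "integrable M (\<lambda>x. \<bar>U x\<bar> powr r)"
    and V: "\<And>k. integrable M (\<lambda>x. \<bar>V k x\<bar> powr r)" "\<And>k. (\<integral>x. \<bar>V k x\<bar> powr r \<partial>M) \<le> K"
    and lim: "AE x in M. (\<lambda>k. V k x) \<longlonglongrightarrow> 0"
  shows "(\<lambda>k. (\<integral>x. \<bar>U x + V k x\<bar> powr r \<partial>M) - (\<integral>x. \<bar>V k x\<bar> powr r \<partial>M)) \<longlonglongrightarrow> (\<integral>x. \<bar>U x\<bar> powr r \<partial>M)"
proof -
  define F where "F k x = \<bar>U x + V k x\<bar> powr r - \<bar>V k x\<bar> powr r - \<bar>U x\<bar> powr r" for k x
  have K: "0 \<le> K" using V(2)[of 0] by (smt (verit) integral_nonneg_AE AE_I2 powr_ge_zero)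
  have UV: "integrable M (\<lambda>x. \<bar>U x + V k x\<bar> powr r)" for k
    using U V r by (intro integrable_powr_add) auto
  have F[measurable]: "F k \<in> borel_measurable M" for k unfolding F_def by measurable
  have Fi: "integrable M (F k)" for k unfolding F_def using UV U V by auto
  have "(\<lambda>k. \<integral>x. F k x \<partial>M) \<longlonglongrightarrow> 0"
  proof (rule LIMSEQ_I)
    fix e :: real assume "0 < e"
    define \<epsilon> where "\<epsilon> = e / (2 * (K + 1))"
    have eps: "0 < \<epsilon>" "\<epsilon> * K < e / 2" using \<open>0 < e\<close> K by (auto simp: \<epsilon>_def field_simps)
    obtain C where C: "0 \<le> C"
      "\<And>x y. \<bar>\<bar>x + y\<bar> powr r - \<bar>x\<bar> powr r\<bar> \<le> \<epsilon> * \<bar>x\<bar> powr r + C * \<bar>y\<bar> powr r"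
      using abs_powr_diff_eps[OF r eps(1)] by blast
    \<comment> \<open>The excess of the defect over the small multiple of
      \<open>\<bar>V k x\<bar> powr r\<close>; only this part is handled by dominated
      convergence.\<close>
    define W where "W k x = max 0 (\<bar>F k x\<bar> - \<epsilon> * \<bar>V k x\<bar> powr r)" for k x
    have W[measurable]: "W k \<in> borel_measurable M" for k unfolding W_def by measurable
    have Wb: "norm (W k x) \<le> (C + 1) * \<bar>U x\<bar> powr r" for k x
    proof -
      have aux: "\<bar>a - v - u\<bar> - e' \<le> c + u" if "\<bar>a - v\<bar> \<le> e' + c" "0 \<le> u" for a v u e' c :: real
        using that by linarith
      have "\<bar>F k x\<bar> - \<epsilon> * \<bar>V k x\<bar> powr r \<le> C * \<bar>U x\<bar> powr r + \<bar>U x\<bar> powr r"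
        unfolding F_def using C(2)[of "V k x" "U x"]
        by (intro aux) (simp_all add: add.commute)
      moreover have "0 \<le> C * \<bar>U x\<bar> powr r + \<bar>U x\<bar> powr r" using C(1) by simp
      ultimately show ?thesis unfolding W_def by (simp add: distrib_right)
    qed
    have "AE x in M. (\<lambda>k. W k x) \<longlonglongrightarrow> 0"
      using lim
    proof eventually_elim
      case (elim x)
      have 1: "(\<lambda>k. \<bar>V k x\<bar> powr r) \<longlonglongrightarrow> \<bar>0\<bar> powr r"
        using elim r by (intro tendsto_abs_powr) auto
      have 2: "(\<lambda>k. \<bar>U x + V k x\<bar> powr r) \<longlonglongrightarrow> \<bar>U x + 0\<bar> powr r"
        using elim r by (intro tendsto_abs_powr tendsto_intros) auto
      have "(\<lambda>k. max 0 (\<bar>F k x\<bar> - \<epsilon> * \<bar>V k x\<bar> powr r)) \<longlonglongrightarrow>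
          max 0 (\<bar>\<bar>U x + 0\<bar> powr r - \<bar>0\<bar> powr r - \<bar>U x\<bar> powr r\<bar> - \<epsilon> * \<bar>0\<bar> powr r)"
        unfolding F_def by (intro tendsto_max tendsto_const tendsto_diff tendsto_mult tendsto_rabs 1 2)
      thus ?case by (simp add: W_def)
    qed
    moreover have "integrable M (\<lambda>x. (C + 1) * \<bar>U x\<bar> powr r)" using U by auto
    ultimately have W0: "(\<lambda>k. \<integral>x. W k x \<partial>M) \<longlonglongrightarrow> (\<integral>x. 0 \<partial>M)" and Wi: "integrable M (W k)" for k
    proof -
      assume 1: "AE x in M. (\<lambda>k. W k x) \<longlonglongrightarrow> 0" and 2: "integrable M (\<lambda>x. (C + 1) * \<bar>U x\<bar> powr r)"
      show "(\<lambda>k. \<integral>x. W k x \<partial>M) \<longlonglongrightarrow> (\<integral>x. 0 \<partial>M)"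
        by (rule integral_dominated_convergence[OF _ _ 2 1 AE_I2[OF Wb]]) auto
      show "integrable M (W k)"
        by (rule integrable_dominated_convergence2[OF _ _ 2 1 AE_I2[OF Wb]]) auto
    qed
    from W0 have "eventually (\<lambda>k. (\<integral>x. W k x \<partial>M) < e / 2) sequentially"
      using \<open>0 < e\<close> by (intro order_tendstoD(2)) auto
    then obtain N where N: "\<And>k. k \<ge> N \<Longrightarrow> (\<integral>x. W k x \<partial>M) < e / 2"
      by (auto simp: eventually_sequentially)
    have "norm ((\<integral>x. F k x \<partial>M) - 0) < e" if "k \<ge> N" for k
    proof -
      have "norm (\<integral>x. F k x \<partial>M) \<le> (\<integral>x. norm (F k x) \<partial>M)" by (rule integral_norm_bound)
      also have "\<dots> \<le> (\<integral>x. W k x + \<epsilon> * \<bar>V k x\<bar> powr r \<partial>M)"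
        using Fi Wi V by (intro integral_mono) (auto simp: W_def)
      also have "\<dots> = (\<integral>x. W k x \<partial>M) + \<epsilon> * (\<integral>x. \<bar>V k x\<bar> powr r \<partial>M)"
        using Wi V by simp
      also have "\<epsilon> * (\<integral>x. \<bar>V k x\<bar> powr r \<partial>M) \<le> \<epsilon> * K" using V(2) eps by (intro mult_left_mono) auto
      finally show ?thesis using N[OF that] eps by simp
    qed
    thus "\<exists>no. \<forall>n\<ge>no. norm ((\<integral>x. F n x \<partial>M) - 0) < e" by blast
  qed
  moreover have "(\<integral>x. F k x \<partial>M) = (\<integral>x. \<bar>U x + V k x\<bar> powr r \<partial>M) - (\<integral>x. \<bar>V k x\<bar> powr r \<partial>M) - (\<integral>x. \<bar>U x\<bar> powr r \<partial>M)" for k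
    unfolding F_def using UV V U by simp
  ultimately show ?thesis by (simp add: LIM_zero_iff)
qed

lemma integrable_powr_prod:
  fixes f g :: "'a \<Rightarrow> real"
  assumes r: "1 < r" and [measurable]: "f \<in> borel_measurable M" "g \<in> borel_measurable M"
    and "integrable M (\<lambda>x. \<bar>f x\<bar> powr r)" "integrable M (\<lambda>x. \<bar>g x\<bar> powr r)"
  shows "integrable M (\<lambda>x. \<bar>f x\<bar> powr (r - 1) * \<bar>g x\<bar>)"
    and "integrable M (\<lambda>x. \<bar>f x\<bar> powr (r - 2) * f x * g x)"
proof -
  show i: "integrable M (\<lambda>x. \<bar>f x\<bar> powr (r - 1) * \<bar>g x\<bar>)"
  proof (rule Bochner_Integration.integrable_bound)
    show "integrable M (\<lambda>x. \<bar>f x\<bar> powr r + \<bar>g x\<bar> powr r)" using assms by auto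
    show "AE x in M. norm (\<bar>f x\<bar> powr (r - 1) * \<bar>g x\<bar>) \<le> norm (\<bar>f x\<bar> powr r + \<bar>g x\<bar> powr r)"
      using abs_powr_prod_le[OF r] by (auto simp: abs_mult)
  qed measurable
  show "integrable M (\<lambda>x. \<bar>f x\<bar> powr (r - 2) * f x * g x)"
  proof (rule Bochner_Integration.integrable_bound[OF i])
    show "AE x in M. norm (\<bar>f x\<bar> powr (r - 2) * f x * g x) \<le> norm (\<bar>f x\<bar> powr (r - 1) * \<bar>g x\<bar>)"
      using abs_powr_mult_abs[OF r] by (auto simp: abs_mult)
  qed measurable
qed

text \<open>The bound \<open>e k \<le> 1\<close> lets one integrable function dominate all
  difference quotients, via the mean value estimate. Applied to the energy and to the power
  integral, it yields their directional derivatives.\<close>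

lemma integral_powr_derivative:
  fixes f g :: "'a \<Rightarrow> real" and e :: "nat \<Rightarrow> real"
  assumes r: "1 < r" and [measurable]: "f \<in> borel_measurable M" "g \<in> borel_measurable M"
    and f: "integrable M (\<lambda>x. \<bar>f x\<bar> powr r)" and g: "integrable M (\<lambda>x. \<bar>g x\<bar> powr r)"
    and e: "\<And>k. 0 < e k" "\<And>k. e k \<le> 1" "e \<longlonglongrightarrow> 0"
  shows "(\<lambda>k. ((\<integral>x. \<bar>f x + e k * g x\<bar> powr r \<partial>M) - (\<integral>x. \<bar>f x\<bar> powr r \<partial>M)) / e k)
    \<longlonglongrightarrow> r * (\<integral>x. \<bar>f x\<bar> powr (r - 2) * f x * g x \<partial>M)"
proof -
  define Q where "Q k x = (\<bar>f x + e k * g x\<bar> powr r - \<bar>f x\<bar> powr r) / e k" for k x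
  have i: "integrable M (\<lambda>x. \<bar>f x + e k * g x\<bar> powr r)" for k
    using integrable_powr_add[OF _ _ f integrable_powr_cmult(1)[OF g, of "e k"]] r by auto
  have "(\<lambda>k. \<integral>x. Q k x \<partial>M) \<longlonglongrightarrow> (\<integral>x. r * (\<bar>f x\<bar> powr (r - 2) * f x * g x) \<partial>M)"
  proof (rule integral_dominated_convergence)
    show "integrable M (\<lambda>x. r * (2 powr r * (\<bar>f x\<bar> powr r + \<bar>g x\<bar> powr r)))" using f g by auto
    show "Q k \<in> borel_measurable M" for k unfolding Q_def by measurable
    show "AE x in M. (\<lambda>k. Q k x) \<longlonglongrightarrow> r * (\<bar>f x\<bar> powr (r - 2) * f x * g x)"
    proof (rule AE_I2)
      fix x
      have "((\<lambda>t. \<bar>f x + t * g x\<bar> powr r) has_real_derivative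
          (r * (\<bar>f x + 0 * g x\<bar> powr (r - 2) * (f x + 0 * g x))) * g x) (at 0)"
        by (rule DERIV_chain'[OF _ abs_powr_has_derivative[OF r]]) (auto intro!: derivative_eq_intros)
      hence "((\<lambda>t. (\<bar>f x + t * g x\<bar> powr r - \<bar>f x\<bar> powr r) / t) \<longlongrightarrow> r * (\<bar>f x\<bar> powr (r - 2) * f x * g x)) (at 0)"
        unfolding DERIV_def by (simp add: mult.assoc)
      moreover have "filterlim e (at 0) sequentially"
        using e by (auto simp: filterlim_at less_imp_neq[symmetric])
      ultimately show "(\<lambda>k. Q k x) \<longlonglongrightarrow> r * (\<bar>f x\<bar> powr (r - 2) * f x * g x)"
        unfolding Q_def by (rule filterlim_compose)
    qed
    show "AE x in M. norm (Q k x) \<le> r * (2 powr r * (\<bar>f x\<bar> powr r + \<bar>g x\<bar> powr r))" for k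
    proof (rule AE_I2)
      fix x
      have eg: "\<bar>e k * g x\<bar> \<le> \<bar>g x\<bar>" using e(1)[of k] e(2)[of k] by (simp add: abs_mult mult_left_le_one_le)
      have "norm (Q k x) = \<bar>\<bar>f x + e k * g x\<bar> powr r - \<bar>f x\<bar> powr r\<bar> / e k"
        using e by (simp add: Q_def abs_of_pos)
      also have "\<dots> \<le> r * (\<bar>f x\<bar> + \<bar>e k * g x\<bar>) powr (r - 1) * \<bar>e k * g x\<bar> / e k"
        using e(1)[of k] e(2)[of k] r by (intro divide_right_mono abs_powr_diff_le) auto
      also have "\<dots> = r * ((\<bar>f x\<bar> + \<bar>e k * g x\<bar>) powr (r - 1) * \<bar>g x\<bar>)"
        using e(1)[of k] by (simp add: abs_mult)
      also have "\<dots> \<le> r * ((\<bar>f x\<bar> + \<bar>g x\<bar>) powr (r - 1) * (\<bar>f x\<bar> + \<bar>g x\<bar>))"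
        using r eg by (intro mult_left_mono mult_mono powr_mono2) auto
      also have "(\<bar>f x\<bar> + \<bar>g x\<bar>) powr (r - 1) * (\<bar>f x\<bar> + \<bar>g x\<bar>) = (\<bar>f x\<bar> + \<bar>g x\<bar>) powr r"
        using r by (intro powr_minus_one_mult) auto
      also have "r * (\<bar>f x\<bar> + \<bar>g x\<bar>) powr r \<le> r * (2 powr r * (\<bar>f x\<bar> powr r + \<bar>g x\<bar> powr r))"
        using r by (intro mult_left_mono powr_add_le) auto
      finally show "norm (Q k x) \<le> r * (2 powr r * (\<bar>f x\<bar> powr r + \<bar>g x\<bar> powr r))" .
    qed
  qed measurable
  moreover have "(\<integral>x. Q k x \<partial>M) = ((\<integral>x. \<bar>f x + e k * g x\<bar> powr r \<partial>M) - (\<integral>x. \<bar>f x\<bar> powr r \<partial>M)) / e k" for k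
    unfolding Q_def using i f by simp
  ultimately show ?thesis by simp
qed

text \<open>Splitting \<open>\<bar>f\<bar>\<close> at a large height \<open>T\<close>: the upper part contributes at most \<open>K T\<^bsup>\<rho> - r\<^esup>\<close>.\<close>

lemma integral_powr_tendsto:
  fixes f :: "nat \<Rightarrow> 'a \<Rightarrow> real"
  assumes \<rho>: "0 < \<rho>" "\<rho> < r" and [measurable]: "A \<in> sets M" "\<And>k. f k \<in> borel_measurable M" "F \<in> borel_measurable M"
    and A: "emeasure M A < \<infinity>" and f0: "\<And>k x. x \<notin> A \<Longrightarrow> f k x = 0" and F0: "\<And>x. x \<notin> A \<Longrightarrow> F x = 0"
    and lim: "AE x in M. (\<lambda>k. f k x) \<longlonglongrightarrow> F x"
    and int: "\<And>k. integrable M (\<lambda>x. \<bar>f k x\<bar> powr r)" and bd: "\<And>k. (\<integral>x. \<bar>f k x\<bar> powr r \<partial>M) \<le> K"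
  shows "(\<lambda>k. \<integral>x. \<bar>f k x\<bar> powr \<rho> \<partial>M) \<longlonglongrightarrow> (\<integral>x. \<bar>F x\<bar> powr \<rho> \<partial>M)"
    and "integrable M (\<lambda>x. \<bar>F x\<bar> powr \<rho>)" and "\<And>k. integrable M (\<lambda>x. \<bar>f k x\<bar> powr \<rho>)"
proof -
  have K: "0 \<le> K" using bd[of 0] by (smt (verit) integral_nonneg_AE AE_I2 powr_ge_zero)
  have F: "integrable M (\<lambda>x. \<bar>F x\<bar> powr r)" "(\<integral>x. \<bar>F x\<bar> powr r \<partial>M) \<le> K"
  proof -
    have "AE x in M. (\<lambda>k. \<bar>f k x\<bar> powr r) \<longlonglongrightarrow> \<bar>F x\<bar> powr r"
      using lim by eventually_elim (use \<rho> in \<open>auto intro!: tendsto_abs_powr\<close>)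
    from Fatou_integral[OF _ int _ this bd] show "integrable M (\<lambda>x. \<bar>F x\<bar> powr r)" "(\<integral>x. \<bar>F x\<bar> powr r \<partial>M) \<le> K"
      by auto
  qed
  have iA: "integrable M (\<lambda>x. c * indicator A x :: real)" for c
    using A by (intro integrable_mult_right integrable_real_indicator) auto
  have \<rho>i: "integrable M (\<lambda>x. \<bar>g x\<bar> powr \<rho>)" if [measurable]: "g \<in> borel_measurable M"
    and "\<And>x. x \<notin> A \<Longrightarrow> g x = 0" "integrable M (\<lambda>x. \<bar>g x\<bar> powr r)" for g :: "'a \<Rightarrow> real"
  proof (rule Bochner_Integration.integrable_bound)
    show "integrable M (\<lambda>x. 1 * indicator A x + \<bar>g x\<bar> powr r)" using that iA[of 1] by auto
    have "\<bar>g x\<bar> powr \<rho> \<le> 1 * indicator A x + \<bar>g x\<bar> powr r" for x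
    proof (cases "\<bar>g x\<bar> \<le> 1")
      case True
      have "\<bar>g x\<bar> powr \<rho> \<le> 1" using True \<rho> by (intro powr_le1) auto
      thus ?thesis using that(2)[of x] \<rho> by (cases "x \<in> A") (auto intro: add_increasing2)
    next
      case False
      hence "\<bar>g x\<bar> powr \<rho> \<le> \<bar>g x\<bar> powr r" using \<rho> by (intro powr_mono) auto
      thus ?thesis by (simp add: add_increasing)
    qed
    thus "AE x in M. norm (\<bar>g x\<bar> powr \<rho>) \<le> norm (1 * indicator A x + \<bar>g x\<bar> powr r)"
      by auto
  qed measurable
  show Fi: "integrable M (\<lambda>x. \<bar>F x\<bar> powr \<rho>)" using F0 F by (intro \<rho>i) auto
  show fi: "integrable M (\<lambda>x. \<bar>f k x\<bar> powr \<rho>)" for k using f0 int by (intro \<rho>i) auto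
  show "(\<lambda>k. \<integral>x. \<bar>f k x\<bar> powr \<rho> \<partial>M) \<longlonglongrightarrow> (\<integral>x. \<bar>F x\<bar> powr \<rho> \<partial>M)"
  proof (rule LIMSEQ_I)
    fix e :: real assume "0 < e"
    have "((\<lambda>T. K * T powr (\<rho> - r)) \<longlongrightarrow> K * 0) at_top"
      using \<rho> by (intro tendsto_intros tendsto_neg_powr filterlim_ident) auto
    hence "eventually (\<lambda>T. K * T powr (\<rho> - r) < e / 3) at_top" using \<open>0 < e\<close> by (intro order_tendstoD(2)) auto
    then obtain T where T: "0 < T" "K * T powr (\<rho> - r) < e / 3"
      using eventually_conj[OF eventually_gt_at_top[of 0]] by (metis (mono_tags, lifting) eventually_happens trivial_limit_at_top_linorder)
    \<comment> \<open>Truncated powers are bounded by a constant on the finite-measure set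
      \<open>A\<close>, so their integrals converge; the height \<open>T\<close> makes the
      truncation error less than \<open>e / 3\<close> for all members and for the limit.\<close>
    define m where "m g x = (min \<bar>g x\<bar> T) powr \<rho>" for g :: "'a \<Rightarrow> real" and x
    have mi: "integrable M (m g)" if [measurable]: "g \<in> borel_measurable M" and "integrable M (\<lambda>x. \<bar>g x\<bar> powr \<rho>)" for g
    proof (rule Bochner_Integration.integrable_bound[OF that(2)])
      show "AE x in M. norm (m g x) \<le> norm (\<bar>g x\<bar> powr \<rho>)"
        unfolding m_def using T \<rho> by (auto intro!: powr_mono2)
    qed (unfold m_def, measurable)
    have diff: "\<bar>(\<integral>x. \<bar>g x\<bar> powr \<rho> \<partial>M) - (\<integral>x. m g x \<partial>M)\<bar> < e / 3"
      if [measurable]: "g \<in> borel_measurable M" and g: "integrable M (\<lambda>x. \<bar>g x\<bar> powr \<rho>)"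
        "integrable M (\<lambda>x. \<bar>g x\<bar> powr r)" "(\<integral>x. \<bar>g x\<bar> powr r \<partial>M) \<le> K" for g
    proof -
      have b: "0 \<le> \<bar>g x\<bar> powr \<rho> - m g x \<and> \<bar>g x\<bar> powr \<rho> - m g x \<le> T powr (\<rho> - r) * \<bar>g x\<bar> powr r" for x
      proof (cases "\<bar>g x\<bar> \<le> T")
        case False
        hence "\<bar>g x\<bar> powr (\<rho> - r) \<le> T powr (\<rho> - r)" using T \<rho> by (intro powr_mono2') auto
        hence "\<bar>g x\<bar> powr (\<rho> - r) * \<bar>g x\<bar> powr r \<le> T powr (\<rho> - r) * \<bar>g x\<bar> powr r"
          by (intro mult_right_mono) auto
        hence "\<bar>g x\<bar> powr \<rho> \<le> T powr (\<rho> - r) * \<bar>g x\<bar> powr r" using False T by (simp flip: powr_add)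
        moreover have "T powr \<rho> \<le> \<bar>g x\<bar> powr \<rho>" using False T \<rho> by (intro powr_mono2) auto
        ultimately show ?thesis using False by (auto simp: m_def min_def intro: order_trans[rotated])
      qed (auto simp: m_def min_def)
      have "(\<integral>x. \<bar>g x\<bar> powr \<rho> \<partial>M) - (\<integral>x. m g x \<partial>M) = (\<integral>x. \<bar>g x\<bar> powr \<rho> - m g x \<partial>M)"
        using g mi by (simp add: that(1))
      hence eq: "(\<integral>x. \<bar>g x\<bar> powr \<rho> \<partial>M) - (\<integral>x. m g x \<partial>M) = (\<integral>x. \<bar>g x\<bar> powr \<rho> - m g x \<partial>M)" .
      have nn: "0 \<le> (\<integral>x. \<bar>g x\<bar> powr \<rho> - m g x \<partial>M)" using b by (intro integral_nonneg_AE) auto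
      have "(\<integral>x. \<bar>g x\<bar> powr \<rho> - m g x \<partial>M) \<le> (\<integral>x. T powr (\<rho> - r) * \<bar>g x\<bar> powr r \<partial>M)"
        using b g mi by (intro integral_mono) (auto simp: that(1))
      also have "\<dots> \<le> K * T powr (\<rho> - r)" using g(3) by (simp add: mult.commute[of K] mult_left_mono)
      finally show ?thesis using T eq nn by linarith
    qed
    have "(\<lambda>k. \<integral>x. m (f k) x \<partial>M) \<longlonglongrightarrow> (\<integral>x. m F x \<partial>M)"
    proof (rule integral_dominated_convergence[OF _ _ iA[of "T powr \<rho>"]])
      show "AE x in M. (\<lambda>k. m (f k) x) \<longlonglongrightarrow> m F x"
        using lim
      proof eventually_elim
        case (elim x)
        hence "(\<lambda>k. \<bar>min \<bar>f k x\<bar> T\<bar> powr \<rho>) \<longlonglongrightarrow> \<bar>min \<bar>F x\<bar> T\<bar> powr \<rho>"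
          using \<rho> by (intro tendsto_abs_powr tendsto_intros) auto
        thus ?case using T by (simp add: m_def)
      qed
      show "AE x in M. norm (m (f k) x) \<le> T powr \<rho> * indicator A x" for k
        using T \<rho> f0 by (auto simp: m_def indicator_def intro!: powr_mono2)
    qed (unfold m_def, measurable)
    from LIMSEQ_D[OF this, of "e / 3"] \<open>0 < e\<close> obtain N where
      N: "\<And>k. k \<ge> N \<Longrightarrow> norm ((\<integral>x. m (f k) x \<partial>M) - (\<integral>x. m F x \<partial>M)) < e / 3" by auto
    have "norm ((\<integral>x. \<bar>f k x\<bar> powr \<rho> \<partial>M) - (\<integral>x. \<bar>F x\<bar> powr \<rho> \<partial>M)) < e" if "k \<ge> N" for k
      using diff[OF _ fi[of k] int[of k] bd[of k]] diff[OF _ Fi F] N[OF that] by (simp add: abs_if split: if_splits)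
    thus "\<exists>no. \<forall>k\<ge>no. norm ((\<integral>x. \<bar>f k x\<bar> powr \<rho> \<partial>M) - (\<integral>x. \<bar>F x\<bar> powr \<rho> \<partial>M)) < e" by blast
  qed
qed

subsection \<open>Gagliardo energy\<close>

definition dif :: "('a \<Rightarrow> real) \<Rightarrow> 'a \<times> 'a \<Rightarrow> real" where
  "dif u z = u (fst z) - u (snd z)"

lemma dif_measurable [measurable]:
  fixes u :: "'a::euclidean_space \<Rightarrow> real"
  assumes [measurable]: "u \<in> borel_measurable borel"
  shows "dif u \<in> borel_measurable borel"
proof -
  have "fst \<in> borel_measurable (borel :: ('a \<times> 'a) measure)" "snd \<in> borel_measurable (borel :: ('a \<times> 'a) measure)"
    by (auto intro!: borel_measurable_continuous_onI continuous_intros)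
  from measurable_compose[OF this(1) assms] measurable_compose[OF this(2) assms]
  show ?thesis unfolding dif_def by measurable
qed

lemma AE_lborel_pair:
  fixes P :: "'a::euclidean_space \<Rightarrow> bool"
  assumes "AE x in lborel. P x"
  shows "AE z in (lborel :: ('a \<times> 'a) measure). P (fst z) \<and> P (snd z)"
proof -
  obtain N where N: "{x. \<not> P x} \<subseteq> N" "N \<in> null_sets lborel"
    using assms by (auto simp: eventually_ae_filter)
  have "N \<times> UNIV \<in> null_sets (lborel \<Otimes>\<^sub>M (lborel :: 'a measure))"
    "UNIV \<times> N \<in> null_sets (lborel \<Otimes>\<^sub>M (lborel :: 'a measure))"
    using N(2) by (auto intro: lborel.times_in_null_sets1 lborel.times_in_null_sets2)
  hence "N \<times> UNIV \<union> UNIV \<times> N \<in> null_sets (lborel :: ('a \<times> 'a) measure)"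
    unfolding lborel_prod by (rule null_sets.Un)
  thus ?thesis using N(1) by (intro AE_I') auto
qed

locale fractional =
  fixes p s :: real and \<Omega> :: "'a::euclidean_space set"
  assumes p: "1 < p" and s: "0 < s" "s < 1" and dim: "s * p < DIM('a)"
    and \<Omega>: "open \<Omega>" "bounded \<Omega>" "\<Omega> \<noteq> {}"
begin

text \<open>With the singular kernel absorbed into the measure, the Gagliardo energy of
  \<open>u\<close> is the integral of \<open>\<bar>dif u\<bar> powr p\<close>, so the facts on
  integrals of powers apply unchanged. On the diagonal the density is
  \<open>1 / 0 = 0\<close>.\<close>

definition \<mu> :: "('a \<times> 'a) measure" where
  "\<mu> = density lborel (\<lambda>z. ennreal (1 / norm (fst z - snd z) powr (DIM('a) + s * p)))"

definition E :: "('a \<Rightarrow> real) \<Rightarrow> real" where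
  "E u = (\<integral>z. \<bar>dif u z\<bar> powr p \<partial>\<mu>)"

text \<open>Representatives are Borel and vanish everywhere outside \<Omega>, not just almost
  everywhere; hence the energy over the whole product equals that over \<open>Qset \<Omega>\<close>,
  and integrals over \<Omega> become integrals over the space.\<close>

definition W :: "('a \<Rightarrow> real) set" where
  "W = {u \<in> borel_measurable borel. (\<forall>x. x \<notin> \<Omega> \<longrightarrow> u x = 0) \<and> integrable \<mu> (\<lambda>z. \<bar>dif u z\<bar> powr p)}"

lemma sets_\<mu> [measurable_cong, simp]: "sets \<mu> = sets borel"
  by (simp add: \<mu>_def)

lemma sp_pos: "0 < s * p" using p s by simp

lemma kernel_measurable [measurable]:
  "(\<lambda>z::'a \<times> 'a. 1 / norm (fst z - snd z) powr (DIM('a) + s * p)) \<in> borel_measurable borel"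
proof -
  have "fst \<in> borel_measurable (borel :: ('a \<times> 'a) measure)" "snd \<in> borel_measurable (borel :: ('a \<times> 'a) measure)"
    by (auto intro!: borel_measurable_continuous_onI continuous_intros)
  hence [measurable]: "(\<lambda>z::'a \<times> 'a. fst z - snd z) \<in> borel_measurable borel" by measurable
  show ?thesis by measurable
qed

lemma nn_integral_\<mu>:
  assumes [measurable]: "f \<in> borel_measurable borel"
  shows "(\<integral>\<^sup>+z. f z \<partial>\<mu>) = (\<integral>\<^sup>+x. \<integral>\<^sup>+y. ennreal (1 / norm (x - y) powr (DIM('a) + s * p)) * f (x, y) \<partial>lborel \<partial>lborel)"
proof -
  have "(\<integral>\<^sup>+z. f z \<partial>\<mu>) = (\<integral>\<^sup>+z. ennreal (1 / norm (fst z - snd z) powr (DIM('a) + s * p)) * f z \<partial>lborel)"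
    unfolding \<mu>_def by (intro nn_integral_density) auto
  also have "\<dots> = (\<integral>\<^sup>+z. ennreal (1 / norm (fst z - snd z) powr (DIM('a) + s * p)) * f z \<partial>(lborel \<Otimes>\<^sub>M lborel))"
    by (simp add: lborel_prod)
  also have "\<dots> = (\<integral>\<^sup>+x. \<integral>\<^sup>+y. ennreal (1 / norm (x - y) powr (DIM('a) + s * p)) * f (x, y) \<partial>lborel \<partial>lborel)"
    by (subst lborel.nn_integral_fst[symmetric]) (simp_all add: lborel_prod)
  finally show ?thesis .
qed

lemma AE_\<mu>:
  assumes "AE x in lborel. P x" shows "AE z in \<mu>. P (fst z) \<and> P (snd z)"
proof -
  have "(\<lambda>z::'a \<times> 'a. ennreal (1 / norm (fst z - snd z) powr (DIM('a) + s * p))) \<in> borel_measurable lborel"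
    using kernel_measurable by simp
  thus ?thesis unfolding \<mu>_def using AE_lborel_pair[OF assms]
    by (subst AE_density) (auto elim: eventually_mono)
qed

lemma W_measurable: "u \<in> W \<Longrightarrow> u \<in> borel_measurable borel"
  and W_zero: "u \<in> W \<Longrightarrow> x \<notin> \<Omega> \<Longrightarrow> u x = 0"
  and W_integrable: "u \<in> W \<Longrightarrow> integrable \<mu> (\<lambda>z. \<bar>dif u z\<bar> powr p)"
  by (auto simp: W_def)

lemma dif_measurable_\<mu>: "u \<in> borel_measurable borel \<Longrightarrow> dif u \<in> borel_measurable \<mu>"
  using dif_measurable measurable_cong_sets[OF sets_\<mu> refl] by blast

lemma E_nonneg: "0 \<le> E u"
  unfolding E_def by (intro integral_nonneg_AE) auto

lemma E_nn: "u \<in> W \<Longrightarrow> (\<integral>\<^sup>+z. ennreal (\<bar>dif u z\<bar> powr p) \<partial>\<mu>) = ennreal (E u)"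
  unfolding E_def by (intro nn_integral_eq_integral W_integrable) auto

text \<open>Normal contractions decrease the energy pointwise under the integral; positive parts and
  absolute values are the instances used.\<close>

lemma W_contraction:
  assumes u: "u \<in> W" and [measurable]: "v \<in> borel_measurable borel" and "\<And>x. x \<notin> \<Omega> \<Longrightarrow> v x = 0"
    and le: "\<And>x y. \<bar>v x - v y\<bar> \<le> \<bar>u x - u y\<bar>"
  shows "v \<in> W" "E v \<le> E u"
proof -
  have "integrable \<mu> (\<lambda>z. \<bar>dif v z\<bar> powr p)"
  proof (rule Bochner_Integration.integrable_bound[OF W_integrable[OF u]])
    show "AE z in \<mu>. norm (\<bar>dif v z\<bar> powr p) \<le> norm (\<bar>dif u z\<bar> powr p)"
      using le p by (intro AE_I2) (auto simp: dif_def intro!: powr_mono2)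
    show "(\<lambda>z. \<bar>dif v z\<bar> powr p) \<in> borel_measurable \<mu>"
      using dif_measurable_\<mu>[OF assms(2)] by measurable
  qed
  thus "v \<in> W" using assms by (auto simp: W_def)
  thus "E v \<le> E u"
    unfolding E_def using le p W_integrable u
    by (intro integral_mono) (auto simp: dif_def intro!: powr_mono2)
qed

lemma W_add:
  assumes "u \<in> W" "v \<in> W" shows "(\<lambda>x. u x + v x) \<in> W"
proof -
  have "integrable \<mu> (\<lambda>z. \<bar>dif u z + dif v z\<bar> powr p)"
    using assms p by (intro integrable_powr_add dif_measurable_\<mu> W_measurable W_integrable) auto
  moreover have "dif u z + dif v z = dif (\<lambda>x. u x + v x) z" for z by (simp add: dif_def)
  ultimately show ?thesis using assms by (auto simp: W_def)
qed

lemma W_cmult: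
  assumes "u \<in> W" shows "(\<lambda>x. t * u x) \<in> W" "E (\<lambda>x. t * u x) = \<bar>t\<bar> powr p * E u"
proof -
  have d: "dif (\<lambda>x. t * u x) z = t * dif u z" for z by (simp add: dif_def algebra_simps)
  show "(\<lambda>x. t * u x) \<in> W"
    using assms integrable_powr_cmult(1)[OF W_integrable[OF assms], of t] by (auto simp: W_def d)
  show "E (\<lambda>x. t * u x) = \<bar>t\<bar> powr p * E u"
    unfolding E_def d by (rule integrable_powr_cmult(2)[OF W_integrable[OF assms]])
qed

lemma W_diff: "u \<in> W \<Longrightarrow> v \<in> W \<Longrightarrow> (\<lambda>x. u x - v x) \<in> W"
  using W_add[of u "\<lambda>x. - 1 * v x"] W_cmult(1)[of v "- 1"] by simp

lemma W_pos_part: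
  assumes "u \<in> W" shows "(\<lambda>x. max 0 (u x)) \<in> W" "E (\<lambda>x. max 0 (u x)) \<le> E u"
  using assms W_measurable[OF assms] W_zero[OF assms]
  by (auto intro!: W_contraction[OF assms])

lemma W_abs:
  assumes "u \<in> W" shows "(\<lambda>x. \<bar>u x\<bar>) \<in> W" "E (\<lambda>x. \<bar>u x\<bar>) \<le> E u"
  using assms W_measurable[OF assms] W_zero[OF assms]
  by (auto intro!: W_contraction[OF assms])

lemma E_diff_le:
  assumes "u \<in> W" "v \<in> W" shows "E (\<lambda>x. u x - v x) \<le> 2 powr p * (E u + E v)"
proof -
  have "E (\<lambda>x. u x - v x) \<le> (\<integral>z. 2 powr p * (\<bar>dif u z\<bar> powr p + \<bar>dif v z\<bar> powr p) \<partial>\<mu>)"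
    unfolding E_def
  proof (rule integral_mono)
    show "integrable \<mu> (\<lambda>z. \<bar>dif (\<lambda>x. u x - v x) z\<bar> powr p)" by (intro W_integrable W_diff assms)
    show "integrable \<mu> (\<lambda>z. 2 powr p * (\<bar>dif u z\<bar> powr p + \<bar>dif v z\<bar> powr p))"
      using assms by (auto intro!: W_integrable)
    show "\<bar>dif (\<lambda>x. u x - v x) z\<bar> powr p \<le> 2 powr p * (\<bar>dif u z\<bar> powr p + \<bar>dif v z\<bar> powr p)" for z
    proof -
      have "dif (\<lambda>x. u x - v x) z = dif u z + - dif v z" by (simp add: dif_def)
      thus ?thesis using abs_add_powr_le[of p "dif u z" "- dif v z"] p by simp
    qed
  qed
  also have "\<dots> = 2 powr p * (E u + E v)"
    unfolding E_def using assms by (simp add: W_integrable)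
  finally show ?thesis .
qed

subsection \<open>Weak-type Sobolev inequality\<close>

lemma finite_\<Omega>: "emeasure lborel \<Omega> < \<infinity>" "\<Omega> \<in> sets borel"
  using emeasure_bounded_finite[OF \<Omega>(2)] \<Omega>(1) by auto

definition level :: "('a \<Rightarrow> real) \<Rightarrow> real \<Rightarrow> 'a set" where "level u T = {x. T < \<bar>u x\<bar>}"

lemma level_sets [measurable]: "u \<in> borel_measurable borel \<Longrightarrow> level u T \<in> sets borel"
  unfolding level_def by measurable

lemma level_subset: "u \<in> W \<Longrightarrow> 0 \<le> T \<Longrightarrow> level u T \<subseteq> \<Omega>"
  using W_zero[of u] by (force simp: level_def)

lemma level_finite: "u \<in> W \<Longrightarrow> 0 \<le> T \<Longrightarrow> emeasure lborel (level u T) < \<infinity>"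
  using emeasure_mono[OF level_subset[of u T], of lborel] finite_\<Omega> by (auto intro: le_less_trans)

text \<open>Around each point of the level set at height \<open>2T\<close>, the ball of twice the measure of the level set
  at height \<open>T\<close> contains enough points where \<open>\<bar>u\<bar> \<le> T\<close>.\<close>

lemma level_step:
  obtains C where "0 < C" "\<And>u T. u \<in> W \<Longrightarrow> 0 < T \<Longrightarrow>
    measure lborel (level u (2 * T)) \<le> C * E u * T powr (- p) * measure lborel (level u T) powr (s * p / DIM('a))"
proof -
  define n where "n = real DIM('a)"
  define \<omega> where "\<omega> = unit_ball_vol n"
  have n: "0 < n" and \<omega>: "0 < \<omega>" by (auto simp: n_def \<omega>_def)
  define C where "C = (2 / \<omega>) powr ((n + s * p) / n)"
  have "measure lborel (level u (2 * T)) \<le> C * E u * T powr (- p) * measure lborel (level u T) powr (s * p / n)"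
    if u: "u \<in> W" and T: "0 < T" for u T
  proof (cases "measure lborel (level u T) = 0")
    case True
    have "measure lborel (level u (2 * T)) \<le> measure lborel (level u T)"
      using level_finite[OF u, of T] T W_measurable[OF u]
      by (intro measure_mono_fmeasurable fmeasurableI) (auto simp: level_def)
    thus ?thesis using True by simp
  next
    case False
    define m where "m = measure lborel (level u T)"
    define m2 where "m2 = measure lborel (level u (2 * T))"
    have m: "0 < m" using False by (simp add: m_def zero_less_measure_iff)
    have [measurable]: "u \<in> borel_measurable borel" using W_measurable[OF u] .
    have em: "emeasure lborel (level u T) = ennreal m" "emeasure lborel (level u (2 * T)) = ennreal m2"
      using level_finite[OF u, of T] level_finite[OF u, of "2 * T"] T
      by (auto simp: m_def m2_def less_top emeasure_eq_ennreal_measure)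
    define \<rho> where "\<rho> = (2 * m / \<omega>) powr (1 / n)"
    have \<rho>: "0 < \<rho>" using m \<omega> by (simp add: \<rho>_def)
    have \<rho>n: "\<omega> * \<rho> ^ DIM('a) = 2 * m"
      using \<rho> m \<omega> n by (simp add: \<rho>_def powr_powr flip: powr_realpow n_def)
    have ball: "ennreal m \<le> emeasure lborel (ball x \<rho> - level u T)" for x :: 'a
    proof -
      have eq: "emeasure lborel (ball x \<rho>) = ennreal m + ennreal m"
        using emeasure_ball[of \<rho> x] \<rho> \<rho>n m by (simp add: \<omega>_def n_def flip: ennreal_plus)
      have "emeasure lborel (ball x \<rho>) \<le> emeasure lborel ((ball x \<rho> - level u T) \<union> level u T)"
        by (intro emeasure_mono) auto
      also have "\<dots> \<le> emeasure lborel (ball x \<rho> - level u T) + emeasure lborel (level u T)"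
        by (intro emeasure_subadditive) auto
      finally have "ennreal m + ennreal m \<le> ennreal m + emeasure lborel (ball x \<rho> - level u T)"
        using em eq by (simp add: add.commute)
      thus ?thesis by (subst (asm) ennreal_add_left_cancel_le) auto
    qed
    \<comment> \<open>A lower bound for the kernel times \<open>\<bar>u x - u y\<bar> powr p\<close>
      when \<open>\<bar>u x\<bar>\<close> exceeds \<open>2 * T\<close>,
      \<open>\<bar>u y\<bar>\<close> is at most \<open>T\<close>, and the points are closer than
      \<rho>.\<close>
    define c where "c = T powr p / \<rho> powr (n + s * p)"
    have c: "0 < c" using T \<rho> by (simp add: c_def)
    have "ennreal (c * m * m2) = (\<integral>\<^sup>+x. ennreal (c * m) * indicator (level u (2 * T)) x \<partial>lborel)"
      using em m c by (simp add: nn_integral_cmult_indicator ennreal_mult m2_def)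
    also have "\<dots> \<le> (\<integral>\<^sup>+x. \<integral>\<^sup>+y. ennreal (1 / norm (x - y) powr (DIM('a) + s * p)) *
        ennreal (\<bar>dif u (x, y)\<bar> powr p) \<partial>lborel \<partial>lborel)"
    proof (rule nn_integral_mono)
      fix x :: 'a
      show "ennreal (c * m) * indicator (level u (2 * T)) x \<le> (\<integral>\<^sup>+y. ennreal (1 / norm (x - y) powr (DIM('a) + s * p)) *
        ennreal (\<bar>dif u (x, y)\<bar> powr p) \<partial>lborel)"
      proof (cases "x \<in> level u (2 * T)")
        case x: True
        have "ennreal (c * m) \<le> ennreal c * emeasure lborel (ball x \<rho> - level u T)"
          using ball[of x] c m by (simp add: ennreal_mult mult_left_mono)
        also have "\<dots> = (\<integral>\<^sup>+y. ennreal c * indicator (ball x \<rho> - level u T) y \<partial>lborel)"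
          by (simp add: nn_integral_cmult_indicator)
        also have "\<dots> \<le> (\<integral>\<^sup>+y. ennreal (1 / norm (x - y) powr (DIM('a) + s * p)) *
            ennreal (\<bar>dif u (x, y)\<bar> powr p) \<partial>lborel)"
        proof (rule nn_integral_mono)
          fix y
          show "ennreal c * indicator (ball x \<rho> - level u T) y \<le> ennreal (1 / norm (x - y) powr (DIM('a) + s * p)) *
            ennreal (\<bar>dif u (x, y)\<bar> powr p)"
          proof (cases "y \<in> ball x \<rho> - level u T")
            case y: True
            have "T \<le> \<bar>u x - u y\<bar>" using x y by (auto simp: level_def)
            hence 1: "T powr p \<le> \<bar>dif u (x, y)\<bar> powr p" using T p by (auto simp: dif_def intro!: powr_mono2)
            have "x \<noteq> y" using x y T by (auto simp: level_def)
            hence 2: "1 / \<rho> powr (n + s * p) \<le> 1 / norm (x - y) powr (n + s * p)"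
              using y \<rho> n sp_pos by (intro divide_left_mono powr_mono2 mult_pos_pos) (auto simp: dist_norm)
            have "c = (1 / \<rho> powr (n + s * p)) * T powr p" by (simp add: c_def)
            also have "\<dots> \<le> (1 / norm (x - y) powr (n + s * p)) * \<bar>dif u (x, y)\<bar> powr p"
              using 1 2 by (intro mult_mono) auto
            finally show ?thesis using y by (simp add: n_def flip: ennreal_mult)
          qed auto
        qed
        finally show ?thesis using x by simp
      qed auto
    qed
    also have "\<dots> = ennreal (E u)"
      using E_nn[OF u] nn_integral_\<mu>[of "\<lambda>z. ennreal (\<bar>dif u z\<bar> powr p)"] by simp
    finally have "c * m * m2 \<le> E u" using E_nonneg by (simp add: ennreal_le_iff)
    hence "m2 \<le> E u / (c * m)" using c m by (simp add: field_simps)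
    also have "E u / (c * m) = E u * T powr (- p) * (\<rho> powr (n + s * p) / m)"
      using T m by (simp add: c_def powr_minus field_simps)
    also have "\<rho> powr (n + s * p) = (2 * m / \<omega>) powr ((n + s * p) / n)"
      by (simp add: \<rho>_def powr_powr)
    also have "\<dots> = C * m powr ((n + s * p) / n)"
      using m \<omega> by (simp add: C_def powr_mult powr_divide)
    also have "(n + s * p) / n = s * p / n + 1" using n by (simp add: field_simps)
    also have "m powr (s * p / n + 1) = m powr (s * p / n) * m" using m by (simp add: powr_add)
    finally show ?thesis using m by (simp add: m_def m2_def algebra_simps)
  qed
  moreover have "0 < C" using \<omega> by (simp add: C_def)
  ultimately show ?thesis using that by (simp add: n_def)
qed

definition pstar :: real where "pstar = DIM('a) * p / (DIM('a) - s * p)"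

lemma pstar_gt: "p < pstar" "1 < pstar"
proof -
  have "p * (DIM('a) - s * p) < p * DIM('a)"
    using dim p sp_pos by (intro mult_strict_left_mono) auto
  thus "p < pstar" using dim by (simp add: pstar_def field_simps)
  thus "1 < pstar" using p by simp
qed

text \<open>Iteration of \<open>level_step\<close> by doubling the height. The ansatz
  \<open>B * T powr (- pstar)\<close> reproduces itself, since the exponent \<open>pstar\<close> is
  the fixed point of the recursion; this yields the weak-type bound at the critical
  exponent.\<close>

lemma level_bound:
  obtains B where "0 \<le> B" "\<And>u T. u \<in> W \<Longrightarrow> E u \<le> K \<Longrightarrow> 0 < T \<Longrightarrow> measure lborel (level u T) \<le> B * T powr (- pstar)"
proof -
  obtain C where C: "0 < C" "\<And>u T. u \<in> W \<Longrightarrow> 0 < T \<Longrightarrow>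
    measure lborel (level u (2 * T)) \<le> C * E u * T powr (- p) * measure lborel (level u T) powr (s * p / DIM('a))"
    using level_step by blast
  define \<theta> where "\<theta> = s * p / DIM('a)"
  have \<theta>: "0 < \<theta>" "\<theta> < 1" using dim sp_pos by (auto simp: \<theta>_def)
  have ps: "p + pstar * \<theta> = pstar"
    using dim by (simp add: pstar_def \<theta>_def field_simps)
  define D where "D = 2 powr pstar * C * max K 1"
  have D: "0 < D" using C by (simp add: D_def)
  \<comment> \<open>The first entry starts the induction at heights up to 1, where the measure of
    \<Omega> suffices; the second gives \<open>D * B powr \<theta> \<le> B\<close>, solvable because
    \<open>\<theta> < 1\<close>.\<close>
  define B where "B = max (measure lborel \<Omega>) (D powr (1 / (1 - \<theta>)))"
  have B: "0 < B" using D by (simp add: B_def less_max_iff_disj)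
  have DB: "D * B powr \<theta> \<le> B"
  proof -
    have "D = (D powr (1 / (1 - \<theta>))) powr (1 - \<theta>)" using D \<theta> by (simp add: powr_powr)
    also have "\<dots> \<le> B powr (1 - \<theta>)" using \<theta> by (intro powr_mono2) (auto simp: B_def)
    finally have "D * B powr \<theta> \<le> B powr (1 - \<theta>) * B powr \<theta>" by (intro mult_right_mono) auto
    thus ?thesis using B by (simp flip: powr_add)
  qed
  have "measure lborel (level u T) \<le> B * T powr (- pstar)" if u: "u \<in> W" "E u \<le> K" and T: "0 < T" for u T
  proof -
    have "\<forall>T. 0 < T \<and> T \<le> 2 ^ k \<longrightarrow> measure lborel (level u T) \<le> B * T powr (- pstar)" for k :: nat
    proof (induction k)
      case 0
      show ?case
      proof safe
        fix T :: real assume T: "0 < T" "T \<le> 2 ^ 0"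
        have "measure lborel (level u T) \<le> measure lborel \<Omega>"
          using level_subset[OF u(1), of T] T W_measurable[OF u(1)] finite_\<Omega>
          by (intro measure_mono_fmeasurable fmeasurableI) auto
        also have "\<dots> \<le> B * 1" by (simp add: B_def)
        also have "\<dots> \<le> B * T powr (- pstar)"
          using T B pstar_gt powr_mono2'[of "- pstar" T 1] by (intro mult_left_mono) auto
        finally show "measure lborel (level u T) \<le> B * T powr (- pstar)" .
      qed
    next
      case (Suc k)
      show ?case
      proof safe
        fix T :: real assume T: "0 < T" "T \<le> 2 ^ Suc k"
        define S where "S = T / 2"
        have S: "0 < S" "S \<le> 2 ^ k" "T = 2 * S" using T by (auto simp: S_def)
        have IH: "measure lborel (level u S) \<le> B * S powr (- pstar)" using Suc S by blast
        have "measure lborel (level u T) \<le> C * E u * S powr (- p) * measure lborel (level u S) powr \<theta>"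
          using C(2)[OF u(1) S(1)] S by (simp add: \<theta>_def)
        also have "\<dots> \<le> C * max K 1 * S powr (- p) * (B * S powr (- pstar)) powr \<theta>"
        proof (rule mult_mono)
          show "C * E u * S powr (- p) \<le> C * max K 1 * S powr (- p)"
            using C(1) u(2) by (intro mult_right_mono mult_left_mono) auto
          show "measure lborel (level u S) powr \<theta> \<le> (B * S powr (- pstar)) powr \<theta>"
            using IH \<theta> by (intro powr_mono2) auto
          show "0 \<le> C * max K 1 * S powr (- p)" using C(1) by (intro mult_nonneg_nonneg) auto
        qed auto
        also have "\<dots> = C * max K 1 * B powr \<theta> * (S powr (- p) * S powr (- (pstar * \<theta>)))"
          using S B by (simp add: powr_mult powr_powr)
        also have "S powr (- p) * S powr (- (pstar * \<theta>)) = S powr (- pstar)"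
        proof -
          have "- p + - (pstar * \<theta>) = - pstar" using ps by linarith
          thus ?thesis using powr_add[of S "- p" "- (pstar * \<theta>)"] by metis
        qed
        also have "S powr (- pstar) = 2 powr pstar * T powr (- pstar)"
          using S(1) unfolding S(3) by (simp add: powr_mult powr_minus)
        finally have "measure lborel (level u T) \<le> (D * B powr \<theta>) * T powr (- pstar)"
          by (simp add: D_def algebra_simps)
        also have "\<dots> \<le> B * T powr (- pstar)" using DB by (intro mult_right_mono) auto
        finally show "measure lborel (level u T) \<le> B * T powr (- pstar)" .
      qed
    qed
    moreover obtain k :: nat where "T \<le> 2 ^ k"
      using real_arch_pow[of 2 T] by (auto intro: less_imp_le)
    ultimately show ?thesis using T by blast
  qed
  thus ?thesis using that[of B] B by auto
qed

text \<open>Dyadic layers: where \<open>\<bar>u\<bar>\<close> lies between \<open>2 ^ j\<close> and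
  \<open>2 ^ (j + 1)\<close> the integrand is at most \<open>2 powr (r * (j + 1))\<close>, and the
  weak-type bound makes the layer contributions geometric with ratio
  \<open>2 powr (r - pstar) < 1\<close>.\<close>

lemma Lr_bound:
  assumes r: "0 < r" "r < pstar"
  obtains C where "\<And>u. u \<in> W \<Longrightarrow> E u \<le> K \<Longrightarrow> integrable lborel (\<lambda>x. \<bar>u x\<bar> powr r)"
    "\<And>u. u \<in> W \<Longrightarrow> E u \<le> K \<Longrightarrow> (\<integral>x. \<bar>u x\<bar> powr r \<partial>lborel) \<le> C"
proof -
  obtain B where B: "0 \<le> B" "\<And>u T. u \<in> W \<Longrightarrow> E u \<le> K \<Longrightarrow> 0 < T \<Longrightarrow> measure lborel (level u T) \<le> B * T powr (- pstar)"
    using level_bound by blast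
  define q where "q = 2 powr (r - pstar)"
  have q: "0 < q" "q < 1" using r by (auto simp: q_def powr_less_one)
  define C where "C = measure lborel \<Omega> + 2 powr r * B * (1 / (1 - q))"
  have main: "(\<integral>\<^sup>+x. ennreal (\<bar>u x\<bar> powr r) \<partial>lborel) \<le> ennreal C" if u: "u \<in> W" "E u \<le> K" for u
  proof -
    have [measurable]: "u \<in> borel_measurable borel" "\<Omega> \<in> sets borel" using W_measurable[OF u(1)] finite_\<Omega> by auto
    define g where "g j x = ennreal (2 powr (r * (real j + 1))) * indicator (level u (2 ^ j)) x" for j :: nat and x
    have "ennreal (\<bar>u x\<bar> powr r) \<le> indicator \<Omega> x + (\<Sum>j. g j x)" for x
    proof (cases "\<bar>u x\<bar> \<le> 1")
      case True
      hence "ennreal (\<bar>u x\<bar> powr r) \<le> indicator \<Omega> x"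
        using W_zero[OF u(1), of x] r powr_le1[of r "\<bar>u x\<bar>"] by (cases "x \<in> \<Omega>") auto
      thus ?thesis by (simp add: add_increasing2)
    next
      case False
      define k where "k = (LEAST k. \<bar>u x\<bar> \<le> 2 ^ k)"
      have ex: "\<exists>k. \<bar>u x\<bar> \<le> 2 ^ k" using real_arch_pow[of 2 "\<bar>u x\<bar>"] by (auto intro: less_imp_le)
      have k: "\<bar>u x\<bar> \<le> 2 ^ k" unfolding k_def by (rule LeastI_ex[OF ex])
      have "k \<noteq> 0" using False k by (cases k) auto
      then obtain j where j: "k = Suc j" by (cases k) auto
      have "\<not> \<bar>u x\<bar> \<le> 2 ^ j" using not_less_Least[of j "\<lambda>k. \<bar>u x\<bar> \<le> 2 ^ k"] j by (simp add: k_def)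
      hence l: "x \<in> level u (2 ^ j)" by (simp add: level_def)
      have "\<bar>u x\<bar> powr r \<le> (2 ^ k) powr r" using k r by (intro powr_mono2) auto
      also have "(2::real) ^ k = 2 powr (real j + 1)" by (simp add: j powr_realpow flip: powr_realpow[of 2 "Suc j"] of_nat_Suc add.commute)
      also have "\<dots> powr r = 2 powr (r * (real j + 1))" by (simp add: powr_powr mult.commute)
      finally have "ennreal (\<bar>u x\<bar> powr r) \<le> g j x" using l by (simp add: g_def)
      also have "\<dots> \<le> (\<Sum>j. g j x)"
        using sum_le_suminf[of "\<lambda>j. g j x" "{j}"] by (simp add: summableI)
      finally show ?thesis by (simp add: add_increasing)
    qed
    hence "(\<integral>\<^sup>+x. ennreal (\<bar>u x\<bar> powr r) \<partial>lborel) \<le> (\<integral>\<^sup>+x. indicator \<Omega> x + (\<Sum>j. g j x) \<partial>lborel)"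
      by (intro nn_integral_mono) auto
    also have "\<dots> = emeasure lborel \<Omega> + (\<Sum>j. \<integral>\<^sup>+x. g j x \<partial>lborel)"
      unfolding g_def by (subst nn_integral_add) (auto simp: nn_integral_suminf)
    also have "(\<Sum>j. \<integral>\<^sup>+x. g j x \<partial>lborel) \<le> (\<Sum>j. ennreal (2 powr r * B * q ^ j))"
    proof (intro suminf_le summableI)
      fix j :: nat
      have "(\<integral>\<^sup>+x. g j x \<partial>lborel) = ennreal (2 powr (r * (real j + 1))) * emeasure lborel (level u (2 ^ j))"
        unfolding g_def by (simp add: nn_integral_cmult_indicator)
      also have "\<dots> = ennreal (2 powr (r * (real j + 1)) * measure lborel (level u (2 ^ j)))"
        using level_finite[OF u(1), of "2 ^ j"] by (simp add: emeasure_eq_ennreal_measure ennreal_mult)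
      also have "\<dots> \<le> ennreal (2 powr (r * (real j + 1)) * (B * (2 ^ j) powr (- pstar)))"
        using B(2)[OF u, of "2 ^ j"] by (intro ennreal_leI mult_left_mono) auto
      also have "2 powr (r * (real j + 1)) * (B * (2 ^ j) powr (- pstar)) = 2 powr r * B * (2 powr (r * real j) * 2 powr (- pstar * real j))"
        by (simp add: algebra_simps powr_add powr_powr flip: powr_realpow)
      also have "2 powr (r * real j) * 2 powr (- pstar * real j) = q ^ j"
        by (simp add: q_def algebra_simps powr_powr flip: powr_realpow powr_add)
      finally show "(\<integral>\<^sup>+x. g j x \<partial>lborel) \<le> ennreal (2 powr r * B * q ^ j)" .
    qed
    also have "(\<Sum>j. ennreal (2 powr r * B * q ^ j)) = ennreal (2 powr r * B * (1 / (1 - q)))"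
      using q B by (intro suminf_ennreal_eq sums_mult geometric_sums) auto
    also have "emeasure lborel \<Omega> = ennreal (measure lborel \<Omega>)"
      using finite_\<Omega> by (simp add: emeasure_eq_ennreal_measure)
    finally show ?thesis using B q by (simp add: C_def ennreal_plus add_left_mono)
  qed
  have C: "0 \<le> C" using B q by (simp add: C_def)
  have int: "integrable lborel (\<lambda>x. \<bar>u x\<bar> powr r)" if u: "u \<in> W" "E u \<le> K" for u
    using main[OF u] W_measurable[OF u(1)] by (intro integrableI_bounded) (auto simp: le_less_trans)
  have "(\<integral>x. \<bar>u x\<bar> powr r \<partial>lborel) \<le> C" if u: "u \<in> W" "E u \<le> K" for u
    using main[OF u] C by (subst (asm) nn_integral_eq_integral[OF int[OF u]]) (auto simp: ennreal_le_iff)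
  with int that show ?thesis by blast
qed

end

subsection \<open>Compactness\<close>

text \<open>Cantor's diagonal argument over an enumeration of \<open>S\<close>; the enumeration may
  repeat elements, so finite index sets are included.\<close>

lemma countable_bounded_subsequence:
  fixes f :: "'i \<Rightarrow> nat \<Rightarrow> real"
  assumes S: "countable S" and bd: "\<And>i k. i \<in> S \<Longrightarrow> \<bar>f i k\<bar> \<le> B i"
  obtains r where "strict_mono r" "\<And>i. i \<in> S \<Longrightarrow> convergent (\<lambda>k. f i (r k))"
proof (cases "S = {}")
  case False
  interpret subseqs "\<lambda>n s. convergent (\<lambda>k. f (from_nat_into S n) (s k))"
  proof
    fix n and s :: "nat \<Rightarrow> nat"
    have "from_nat_into S n \<in> S" using False by (rule from_nat_into)
    hence "bounded (range (\<lambda>k. f (from_nat_into S n) (s k)))"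
      using bd by (auto simp: bounded_iff)
    from bounded_imp_convergent_subsequence[OF this] obtain l r where
      "strict_mono r" "((\<lambda>k. f (from_nat_into S n) (s k)) \<circ> r) \<longlonglongrightarrow> l" by blast
    thus "\<exists>r'. strict_mono r' \<and> convergent (\<lambda>k. f (from_nat_into S n) ((s \<circ> r') k))"
      by (auto simp: convergent_def o_def)
  qed
  have "convergent (\<lambda>k. f i (diagseq k))" if i: "i \<in> S" for i
  proof -
    obtain n where n: "from_nat_into S n = i" using from_nat_into_to_nat_on[OF S i] by blast
    have "convergent (\<lambda>k. f (from_nat_into S n) ((diagseq \<circ> (+) (Suc n)) k))"
    proof (rule diagseq_holds)
      fix r s :: "nat \<Rightarrow> nat" and n
      assume "strict_mono r" "convergent (\<lambda>k. f (from_nat_into S n) (s k))"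
      thus "convergent (\<lambda>k. f (from_nat_into S n) ((s \<circ> r) k))"
        using convergent_subseq_convergent[of "\<lambda>k. f (from_nat_into S n) (s k)" r] by (simp add: o_def)
    qed
    hence "convergent (\<lambda>k. f i (diagseq (k + Suc n)))" by (simp add: n o_def add.commute)
    thus ?thesis by (rule iffD1[OF convergent_ignore_initial_segment[of "\<lambda>k. f i (diagseq k)" "Suc n"]])
  qed
  thus ?thesis using that subseq_diagseq by blast
qed (use that[of id] in \<open>auto simp: strict_mono_def\<close>)

text \<open>The half-open cell of the grid of side \<delta> that contains \<open>x\<close>.
  Comparing floors makes lying in the same cell an equivalence relation, so distinct cells are
  disjoint with no care about faces.\<close>

definition cube :: "real \<Rightarrow> 'a::euclidean_space \<Rightarrow> 'a set" where
  "cube \<delta> x = {y. \<forall>b\<in>Basis. \<lfloor>y \<bullet> b / \<delta>\<rfloor> = \<lfloor>x \<bullet> b / \<delta>\<rfloor>}"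

lemma cube_sets [measurable]: "cube \<delta> (x :: 'a::euclidean_space) \<in> sets borel"
proof -
  have "cube \<delta> x = (\<Inter>b\<in>Basis. {y. \<lfloor>y \<bullet> b / \<delta>\<rfloor> = \<lfloor>x \<bullet> b / \<delta>\<rfloor>})"
    by (auto simp: cube_def)
  also have "\<dots> = (\<Inter>b\<in>Basis. {y. \<lfloor>x \<bullet> b / \<delta>\<rfloor> \<le> y \<bullet> b / \<delta> \<and> y \<bullet> b / \<delta> < \<lfloor>x \<bullet> b / \<delta>\<rfloor> + 1})"
    by (simp add: floor_eq_iff)
  also have "\<dots> \<in> sets borel" by (intro sets.finite_INT) (auto, measurable)
  finally show ?thesis .
qed

lemma cube_floor_bounds:
  assumes "0 < \<delta>" "y \<in> cube \<delta> x" "b \<in> Basis"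
  shows "\<delta> * \<lfloor>x \<bullet> b / \<delta>\<rfloor> \<le> y \<bullet> b" "y \<bullet> b \<le> \<delta> * \<lfloor>x \<bullet> b / \<delta>\<rfloor> + \<delta>"
proof -
  have *: "\<lfloor>y \<bullet> b / \<delta>\<rfloor> = \<lfloor>x \<bullet> b / \<delta>\<rfloor>" using assms by (auto simp: cube_def)
  have "\<lfloor>y \<bullet> b / \<delta>\<rfloor> \<le> y \<bullet> b / \<delta>" "y \<bullet> b / \<delta> < \<lfloor>y \<bullet> b / \<delta>\<rfloor> + 1" by linarith+
  thus "\<delta> * \<lfloor>x \<bullet> b / \<delta>\<rfloor> \<le> y \<bullet> b" "y \<bullet> b \<le> \<delta> * \<lfloor>x \<bullet> b / \<delta>\<rfloor> + \<delta>"
    unfolding * using assms by (auto simp: field_simps)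
qed

lemma cube_diam:
  fixes x :: "'a::euclidean_space" and \<delta> :: real
  assumes "0 < \<delta>" "y \<in> cube \<delta> x" "z \<in> cube \<delta> x"
  shows "norm (y - z) \<le> DIM('a) * \<delta>"
proof -
  have "norm (y - z) \<le> (\<Sum>b\<in>Basis. \<bar>(y - z) \<bullet> b\<bar>)" by (rule norm_le_l1)
  also have "\<dots> \<le> (\<Sum>b\<in>(Basis :: 'a set). \<delta>)"
  proof (rule sum_mono)
    fix b :: 'a assume b: "b \<in> Basis"
    show "\<bar>(y - z) \<bullet> b\<bar> \<le> \<delta>"
      using cube_floor_bounds[OF assms(1,2) b] cube_floor_bounds[OF assms(1,3) b]
      by (simp add: inner_diff_left abs_le_iff)
  qed
  finally show ?thesis by simp
qed

lemma emeasure_cube: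
  fixes x :: "'a::euclidean_space" and \<delta> :: real
  assumes "0 < \<delta>" shows "emeasure lborel (cube \<delta> x) = ennreal (\<delta> ^ DIM('a))"
proof (rule antisym)
  define l where "l = (\<Sum>b\<in>Basis. (\<delta> * \<lfloor>x \<bullet> b / \<delta>\<rfloor>) *\<^sub>R b)"
  define u where "u = (\<Sum>b\<in>Basis. (\<delta> * \<lfloor>x \<bullet> b / \<delta>\<rfloor> + \<delta>) *\<^sub>R b)"
  have l: "l \<bullet> b = \<delta> * \<lfloor>x \<bullet> b / \<delta>\<rfloor>" and u: "u \<bullet> b = \<delta> * \<lfloor>x \<bullet> b / \<delta>\<rfloor> + \<delta>" if "b \<in> Basis" for b
    using that by (simp_all add: l_def u_def)
  have "cube \<delta> x \<subseteq> cbox l u"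
    using cube_floor_bounds[OF assms] by (auto simp: mem_box l u)
  hence "emeasure lborel (cube \<delta> x) \<le> emeasure lborel (cbox l u)" by (intro emeasure_mono) auto
  also have "\<dots> = ennreal (\<delta> ^ DIM('a))"
    using assms by (subst emeasure_lborel_cbox) (auto simp: l u inner_diff_left)
  finally show "emeasure lborel (cube \<delta> x) \<le> ennreal (\<delta> ^ DIM('a))" .
  have "box l u \<subseteq> cube \<delta> x"
  proof
    fix y assume y: "y \<in> box l u"
    have "\<lfloor>y \<bullet> b / \<delta>\<rfloor> = \<lfloor>x \<bullet> b / \<delta>\<rfloor>" if b: "b \<in> Basis" for b
    proof -
      have "\<delta> * \<lfloor>x \<bullet> b / \<delta>\<rfloor> < y \<bullet> b" "y \<bullet> b < \<delta> * \<lfloor>x \<bullet> b / \<delta>\<rfloor> + \<delta>"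
        using y b by (auto simp: mem_box l u)
      thus ?thesis using assms by (intro floor_unique) (auto simp: field_simps)
    qed
    thus "y \<in> cube \<delta> x" by (auto simp: cube_def)
  qed
  hence "emeasure lborel (box l u) \<le> emeasure lborel (cube \<delta> x)" by (intro emeasure_mono) auto
  moreover have "emeasure lborel (box l u) = ennreal (\<delta> ^ DIM('a))"
    using assms by (subst emeasure_lborel_box) (auto simp: l u inner_diff_left)
  ultimately show "ennreal (\<delta> ^ DIM('a)) \<le> emeasure lborel (cube \<delta> x)" by simp
qed

lemma finite_cubes:
  fixes S :: "'a::euclidean_space set"
  assumes "0 < \<delta>" "bounded S" shows "finite (cube \<delta> ` S)"
proof -
  obtain R where R: "\<And>x. x \<in> S \<Longrightarrow> norm x \<le> R" using assms(2) by (auto simp: bounded_iff)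
  have "cube \<delta> ` S \<subseteq> (\<lambda>j. {y. \<forall>b\<in>Basis. \<lfloor>y \<bullet> b / \<delta>\<rfloor> = j b}) ` (Basis \<rightarrow>\<^sub>E {\<lfloor>- R / \<delta>\<rfloor>..\<lfloor>R / \<delta>\<rfloor>})"
  proof
    fix Q assume "Q \<in> cube \<delta> ` S"
    then obtain x where x: "x \<in> S" "Q = cube \<delta> x" by blast
    have "\<lfloor>x \<bullet> b / \<delta>\<rfloor> \<in> {\<lfloor>- R / \<delta>\<rfloor>..\<lfloor>R / \<delta>\<rfloor>}" if "b \<in> Basis" for b
    proof -
      have "\<bar>x \<bullet> b\<bar> \<le> R" using Basis_le_norm[OF that, of x] R[OF x(1)] by linarith
      hence "- R / \<delta> \<le> x \<bullet> b / \<delta>" "x \<bullet> b / \<delta> \<le> R / \<delta>"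
        using assms(1) by (intro divide_right_mono; simp)+
      thus ?thesis by (auto intro!: floor_mono)
    qed
    hence "(\<lambda>b\<in>Basis. \<lfloor>x \<bullet> b / \<delta>\<rfloor>) \<in> (Basis \<rightarrow>\<^sub>E {\<lfloor>- R / \<delta>\<rfloor>..\<lfloor>R / \<delta>\<rfloor>})" by auto
    moreover have "Q = {y. \<forall>b\<in>Basis. \<lfloor>y \<bullet> b / \<delta>\<rfloor> = (\<lambda>b\<in>Basis. \<lfloor>x \<bullet> b / \<delta>\<rfloor>) b}"
      unfolding x cube_def by auto
    ultimately show "Q \<in> (\<lambda>j. {y. \<forall>b\<in>Basis. \<lfloor>y \<bullet> b / \<delta>\<rfloor> = j b}) ` (Basis \<rightarrow>\<^sub>E {\<lfloor>- R / \<delta>\<rfloor>..\<lfloor>R / \<delta>\<rfloor>})" by blast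
  qed
  thus ?thesis by (rule finite_subset) (intro finite_imageI finite_PiE; simp)
qed

lemma cube_eq: "y \<in> cube \<delta> x \<Longrightarrow> cube \<delta> y = cube \<delta> x"
  unfolding cube_def by (rule Collect_cong) (metis (mono_tags, lifting) mem_Collect_eq)

context fractional
begin

lemma W_integrable1:
  assumes "u \<in> W" shows "integrable lborel u"
proof -
  obtain C where "integrable lborel (\<lambda>x. \<bar>u x\<bar> powr 1)"
    using Lr_bound[of 1 "E u"] pstar_gt(2) assms by auto
  thus ?thesis using integrable_abs_cancel[of lborel u] W_measurable[OF assms] by simp
qed

text \<open>A Poincare inequality in L1 without Hoelder. Differences up to \<theta> contribute at
  most \<open>\<theta>\<close> times the squared volume. Larger ones satisfy \<open>\<bar>dif v
  z\<bar> \<le> \<theta> powr (1 - p) * \<bar>dif v z\<bar> powr p\<close>, and the diameter of the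
  cell bounds the inverse kernel; this explains \<open>c\<close>.\<close>

lemma cube_estimate:
  fixes \<delta> :: real
  assumes v: "v \<in> W" and \<delta>: "0 < \<delta>" and \<theta>: "0 < \<theta>" and Q: "Q = cube \<delta> x0"
  defines "c \<equiv> \<theta> powr (1 - p) * (DIM('a) * \<delta>) powr (DIM('a) + s * p)"
  shows "ennreal (\<delta> ^ DIM('a)) * (\<integral>\<^sup>+x. ennreal \<bar>v x\<bar> * indicator Q x \<partial>lborel) \<le>
    ennreal (\<theta> * (\<delta> ^ DIM('a)) ^ 2 + \<delta> ^ DIM('a) * \<bar>\<integral>x. v x * indicator Q x \<partial>lborel\<bar>) +
    ennreal c * (\<integral>\<^sup>+z. ennreal (\<bar>dif v z\<bar> powr p) * indicator (Q \<times> Q) z \<partial>\<mu>)"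
proof -
  define d where "d = \<delta> ^ DIM('a)"
  define m where "m = (\<integral>x. v x * indicator Q x \<partial>lborel)"
  have d: "0 < d" using \<delta> by (simp add: d_def)
  have [measurable]: "v \<in> borel_measurable borel" "Q \<in> sets borel" using W_measurable[OF v] Q by auto
  have QQ[measurable]: "Q \<times> Q \<in> sets borel" by (simp add: borel_prod[symmetric])
  have eQ: "emeasure lborel Q = ennreal d" using emeasure_cube[OF \<delta>] Q by (simp add: d_def)
  have eQQ: "emeasure lborel (Q \<times> Q) = ennreal (d * d)"
    using lborel.emeasure_pair_measure_Times[of Q lborel Q] d eQ by (simp add: lborel_prod ennreal_mult)
  have iQ: "integrable lborel (\<lambda>y. v x * indicator Q y)" for x
    using eQ by (intro integrable_mult_right integrable_real_indicator) auto
  have ivQ: "integrable lborel (\<lambda>y. v y * indicator Q y)"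
    by (intro integrable_real_mult_indicator W_integrable1 v) auto
  \<comment> \<open>Here \<open>d * v x - m\<close> is the integral over \<open>Q\<close> of
    \<open>v x - v y\<close> in \<open>y\<close>, because \<open>d\<close> is the volume of
    \<open>Q\<close> and \<open>m\<close> the integral of \<open>v\<close> over it.\<close>
  have A: "ennreal (d * \<bar>v x\<bar>) \<le> (\<integral>\<^sup>+y. ennreal \<bar>dif v (x, y)\<bar> * indicator Q y \<partial>lborel) + ennreal \<bar>m\<bar>" for x
  proof -
    have "(\<integral>y. v x * indicator Q y - v y * indicator Q y \<partial>lborel) = d * v x - m"
    proof -
      have "(\<integral>y. v x * indicator Q y \<partial>lborel) = d * v x" using d by (simp add: measure_def eQ)
      thus ?thesis using iQ[of x] ivQ by (simp add: m_def)
    qed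
    hence "ennreal \<bar>d * v x - m\<bar> = ennreal (norm (\<integral>y. v x * indicator Q y - v y * indicator Q y \<partial>lborel))" by simp
    also have "\<dots> \<le> (\<integral>\<^sup>+y. ennreal (norm (v x * indicator Q y - v y * indicator Q y)) \<partial>lborel)"
      using iQ ivQ by (intro integral_norm_bound_ennreal) auto
    also have "\<dots> = (\<integral>\<^sup>+y. ennreal \<bar>dif v (x, y)\<bar> * indicator Q y \<partial>lborel)"
      by (intro nn_integral_cong) (auto simp: dif_def indicator_def)
    finally have 1: "ennreal \<bar>d * v x - m\<bar> \<le> (\<integral>\<^sup>+y. ennreal \<bar>dif v (x, y)\<bar> * indicator Q y \<partial>lborel)" .
    have "d * \<bar>v x\<bar> = \<bar>d * v x\<bar>" using d by (simp add: abs_mult)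
    hence "d * \<bar>v x\<bar> \<le> \<bar>d * v x - m\<bar> + \<bar>m\<bar>" by linarith
    hence "ennreal (d * \<bar>v x\<bar>) \<le> ennreal \<bar>d * v x - m\<bar> + ennreal \<bar>m\<bar>"
      by (simp flip: ennreal_plus)
    thus ?thesis using 1 by (meson add_right_mono order_trans)
  qed
  have "ennreal d * (\<integral>\<^sup>+x. ennreal \<bar>v x\<bar> * indicator Q x \<partial>lborel) = (\<integral>\<^sup>+x. ennreal d * (ennreal \<bar>v x\<bar> * indicator Q x) \<partial>lborel)"
    by (subst nn_integral_cmult) auto
  also have "\<dots> \<le> (\<integral>\<^sup>+x. (\<integral>\<^sup>+y. ennreal \<bar>dif v (x, y)\<bar> * indicator (Q \<times> Q) (x, y) \<partial>lborel) + ennreal \<bar>m\<bar> * indicator Q x \<partial>lborel)"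
  proof (rule nn_integral_mono)
    fix x
    show "ennreal d * (ennreal \<bar>v x\<bar> * indicator Q x) \<le>
      (\<integral>\<^sup>+y. ennreal \<bar>dif v (x, y)\<bar> * indicator (Q \<times> Q) (x, y) \<partial>lborel) + ennreal \<bar>m\<bar> * indicator Q x"
    proof (cases "x \<in> Q")
      case True
      have "indicator (Q \<times> Q) (x, y) = (indicator Q y :: ennreal)" for y using True by (auto simp: indicator_def)
      thus ?thesis using A[of x] True d by (simp add: ennreal_mult)
    qed auto
  qed
  also have "\<dots> = (\<integral>\<^sup>+x. (\<integral>\<^sup>+y. ennreal \<bar>dif v (x, y)\<bar> * indicator (Q \<times> Q) (x, y) \<partial>lborel) \<partial>lborel) + (\<integral>\<^sup>+x. ennreal \<bar>m\<bar> * indicator Q x \<partial>lborel)"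
  proof (rule nn_integral_add)
    have "(\<lambda>z. ennreal \<bar>dif v z\<bar> * indicator (Q \<times> Q) z) \<in> borel_measurable (lborel \<Otimes>\<^sub>M lborel)"
      by (simp add: lborel_prod)
    from lborel.borel_measurable_nn_integral_fst[OF this]
    show "(\<lambda>x. \<integral>\<^sup>+y. ennreal \<bar>dif v (x, y)\<bar> * indicator (Q \<times> Q) (x, y) \<partial>lborel) \<in> borel_measurable lborel" .
  qed auto
  also have "(\<integral>\<^sup>+x. ennreal \<bar>m\<bar> * indicator Q x \<partial>lborel) = ennreal (d * \<bar>m\<bar>)"
    using eQ d by (simp add: nn_integral_cmult_indicator ennreal_mult mult.commute)
  also have "(\<integral>\<^sup>+x. (\<integral>\<^sup>+y. ennreal \<bar>dif v (x, y)\<bar> * indicator (Q \<times> Q) (x, y) \<partial>lborel) \<partial>lborel) =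
      (\<integral>\<^sup>+z. ennreal \<bar>dif v z\<bar> * indicator (Q \<times> Q) z \<partial>lborel)"
    by (subst lborel.nn_integral_fst) (simp_all add: lborel_prod)
  also have "\<dots> \<le> (\<integral>\<^sup>+z. ennreal \<theta> * indicator (Q \<times> Q) z + ennreal c *
      (ennreal (1 / norm (fst z - snd z) powr (DIM('a) + s * p)) * (ennreal (\<bar>dif v z\<bar> powr p) * indicator (Q \<times> Q) z)) \<partial>lborel)"
  proof (rule nn_integral_mono)
    fix z :: "'a \<times> 'a"
    obtain x y where z: "z = (x, y)" by (cases z)
    show "ennreal \<bar>dif v z\<bar> * indicator (Q \<times> Q) z \<le> ennreal \<theta> * indicator (Q \<times> Q) z + ennreal c *
      (ennreal (1 / norm (fst z - snd z) powr (DIM('a) + s * p)) * (ennreal (\<bar>dif v z\<bar> powr p) * indicator (Q \<times> Q) z))"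
    proof (cases "z \<in> Q \<times> Q \<and> \<bar>dif v z\<bar> > \<theta>")
      case True
      hence xy: "x \<in> Q" "y \<in> Q" "x \<noteq> y" using \<theta> by (auto simp: z dif_def)
      define N where "N = norm (x - y) powr (DIM('a) + s * p)"
      have N: "0 < N" "N \<le> (DIM('a) * \<delta>) powr (DIM('a) + s * p)"
        using xy cube_diam[OF \<delta>, of x x0 y] sp_pos Q by (auto simp: N_def intro!: powr_mono2)
      have "\<bar>dif v z\<bar> = \<bar>dif v z\<bar> powr (1 - p) * \<bar>dif v z\<bar> powr p"
        using True \<theta> by (simp flip: powr_add)
      also have "\<dots> \<le> \<theta> powr (1 - p) * \<bar>dif v z\<bar> powr p"
        using True \<theta> p by (intro mult_right_mono powr_mono2') auto
      also have "\<dots> = \<theta> powr (1 - p) * N * (1 / N * \<bar>dif v z\<bar> powr p)" using N by simp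
      also have "\<dots> \<le> c * (1 / N * \<bar>dif v z\<bar> powr p)"
        unfolding c_def using N by (intro mult_right_mono mult_left_mono) auto
      finally have "ennreal \<bar>dif v z\<bar> \<le> ennreal c * (ennreal (1 / N) * ennreal (\<bar>dif v z\<bar> powr p))"
        using N by (simp add: c_def ennreal_leI flip: ennreal_mult)
      thus ?thesis using True by (simp add: z N_def add_increasing)
    next
      case False
      show ?thesis
      proof (cases "z \<in> Q \<times> Q")
        case True
        with False have "ennreal \<bar>dif v z\<bar> \<le> ennreal \<theta>" by (auto intro: ennreal_leI)
        thus ?thesis using True by (simp add: add_increasing2)
      qed auto
    qed
  qed
  also have "\<dots> = ennreal (\<theta> * (d * d)) + ennreal c * (\<integral>\<^sup>+z. ennreal (\<bar>dif v z\<bar> powr p) * indicator (Q \<times> Q) z \<partial>\<mu>)"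
  proof -
    have k: "(\<lambda>z::'a \<times> 'a. ennreal (1 / norm (fst z - snd z) powr (DIM('a) + s * p))) \<in> borel_measurable lborel"
      using kernel_measurable by simp
    have f: "(\<lambda>z. ennreal (\<bar>dif v z\<bar> powr p) * indicator (Q \<times> Q) z) \<in> borel_measurable lborel" by simp
    note [measurable] = k f
    have "(\<integral>\<^sup>+z. ennreal (\<bar>dif v z\<bar> powr p) * indicator (Q \<times> Q) z \<partial>\<mu>) =
      (\<integral>\<^sup>+z. ennreal (1 / norm (fst z - snd z) powr (DIM('a) + s * p)) * (ennreal (\<bar>dif v z\<bar> powr p) * indicator (Q \<times> Q) z) \<partial>lborel)"
      unfolding \<mu>_def using k f by (rule nn_integral_density)
    moreover have "(\<integral>\<^sup>+z. ennreal \<theta> * indicator (Q \<times> Q) z \<partial>lborel) = ennreal (\<theta> * (d * d))"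
      using \<theta> d by (simp add: nn_integral_cmult_indicator eQQ ennreal_mult)
    ultimately show ?thesis
      using k f by (subst nn_integral_add) (simp_all add: nn_integral_cmult)
  qed
  finally show ?thesis
    using d \<theta> by (simp add: d_def[symmetric] m_def[symmetric] power2_eq_square ennreal_plus ac_simps)
qed

text \<open>Total boundedness in disguise: up to \<eta>, finitely many cell integrals control the L1
  norm uniformly over functions of bounded energy. They are linear in \<open>v\<close>, so
  convergence of these numbers makes a sequence nearly Cauchy.\<close>

lemma cube_family:
  assumes \<eta>: "0 < \<eta>"
  obtains F where "finite F" "F \<subseteq> sets borel"
    "\<And>v. v \<in> W \<Longrightarrow> E v \<le> K \<Longrightarrow> (\<integral>x. \<bar>v x\<bar> \<partial>lborel) \<le> \<eta> + (\<Sum>Q\<in>F. \<bar>\<integral>x. v x * indicator Q x \<partial>lborel\<bar>)"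
proof -
  define n where "n = DIM('a)"
  obtain R where R: "\<And>x. x \<in> \<Omega> \<Longrightarrow> norm x \<le> R" using \<Omega>(2) by (auto simp: bounded_iff)
  \<comment> \<open>For side at most 1 a cell meeting \<Omega> has diameter at most
    \<open>n\<close>, so all such cells lie in this ball. Their total volume is thus bounded
    independently of \<delta>, and \<theta> can be fixed first.\<close>
  define V where "V = measure lborel (cball (0::'a) (R + n))"
  have V: "0 \<le> V" by (simp add: V_def)
  define \<theta> where "\<theta> = \<eta> / (2 * (V + 1))"
  have \<theta>: "0 < \<theta>" "\<theta> * V \<le> \<eta> / 2" using \<eta> V by (auto simp: \<theta>_def field_simps)
  define A where "A = \<theta> powr (1 - p) * n powr (n + s * p) * max K 0"
  have A: "0 \<le> A" by (simp add: A_def)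
  \<comment> \<open>The constant of \<open>cube_estimate\<close> scales like
    \<open>\<delta> powr (n + s * p)\<close> and is divided by the cell volume
    \<open>\<delta> ^ n\<close>; the surviving \<open>\<delta> powr (s * p)\<close> is made
    small.\<close>
  define \<delta> where "\<delta> = min 1 ((\<eta> / (2 * (A + 1))) powr (1 / (s * p)))"
  have \<delta>: "0 < \<delta>" "\<delta> \<le> 1" using \<eta> A by (auto simp: \<delta>_def)
  have A\<delta>: "A * \<delta> powr (s * p) \<le> \<eta> / 2"
  proof -
    have "\<delta> powr (s * p) \<le> ((\<eta> / (2 * (A + 1))) powr (1 / (s * p))) powr (s * p)"
      using \<delta> sp_pos by (intro powr_mono2) (auto simp: \<delta>_def)
    also have "\<dots> = \<eta> / (2 * (A + 1))" using sp_pos \<eta> A s p by (simp add: powr_powr)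
    finally have "A * \<delta> powr (s * p) \<le> A * (\<eta> / (2 * (A + 1)))" using A by (intro mult_left_mono) auto
    also have "\<dots> \<le> \<eta> / 2" using A \<eta> by (simp add: field_simps)
    finally show ?thesis .
  qed
  define d where "d = \<delta> ^ n"
  have d: "0 < d" using \<delta> by (simp add: d_def)
  define F where "F = cube \<delta> ` \<Omega>"
  have fin: "finite F" unfolding F_def using finite_cubes[OF \<delta>(1) \<Omega>(2)] .
  have sets: "F \<subseteq> sets borel" by (auto simp: F_def)
  have disj: "disjoint_family_on (\<lambda>Q. Q) F"
    unfolding disjoint_family_on_def F_def using cube_eq by blast
  have vol: "card F * d \<le> V"
  proof -
    have "ennreal (card F * d) = (\<Sum>Q\<in>F. emeasure lborel Q)"
    proof -
      have "emeasure lborel Q = ennreal d" if "Q \<in> F" for Q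
        using that emeasure_cube[OF \<delta>(1)] by (auto simp: F_def d_def n_def)
      hence "(\<Sum>Q\<in>F. emeasure lborel Q) = (\<Sum>Q\<in>F. ennreal d)" by (intro sum.cong) auto
      thus ?thesis using d by (simp add: ennreal_mult ennreal_of_nat_eq_real_of_nat)
    qed
    also have "\<dots> = emeasure lborel (\<Union>Q\<in>F. Q)"
      using sets fin disj by (intro sum_emeasure) auto
    also have "\<dots> \<le> emeasure lborel (cball (0::'a) (R + n))"
    proof (intro emeasure_mono)
      show "(\<Union>Q\<in>F. Q) \<subseteq> cball 0 (R + n)"
      proof
        fix y assume "y \<in> (\<Union>Q\<in>F. Q)"
        then obtain x where x: "x \<in> \<Omega>" "y \<in> cube \<delta> x" by (auto simp: F_def)
        have "norm (y - x) \<le> n * \<delta>" using cube_diam[OF \<delta>(1) x(2), of x] by (simp add: cube_def n_def)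
        also have "\<dots> \<le> n" using \<delta> by (simp add: mult_left_le)
        finally show "y \<in> cball 0 (R + n)" using R[OF x(1)] norm_triangle_sub[of y x] by simp
      qed
    qed auto
    also have "\<dots> = ennreal V"
      using emeasure_bounded_finite[OF bounded_cball, of "0::'a" "R + n"] unfolding V_def
      by (intro emeasure_eq_ennreal_measure) auto
    finally show ?thesis using V by (simp add: ennreal_le_iff)
  qed
  have "(\<integral>x. \<bar>v x\<bar> \<partial>lborel) \<le> \<eta> + (\<Sum>Q\<in>F. \<bar>\<integral>x. v x * indicator Q x \<partial>lborel\<bar>)"
    if v: "v \<in> W" "E v \<le> K" for v
  proof -
    define S where "S = (\<Sum>Q\<in>F. \<bar>\<integral>x. v x * indicator Q x \<partial>lborel\<bar>)"
    define c where "c = \<theta> powr (1 - p) * (n * \<delta>) powr (n + s * p)"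
    define e where "e Q = (\<integral>\<^sup>+z. ennreal (\<bar>dif v z\<bar> powr p) * indicator (Q \<times> Q) z \<partial>\<mu>)" for Q
    have [measurable]: "v \<in> borel_measurable borel" using W_measurable[OF v(1)] .
    have QQ: "Q \<times> Q \<in> sets borel" if "Q \<in> F" for Q
      using that sets by (auto simp: borel_prod[symmetric])
    \<comment> \<open>The squares \<open>Q \<times> Q\<close> are pairwise disjoint, so the cell
      energies add up to at most the full energy.\<close>
    have e: "(\<Sum>Q\<in>F. e Q) \<le> ennreal (max K 0)"
    proof -
      have "(\<Sum>Q\<in>F. e Q) = (\<integral>\<^sup>+z. (\<Sum>Q\<in>F. ennreal (\<bar>dif v z\<bar> powr p) * indicator (Q \<times> Q) z) \<partial>\<mu>)"
        unfolding e_def using QQ dif_measurable_\<mu>[of v] by (intro nn_integral_sum[symmetric]) auto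
      also have "\<dots> \<le> (\<integral>\<^sup>+z. ennreal (\<bar>dif v z\<bar> powr p) \<partial>\<mu>)"
      proof (rule nn_integral_mono)
        fix z :: "'a \<times> 'a"
        have "(\<Sum>Q\<in>F. indicator (Q \<times> Q) z) \<le> (1 :: ennreal)"
        proof (cases "\<exists>Q\<in>F. z \<in> Q \<times> Q")
          case True
          then obtain Q where Q: "Q \<in> F" "z \<in> Q \<times> Q" by blast
          have "z \<notin> Q' \<times> Q'" if "Q' \<in> F - {Q}" for Q'
            using disj that Q by (auto simp: disjoint_family_on_def)
          hence "(\<Sum>Q\<in>F. indicator (Q \<times> Q) z) = (indicator (Q \<times> Q) z :: ennreal)"
            using sum.neutral[of "F - {Q}" "\<lambda>Q. indicator (Q \<times> Q) z :: ennreal"]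
            by (subst sum.remove[OF fin Q(1)]) (simp add: indicator_def)
          thus ?thesis by (auto simp: indicator_def)
        next
          case False
          hence "(\<Sum>Q\<in>F. indicator (Q \<times> Q) z) = (0::ennreal)" by (intro sum.neutral) (auto simp: indicator_def)
          thus ?thesis by simp
        qed
        hence "ennreal (\<bar>dif v z\<bar> powr p) * (\<Sum>Q\<in>F. indicator (Q \<times> Q) z) \<le> ennreal (\<bar>dif v z\<bar> powr p) * 1"
          by (intro mult_left_mono) auto
        thus "(\<Sum>Q\<in>F. ennreal (\<bar>dif v z\<bar> powr p) * indicator (Q \<times> Q) z) \<le> ennreal (\<bar>dif v z\<bar> powr p)"
          by (simp add: sum_distrib_left)
      qed
      also have "\<dots> = ennreal (E v)" by (rule E_nn[OF v(1)])
      also have "\<dots> \<le> ennreal (max K 0)" using v(2) by (intro ennreal_leI) auto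
      finally show ?thesis .
    qed
    have "ennreal d * (\<integral>\<^sup>+x. ennreal \<bar>v x\<bar> \<partial>lborel) \<le> ennreal d * (\<integral>\<^sup>+x. (\<Sum>Q\<in>F. ennreal \<bar>v x\<bar> * indicator Q x) \<partial>lborel)"
    proof (intro mult_left_mono nn_integral_mono)
      fix x
      show "ennreal \<bar>v x\<bar> \<le> (\<Sum>Q\<in>F. ennreal \<bar>v x\<bar> * indicator Q x)"
      proof (cases "x \<in> \<Omega>")
        case True
        hence Q: "cube \<delta> x \<in> F" "x \<in> cube \<delta> x" by (auto simp: F_def cube_def)
        hence "ennreal \<bar>v x\<bar> = ennreal \<bar>v x\<bar> * indicator (cube \<delta> x) x" by simp
        also have "\<dots> \<le> (\<Sum>Q\<in>F. ennreal \<bar>v x\<bar> * indicator Q x)" using fin Q by (intro member_le_sum) auto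
        finally show ?thesis .
      qed (simp add: W_zero[OF v(1)])
    qed auto
    also have "\<dots> = (\<Sum>Q\<in>F. ennreal d * (\<integral>\<^sup>+x. ennreal \<bar>v x\<bar> * indicator Q x \<partial>lborel))"
      using sets by (subst nn_integral_sum) (auto simp: sum_distrib_left)
    also have "\<dots> \<le> (\<Sum>Q\<in>F. ennreal (\<theta> * d ^ 2 + d * \<bar>\<integral>x. v x * indicator Q x \<partial>lborel\<bar>) + ennreal c * e Q)"
    proof (rule sum_mono)
      fix Q assume "Q \<in> F"
      then obtain x where "Q = cube \<delta> x" by (auto simp: F_def)
      from cube_estimate[OF v(1) \<delta>(1) \<theta>(1) this]
      show "ennreal d * (\<integral>\<^sup>+x. ennreal \<bar>v x\<bar> * indicator Q x \<partial>lborel) \<le>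
        ennreal (\<theta> * d ^ 2 + d * \<bar>\<integral>x. v x * indicator Q x \<partial>lborel\<bar>) + ennreal c * e Q"
        by (simp add: c_def d_def e_def n_def)
    qed
    also have "\<dots> = ennreal (\<Sum>Q\<in>F. \<theta> * d ^ 2 + d * \<bar>\<integral>x. v x * indicator Q x \<partial>lborel\<bar>) + ennreal c * (\<Sum>Q\<in>F. e Q)"
    proof -
      have "(\<Sum>Q\<in>F. ennreal (\<theta> * d ^ 2 + d * \<bar>\<integral>x. v x * indicator Q x \<partial>lborel\<bar>)) =
          ennreal (\<Sum>Q\<in>F. \<theta> * d ^ 2 + d * \<bar>\<integral>x. v x * indicator Q x \<partial>lborel\<bar>)"
        using \<theta> d by (intro sum_ennreal) auto
      thus ?thesis by (simp only: sum.distrib[of _ _ F] sum_distrib_left[symmetric])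
    qed
    also have "\<dots> \<le> ennreal (card F * (\<theta> * d ^ 2) + d * S) + ennreal c * ennreal (max K 0)"
      using e by (intro add_mono mult_left_mono) (auto simp: sum.distrib S_def sum_distrib_left)
    also have "\<dots> = ennreal (card F * (\<theta> * d ^ 2) + d * S + c * max K 0)"
      using \<theta> d by (simp add: ennreal_mult c_def S_def sum_nonneg ennreal_plus)
    also have "(\<integral>\<^sup>+x. ennreal \<bar>v x\<bar> \<partial>lborel) = ennreal (\<integral>x. \<bar>v x\<bar> \<partial>lborel)"
      using W_integrable1[OF v(1)] by (intro nn_integral_eq_integral) auto
    finally have "ennreal (d * (\<integral>x. \<bar>v x\<bar> \<partial>lborel)) \<le> ennreal (card F * (\<theta> * d ^ 2) + d * S + c * max K 0)"
      using d by (simp add: ennreal_mult)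
    hence "d * (\<integral>x. \<bar>v x\<bar> \<partial>lborel) \<le> card F * (\<theta> * d ^ 2) + d * S + c * max K 0"
      using \<theta> d by (subst (asm) ennreal_le_iff) (auto simp: c_def S_def intro!: add_nonneg_nonneg sum_nonneg mult_nonneg_nonneg)
    also have "card F * (\<theta> * d ^ 2) = d * (\<theta> * (card F * d))" by (simp add: power2_eq_square)
    also have "c * max K 0 = d * (A * \<delta> powr (s * p))"
      using \<delta> by (simp add: c_def A_def d_def powr_mult powr_add powr_realpow mult_ac)
    finally have "d * (\<integral>x. \<bar>v x\<bar> \<partial>lborel) \<le> d * (\<theta> * (card F * d) + S + A * \<delta> powr (s * p))"
      by (simp add: algebra_simps)
    hence "(\<integral>x. \<bar>v x\<bar> \<partial>lborel) \<le> \<theta> * (card F * d) + S + A * \<delta> powr (s * p)" using d by simp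
    moreover have "\<theta> * (card F * d) \<le> \<theta> * V" using vol \<theta> by (intro mult_left_mono) auto
    ultimately show ?thesis using A\<delta> \<theta>(2) unfolding S_def by linarith
  qed
  thus ?thesis using that fin sets by blast
qed

text \<open>Along a diagonal subsequence all integrals over all chosen cells converge. Applying
  \<open>cube_family\<close> to differences then gives an L1 Cauchy sequence, a further subsequence
  converges almost everywhere, and Fatou puts the limit in \<open>W\<close>.\<close>

lemma W_compact:
  fixes u :: "nat \<Rightarrow> 'a \<Rightarrow> real"
  assumes u: "\<And>k. u k \<in> W" and K: "\<And>k. E (u k) \<le> K"
  obtains r w where "strict_mono r" "w \<in> W" "AE x in lborel. (\<lambda>k. u (r k) x) \<longlonglongrightarrow> w x"
proof -
  \<comment> \<open>The energy bound for differences of two members, to which the cell estimate is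
    applied.\<close>
  define K' where "K' = 2 powr p * (K + K)"
  obtain C where "\<And>u. u \<in> W \<Longrightarrow> E u \<le> K \<Longrightarrow> (\<integral>x. \<bar>u x\<bar> powr 1 \<partial>lborel) \<le> C"
    using Lr_bound[of 1 K] pstar_gt(2) by (metis zero_less_one)
  hence C: "\<And>u. u \<in> W \<Longrightarrow> E u \<le> K \<Longrightarrow> (\<integral>x. \<bar>u x\<bar> \<partial>lborel) \<le> C" by simp
  have "\<forall>m :: nat. \<exists>F. finite F \<and> F \<subseteq> sets borel \<and> (\<forall>v\<in>W. E v \<le> K' \<longrightarrow>
    (\<integral>x. \<bar>v x\<bar> \<partial>lborel) \<le> 1 / (real m + 1) + (\<Sum>Q\<in>F. \<bar>\<integral>x. v x * indicator Q x \<partial>lborel\<bar>))"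
  proof
    fix m :: nat
    have "0 < 1 / (real m + 1)" by simp
    from cube_family[OF this, of K'] show "\<exists>F. finite F \<and> F \<subseteq> sets borel \<and> (\<forall>v\<in>W. E v \<le> K' \<longrightarrow>
      (\<integral>x. \<bar>v x\<bar> \<partial>lborel) \<le> 1 / (real m + 1) + (\<Sum>Q\<in>F. \<bar>\<integral>x. v x * indicator Q x \<partial>lborel\<bar>))" by metis
  qed
  from choice[OF this] obtain F where F: "\<And>m. finite (F m)" "\<And>m. F m \<subseteq> sets borel"
    "\<And>m v. v \<in> W \<Longrightarrow> E v \<le> K' \<Longrightarrow> (\<integral>x. \<bar>v x\<bar> \<partial>lborel) \<le> 1 / (real m + 1) + (\<Sum>Q\<in>F m. \<bar>\<integral>x. v x * indicator Q x \<partial>lborel\<bar>)"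
    by blast
  define f where "f Q k = (\<integral>x. u k x * indicator Q x \<partial>lborel)" for Q k
  have i: "integrable lborel (\<lambda>x. v x * indicator Q x)" if "Q \<in> sets borel" "v \<in> W" for Q v
    using that by (intro integrable_real_mult_indicator W_integrable1) auto
  have "\<bar>f Q k\<bar> \<le> C" if "Q \<in> (\<Union>m. F m)" for Q k
  proof -
    have Q: "Q \<in> sets borel" using that F(2) by auto
    have "\<bar>f Q k\<bar> \<le> (\<integral>x. \<bar>u k x * indicator Q x\<bar> \<partial>lborel)"
      unfolding f_def by (rule integral_abs_bound)
    also have "\<dots> \<le> (\<integral>x. \<bar>u k x\<bar> \<partial>lborel)"
      using i[OF Q u] W_integrable1[OF u] by (intro integral_mono) (auto simp: indicator_def)
    also have "\<dots> \<le> C" using C u K by blast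
    finally show ?thesis .
  qed
  moreover have "countable (\<Union>m. F m)" using F(1) by (simp add: countable_finite)
  ultimately obtain r1 where r1: "strict_mono r1" "\<And>Q. Q \<in> (\<Union>m. F m) \<Longrightarrow> convergent (\<lambda>k. f Q (r1 k))"
    using countable_bounded_subsequence[of "\<Union>m. F m" f "\<lambda>_. C"] by blast
  have "\<exists>N. \<forall>i\<ge>N. \<forall>j\<ge>N. (\<integral>x. norm (u (r1 i) x - u (r1 j) x) \<partial>lborel) < e" if e: "0 < e" for e
  proof -
    obtain m :: nat where "1 / real (Suc m) < e / 2"
      using nat_approx_posE[of "e / 2"] e by (meson half_gt_zero)
    hence m: "1 / (real m + 1) < e / 2" by (simp add: add.commute)
    define e' where "e' = e / 2 / (real (card (F m)) + 1)"
    have e': "0 < e'" using e by (simp add: e'_def)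
    have aux: "c * (y / c) = y" if "c \<noteq> 0" for c y :: real using that by simp
    have "real (card (F m)) + 1 \<noteq> 0" by linarith
    hence "(real (card (F m)) + 1) * e' = e / 2" unfolding e'_def using aux by blast
    hence e'2: "card (F m) * e' < e / 2" using e' by (simp add: distrib_right)
    have "\<forall>Q\<in>F m. \<exists>N. \<forall>i\<ge>N. \<forall>j\<ge>N. \<bar>f Q (r1 i) - f Q (r1 j)\<bar> < e'"
    proof
      fix Q assume "Q \<in> F m"
      hence "convergent (\<lambda>k. f Q (r1 k))" by (intro r1(2) UN_I[of m]) auto
      from CauchyD[OF convergent_Cauchy[OF this] e']
      show "\<exists>N. \<forall>i\<ge>N. \<forall>j\<ge>N. \<bar>f Q (r1 i) - f Q (r1 j)\<bar> < e'" unfolding real_norm_def .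
    qed
    from bchoice[OF this] obtain N where
      N: "\<And>Q i j. Q \<in> F m \<Longrightarrow> i \<ge> N Q \<Longrightarrow> j \<ge> N Q \<Longrightarrow> \<bar>f Q (r1 i) - f Q (r1 j)\<bar> < e'" by blast
    define M where "M = Max (insert 0 (N ` F m))"
    have M: "N Q \<le> M" if "Q \<in> F m" for Q using F(1) that by (auto simp: M_def)
    have "(\<integral>x. norm (u (r1 i) x - u (r1 j) x) \<partial>lborel) < e" if ij: "i \<ge> M" "j \<ge> M" for i j
    proof -
      have "E (\<lambda>x. u (r1 i) x - u (r1 j) x) \<le> 2 powr p * (E (u (r1 i)) + E (u (r1 j)))" by (intro E_diff_le u)
      also have "\<dots> \<le> K'" unfolding K'_def by (intro mult_left_mono add_mono K) auto
      finally have "(\<integral>x. \<bar>u (r1 i) x - u (r1 j) x\<bar> \<partial>lborel) \<le> 1 / (real m + 1) +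
          (\<Sum>Q\<in>F m. \<bar>\<integral>x. (u (r1 i) x - u (r1 j) x) * indicator Q x \<partial>lborel\<bar>)"
        by (intro F(3) W_diff u)
      also have "(\<Sum>Q\<in>F m. \<bar>\<integral>x. (u (r1 i) x - u (r1 j) x) * indicator Q x \<partial>lborel\<bar>) = (\<Sum>Q\<in>F m. \<bar>f Q (r1 i) - f Q (r1 j)\<bar>)"
        using F(2)[of m] i[OF _ u] unfolding f_def left_diff_distrib by (intro sum.cong refl) (simp add: subset_iff)
      also have "\<dots> \<le> (\<Sum>Q\<in>F m. e')"
        using N[OF _ order_trans[OF M ij(1)] order_trans[OF M ij(2)]] by (intro sum_mono less_imp_le) blast
      finally show ?thesis using m e'2 by simp
    qed
    thus ?thesis by blast
  qed
  then obtain r2 where r2: "strict_mono r2" "AE x in lborel. Cauchy (\<lambda>i. u (r1 (r2 i)) x)"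
    using cauchy_L1_AE_cauchy_subseq[of lborel "\<lambda>k. u (r1 k)"] W_integrable1[OF u] by blast
  define r where "r = r1 \<circ> r2"
  have r: "strict_mono r" unfolding r_def using r1(1) r2(1) by (rule strict_mono_o)
  define w where "w x = lim (\<lambda>k. u (r k) x)" for x
  have [measurable]: "u k \<in> borel_measurable borel" for k using W_measurable[OF u] .
  have w[measurable]: "w \<in> borel_measurable borel" unfolding w_def by measurable
  have lim: "AE x in lborel. (\<lambda>k. u (r k) x) \<longlonglongrightarrow> w x"
    using r2(2) by eventually_elim (auto simp: w_def r_def Cauchy_convergent_iff convergent_LIMSEQ_iff)
  have "w x = 0" if "x \<notin> \<Omega>" for x using W_zero[OF u that] by (simp add: w_def)
  moreover have "integrable \<mu> (\<lambda>z. \<bar>dif w z\<bar> powr p)"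
  proof (rule Fatou_integral(1))
    show "(\<lambda>z. \<bar>dif w z\<bar> powr p) \<in> borel_measurable \<mu>" using dif_measurable_\<mu>[OF w] by measurable
    show "integrable \<mu> (\<lambda>z. \<bar>dif (u (r k)) z\<bar> powr p)" for k by (intro W_integrable u)
    show "AE z in \<mu>. (\<lambda>k. \<bar>dif (u (r k)) z\<bar> powr p) \<longlonglongrightarrow> \<bar>dif w z\<bar> powr p"
      using AE_\<mu>[OF lim] unfolding dif_def by eventually_elim (use p in \<open>auto intro!: tendsto_abs_powr tendsto_diff\<close>)
    show "(\<integral>z. \<bar>dif (u (r k)) z\<bar> powr p \<partial>\<mu>) \<le> K" for k using K by (simp add: E_def)
  qed auto
  ultimately have "w \<in> W" using w by (auto simp: W_def)
  with r lim that show ?thesis by blast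
qed

end

subsection \<open>Lipschitz functions\<close>

lemma ennreal_le_suminf:
  fixes f :: "nat \<Rightarrow> ennreal"
  shows "f j \<le> (\<Sum>i. f i)"
  using sum_le_suminf[of f "{j}"] by (simp add: summableI)

lemma C1_Lipschitz_on_ball:
  fixes f :: "'a::euclidean_space \<Rightarrow> real"
  assumes "Ck_on (Suc 0) UNIV f"
  obtains L where "0 \<le> L" "\<And>x y. norm x \<le> R \<Longrightarrow> norm y \<le> R \<Longrightarrow> \<bar>f x - f y\<bar> \<le> L * norm (x - y)"
proof -
  define f' where "f' x = frechet_derivative f (at x)" for x
  have d: "(f has_derivative f' x) (at x)" for x
    using assms by (auto simp: f'_def differentiable_on_def frechet_derivative_works[symmetric])
  have c: "continuous_on UNIV (\<lambda>x. f' x i)" if "i \<in> Basis" for i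
    using assms that by (auto simp: f'_def)
  have "continuous_on (cball 0 R) (\<lambda>x. \<Sum>i\<in>Basis. \<bar>f' x i\<bar>)"
    by (intro continuous_intros continuous_on_subset[OF c]) auto
  hence "bounded ((\<lambda>x. \<Sum>i\<in>Basis. \<bar>f' x i\<bar>) ` cball 0 R)"
    by (intro compact_imp_bounded compact_continuous_image) auto
  then obtain B where B: "\<And>x. norm x \<le> R \<Longrightarrow> (\<Sum>i\<in>Basis. \<bar>f' x i\<bar>) \<le> B"
    unfolding bounded_iff by (force simp: abs_le_iff)
  define L where "L = max B 0"
  have "\<bar>f x - f y\<bar> \<le> L * norm (x - y)" if xy: "norm x \<le> R" "norm y \<le> R" for x y
  proof -
    have "norm (f x - f y) \<le> L * norm (x - y)"
    proof (rule differentiable_bound[of "cball 0 R"])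
      show "(f has_derivative f' x) (at x within cball 0 R)" for x
        using d by (rule has_derivative_at_withinI)
      show "onorm (f' x) \<le> L" if x: "x \<in> cball 0 R" for x
      proof (rule onorm_le)
        fix h :: 'a
        have lin: "linear (f' x)" using d has_derivative_linear by blast
        have "f' x h = f' x (\<Sum>i\<in>Basis. (h \<bullet> i) *\<^sub>R i)" by (simp add: euclidean_representation)
        also have "\<dots> = (\<Sum>i\<in>Basis. (h \<bullet> i) * f' x i)"
          by (simp add: linear_sum[OF lin] linear_cmul[OF lin])
        also have "\<bar>\<dots>\<bar> \<le> (\<Sum>i\<in>Basis. \<bar>(h \<bullet> i) * f' x i\<bar>)" by (rule sum_abs)
        also have "\<dots> \<le> (\<Sum>i\<in>Basis. norm h * \<bar>f' x i\<bar>)"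
          by (intro sum_mono) (auto simp: abs_mult Basis_le_norm mult_right_mono)
        also have "\<dots> = (\<Sum>i\<in>Basis. \<bar>f' x i\<bar>) * norm h" by (simp add: sum_distrib_left mult.commute)
        also have "\<dots> \<le> L * norm h"
          using B[of x] x by (intro mult_right_mono) (auto simp: L_def)
        finally show "norm (f' x h) \<le> L * norm h" by simp
      qed
    qed (use xy in auto)
    thus ?thesis by simp
  qed
  moreover have "0 \<le> L" by (simp add: L_def)
  ultimately show ?thesis using that by blast
qed

section \<open>Finite energy of Lipschitz and test functions\<close>

context fractional
begin

text \<open>Dyadic shells on both sides of radius 1. Near the point the contributions decay with
  ratio \<open>(1/2) powr (p * (1 - s))\<close>, which needs \<open>s < 1\<close>; far away with
  ratio \<open>(1/2) powr (s * p)\<close>, which needs \<open>s > 0\<close>.\<close>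

lemma kernel_bound:
  obtains C :: real where "0 \<le> C"
    "\<And>x::'a. (\<integral>\<^sup>+y. ennreal (min (norm (x - y)) 1 powr p / norm (x - y) powr (DIM('a) + s * p)) \<partial>lborel) \<le> ennreal C"
proof -
  define n where "n = real DIM('a)"
  define \<omega> where "\<omega> = unit_ball_vol n"
  have \<omega>: "0 \<le> \<omega>" and n: "0 < n" by (auto simp: \<omega>_def n_def)
  define m where "m = n + s * p"
  have m: "0 < m" using n sp_pos by (simp add: m_def)
  \<comment> \<open>An upper bound of the integrand on the shell with radii between
    \<open>(1/2) ^ (j + 1)\<close> and \<open>(1/2) ^ j\<close>; \<open>b j\<close> is the analogue
    on the shell between \<open>2 ^ j\<close> and \<open>2 ^ (j + 1)\<close>.\<close>
  define a where "a j = (1/2) powr (j * p) / (1/2) powr ((j + 1) * m)" for j :: nat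
  define b where "b j = 1 / 2 powr (j * m)" for j :: nat
  define q1 where "q1 = (1/2 :: real) powr (p * (1 - s))"
  define q2 where "q2 = (1/2 :: real) powr (s * p)"
  have hp: "(c ^ i) powr t = c powr (real i * t)" if "0 < c" for c t :: real and i :: nat
    using that by (simp add: powr_powr flip: powr_realpow)
  have hq: "(1/2 :: real) powr (real i * t) = ((1/2) powr t) ^ i" for i :: nat and t
    by (simp add: powr_powr mult.commute flip: powr_realpow)
  have hn: "(2::real) powr (- t) = (1/2) powr t" for t
    by (simp add: powr_minus_divide powr_divide)
  have half: "(1/2 :: real) powr r < 1" if "0 < r" for r
    using powr_less_mono2[of r "1/2" 1] that by simp
  have q1: "0 \<le> q1" "q1 < 1" using p s by (auto simp: q1_def intro!: half)
  have q2: "0 \<le> q2" "q2 < 1" using sp_pos by (auto simp: q2_def intro!: half)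
  define C1 where "C1 = \<omega> * 2 powr m * (1 / (1 - q1))"
  define C2 where "C2 = \<omega> * 2 powr n * (1 / (1 - q2))"
  have C: "0 \<le> C1" "0 \<le> C2" using q1 q2 \<omega> by (auto simp: C1_def C2_def)
  have "(\<integral>\<^sup>+y. ennreal (min (norm (x - y)) 1 powr p / norm (x - y) powr m) \<partial>lborel) \<le> ennreal (C1 + C2)" for x :: 'a
  proof -
    have "(\<integral>\<^sup>+y. ennreal (min (norm (x - y)) 1 powr p / norm (x - y) powr m) \<partial>lborel) \<le>
      (\<integral>\<^sup>+y. (\<Sum>j. ennreal (a j) * indicator (cball x ((1/2) ^ j)) y) + (\<Sum>j. ennreal (b j) * indicator (cball x (2 ^ (j + 1))) y) \<partial>lborel)"
    proof (rule nn_integral_mono)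
      fix y :: 'a
      define r where "r = norm (x - y)"
      have r0: "0 \<le> r" by (simp add: r_def)
      consider "r = 0" | "0 < r" "r \<le> 1" | "1 < r" using r0 by linarith
      thus "ennreal (min (norm (x - y)) 1 powr p / norm (x - y) powr m) \<le>
        (\<Sum>j. ennreal (a j) * indicator (cball x ((1/2) ^ j)) y) + (\<Sum>j. ennreal (b j) * indicator (cball x (2 ^ (j + 1))) y)"
      proof cases
        case 1 thus ?thesis using p by (simp add: r_def)
      next
        case 2
        have ex: "\<exists>j. (1/2) ^ Suc j < r"
        proof -
          obtain j where "(1/2) ^ j < r" using real_arch_pow_inv[of r "1/2"] 2 by auto
          hence "(1/2) ^ Suc j < r" using 2 by simp
          thus ?thesis by blast
        qed
        define j where "j = (LEAST j. (1/2) ^ Suc j < r)"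
        have j1: "(1/2) ^ Suc j < r" unfolding j_def by (rule LeastI_ex[OF ex])
        have j2: "r \<le> (1/2) ^ j"
        proof (cases j)
          case (Suc i)
          hence "\<not> (1/2) ^ Suc i < r" using not_less_Least[of i "\<lambda>j. (1/2) ^ Suc j < r"] by (simp add: j_def)
          thus ?thesis using Suc by simp
        qed (use 2 in simp)
        have "r powr p / r powr m \<le> ((1/2) ^ j) powr p / ((1/2) ^ Suc j) powr m"
          using j1 j2 2 p m by (intro frac_le powr_mono2) auto
        also have "\<dots> = a j"
          unfolding a_def hp[OF half_gt_zero[OF zero_less_one]] by (simp add: add.commute)
        finally have "ennreal (min r 1 powr p / r powr m) \<le> ennreal (a j) * indicator (cball x ((1/2) ^ j)) y"
          using 2 j2 by (simp add: r_def dist_norm ennreal_leI)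
        also have "\<dots> \<le> (\<Sum>j. ennreal (a j) * indicator (cball x ((1/2) ^ j)) y)"
          by (rule ennreal_le_suminf)
        finally show ?thesis by (simp add: r_def add_increasing2)
      next
        case 3
        have ex: "\<exists>j. r \<le> 2 ^ Suc j"
        proof -
          obtain j where "r < 2 ^ j" using real_arch_pow[of 2 r] by auto
          hence "r \<le> 2 ^ Suc j" using 3 by simp
          thus ?thesis by blast
        qed
        define j where "j = (LEAST j. r \<le> 2 ^ Suc j)"
        have j1: "r \<le> 2 ^ Suc j" unfolding j_def by (rule LeastI_ex[OF ex])
        have j2: "2 ^ j \<le> r"
        proof (cases j)
          case (Suc i)
          hence "\<not> r \<le> 2 ^ Suc i" using not_less_Least[of i "\<lambda>j. r \<le> 2 ^ Suc j"] by (simp add: j_def)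
          thus ?thesis using Suc by simp
        qed (use 3 in simp)
        have "1 / r powr m \<le> 1 / (2 ^ j) powr m"
          using j2 3 m by (intro frac_le powr_mono2) auto
        also have "\<dots> = b j"
          by (simp add: b_def hp)
        finally have "ennreal (min r 1 powr p / r powr m) \<le> ennreal (b j) * indicator (cball x (2 ^ (j + 1))) y"
          using 3 j1 by (simp add: r_def dist_norm ennreal_leI)
        also have "\<dots> \<le> (\<Sum>j. ennreal (b j) * indicator (cball x (2 ^ (j + 1))) y)"
          by (rule ennreal_le_suminf)
        finally show ?thesis by (simp add: r_def add_increasing)
      qed
    qed
    also have "\<dots> = (\<Sum>j. \<integral>\<^sup>+y. ennreal (a j) * indicator (cball x ((1/2) ^ j)) y \<partial>lborel) +
        (\<Sum>j. \<integral>\<^sup>+y. ennreal (b j) * indicator (cball x (2 ^ (j + 1))) y \<partial>lborel)"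
    proof -
      have [measurable]: "cball x t \<in> sets borel" for t by (simp add: borel_closed)
      have "(\<lambda>y. ennreal c * indicator (cball x t) y) \<in> borel_measurable lborel" for c t by measurable
      hence m: "(\<lambda>y. ennreal (c j) * indicator (cball x (t j)) y) \<in> borel_measurable lborel"
        for c t :: "nat \<Rightarrow> real" and j .
      have s: "(\<lambda>y. \<Sum>j. ennreal (c j) * indicator (cball x (t j)) y) \<in> borel_measurable lborel"
        for c t :: "nat \<Rightarrow> real" using m by (rule borel_measurable_suminf_order)
      show ?thesis
        by (simp only: nn_integral_add[OF s[of a "\<lambda>j. (1/2) ^ j"] s[of b "\<lambda>j. 2 ^ (j + 1)"]]
          nn_integral_suminf[OF m[of a _ "\<lambda>j. (1/2) ^ j"]] nn_integral_suminf[OF m[of b _ "\<lambda>j. 2 ^ (j + 1)"]])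
    qed
    also have "(\<Sum>j. \<integral>\<^sup>+y. ennreal (a j) * indicator (cball x ((1/2) ^ j)) y \<partial>lborel) = (\<Sum>j. ennreal (\<omega> * 2 powr m * q1 ^ j))"
    proof (intro suminf_cong)
      fix j :: nat
      have "(\<integral>\<^sup>+y. ennreal (a j) * indicator (cball x ((1/2) ^ j)) y \<partial>lborel) = ennreal (a j * (\<omega> * ((1/2) ^ j) ^ DIM('a)))"
        using \<omega> by (simp add: nn_integral_cmult_indicator emeasure_cball \<omega>_def n_def a_def flip: ennreal_mult)
      also have "((1/2::real) ^ j) ^ DIM('a) = (1/2) powr (j * n)"
        by (simp add: n_def powr_realpow[symmetric] powr_powr power_mult[symmetric])
      also have "a j * (\<omega> * (1/2) powr (j * n)) = \<omega> * (1/2) powr (real j * p - (real j + 1) * m + real j * n)"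
        unfolding a_def powr_add powr_diff by (simp add: add.commute)
      also have "real j * p - (real j + 1) * m + real j * n = - m + real j * (p * (1 - s))"
        unfolding m_def by (simp add: algebra_simps)
      also have "(1/2 :: real) powr (- m + real j * (p * (1 - s))) = 2 powr m * q1 ^ j"
        unfolding powr_add q1_def hq by (simp add: powr_minus powr_divide)
      finally show "(\<integral>\<^sup>+y. ennreal (a j) * indicator (cball x ((1/2) ^ j)) y \<partial>lborel) = ennreal (\<omega> * 2 powr m * q1 ^ j)"
        by (simp add: mult.assoc)
    qed
    also have "(\<Sum>j. \<integral>\<^sup>+y. ennreal (b j) * indicator (cball x (2 ^ (j + 1))) y \<partial>lborel) = (\<Sum>j. ennreal (\<omega> * 2 powr n * q2 ^ j))"
    proof (intro suminf_cong)
      fix j :: nat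
      have "(\<integral>\<^sup>+y. ennreal (b j) * indicator (cball x (2 ^ (j + 1))) y \<partial>lborel) = ennreal (b j * (\<omega> * (2 ^ (j + 1)) ^ DIM('a)))"
        using \<omega> by (simp add: nn_integral_cmult_indicator emeasure_cball \<omega>_def n_def b_def flip: ennreal_mult)
      also have "((2::real) ^ (j + 1)) ^ DIM('a) = 2 powr ((j + 1) * n)"
        by (simp add: n_def powr_realpow[symmetric] powr_powr power_mult[symmetric] del: power_Suc)
      also have "b j * (\<omega> * 2 powr ((j + 1) * n)) = \<omega> * 2 powr ((real j + 1) * n - real j * m)"
        unfolding b_def powr_diff by (simp add: add.commute)
      also have "(real j + 1) * n - real j * m = n + - (real j * (s * p))"
        unfolding m_def by (simp add: algebra_simps)
      also have "2 powr (n + - (real j * (s * p))) = 2 powr n * q2 ^ j"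
        unfolding powr_add hn q2_def hq ..
      finally show "(\<integral>\<^sup>+y. ennreal (b j) * indicator (cball x (2 ^ (j + 1))) y \<partial>lborel) = ennreal (\<omega> * 2 powr n * q2 ^ j)"
        by (simp add: mult.assoc)
    qed
    also have "(\<Sum>j. ennreal (\<omega> * 2 powr m * q1 ^ j)) = ennreal C1"
      unfolding C1_def using q1 \<omega> by (intro suminf_ennreal_eq sums_mult geometric_sums) auto
    also have "(\<Sum>j. ennreal (\<omega> * 2 powr n * q2 ^ j)) = ennreal C2"
      unfolding C2_def using q2 \<omega> by (intro suminf_ennreal_eq sums_mult geometric_sums) auto
    finally show ?thesis using C by (simp add: ennreal_plus)
  qed
  thus ?thesis using that[of "C1 + C2"] C by (simp add: m_def n_def)
qed

text \<open>The integrand vanishes unless one of the two points is in \<Omega>. Integrating first in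
  the other point costs a constant by \<open>kernel_bound\<close>, and \<Omega> has finite
  measure.\<close>

lemma W_Lipschitz:
  assumes L: "\<And>x y. \<bar>\<psi> x - \<psi> y\<bar> \<le> L * norm (x - y)" and M: "\<And>x. \<bar>\<psi> x\<bar> \<le> M"
    and zero: "\<And>x. x \<notin> \<Omega> \<Longrightarrow> \<psi> x = 0"
  shows "\<psi> \<in> W"
proof -
  obtain C where C: "0 \<le> C"
    "\<And>x::'a. (\<integral>\<^sup>+y. ennreal (min (norm (x - y)) 1 powr p / norm (x - y) powr (DIM('a) + s * p)) \<partial>lborel) \<le> ennreal C"
    using kernel_bound by blast
  \<comment> \<open>One constant for both regimes: the Lipschitz bound at distances below 1 and the
    oscillation bound \<open>2 * M\<close> beyond.\<close>
  define D where "D = max (max L (2 * M)) 0"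
  have D: "0 \<le> D" by (simp add: D_def)
  have le: "\<bar>\<psi> x - \<psi> y\<bar> \<le> D * min (norm (x - y)) 1" for x y
  proof -
    have "L * norm (x - y) \<le> D * norm (x - y)" by (intro mult_right_mono) (auto simp: D_def)
    moreover have "\<bar>\<psi> x - \<psi> y\<bar> \<le> D" using M[of x] M[of y] by (auto simp: D_def)
    ultimately show ?thesis using L[of x y] by (auto simp: min_def)
  qed
  have "continuous_on UNIV \<psi>"
  proof (rule continuous_onI)
    fix x and e :: real assume e: "0 < e"
    have "dist (\<psi> y) (\<psi> x) < e" if "dist y x < e / (D + 1)" for y
    proof -
      have "\<bar>\<psi> y - \<psi> x\<bar> \<le> D * norm (y - x)" using le[of y x] D by (meson min.cobounded1 mult_left_mono order_trans)
      also have "\<dots> \<le> (D + 1) * norm (y - x)" by (intro mult_right_mono) auto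
      also have "\<dots> < e" using that D by (simp add: dist_norm field_simps)
      finally show ?thesis by (simp add: dist_norm)
    qed
    thus "\<exists>d>0. \<forall>x'\<in>UNIV. dist x' x < d \<longrightarrow> dist (\<psi> x') (\<psi> x) \<le> e"
      using e D by (intro exI[of _ "e / (D + 1)"]) (auto intro: less_imp_le)
  qed
  hence [measurable]: "\<psi> \<in> borel_measurable borel" by (rule borel_measurable_continuous_onI)
  define k where "k z = ennreal (D powr p) * ennreal (min (norm (fst z - snd z)) 1 powr p / norm (fst z - snd z) powr (DIM('a) + s * p))"
    for z :: "'a \<times> 'a"
  have [measurable]: "k \<in> borel_measurable (lborel \<Otimes>\<^sub>M lborel)" unfolding k_def by measurable
  have \<Omega>m[measurable]: "\<Omega> \<in> sets borel" using \<Omega> by simp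
  have k: "(\<integral>\<^sup>+y. k (x, y) \<partial>lborel) \<le> ennreal (D powr p * C)" "(\<integral>\<^sup>+y. k (y, x) \<partial>lborel) \<le> ennreal (D powr p * C)" for x
  proof -
    have "(\<integral>\<^sup>+y. k (x, y) \<partial>lborel) = ennreal (D powr p) * (\<integral>\<^sup>+y. ennreal (min (norm (x - y)) 1 powr p / norm (x - y) powr (DIM('a) + s * p)) \<partial>lborel)"
      unfolding k_def by (subst nn_integral_cmult) auto
    also have "\<dots> \<le> ennreal (D powr p) * ennreal C" by (intro mult_left_mono C) auto
    finally show 1: "(\<integral>\<^sup>+y. k (x, y) \<partial>lborel) \<le> ennreal (D powr p * C)" using C by (simp add: ennreal_mult)
    have "k (y, x) = k (x, y)" for y by (simp add: k_def norm_minus_commute)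
    thus "(\<integral>\<^sup>+y. k (y, x) \<partial>lborel) \<le> ennreal (D powr p * C)" using 1 by simp
  qed
  define J where "J = ennreal (D powr p * C) * emeasure lborel \<Omega>"
  have "(\<integral>\<^sup>+z. ennreal (\<bar>dif \<psi> z\<bar> powr p) \<partial>\<mu>) =
      (\<integral>\<^sup>+x. \<integral>\<^sup>+y. ennreal (1 / norm (x - y) powr (DIM('a) + s * p)) * ennreal (\<bar>dif \<psi> (x, y)\<bar> powr p) \<partial>lborel \<partial>lborel)"
    by (intro nn_integral_\<mu>) measurable
  also have "\<dots> \<le> (\<integral>\<^sup>+x. \<integral>\<^sup>+y. k (x, y) * indicator \<Omega> x + k (x, y) * indicator \<Omega> y \<partial>lborel \<partial>lborel)"
  proof (intro nn_integral_mono)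
    fix x y
    show "ennreal (1 / norm (x - y) powr (DIM('a) + s * p)) * ennreal (\<bar>dif \<psi> (x, y)\<bar> powr p) \<le>
        k (x, y) * indicator \<Omega> x + k (x, y) * indicator \<Omega> y"
    proof (cases "x \<in> \<Omega> \<or> y \<in> \<Omega>")
      case True
      have "\<bar>dif \<psi> (x, y)\<bar> powr p \<le> (D * min (norm (x - y)) 1) powr p"
        using le[of x y] p by (intro powr_mono2) (auto simp: dif_def)
      also have "\<dots> = D powr p * min (norm (x - y)) 1 powr p" using D by (simp add: powr_mult)
      finally have "1 / norm (x - y) powr (DIM('a) + s * p) * \<bar>dif \<psi> (x, y)\<bar> powr p \<le>
          1 / norm (x - y) powr (DIM('a) + s * p) * (D powr p * min (norm (x - y)) 1 powr p)"
        by (intro mult_left_mono) auto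
      hence "ennreal (1 / norm (x - y) powr (DIM('a) + s * p)) * ennreal (\<bar>dif \<psi> (x, y)\<bar> powr p) \<le> k (x, y)"
        unfolding k_def by (simp add: ennreal_leI flip: ennreal_mult)
      thus ?thesis using True by (auto intro: add_increasing add_increasing2)
    next
      case False
      thus ?thesis using zero p by (simp add: dif_def)
    qed
  qed
  also have "\<dots> = (\<integral>\<^sup>+x. (\<integral>\<^sup>+y. k (x, y) * indicator \<Omega> x \<partial>lborel) + (\<integral>\<^sup>+y. k (x, y) * indicator \<Omega> y \<partial>lborel) \<partial>lborel)"
    by (intro nn_integral_cong nn_integral_add) measurable
  also have "\<dots> = (\<integral>\<^sup>+x. (\<integral>\<^sup>+y. k (x, y) * indicator \<Omega> x \<partial>lborel) \<partial>lborel) + (\<integral>\<^sup>+x. (\<integral>\<^sup>+y. k (x, y) * indicator \<Omega> y \<partial>lborel) \<partial>lborel)"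
    by (intro nn_integral_add) measurable
  also have "(\<integral>\<^sup>+x. (\<integral>\<^sup>+y. k (x, y) * indicator \<Omega> y \<partial>lborel) \<partial>lborel) = (\<integral>\<^sup>+y. (\<integral>\<^sup>+x. k (x, y) * indicator \<Omega> y \<partial>lborel) \<partial>lborel)"
    by (intro lborel_pair.Fubini'[symmetric]) measurable
  also have "(\<integral>\<^sup>+x. (\<integral>\<^sup>+y. k (x, y) * indicator \<Omega> x \<partial>lborel) \<partial>lborel) \<le> J"
  proof -
    have "(\<integral>\<^sup>+x. (\<integral>\<^sup>+y. k (x, y) * indicator \<Omega> x \<partial>lborel) \<partial>lborel) \<le> (\<integral>\<^sup>+x. ennreal (D powr p * C) * indicator \<Omega> x \<partial>lborel)"
      using k by (intro nn_integral_mono) (auto simp: nn_integral_multc indicator_def)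
    thus ?thesis by (simp add: J_def nn_integral_cmult_indicator)
  qed
  also have "(\<integral>\<^sup>+y. (\<integral>\<^sup>+x. k (x, y) * indicator \<Omega> y \<partial>lborel) \<partial>lborel) \<le> J"
  proof -
    have "(\<integral>\<^sup>+y. (\<integral>\<^sup>+x. k (x, y) * indicator \<Omega> y \<partial>lborel) \<partial>lborel) \<le> (\<integral>\<^sup>+y. ennreal (D powr p * C) * indicator \<Omega> y \<partial>lborel)"
      using k by (intro nn_integral_mono) (auto simp: nn_integral_multc indicator_def)
    thus ?thesis by (simp add: J_def nn_integral_cmult_indicator)
  qed
  finally have fin: "(\<integral>\<^sup>+z. ennreal (\<bar>dif \<psi> z\<bar> powr p) \<partial>\<mu>) \<le> J + J" by (simp add: add_left_mono add_right_mono)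
  have "J + J < \<infinity>" using finite_\<Omega>(1) by (simp add: J_def ennreal_mult_less_top)
  with fin have "integrable \<mu> (\<lambda>z. \<bar>dif \<psi> z\<bar> powr p)"
    using dif_measurable_\<mu>[of \<psi>] by (intro integrableI_bounded) (auto intro: le_less_trans)
  thus ?thesis using zero by (auto simp: W_def)
qed

text \<open>Continuous first derivatives give a Lipschitz constant only on bounded sets. A point
  beyond the enlarged ball has distance at least 1 from \<Omega>, and there the sup bound serves as
  Lipschitz bound.\<close>

lemma test_function_W:
  assumes "\<psi> \<in> test_functions \<Omega>" shows "\<psi> \<in> W"
proof -
  have C: "Ck_on (Suc 0) UNIV \<psi>" and supp: "closure {x. \<psi> x \<noteq> 0} \<subseteq> \<Omega>" and comp: "compact (closure {x. \<psi> x \<noteq> 0})"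
    using assms by (auto simp: test_functions_def Cinf_def simp del: Ck_on.simps)
  have zero: "\<psi> x = 0" if "x \<notin> \<Omega>" for x
    using that supp closure_subset[of "{x. \<psi> x \<noteq> 0}"] by blast
  have "Ck_on 0 UNIV \<psi>" using assms by (auto simp: test_functions_def Cinf_def simp del: Ck_on.simps)
  hence cont: "continuous_on UNIV \<psi>" by simp
  obtain R where R: "\<And>x. x \<in> \<Omega> \<Longrightarrow> norm x \<le> R" using \<Omega>(2) by (auto simp: bounded_iff)
  obtain L where L: "0 \<le> L" "\<And>x y. norm x \<le> R + 1 \<Longrightarrow> norm y \<le> R + 1 \<Longrightarrow> \<bar>\<psi> x - \<psi> y\<bar> \<le> L * norm (x - y)"
    using C1_Lipschitz_on_ball[OF C, of "R + 1"] by blast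
  have "bounded (\<psi> ` closure {x. \<psi> x \<noteq> 0})"
    using comp by (intro compact_imp_bounded compact_continuous_image continuous_on_subset[OF cont]) auto
  then obtain B where B: "\<And>x. x \<in> closure {x. \<psi> x \<noteq> 0} \<Longrightarrow> \<bar>\<psi> x\<bar> \<le> B" by (auto simp: bounded_iff)
  define M where "M = max B 0"
  have M: "\<bar>\<psi> x\<bar> \<le> M" for x
  proof (cases "\<psi> x = 0")
    case False
    hence "x \<in> closure {x. \<psi> x \<noteq> 0}" using closure_subset[of "{x. \<psi> x \<noteq> 0}"] by blast
    thus ?thesis using B by (simp add: M_def le_max_iff_disj)
  qed (simp add: M_def)
  have far: "\<bar>\<psi> x - \<psi> y\<bar> \<le> max L M * norm (x - y)" if "x \<in> \<Omega>" for x y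
  proof (cases "norm y \<le> R + 1")
    case True
    have "\<bar>\<psi> x - \<psi> y\<bar> \<le> L * norm (x - y)" using L(2)[of x y] R[OF that] True by simp
    also have "\<dots> \<le> max L M * norm (x - y)" by (intro mult_right_mono) auto
    finally show ?thesis .
  next
    case False
    hence "y \<notin> \<Omega>" using R[of y] by auto
    hence "\<bar>\<psi> x - \<psi> y\<bar> \<le> M * 1" using zero[of y] M[of x] by simp
    also have "1 \<le> norm (x - y)" using R[OF that] False norm_triangle_ineq2[of y x] by (simp add: norm_minus_commute)
    hence "M * 1 \<le> max L M * norm (x - y)" using M[of x] by (intro mult_mono) auto
    finally show ?thesis .
  qed
  have "\<bar>\<psi> x - \<psi> y\<bar> \<le> max L M * norm (x - y)" for x y
  proof -
    consider "x \<in> \<Omega>" | "y \<in> \<Omega>" | "x \<notin> \<Omega>" "y \<notin> \<Omega>" by blast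
    thus ?thesis
    proof cases
      case 2 thus ?thesis using far[of y x] by (simp add: norm_minus_commute abs_minus_commute)
    next
      case 3 thus ?thesis using zero L(1) by (simp add: le_max_iff_disj)
    qed (rule far)
  qed
  thus ?thesis using M zero by (rule W_Lipschitz)
qed

text \<open>The reference function of the development: positive exactly on \<Omega>, Lipschitz, of
  finite energy. It is the explicit member of the cone and the direction in which positivity of
  minimisers is tested.\<close>

definition bdist :: "'a \<Rightarrow> real" where "bdist x = infdist x (- \<Omega>)"

lemma compl_\<Omega>: "- \<Omega> \<noteq> {}" "closed (- \<Omega>)"
proof -
  have "\<Omega> \<noteq> UNIV" using \<Omega>(2) not_bounded_UNIV by blast
  thus "- \<Omega> \<noteq> {}" by blast
  show "closed (- \<Omega>)" using \<Omega>(1) by (rule closed_Compl)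
qed

lemma bdist_pos_iff: "0 < bdist x \<longleftrightarrow> x \<in> \<Omega>"
  using in_closed_iff_infdist_zero[OF compl_\<Omega>(2,1), of x] infdist_nonneg[of x "- \<Omega>"] by (auto simp: bdist_def less_le)

lemma bdist_nonneg: "0 \<le> bdist x"
  by (simp add: bdist_def infdist_nonneg)

lemma bdist_zero: "x \<notin> \<Omega> \<Longrightarrow> bdist x = 0"
  using bdist_pos_iff[of x] bdist_nonneg[of x] by auto

lemma bdist_Lipschitz: "\<bar>bdist x - bdist y\<bar> \<le> norm (x - y)"
  using infdist_triangle_abs[of x "- \<Omega>" y] by (simp add: bdist_def dist_norm)

lemma bdist_bounded: obtains M where "\<And>x. bdist x \<le> M"
proof -
  obtain R where R: "\<And>x. x \<in> \<Omega> \<Longrightarrow> norm x \<le> R" using \<Omega>(2) by (auto simp: bounded_iff)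
  obtain z where z: "z \<notin> \<Omega>" using compl_\<Omega>(1) by auto
  have "bdist x \<le> max 0 (R + norm z)" for x
  proof (cases "x \<in> \<Omega>")
    case True
    have "bdist x \<le> norm (x - z)" using bdist_Lipschitz[of x z] bdist_zero[OF z] by simp
    also have "\<dots> \<le> norm x + norm z" by (rule norm_triangle_ineq4)
    finally show ?thesis using R[OF True] by simp
  qed (simp add: bdist_zero)
  thus ?thesis using that by blast
qed

lemma bdist_W: "bdist \<in> W"
proof -
  obtain M where M: "\<And>x. bdist x \<le> M" using bdist_bounded by blast
  show ?thesis
  proof (rule W_Lipschitz)
    show "\<bar>bdist x - bdist y\<bar> \<le> 1 * norm (x - y)" for x y using bdist_Lipschitz by simp
    show "\<bar>bdist x\<bar> \<le> M" for x using M[of x] bdist_nonneg[of x] by simp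
  qed (rule bdist_zero)
qed

lemma \<Omega>_not_null: "\<not> (AE x in lborel. x \<notin> \<Omega>)"
proof
  assume "AE x in lborel. x \<notin> \<Omega>"
  hence "\<Omega> \<in> null_sets lborel" using finite_\<Omega> by (subst (asm) AE_iff_null_sets[symmetric]) auto
  hence "negligible \<Omega>" by (simp add: negligible_iff_null_sets null_sets_completionI)
  thus False using open_not_negligible[OF \<Omega>(1,3)] by blast
qed

end

subsection \<open>Integrability of the logarithm of the boundary distance\<close>

text \<open>Disjoint translates in the direction \<open>e\<close> of the layer \<open>0 < h \<le> \<eta>\<close> fill a bounded set.\<close>

lemma layer_measure:
  fixes h :: "'a::euclidean_space \<Rightarrow> real"
  assumes [measurable]: "h \<in> borel_measurable borel" and e: "norm e = 1"
    and h: "\<And>x t. h (x + t *\<^sub>R e) = h x + t"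
    and \<eta>: "0 < \<eta>" "\<eta> \<le> 1"
  shows "measure lborel {x \<in> ball z r. 0 < h x \<and> h x \<le> \<eta>} \<le> 2 * \<eta> * measure lborel (ball z (r + 1))"
proof -
  define S where "S = {x \<in> ball z r. 0 < h x \<and> h x \<le> \<eta>}"
  have [measurable]: "ball z r \<in> sets borel" by simp
  have S[measurable]: "S \<in> sets borel" unfolding S_def by measurable
  \<comment> \<open>The number of steps of length \<eta> that fit into total displacement 1, so the
    translates stay in the ball of radius \<open>r + 1\<close>. As \<open>\<eta> \<le> 1\<close>,
    rounding down loses at most a factor 2.\<close>
  define N where "N = nat \<lfloor>1 / \<eta>\<rfloor>"
  have N: "real N \<le> 1 / \<eta>" "1 / (2 * \<eta>) \<le> real N"
  proof -
    have 1: "1 \<le> 1 / \<eta>" using \<eta> by (simp add: field_simps)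
    hence fl: "1 \<le> \<lfloor>1 / \<eta>\<rfloor>" by linarith
    have NN: "real N = \<lfloor>1 / \<eta>\<rfloor>" unfolding N_def using fl by (intro of_nat_nat) linarith
    show "real N \<le> 1 / \<eta>" unfolding NN by linarith
    have "1 / \<eta> < \<lfloor>1 / \<eta>\<rfloor> + 1" by linarith
    hence "1 / \<eta> < 2 * real N" using fl NN by linarith
    thus "1 / (2 * \<eta>) \<le> real N" by simp
  qed
  define T where "T k = (\<lambda>x. x - (real k * \<eta>) *\<^sub>R e) -` S" for k :: nat
  have T[measurable]: "T k \<in> sets borel" for k
  proof -
    have "(\<lambda>x. x - (real k * \<eta>) *\<^sub>R e) \<in> borel_measurable borel" by measurable
    from measurable_sets[OF this S] show ?thesis by (simp add: T_def)
  qed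
  have fin: "emeasure lborel (ball z t) < \<infinity>" for t by (rule emeasure_lborel_ball_finite)
  have eT: "emeasure lborel (T k) = emeasure lborel S" for k
  proof -
    have "emeasure lborel S = emeasure (distr lborel borel (\<lambda>x. - ((real k * \<eta>) *\<^sub>R e) + x)) S"
      by (simp only: lborel_distr_plus)
    also have "\<dots> = emeasure lborel (T k)"
      by (subst emeasure_distr) (auto simp: T_def vimage_def)
    finally show ?thesis by simp
  qed
  have hT: "real k * \<eta> < h x \<and> h x \<le> (real k + 1) * \<eta>" if "x \<in> T k" for x k
    using that h[of x "- (real k * \<eta>)"] by (auto simp: T_def S_def algebra_simps)
  have disj: "disjoint_family_on T {..<N}"
  proof -
    have "T i \<inter> T j = {}" if "i < j" for i j :: nat
    proof -
      have "(real i + 1) * \<eta> \<le> real j * \<eta>" using that \<eta> by (intro mult_right_mono) auto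
      hence "x \<notin> T j" if "x \<in> T i" for x using hT[of x i] hT[of x j] that by linarith
      thus ?thesis by blast
    qed
    thus ?thesis unfolding disjoint_family_on_def by (metis Int_commute nat_neq_iff)
  qed
  have sub: "(\<Union>k<N. T k) \<subseteq> ball z (r + 1)"
  proof
    fix x assume "x \<in> (\<Union>k<N. T k)"
    then obtain k where k: "k < N" "x - (real k * \<eta>) *\<^sub>R e \<in> ball z r" by (auto simp: T_def S_def)
    have "real k * \<eta> \<le> real N * \<eta>" using k(1) \<eta> by (intro mult_right_mono) auto
    also have "\<dots> \<le> 1" using N(1) \<eta> by (simp add: pos_le_divide_eq)
    finally have "real k * \<eta> \<le> 1" .
    hence "norm ((real k * \<eta>) *\<^sub>R e) \<le> 1" using e \<eta> by simp
    moreover have "dist z x \<le> dist z (x - (real k * \<eta>) *\<^sub>R e) + norm ((real k * \<eta>) *\<^sub>R e)"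
      using norm_triangle_ineq4[of "z - (x - (real k * \<eta>) *\<^sub>R e)" "(real k * \<eta>) *\<^sub>R e"] by (simp add: dist_norm algebra_simps)
    ultimately show "x \<in> ball z (r + 1)" using k(2) by simp
  qed
  have Sfin: "emeasure lborel S < \<infinity>"
    by (rule le_less_trans[OF emeasure_mono fin[of r]]) (auto simp: S_def)
  have "of_nat N * emeasure lborel S = (\<Sum>k<N. emeasure lborel (T k))" by (simp add: eT)
  also have "\<dots> = emeasure lborel (\<Union>k<N. T k)" using disj by (intro sum_emeasure) auto
  also have "\<dots> \<le> emeasure lborel (ball z (r + 1))" using sub by (intro emeasure_mono) auto
  finally have le: "of_nat N * emeasure lborel S \<le> emeasure lborel (ball z (r + 1))" .
  have "ennreal (real N * measure lborel S) \<le> ennreal (measure lborel (ball z (r + 1)))"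
  proof -
    have "emeasure lborel S = ennreal (measure lborel S)"
      "emeasure lborel (ball z (r + 1)) = ennreal (measure lborel (ball z (r + 1)))"
      using Sfin fin[of "r + 1"] by (intro emeasure_eq_ennreal_measure; simp)+
    thus ?thesis using le
      by (simp add: ennreal_mult ennreal_of_nat_eq_real_of_nat)
  qed
  hence 1: "real N * measure lborel S \<le> measure lborel (ball z (r + 1))" by (simp add: ennreal_le_iff)
  have "1 / (2 * \<eta>) * measure lborel S \<le> real N * measure lborel S" using N(2) by (intro mult_right_mono) auto
  with 1 have "1 / (2 * \<eta>) * measure lborel S \<le> measure lborel (ball z (r + 1))" by linarith
  thus ?thesis using \<eta> by (simp add: S_def field_simps)
qed

context fractional
begin

lemma bdist_attained: obtains y where "y \<notin> \<Omega>" "dist x y = bdist x"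
proof (rule infdist_attains_inf[OF compl_\<Omega>(2,1), of x])
  fix y assume "y \<in> - \<Omega>" "infdist x (- \<Omega>) = dist x y"
  thus thesis using that[of y] by (simp add: bdist_def)
qed

text \<open>In a chart let \<open>h\<close> be the height above the graph. A point of \<Omega>
  within \<delta> of the complement has a nearby \<open>y\<close> with \<open>h y \<le> 0\<close>,
  so the Lipschitz bound gives \<open>h x \<le> L' * \<delta>\<close>. Such layers are measured by
  \<open>layer_measure\<close>.\<close>

lemma boundary_layer_local:
  assumes "smooth_boundary \<Omega>" "z \<in> frontier \<Omega>"
  obtains r C :: real where "0 < r" "0 \<le> C" "\<And>\<delta>. 0 < \<delta> \<Longrightarrow> \<delta> < r \<Longrightarrow>
    measure lborel {x \<in> \<Omega>. x \<in> ball z r \<and> bdist x < \<delta>} \<le> C * \<delta>"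
proof -
  obtain \<rho> e \<gamma> where \<rho>: "0 < \<rho>" and e: "norm e = 1" and \<gamma>: "Cinf \<gamma>"
    and eq: "\<Omega> \<inter> ball z \<rho> = {x \<in> ball z \<rho>. \<gamma> (x - (x \<bullet> e) *\<^sub>R e) < x \<bullet> e}"
    using assms unfolding smooth_boundary_def by blast
  define P where "P x = x - (x \<bullet> e) *\<^sub>R e" for x
  define h where "h x = x \<bullet> e - \<gamma> (P x)" for x
  have ee: "e \<bullet> e = 1" using e by (simp add: dot_square_norm)
  have P: "norm (P x) \<le> 2 * norm x" "P x - P y = P (x - y)" for x y
  proof -
    have "\<bar>x \<bullet> e\<bar> \<le> norm x" using Cauchy_Schwarz_ineq2[of x e] e by simp
    thus "norm (P x) \<le> 2 * norm x"
      unfolding P_def using norm_triangle_ineq4[of x "(x \<bullet> e) *\<^sub>R e"] e by simp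
    show "P x - P y = P (x - y)" by (simp add: P_def algebra_simps inner_diff_left)
  qed
  have "Ck_on (Suc 0) UNIV \<gamma>" "Ck_on 0 UNIV \<gamma>" using \<gamma> by (auto simp: Cinf_def simp del: Ck_on.simps)
  hence cont: "continuous_on UNIV \<gamma>" by simp
  define R where "R = norm z + \<rho>"
  obtain L where L: "0 \<le> L" "\<And>x y. norm x \<le> 2 * R \<Longrightarrow> norm y \<le> 2 * R \<Longrightarrow> \<bar>\<gamma> x - \<gamma> y\<bar> \<le> L * norm (x - y)"
    using C1_Lipschitz_on_ball[OF \<open>Ck_on (Suc 0) UNIV \<gamma>\<close>, of "2 * R"] by blast
  have "continuous_on UNIV P" unfolding P_def by (intro continuous_intros)
  hence "continuous_on UNIV (\<lambda>x. \<gamma> (P x))" by (rule continuous_on_compose2[OF cont]) auto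
  hence "continuous_on UNIV h" unfolding h_def by (intro continuous_intros)
  hence hm[measurable]: "h \<in> borel_measurable borel" by (rule borel_measurable_continuous_onI)
  have hshift: "h (x + t *\<^sub>R e) = h x + t" for x t
    by (simp add: h_def P_def inner_add_left ee algebra_simps)
  define L' where "L' = 1 + 2 * L"
  have L': "1 \<le> L'" using L by (simp add: L'_def)
  have hL: "h x - h y \<le> L' * norm (x - y)" if "x \<in> ball z \<rho>" "y \<in> ball z \<rho>" for x y
  proof -
    have n: "norm w \<le> R" if "w \<in> ball z \<rho>" for w
      using that norm_triangle_ineq2[of w z] by (simp add: R_def dist_norm norm_minus_commute)
    have nP: "norm (P w) \<le> 2 * R" if "w \<in> ball z \<rho>" for w using P(1)[of w] n[OF that] by simp
    have "\<bar>\<gamma> (P x) - \<gamma> (P y)\<bar> \<le> L * norm (P x - P y)" using L(2) nP that by blast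
    also have "\<dots> \<le> L * (2 * norm (x - y))" unfolding P(2) using L(1) P(1) by (intro mult_left_mono)
    finally have 1: "\<bar>\<gamma> (P x) - \<gamma> (P y)\<bar> \<le> 2 * L * norm (x - y)" by simp
    have "(x - y) \<bullet> e \<le> norm (x - y)" using Cauchy_Schwarz_ineq2[of "x - y" e] e by simp
    with 1 show ?thesis by (simp add: h_def L'_def inner_diff_left algebra_simps abs_le_iff)
  qed
  define V where "V = measure lborel (ball z (\<rho> / 2 + 1))"
  \<comment> \<open>The first bound keeps the nearby outside point in the chart; the second makes
    the layer height \<open>L' * \<delta>\<close> at most 1, as the translation argument
    requires.\<close>
  define r where "r = min (\<rho> / 2) (1 / L')"
  have r: "0 < r" "r \<le> \<rho> / 2" "r \<le> 1 / L'" using \<rho> L' by (auto simp: r_def)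
  have "measure lborel {x \<in> \<Omega>. x \<in> ball z r \<and> bdist x < \<delta>} \<le> (2 * L' * V) * \<delta>" if \<delta>: "0 < \<delta>" "\<delta> < r" for \<delta>
  proof -
    have "{x \<in> \<Omega>. x \<in> ball z r \<and> bdist x < \<delta>} \<subseteq> {x \<in> ball z (\<rho> / 2). 0 < h x \<and> h x \<le> L' * \<delta>}"
    proof safe
      fix x assume x: "x \<in> \<Omega>" "x \<in> ball z r" "bdist x < \<delta>"
      show xb: "x \<in> ball z (\<rho> / 2)" using x(2) r by simp
      hence xb': "x \<in> ball z \<rho>" using \<rho> by simp
      have "x \<in> {x \<in> ball z \<rho>. \<gamma> (x - (x \<bullet> e) *\<^sub>R e) < x \<bullet> e}" using eq x(1) xb' by blast
      thus "0 < h x" unfolding h_def P_def by simp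
      obtain y where y: "y \<notin> \<Omega>" "dist x y < \<delta>"
        using bdist_attained[of x] x(3) by metis
      have yb: "y \<in> ball z \<rho>" using xb y(2) \<delta> r dist_triangle[of z y x] by simp
      have "y \<notin> {x \<in> ball z \<rho>. \<gamma> (x - (x \<bullet> e) *\<^sub>R e) < x \<bullet> e}" using eq y(1) by blast
      hence "h y \<le> 0" using yb unfolding h_def P_def by simp
      hence "h x \<le> L' * norm (x - y)" using hL[OF xb' yb] by linarith
      also have "\<dots> \<le> L' * \<delta>" using y(2) L' by (intro mult_left_mono) (auto simp: dist_norm)
      finally show "h x \<le> L' * \<delta>" .
    qed
    moreover have "bdist \<in> borel_measurable borel" using W_measurable[OF bdist_W] .
    moreover have [measurable]: "ball z r \<in> sets borel" "ball z (\<rho> / 2) \<in> sets borel" "\<Omega> \<in> sets borel" using \<Omega> by auto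
    ultimately have "measure lborel {x \<in> \<Omega>. x \<in> ball z r \<and> bdist x < \<delta>} \<le> measure lborel {x \<in> ball z (\<rho> / 2). 0 < h x \<and> h x \<le> L' * \<delta>}"
    proof (intro measure_mono_fmeasurable)
      show "{x \<in> \<Omega>. x \<in> ball z r \<and> bdist x < \<delta>} \<in> sets lborel"
        using W_measurable[OF bdist_W] \<open>\<Omega> \<in> sets borel\<close> by simp
      have "emeasure lborel {x \<in> ball z (\<rho> / 2). 0 < h x \<and> h x \<le> L' * \<delta>} \<le> emeasure lborel (ball z (\<rho> / 2))"
        by (intro emeasure_mono) auto
      also have "\<dots> < \<infinity>" by (rule emeasure_lborel_ball_finite)
      finally show "{x \<in> ball z (\<rho> / 2). 0 < h x \<and> h x \<le> L' * \<delta>} \<in> fmeasurable lborel"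
        using hm by (intro fmeasurableI) auto
    qed auto
    also have "\<dots> \<le> 2 * (L' * \<delta>) * V"
      unfolding V_def
    proof (rule layer_measure[OF hm e hshift])
      have "L' * \<delta> \<le> L' * r" using \<delta> L' by (intro mult_left_mono) auto
      also have "\<dots> \<le> 1" using r(3) L' by (simp add: field_simps)
      finally show "L' * \<delta> \<le> 1" .
    qed (use \<delta> L' in auto)
    finally show ?thesis by (simp add: algebra_simps)
  qed
  moreover have "0 \<le> 2 * L' * V" using L' by (simp add: V_def)
  ultimately show ?thesis using that r(1) by blast
qed

text \<open>Compactness of the frontier reduces small \<delta> to finitely many charts; for \<delta>
  not small the volume of \<Omega> is itself a multiple of \<delta>.\<close>

lemma boundary_layer:
  assumes sb: "smooth_boundary \<Omega>"
  obtains C :: real where "0 \<le> C" "\<And>\<delta>. 0 < \<delta> \<Longrightarrow> measure lborel {x \<in> \<Omega>. bdist x < \<delta>} \<le> C * \<delta>"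
proof -
  have "\<forall>z\<in>frontier \<Omega>. \<exists>r C. 0 < r \<and> 0 \<le> C \<and> (\<forall>\<delta>. 0 < \<delta> \<longrightarrow> \<delta> < r \<longrightarrow>
    measure lborel {x \<in> \<Omega>. x \<in> ball z r \<and> bdist x < \<delta>} \<le> C * \<delta>)"
  proof
    fix z assume "z \<in> frontier \<Omega>"
    from boundary_layer_local[OF sb this] show "\<exists>r C. 0 < r \<and> 0 \<le> C \<and> (\<forall>\<delta>. 0 < \<delta> \<longrightarrow> \<delta> < r \<longrightarrow>
      measure lborel {x \<in> \<Omega>. x \<in> ball z r \<and> bdist x < \<delta>} \<le> C * \<delta>)" by metis
  qed
  from bchoice[OF this] obtain r where "\<forall>z\<in>frontier \<Omega>. \<exists>C. 0 < r z \<and> 0 \<le> C \<and> (\<forall>\<delta>. 0 < \<delta> \<longrightarrow> \<delta> < r z \<longrightarrow>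
    measure lborel {x \<in> \<Omega>. x \<in> ball z (r z) \<and> bdist x < \<delta>} \<le> C * \<delta>)" by blast
  from bchoice[OF this] obtain C where rC: "\<And>z. z \<in> frontier \<Omega> \<Longrightarrow> 0 < r z" "\<And>z. z \<in> frontier \<Omega> \<Longrightarrow> (0::real) \<le> C z"
    "\<And>z \<delta>. z \<in> frontier \<Omega> \<Longrightarrow> 0 < \<delta> \<Longrightarrow> \<delta> < r z \<Longrightarrow> measure lborel {x \<in> \<Omega>. x \<in> ball z (r z) \<and> bdist x < \<delta>} \<le> C z * \<delta>"
    by blast
  have comp: "compact (frontier \<Omega>)" using \<Omega>(2) by (rule compact_frontier_bounded)
  have "frontier \<Omega> \<subseteq> (\<Union>z\<in>frontier \<Omega>. ball z (r z / 2))" using rC(1) by force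
  then obtain F where F: "F \<subseteq> frontier \<Omega>" "finite F" "frontier \<Omega> \<subseteq> (\<Union>z\<in>F. ball z (r z / 2))"
    using compactE_image[OF comp, of "frontier \<Omega>" "\<lambda>z. ball z (r z / 2)"] by auto
  define \<delta>0 where "\<delta>0 = Min (insert 1 ((\<lambda>z. r z / 2) ` F))"
  have "0 < \<delta>0" unfolding \<delta>0_def using F(1,2) rC(1) by (subst Min_gr_iff) auto
  moreover have "\<delta>0 \<le> r z / 2" if "z \<in> F" for z
    unfolding \<delta>0_def using F(2) that by (intro Min_le) auto
  ultimately have \<delta>0: "0 < \<delta>0" "\<And>z. z \<in> F \<Longrightarrow> \<delta>0 \<le> r z / 2" by auto
  define C0 where "C0 = (\<Sum>z\<in>F. C z) + measure lborel \<Omega> / \<delta>0"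
  have sumC: "0 \<le> (\<Sum>z\<in>F. C z)" using rC(2) F(1) by (intro sum_nonneg) auto
  have [measurable]: "\<Omega> \<in> sets borel" "bdist \<in> borel_measurable borel" "\<And>z t. ball (z::'a) t \<in> sets borel"
    using W_measurable[OF bdist_W] \<Omega> by simp_all
  have fm: "A \<in> fmeasurable lborel" if "A \<subseteq> \<Omega>" "A \<in> sets borel" for A
    using le_less_trans[OF emeasure_mono[OF that(1), of lborel] finite_\<Omega>(1)] that(2) finite_\<Omega>(2)
    by (intro fmeasurableI) auto
  have Am: "{x \<in> \<Omega>. bdist x < \<delta>} \<in> sets borel"
    and Bm: "{x \<in> \<Omega>. x \<in> ball z t \<and> bdist x < \<delta>} \<in> sets borel" for z t \<delta>
    by measurable
  have "measure lborel {x \<in> \<Omega>. bdist x < \<delta>} \<le> C0 * \<delta>" if \<delta>: "0 < \<delta>" for \<delta>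
  proof (cases "\<delta> < \<delta>0")
    case True
    have "{x \<in> \<Omega>. bdist x < \<delta>} \<subseteq> (\<Union>z\<in>F. {x \<in> \<Omega>. x \<in> ball z (r z) \<and> bdist x < \<delta>})"
    proof safe
      fix x assume x: "x \<in> \<Omega>" "bdist x < \<delta>"
      obtain y where y: "y \<notin> \<Omega>" "dist x y < \<delta>"
        using bdist_attained[of x] x(2) by metis
      \<comment> \<open>The segment to a nearby outside point crosses the frontier, so
        \<open>x\<close> is within \<delta> of a frontier point; the halved radii of the cover leave
        room for this distance.\<close>
      have "closed_segment x y \<inter> frontier \<Omega> \<noteq> {}"
        using x(1) y(1) by (intro connected_Int_frontier) auto
      then obtain w where w: "w \<in> closed_segment x y" "w \<in> frontier \<Omega>" by blast
      then obtain z where z: "z \<in> F" "w \<in> ball z (r z / 2)" using F(3) by blast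
      have "dist x w \<le> dist x y" using dist_in_closed_segment[OF w(1)] by (simp add: dist_commute)
      hence "dist z x < r z" using z y(2) True \<delta>0(2)[OF z(1)] dist_triangle[of z x w] by (simp add: dist_commute)
      thus "x \<in> (\<Union>z\<in>F. {x \<in> \<Omega>. x \<in> ball z (r z) \<and> bdist x < \<delta>})" using x z by auto
    qed
    hence "measure lborel {x \<in> \<Omega>. bdist x < \<delta>} \<le> measure lborel (\<Union>z\<in>F. {x \<in> \<Omega>. x \<in> ball z (r z) \<and> bdist x < \<delta>})"
    proof (rule measure_mono_fmeasurable)
      show "(\<Union>z\<in>F. {x \<in> \<Omega>. x \<in> ball z (r z) \<and> bdist x < \<delta>}) \<in> fmeasurable lborel"
        using F(2) Bm by (intro fm sets.finite_UN) blast+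
    qed (simp only: sets_lborel Am)
    also have "\<dots> \<le> (\<Sum>z\<in>F. measure lborel {x \<in> \<Omega>. x \<in> ball z (r z) \<and> bdist x < \<delta>})"
      using F(2) Bm by (intro measure_UNION_le) (simp_all only: sets_lborel)
    also have "\<dots> \<le> (\<Sum>z\<in>F. C z * \<delta>)"
    proof (rule sum_mono)
      fix z assume z: "z \<in> F"
      have "\<delta> < r z" using True \<delta>0(2)[OF z] rC(1)[of z] z F(1) by auto
      thus "measure lborel {x \<in> \<Omega>. x \<in> ball z (r z) \<and> bdist x < \<delta>} \<le> C z * \<delta>"
        using rC(3)[of z \<delta>] z F(1) \<delta> by auto
    qed
    also have "\<dots> = (\<Sum>z\<in>F. C z) * \<delta>" by (simp add: sum_distrib_right)
    also have "\<dots> \<le> C0 * \<delta>" using \<delta> \<delta>0 by (intro mult_right_mono) (auto simp: C0_def)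
    finally show ?thesis .
  next
    case False
    have "measure lborel {x \<in> \<Omega>. bdist x < \<delta>} \<le> measure lborel \<Omega>"
    proof (rule measure_mono_fmeasurable)
      show "\<Omega> \<in> fmeasurable lborel" using finite_\<Omega>(2) by (intro fm) auto
    qed (auto simp only: sets_lborel Am)
    also have "\<dots> = measure lborel \<Omega> / \<delta>0 * \<delta>0" using \<delta>0(1) by simp
    also have "\<dots> \<le> measure lborel \<Omega> / \<delta>0 * \<delta>" using False \<delta>0(1) by (intro mult_left_mono) auto
    also have "\<dots> \<le> C0 * \<delta>" using \<delta> sumC by (intro mult_right_mono) (auto simp: C0_def)
    finally show ?thesis .
  qed
  moreover have "0 \<le> C0" using sumC \<delta>0(1) by (simp add: C0_def)
  ultimately show ?thesis using that by blast
qed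

text \<open>Where the distance is below 1, \<open>\<bar>ln (bdist x)\<bar>\<close> is at most the
  number of dyadic layers containing \<open>x\<close>, because \<open>ln 2 < 1\<close>. The layer
  measures are summable by the linear bound.\<close>

lemma ln_bdist_integrable:
  assumes "smooth_boundary \<Omega>"
  shows "integrable lborel (\<lambda>x. ln (bdist x))"
proof -
  obtain C :: real where C: "0 \<le> C" "\<And>\<delta>. 0 < \<delta> \<Longrightarrow> measure lborel {x \<in> \<Omega>. bdist x < \<delta>} \<le> C * \<delta>"
    using boundary_layer[OF assms] by blast
  obtain M where M: "\<And>x. bdist x \<le> M" using bdist_bounded by blast
  define K where "K = max M 0"
  have [measurable]: "\<Omega> \<in> sets borel" "bdist \<in> borel_measurable borel" using W_measurable[OF bdist_W] \<Omega> by auto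
  define A where "A j = {x \<in> \<Omega>. bdist x < (1/2) ^ j}" for j :: nat
  have [measurable]: "A j \<in> sets borel" for j unfolding A_def by measurable
  have pt: "ennreal \<bar>ln (bdist x)\<bar> \<le> ennreal K * indicator \<Omega> x + (\<Sum>j. indicator (A j) x)" for x
  proof (cases "x \<in> \<Omega>")
    case True
    hence d: "0 < bdist x" by (simp add: bdist_pos_iff)
    show ?thesis
    proof (cases "1 \<le> bdist x")
      case True
      have "ln (bdist x) \<le> bdist x - 1" using d by (rule ln_le_minus_one)
      hence "\<bar>ln (bdist x)\<bar> \<le> K" using True M[of x] by (auto simp: K_def)
      thus ?thesis using \<open>x \<in> \<Omega>\<close> by (simp add: ennreal_leI add_increasing2)
    next
      case False
      have ex: "\<exists>k. (1/2) ^ k \<le> bdist x" using real_arch_pow_inv[of "bdist x" "1/2"] d by (auto intro: less_imp_le)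
      define k where "k = (LEAST k. (1/2) ^ k \<le> bdist x)"
      have k: "(1/2) ^ k \<le> bdist x" unfolding k_def by (rule LeastI_ex[OF ex])
      have j: "x \<in> A j" if "j < k" for j
        using not_less_Least[of j "\<lambda>k. (1/2) ^ k \<le> bdist x"] that \<open>x \<in> \<Omega>\<close> by (simp add: k_def A_def)
      have "ln ((1/2) ^ k) \<le> ln (bdist x)" using k d by (subst ln_le_cancel_iff) auto
      hence "- ln (bdist x) \<le> k * ln 2" by (simp add: ln_realpow ln_div)
      also have "\<dots> \<le> real k * 1" using ln_2_less_1 by (intro mult_left_mono) auto
      finally have "\<bar>ln (bdist x)\<bar> \<le> k" using False d by simp
      hence "ennreal \<bar>ln (bdist x)\<bar> \<le> of_nat k" by (metis ennreal_leI ennreal_of_nat_eq_real_of_nat)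
      also have "of_nat k = (\<Sum>j<k. indicator (A j) x :: ennreal)" using j by simp
      also have "\<dots> \<le> (\<Sum>j. indicator (A j) x)" by (rule sum_le_suminf) (auto simp: summableI)
      finally show ?thesis by (simp add: add_increasing)
    qed
  qed (simp add: bdist_zero)
  have "(\<integral>\<^sup>+x. ennreal \<bar>ln (bdist x)\<bar> \<partial>lborel) \<le> (\<integral>\<^sup>+x. ennreal K * indicator \<Omega> x + (\<Sum>j. indicator (A j) x) \<partial>lborel)"
    using pt by (intro nn_integral_mono) auto
  also have "\<dots> = ennreal K * emeasure lborel \<Omega> + (\<Sum>j. emeasure lborel (A j))"
    by (subst nn_integral_add) (auto simp: nn_integral_suminf nn_integral_cmult_indicator)
  also have "(\<Sum>j. emeasure lborel (A j)) \<le> (\<Sum>j. ennreal (C * (1/2) ^ j))"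
  proof (intro suminf_le summableI)
    fix j
    have "emeasure lborel (A j) \<le> emeasure lborel \<Omega>" by (intro emeasure_mono) (auto simp: A_def)
    hence "emeasure lborel (A j) \<noteq> \<infinity>" using finite_\<Omega>(1) by auto
    hence "emeasure lborel (A j) = ennreal (measure lborel (A j))" by (intro emeasure_eq_ennreal_measure) auto
    also have "\<dots> \<le> ennreal (C * (1/2) ^ j)" unfolding A_def using C(2)[of "(1/2) ^ j"] by (intro ennreal_leI) auto
    finally show "emeasure lborel (A j) \<le> ennreal (C * (1/2) ^ j)" .
  qed
  also have "(\<Sum>j. ennreal (C * (1/2) ^ j)) = ennreal (C * (1 / (1 - 1/2)))"
    using C by (intro suminf_ennreal_eq sums_mult geometric_sums) auto
  finally have "(\<integral>\<^sup>+x. ennreal \<bar>ln (bdist x)\<bar> \<partial>lborel) \<le> ennreal K * emeasure lborel \<Omega> + ennreal (C * (1 / (1 - 1/2)))"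
    by (simp add: add_left_mono)
  also have "\<dots> < \<infinity>" using finite_\<Omega>(1) by (simp add: ennreal_mult_less_top)
  finally show ?thesis by (intro integrableI_bounded) auto
qed

end

subsection \<open>The singular term\<close>

locale singular = fractional p s \<Omega> for p s :: real and \<Omega> :: "'a::euclidean_space set" +
  fixes q :: real
  assumes q: "0 < q" "q \<le> 1" and smooth: "smooth_boundary \<Omega>"
begin

text \<open>A real-valued stand-in for \<open>G q\<close>. Since \<open>ln 0 = 0\<close> in HOL,
  \<open>g 0 = 0\<close> in both cases and the integral may run over the whole space. For
  \<open>q = 1\<close> it agrees with \<open>G q\<close> only at nonzero arguments, which is why
  \<open>P\<close> demands positivity in \<Omega> then.\<close>

definition g :: "real \<Rightarrow> real" where
  "g x = (if q = 1 then ln x else x powr (1 - q) / (1 - q))"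

definition P :: "('a \<Rightarrow> real) set" where
  "P = {u \<in> W. (\<forall>x. 0 \<le> u x) \<and> \<not> (AE x in lborel. u x = 0) \<and>
     (q = 1 \<longrightarrow> (AE x in lborel. x \<in> \<Omega> \<longrightarrow> 0 < u x) \<and> integrable lborel (\<lambda>x. ln (u x)))}"

text \<open>The coefficient in the derivative \<open>t powr (- q) * b u\<close> of the singular
  integral along a ray. For \<open>q = 1\<close> the convention \<open>0 powr 0 = 0\<close> turns
  the integrand into an indicator, so that \<open>b\<close> is the measure of \<Omega> on all of
  \<open>P\<close>.\<close>

definition b :: "('a \<Rightarrow> real) \<Rightarrow> real" where "b u = (\<integral>x. u x powr (1 - q) \<partial>lborel)"

definition Gam :: "('a \<Rightarrow> real) \<Rightarrow> real" where "Gam u = (\<integral>x. g (u x) \<partial>lborel)"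

lemma P_W: "u \<in> P \<Longrightarrow> u \<in> W" and P_nonneg: "u \<in> P \<Longrightarrow> 0 \<le> u x"
  and P_nontrivial: "u \<in> P \<Longrightarrow> \<not> (AE x in lborel. u x = 0)"
  by (auto simp: P_def)

lemma P_pos: "u \<in> P \<Longrightarrow> q = 1 \<Longrightarrow> AE x in lborel. x \<in> \<Omega> \<longrightarrow> 0 < u x"
  and P_ln_integrable: "u \<in> P \<Longrightarrow> q = 1 \<Longrightarrow> integrable lborel (\<lambda>x. ln (u x))"
  unfolding P_def by auto

lemma g_ln: "q = 1 \<Longrightarrow> g x = ln x"
  unfolding g_def by (rule if_P)

lemma Gam_ln: "q = 1 \<Longrightarrow> Gam u = (\<integral>x. ln (u x) \<partial>lborel)"
  unfolding Gam_def by (subst g_ln) auto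

lemma g_zero [simp]: "g 0 = 0" by (simp add: g_def)

lemma g_measurable [measurable]: "g \<in> borel_measurable borel"
  unfolding g_def by measurable

lemma integrable_\<Omega>: "integrable lborel (\<lambda>x. indicator \<Omega> x :: real)"
  using finite_\<Omega> by (intro integrable_real_indicator) auto

lemma powr_le_indicator:
  assumes "u \<in> W" "\<And>x. 0 \<le> u x"
  shows "u x powr (1 - q) \<le> indicator \<Omega> x + u x"
proof (cases "u x \<le> 1")
  case True
  thus ?thesis using W_zero[OF assms(1), of x] assms(2)[of x] q powr_le1[of "1 - q" "u x"]
    by (cases "x \<in> \<Omega>") auto
next
  case False
  hence "u x powr (1 - q) \<le> u x powr 1" using q by (intro powr_mono) auto
  thus ?thesis using False by (simp add: add_increasing)
qed

lemma b_integrable: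
  assumes u: "u \<in> W" "\<And>x. 0 \<le> u x"
  shows "integrable lborel (\<lambda>x. u x powr (1 - q))"
proof (rule Bochner_Integration.integrable_bound)
  show "integrable lborel (\<lambda>x. indicator \<Omega> x + u x)"
    using integrable_\<Omega> W_integrable1[OF u(1)] by auto
  show "AE x in lborel. norm (u x powr (1 - q)) \<le> norm (indicator \<Omega> x + u x)"
    using powr_le_indicator[OF u] u(2) by auto
  show "(\<lambda>x. u x powr (1 - q)) \<in> borel_measurable lborel" using W_measurable[OF u(1)] by measurable
qed

lemma Gam_integrable:
  assumes "u \<in> P" shows "integrable lborel (\<lambda>x. g (u x))"
proof (cases "q = 1")
  case True show ?thesis unfolding g_ln[OF True] by (rule P_ln_integrable[OF assms True])
next
  case False thus ?thesis using b_integrable[OF P_W P_nonneg, OF assms assms] by (simp add: g_def)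
qed

lemma Gam_eq: "q \<noteq> 1 \<Longrightarrow> Gam u = b u / (1 - q)"
  by (simp add: Gam_def b_def g_def)

lemma b_pos:
  assumes "u \<in> P" shows "0 < b u"
proof -
  have i: "integrable lborel (\<lambda>x. u x powr (1 - q))" using b_integrable[OF P_W P_nonneg, OF assms assms] .
  have "0 \<le> b u" unfolding b_def by (intro integral_nonneg_AE) auto
  moreover have "b u \<noteq> 0"
  proof
    assume "b u = 0"
    hence "AE x in lborel. u x powr (1 - q) = 0"
      unfolding b_def using integral_nonneg_eq_0_iff_AE[OF i] by simp
    thus False using P_nontrivial[OF assms] by simp
  qed
  ultimately show ?thesis by simp
qed

lemma b_eq_measure:
  assumes "u \<in> P" "q = 1" shows "b u = measure lborel \<Omega>"
proof -
  have "AE x in lborel. x \<in> \<Omega> \<longrightarrow> 0 < u x" using assms by (rule P_pos)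
  hence "AE x in lborel. u x powr (1 - q) = indicator \<Omega> x"
    by eventually_elim (use assms W_zero[OF P_W[OF assms(1)]] in \<open>auto simp: indicator_def\<close>)
  hence "b u = (\<integral>x. indicator \<Omega> x \<partial>lborel)"
    unfolding b_def using W_measurable[OF P_W[OF assms(1)]] finite_\<Omega>(2) by (intro integral_cong_AE) auto
  thus ?thesis by simp
qed

lemma P_scale:
  assumes u: "u \<in> P" and t: "0 < t"
  shows "(\<lambda>x. t * u x) \<in> P" "b (\<lambda>x. t * u x) = t powr (1 - q) * b u"
    "Gam (\<lambda>x. t * u x) = (if q = 1 then ln t * b u + Gam u else t powr (1 - q) * Gam u)"
proof -
  have pw: "(t * u x) powr (1 - q) = t powr (1 - q) * u x powr (1 - q)" for x
    using t P_nonneg[OF u] by (simp add: powr_mult)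
  show "b (\<lambda>x. t * u x) = t powr (1 - q) * b u" unfolding b_def pw by simp
  \<comment> \<open>For \<open>q = 1\<close> the factor \<open>u x powr (1 - q)\<close> acts as the
    indicator of \<Omega>: the additive \<open>ln t\<close> must appear only where \<open>u\<close>
    is positive.\<close>
  have ln: "AE x in lborel. ln (t * u x) = ln t * u x powr (1 - q) + ln (u x)" if "q = 1"
  proof -
    have "AE x in lborel. x \<in> \<Omega> \<longrightarrow> 0 < u x" using u that by (rule P_pos)
    thus ?thesis
      by eventually_elim (use t that W_zero[OF P_W[OF u]] in \<open>auto simp: ln_mult_pos\<close>)
  qed
  have lnm: "(\<lambda>x. ln (t * u x)) \<in> borel_measurable lborel" "(\<lambda>x. ln t * u x powr (1 - q) + ln (u x)) \<in> borel_measurable lborel"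
    using W_measurable[OF P_W[OF u]] by measurable
  have i: "integrable lborel (\<lambda>x. ln t * u x powr (1 - q) + ln (u x))" if "q = 1"
    using b_integrable[OF P_W P_nonneg, OF u u] P_ln_integrable[OF u that] by auto
  have "integrable lborel (\<lambda>x. ln (t * u x))" if "q = 1"
    using i[OF that] integrable_cong_AE[OF lnm ln[OF that]] by simp
  thus "(\<lambda>x. t * u x) \<in> P"
    using u t W_cmult(1)[of u t] by (auto simp: P_def)
  show "Gam (\<lambda>x. t * u x) = (if q = 1 then ln t * b u + Gam u else t powr (1 - q) * Gam u)"
  proof (cases "q = 1")
    case True
    have "Gam (\<lambda>x. t * u x) = (\<integral>x. ln t * u x powr (1 - q) + ln (u x) \<partial>lborel)"
      unfolding Gam_ln[OF True] by (rule integral_cong_AE[OF lnm ln[OF True]])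
    also have "\<dots> = ln t * b u + Gam u"
      unfolding Gam_ln[OF True] b_def
      using b_integrable[OF P_W P_nonneg, OF u u] P_ln_integrable[OF u True] by simp
    finally show ?thesis using True by simp
  next
    case False
    thus ?thesis unfolding Gam_eq[OF False] \<open>b (\<lambda>x. t * u x) = t powr (1 - q) * b u\<close> by simp
  qed
qed

lemma Gam_derivative:
  assumes u: "u \<in> P" and t: "0 < t"
  shows "((\<lambda>t. Gam (\<lambda>x. t * u x)) has_real_derivative t powr (- q) * b u) (at t)"
proof -
  define F where "F t = (if q = 1 then ln t * b u + Gam u else t powr (1 - q) * Gam u)" for t
  have "(F has_real_derivative t powr (- q) * b u) (at t)"
  proof (cases "q = 1")
    case True
    have "F = (\<lambda>t. ln t * b u + Gam u)" unfolding F_def if_P[OF True] ..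
    moreover have "((\<lambda>t. ln t * b u + Gam u) has_real_derivative (1 / t) * b u) (at t)"
      using t by (auto intro!: derivative_eq_intros)
    moreover have "t powr (- q) = 1 / t" using True t by (simp add: powr_minus divide_inverse)
    ultimately show ?thesis by simp
  next
    case False
    have "F = (\<lambda>t. t powr (1 - q) * Gam u)" using False by (auto simp: F_def)
    moreover have "((\<lambda>t. t powr (1 - q) * Gam u) has_real_derivative ((1 - q) * t powr (1 - q - 1)) * Gam u) (at t)"
      using has_real_derivative_powr[OF t, of "1 - q"] by (rule DERIV_cmult_right)
    ultimately show ?thesis using False by (simp add: Gam_eq mult.commute)
  qed
  moreover have "eventually (\<lambda>t. Gam (\<lambda>x. t * u x) = F t) (nhds t)"
  proof -
    have "Gam (\<lambda>x. r * u x) = F r" if "r \<in> {0<..}" for r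
      unfolding F_def using that by (intro P_scale(3)[OF u]) simp
    moreover have "eventually (\<lambda>r. r \<in> {0<..}) (nhds t)" using t by (intro eventually_nhds_in_open) auto
    ultimately show ?thesis by (rule_tac eventually_mono)
  qed
  ultimately show ?thesis by (subst DERIV_cong_ev[OF refl _ refl])
qed

text \<open>In the logarithmic case scaling adds \<open>ln t * b\<close>, and \<open>b\<close> takes
  the same value at both functions; so differences are homogeneous of degree \<open>1 - q\<close> in
  every case.\<close>

lemma Gam_scale_diff:
  assumes "u \<in> P" "w \<in> P" "0 < t"
  shows "Gam (\<lambda>x. t * w x) - Gam (\<lambda>x. t * u x) = t powr (1 - q) * (Gam w - Gam u)"
proof (cases "q = 1")
  case True
  have "b u = b w" using b_eq_measure[OF _ True] assms by simp
  moreover have "t powr (1 - q) = 1" using True assms by simp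
  ultimately show ?thesis using True assms P_scale(3)[of u t] P_scale(3)[of w t] unfolding if_P[OF True] by simp
qed (use assms in \<open>simp add: P_scale(3) right_diff_distrib\<close>)

text \<open>Upward closedness of the cone. For \<open>q = 1\<close> the logarithm of the larger
  function is squeezed between \<open>ln (u x)\<close> and \<open>w x\<close>, hence
  integrable.\<close>

lemma P_mono:
  assumes u: "u \<in> P" and w: "w \<in> W" and le: "\<And>x. u x \<le> w x"
  shows "w \<in> P" "Gam u \<le> Gam w" "b u \<le> b w"
proof -
  have u0: "0 \<le> u x" for x using P_nonneg[OF u] .
  hence w0: "0 \<le> w x" for x using le[of x] by (meson order_trans)
  have nt: "\<not> (AE x in lborel. w x = 0)"
  proof
    assume "AE x in lborel. w x = 0"
    hence "AE x in lborel. u x = 0" by eventually_elim (use u0 le in \<open>metis order_antisym\<close>)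
    thus False using P_nontrivial[OF u] by simp
  qed
  have pos: "AE x in lborel. x \<in> \<Omega> \<longrightarrow> 0 < u x" if "q = 1" using u that by (rule P_pos)
  have ln: "AE x in lborel. norm (ln (w x)) \<le> norm (\<bar>ln (u x)\<bar> + w x)" if q1: "q = 1"
    using pos[OF that]
  proof eventually_elim
    case (elim x)
    show ?case
    proof (cases "x \<in> \<Omega>")
      case True
      hence "0 < u x" using elim by simp
      hence "ln (u x) \<le> ln (w x)" "ln (w x) \<le> w x" using le[of x] ln_le_minus_one[of "w x"] by (auto simp: ln_le_cancel_iff)
      thus ?thesis using w0[of x] by simp
    qed (use W_zero[OF w] in simp)
  qed
  have "integrable lborel (\<lambda>x. ln (w x))" if "q = 1"
  proof (rule Bochner_Integration.integrable_bound[OF _ _ ln[OF that]])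
    show "integrable lborel (\<lambda>x. \<bar>ln (u x)\<bar> + w x)"
      using P_ln_integrable[OF u that] W_integrable1[OF w] by auto
    show "(\<lambda>x. ln (w x)) \<in> borel_measurable lborel" using W_measurable[OF w] by measurable
  qed
  moreover have "AE x in lborel. x \<in> \<Omega> \<longrightarrow> 0 < w x" if "q = 1"
    using pos[OF that] by eventually_elim (use le in \<open>meson less_le_trans\<close>)
  ultimately show wP: "w \<in> P" using w w0 nt by (simp add: P_def)
  show "b u \<le> b w" unfolding b_def
    using b_integrable[OF P_W P_nonneg, OF u u] b_integrable[OF w w0] u0 le q
    by (intro integral_mono) (auto intro!: powr_mono2)
  show "Gam u \<le> Gam w" unfolding Gam_def
  proof (rule integral_mono_AE[OF Gam_integrable[OF u] Gam_integrable[OF wP]])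
    show "AE x in lborel. g (u x) \<le> g (w x)"
    proof (cases "q = 1")
      case True
      show ?thesis using pos[OF True]
      proof eventually_elim
        case (elim x)
        thus ?case using le[of x] W_zero[OF w, of x] W_zero[OF P_W[OF u], of x]
          unfolding g_ln[OF True] by (cases "x \<in> \<Omega>") (auto simp: ln_le_cancel_iff)
      qed
    next
      case False
      thus ?thesis using u0 le q by (auto simp: g_def intro!: divide_right_mono powr_mono2)
    qed
  qed
qed

text \<open>Boundary regularity enters here, through the integrability of
  \<open>ln (bdist x)\<close>.\<close>

lemma bdist_P: "bdist \<in> P"
proof -
  have "\<not> (AE x in lborel. bdist x = 0)"
  proof
    assume "AE x in lborel. bdist x = 0"
    hence "AE x in lborel. x \<notin> \<Omega>" by eventually_elim (metis bdist_pos_iff less_irrefl)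
    thus False using \<Omega>_not_null by simp
  qed
  thus ?thesis using bdist_W bdist_nonneg ln_bdist_integrable[OF smooth] bdist_pos_iff by (simp add: P_def)
qed

lemma Lp_bounded:
  assumes u: "\<And>k. u k \<in> W" and K: "\<And>k. E (u k) \<le> K"
  obtains C where "\<And>k. integrable lborel (\<lambda>x. \<bar>u k x\<bar> powr p)" "\<And>k. (\<integral>x. \<bar>u k x\<bar> powr p \<partial>lborel) \<le> C"
proof -
  have "0 < p" using p by simp
  then obtain C where "\<And>u. u \<in> W \<Longrightarrow> E u \<le> K \<Longrightarrow> integrable lborel (\<lambda>x. \<bar>u x\<bar> powr p)"
    "\<And>u. u \<in> W \<Longrightarrow> E u \<le> K \<Longrightarrow> (\<integral>x. \<bar>u x\<bar> powr p \<partial>lborel) \<le> C"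
    using Lr_bound[OF _ pstar_gt(1), of K] by metis
  thus ?thesis using that[of C] u K by blast
qed

lemma power_integral_tendsto:
  assumes u: "\<And>k. u k \<in> W" and K: "\<And>k. E (u k) \<le> K" and w: "w \<in> W"
    and lim: "AE x in lborel. (\<lambda>k. u k x) \<longlonglongrightarrow> w x" and \<rho>: "0 < \<rho>" "\<rho> < p"
  shows "(\<lambda>k. \<integral>x. \<bar>u k x\<bar> powr \<rho> \<partial>lborel) \<longlonglongrightarrow> (\<integral>x. \<bar>w x\<bar> powr \<rho> \<partial>lborel)"
proof -
  obtain C where C: "\<And>k. integrable lborel (\<lambda>x. \<bar>u k x\<bar> powr p)" "\<And>k. (\<integral>x. \<bar>u k x\<bar> powr p \<partial>lborel) \<le> C"
    using Lp_bounded[of u K, OF u K] by blast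
  show ?thesis
    using W_zero u w W_measurable finite_\<Omega> by (intro integral_powr_tendsto(1)[OF \<rho> _ _ _ _ _ _ lim C, of \<Omega>]) auto
qed

lemma b_tendsto:
  assumes u: "\<And>k. u k \<in> W" "\<And>k x. 0 \<le> u k x" and K: "\<And>k. E (u k) \<le> K" and w: "w \<in> W" "\<And>x. 0 \<le> w x"
    and lim: "AE x in lborel. (\<lambda>k. u k x) \<longlonglongrightarrow> w x" and q1: "q < 1"
  shows "(\<lambda>k. b (u k)) \<longlonglongrightarrow> b w"
  using power_integral_tendsto[OF u(1) K w(1) lim, of "1 - q"] q q1 p u(2) w(2) by (simp add: b_def)

text \<open>Fatou for the nonnegative functions \<open>u k x - ln (u k x)\<close>. As HOL sets
  \<open>ln 0 = 0\<close>, the limit must first be shown positive: with the logarithm cut off at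
  \<open>1 / (m + 1)\<close>, Fatou bounds \<open>ln (m + 1)\<close> times the measure of the zero
  set uniformly in \<open>m\<close>, so this set is null.\<close>

lemma ln_limit_pos:
  assumes q1: "q = 1" and u: "\<And>k. u k \<in> P" and K: "\<And>k. E (u k) \<le> K" and w: "w \<in> W" "\<And>x. 0 \<le> w x"
    and lim: "AE x in lborel. (\<lambda>k. u k x) \<longlonglongrightarrow> w x"
    and G: "(\<lambda>k. Gam (u k)) \<longlonglongrightarrow> L"
  shows "AE x in lborel. x \<in> \<Omega> \<longrightarrow> 0 < w x" "integrable lborel (\<lambda>x. ln (w x))" "L \<le> Gam w"
proof -
  have uW: "u k \<in> W" and u0: "0 \<le> u k x" for k x using P_W[OF u] P_nonneg[OF u] by auto
  have [measurable]: "u k \<in> borel_measurable borel" "w \<in> borel_measurable borel" "\<Omega> \<in> sets borel" for k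
    using W_measurable uW w finite_\<Omega> by auto
  have pos: "AE x in lborel. \<forall>k. x \<in> \<Omega> \<longrightarrow> 0 < u k x"
    using P_pos[OF u q1] unfolding AE_all_countable by blast
  have lnint: "integrable lborel (\<lambda>x. ln (u k x))" for k using u q1 by (rule P_ln_integrable)
  have Gln: "Gam v = (\<integral>x. ln (v x) \<partial>lborel)" for v by (rule Gam_ln[OF q1])
  have int_u: "(\<lambda>k. \<integral>x. u k x \<partial>lborel) \<longlonglongrightarrow> (\<integral>x. w x \<partial>lborel)"
    using power_integral_tendsto[OF uW K w(1) lim, of 1] p u0 w(2) by simp
  define h where "h k x = u k x - ln (u k x)" for k x
  have hi: "integrable lborel (h k)" for k
    unfolding h_def using lnint W_integrable1[OF uW] by auto
  have hlim: "(\<lambda>k. \<integral>x. h k x \<partial>lborel) \<longlonglongrightarrow> (\<integral>x. w x \<partial>lborel) - L"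
    using tendsto_diff[OF int_u G] lnint W_integrable1[OF uW] by (simp add: h_def Gln)
  then obtain K' where K': "\<And>k. (\<integral>x. h k x \<partial>lborel) \<le> K'"
    using convergent_imp_bounded[of "\<lambda>k. \<integral>x. h k x \<partial>lborel"] by (force simp: convergent_def bounded_iff abs_le_iff)
  \<comment> \<open>The cut-off makes the integrand continuous at 0, so pointwise limits pass
    through it before positivity of \<open>w\<close> is known; on the zero set of \<open>w\<close>
    its value is \<open>ln (m + 1)\<close>.\<close>
  define \<phi> where "\<phi> m x = (x - ln (max x (1 / (real m + 1))))" for m :: nat and x :: real
  have \<phi>0: "0 \<le> \<phi> m x" if "0 \<le> x" for m x
  proof -
    have "ln (max x (1 / (real m + 1))) \<le> x"
    proof (cases "x \<le> 1 / (real m + 1)")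
      case True
      hence "ln (max x (1 / (real m + 1))) = - ln (real m + 1)" by (simp add: max_def ln_div)
      thus ?thesis using that by (smt (verit) ln_ge_zero of_nat_0_le_iff)
    next
      case False
      hence "0 < x" by (smt (verit) divide_pos_pos of_nat_0_le_iff)
      thus ?thesis using False ln_le_minus_one[of x] by (simp add: max_def)
    qed
    thus ?thesis by (simp add: \<phi>_def)
  qed
  have \<phi>h: "\<phi> m x \<le> x - ln x" if "0 < x" for m x
    using that by (simp add: \<phi>_def ln_le_cancel_iff less_max_iff_disj)
  have [measurable]: "\<phi> m \<in> borel_measurable borel" for m unfolding \<phi>_def by measurable
  have A: "integrable lborel (\<lambda>x. \<phi> m (w x) * indicator \<Omega> x)" "(\<integral>x. \<phi> m (w x) * indicator \<Omega> x \<partial>lborel) \<le> K'" for m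
  proof -
    have dom: "AE x in lborel. norm (\<phi> m (u k x) * indicator \<Omega> x) \<le> h k x" for k
      using pos
    proof eventually_elim
      case (elim x)
      show ?case
      proof (cases "x \<in> \<Omega>")
        case True thus ?thesis using elim \<phi>0[OF u0, of m k x] \<phi>h[of "u k x" m] by (simp add: h_def)
      qed (simp add: h_def W_zero[OF uW])
    qed
    have i: "integrable lborel (\<lambda>x. \<phi> m (u k x) * indicator \<Omega> x)" for k
    proof (rule Bochner_Integration.integrable_bound[OF hi[of k]])
      show "AE x in lborel. norm (\<phi> m (u k x) * indicator \<Omega> x) \<le> norm (h k x)"
        using dom[of k] by eventually_elim (rule order_trans, assumption, simp)
    qed measurable
    have bd: "(\<integral>x. \<phi> m (u k x) * indicator \<Omega> x \<partial>lborel) \<le> K'" for k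
    proof -
      have "(\<integral>x. \<phi> m (u k x) * indicator \<Omega> x \<partial>lborel) \<le> (\<integral>x. h k x \<partial>lborel)"
      proof (intro integral_mono_AE i hi)
        show "AE x in lborel. \<phi> m (u k x) * indicator \<Omega> x \<le> h k x"
          using dom[of k] by eventually_elim simp
      qed
      thus ?thesis using K'[of k] by linarith
    qed
    have l: "AE x in lborel. (\<lambda>k. \<phi> m (u k x) * indicator \<Omega> x) \<longlonglongrightarrow> \<phi> m (w x) * indicator \<Omega> x"
      using lim
    proof eventually_elim
      case (elim x)
      have "max (w x) (1 / (real m + 1)) > 0" by (simp add: less_max_iff_disj)
      thus ?case unfolding \<phi>_def using elim
        by (intro tendsto_mult tendsto_diff tendsto_ln tendsto_max tendsto_const) auto
    qed
    have n: "AE x in lborel. 0 \<le> \<phi> m (u k x) * indicator \<Omega> x" for k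
      using \<phi>0 u0 by (simp add: indicator_def)
    have me: "(\<lambda>x. \<phi> m (w x) * indicator \<Omega> x) \<in> borel_measurable lborel" by measurable
    show "integrable lborel (\<lambda>x. \<phi> m (w x) * indicator \<Omega> x)" "(\<integral>x. \<phi> m (w x) * indicator \<Omega> x \<partial>lborel) \<le> K'"
      using Fatou_integral[OF me i n l bd] by auto
  qed
  define Z where "Z = {x \<in> \<Omega>. w x = 0}"
  have [measurable]: "Z \<in> sets borel" unfolding Z_def by measurable
  have Zfin: "emeasure lborel Z < \<infinity>"
    by (rule le_less_trans[OF emeasure_mono finite_\<Omega>(1)]) (auto simp: Z_def finite_\<Omega>)
  have "ln (real m + 1) * measure lborel Z \<le> K'" for m
  proof -
    have iZ: "integrable lborel (\<lambda>x. ln (real m + 1) * indicator Z x)"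
      using Zfin by (intro integrable_mult_right integrable_real_indicator) auto
    have "ln (real m + 1) * measure lborel Z = (\<integral>x. ln (real m + 1) * indicator Z x \<partial>lborel)" by simp
    also have "\<dots> \<le> (\<integral>x. \<phi> m (w x) * indicator \<Omega> x \<partial>lborel)"
    proof (intro integral_mono iZ A)
      fix x
      show "ln (real m + 1) * indicator Z x \<le> \<phi> m (w x) * indicator \<Omega> x"
      proof (cases "x \<in> Z")
        case True thus ?thesis by (simp add: Z_def \<phi>_def ln_div)
      next
        case False thus ?thesis using \<phi>0[OF w(2)[of x], of m] by (simp add: indicator_def)
      qed
    qed
    finally show ?thesis using A(2)[of m] by linarith
  qed
  note Z = this
  have "measure lborel Z = 0"
  proof (rule ccontr)
    assume "measure lborel Z \<noteq> 0"
    hence Zp: "0 < measure lborel Z" by (simp add: zero_less_measure_iff)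
    obtain m :: nat where "exp (K' / measure lborel Z) < real m" using reals_Archimedean2 by blast
    hence "ln (exp (K' / measure lborel Z)) < ln (real m + 1)" by (subst ln_less_cancel_iff) auto
    hence "K' < ln (real m + 1) * measure lborel Z" using Zp by (simp add: field_simps)
    thus False using Z[of m] by linarith
  qed
  hence Z0: "emeasure lborel Z = 0" using Zfin by (simp add: emeasure_eq_ennreal_measure)
  show wpos: "AE x in lborel. x \<in> \<Omega> \<longrightarrow> 0 < w x"
  proof (rule AE_I[OF _ Z0])
    show "{x \<in> space lborel. \<not> (x \<in> \<Omega> \<longrightarrow> 0 < w x)} \<subseteq> Z" using w(2) by (auto simp: Z_def less_le)
  qed auto
  have n: "AE x in lborel. 0 \<le> h k x" for k
    using pos
  proof eventually_elim
    case (elim x)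
    show ?case
    proof (cases "x \<in> \<Omega>")
      case True
      thus ?thesis using elim ln_le_minus_one[of "u k x"] by (simp add: h_def)
    qed (simp add: h_def W_zero[OF uW])
  qed
  have l: "AE x in lborel. (\<lambda>k. h k x) \<longlonglongrightarrow> w x - ln (w x)"
    using lim wpos
  proof eventually_elim
    case (elim x)
    show ?case
    proof (cases "x \<in> \<Omega>")
      case True
      thus ?thesis unfolding h_def using elim by (intro tendsto_diff tendsto_ln) auto
    qed (simp add: h_def W_zero[OF uW] W_zero[OF w(1)])
  qed
  have me: "(\<lambda>x. w x - ln (w x)) \<in> borel_measurable lborel" by measurable
  have F: "integrable lborel (\<lambda>x. w x - ln (w x))" "(\<integral>x. w x - ln (w x) \<partial>lborel) \<le> (\<integral>x. w x \<partial>lborel) - L"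
    using Fatou_integral_lim[OF me hi n l hlim] by auto
  show i: "integrable lborel (\<lambda>x. ln (w x))"
    using Bochner_Integration.integrable_diff[OF W_integrable1[OF w(1)] F(1)] by simp
  show "L \<le> Gam w" using F(2) i W_integrable1[OF w(1)] by (simp add: Gln)
qed

text \<open>For \<open>q < 1\<close> the singular integral converges, as \<open>1 - q\<close> lies
  below \<open>p\<close>; for \<open>q = 1\<close> only the upper bound \<open>L \<le> Gam w\<close>
  survives. In the latter case the limit is positive in \<Omega> and so nontrivial
  automatically.\<close>

lemma P_limit:
  assumes u: "\<And>k. u k \<in> P" and K: "\<And>k. E (u k) \<le> K" and w: "w \<in> W" "\<And>x. 0 \<le> w x"
    and lim: "AE x in lborel. (\<lambda>k. u k x) \<longlonglongrightarrow> w x"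
    and G: "(\<lambda>k. Gam (u k)) \<longlonglongrightarrow> L" and nt: "q < 1 \<Longrightarrow> \<not> (AE x in lborel. w x = 0)"
  shows "w \<in> P" "(\<lambda>k. b (u k)) \<longlonglongrightarrow> b w" "L \<le> Gam w"
proof -
  have "w \<in> P \<and> (\<lambda>k. b (u k)) \<longlonglongrightarrow> b w \<and> L \<le> Gam w"
  proof (cases "q = 1")
    case True
    note * = ln_limit_pos[OF True u K w lim G]
    have "\<not> (AE x in lborel. w x = 0)"
    proof
      assume "AE x in lborel. w x = 0"
      with *(1) have "AE x in lborel. x \<notin> \<Omega>" by eventually_elim auto
      thus False using \<Omega>_not_null by simp
    qed
    hence wP: "w \<in> P" using * w by (simp add: P_def)
    hence "b (u k) = b w" for k using b_eq_measure[OF u True] b_eq_measure[OF _ True] by simp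
    thus ?thesis using wP *(3) by simp
  next
    case False
    hence q1: "q < 1" using q by simp
    have wP: "w \<in> P" using w nt[OF q1] False by (simp add: P_def)
    have bl: "(\<lambda>k. b (u k)) \<longlonglongrightarrow> b w" by (rule b_tendsto[OF P_W[OF u] P_nonneg[OF u] K w lim q1])
    hence "(\<lambda>k. Gam (u k)) \<longlonglongrightarrow> Gam w" unfolding Gam_eq[OF False] using q1 by (intro tendsto_divide tendsto_const) auto
    hence "L = Gam w" using G LIMSEQ_unique by blast
    thus ?thesis using wP bl by simp
  qed
  thus "w \<in> P" "(\<lambda>k. b (u k)) \<longlonglongrightarrow> b w" "L \<le> Gam w" by auto
qed

text \<open>Scaling to energy at most 1 shows that the L1 norm grows like the power
  \<open>1 / p\<close> of the energy, which is sublinear because \<open>p > 1\<close>.\<close>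

lemma L1_sublinear:
  assumes \<eta>: "0 < \<eta>"
  obtains K where "0 \<le> K" "\<And>u. u \<in> W \<Longrightarrow> (\<integral>x. \<bar>u x\<bar> \<partial>lborel) \<le> \<eta> * E u + K"
proof -
  obtain C0 where "\<And>u. u \<in> W \<Longrightarrow> E u \<le> 1 \<Longrightarrow> (\<integral>x. \<bar>u x\<bar> powr 1 \<partial>lborel) \<le> C0"
    using Lr_bound[of 1 1] pstar_gt(2) by (metis zero_less_one)
  hence C0: "\<And>u. u \<in> W \<Longrightarrow> E u \<le> 1 \<Longrightarrow> (\<integral>x. \<bar>u x\<bar> \<partial>lborel) \<le> C0" by simp
  define C where "C = max C0 1"
  have C: "0 < C" "\<And>u. u \<in> W \<Longrightarrow> E u \<le> 1 \<Longrightarrow> (\<integral>x. \<bar>u x\<bar> \<partial>lborel) \<le> C"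
    using C0 by (auto simp: C_def le_max_iff_disj)
  \<comment> \<open>The threshold beyond which
    \<open>C * X powr (1 / p) \<le> \<eta> * X\<close>.\<close>
  define X0 where "X0 = max 1 ((C / \<eta>) powr (p / (p - 1)))"
  define K where "K = \<eta> + C * X0"
  have "(\<integral>x. \<bar>u x\<bar> \<partial>lborel) \<le> \<eta> * E u + K" if u: "u \<in> W" for u
  proof -
    define X where "X = 1 + E u"
    have X: "1 \<le> X" using E_nonneg[of u] by (simp add: X_def)
    define t where "t = X powr (1 / p)"
    have t: "0 < t" "t powr p = X" using X p by (auto simp: t_def powr_powr)
    have "E (\<lambda>x. (1 / t) * u x) = (1 / t) powr p * E u" using W_cmult(2)[OF u, of "1 / t"] t by simp
    also have "\<dots> = E u / X" using t by (simp add: powr_divide)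
    also have "\<dots> \<le> 1" using X by (simp add: X_def)
    finally have "(\<integral>x. \<bar>(1 / t) * u x\<bar> \<partial>lborel) \<le> C" by (intro C(2) W_cmult u)
    moreover have "(\<integral>x. \<bar>(1 / t) * u x\<bar> \<partial>lborel) = (1 / t) * (\<integral>x. \<bar>u x\<bar> \<partial>lborel)"
      using t by (simp add: abs_mult)
    ultimately have 1: "(\<integral>x. \<bar>u x\<bar> \<partial>lborel) \<le> C * t" using t by (simp add: field_simps)
    have "C * t \<le> \<eta> * X + C * X0"
    proof (cases "X \<le> X0")
      case True
      have "t \<le> X powr 1" unfolding t_def using X p by (intro powr_mono) auto
      hence "t \<le> X0" using True X by simp
      hence "C * t \<le> C * X0" using C by (intro mult_left_mono) auto
      thus ?thesis using \<eta> X by (simp add: add_increasing)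
    next
      case False
      have "C / \<eta> = ((C / \<eta>) powr (p / (p - 1))) powr ((p - 1) / p)" using C \<eta> p by (simp add: powr_powr)
      also have "\<dots> \<le> X powr ((p - 1) / p)" using False p by (intro powr_mono2) (auto simp: X0_def)
      finally have "C \<le> \<eta> * X powr ((p - 1) / p)" using \<eta> by (simp add: field_simps)
      hence "C * t \<le> \<eta> * X powr ((p - 1) / p) * t" using t by (intro mult_right_mono) auto
      also have "\<dots> = \<eta> * (X powr ((p - 1) / p) * t)" by (rule mult.assoc)
      also have "X powr ((p - 1) / p) * t = X powr ((p - 1) / p + 1 / p)" by (simp add: t_def powr_add)
      also have "(p - 1) / p + 1 / p = 1" using p by (simp add: field_simps)
      finally have "C * t \<le> \<eta> * (X powr 1)" .
      hence "C * t \<le> \<eta> * X" using X by simp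
      moreover have "0 \<le> C * X0" using C by (simp add: X0_def)
      ultimately show ?thesis by linarith
    qed
    thus ?thesis using 1 by (simp add: X_def K_def algebra_simps)
  qed
  moreover have "0 \<le> K" using \<eta> C by (simp add: K_def X0_def)
  ultimately show ?thesis using that by blast
qed

text \<open>This makes the singular term a small perturbation of the energy in both coercivity
  estimates. The constant \<open>r\<close> of the proof is the factor between \<open>Gam u\<close>
  and \<open>b u\<close> for \<open>q < 1\<close>.\<close>

lemma b_Gam_sublinear:
  assumes \<eta>: "0 < \<eta>"
  obtains K where "0 \<le> K" "\<And>u. u \<in> P \<Longrightarrow> b u \<le> \<eta> * E u + K" "\<And>u. u \<in> P \<Longrightarrow> Gam u \<le> \<eta> * E u + K"
proof -
  define r where "r = (if q = 1 then 1 else 1 / (1 - q))"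
  have r: "1 \<le> r" using q by (auto simp: r_def field_simps)
  obtain K where K: "0 \<le> K" "\<And>u. u \<in> W \<Longrightarrow> (\<integral>x. \<bar>u x\<bar> \<partial>lborel) \<le> (\<eta> / r) * E u + K"
    using L1_sublinear[of "\<eta> / r"] \<eta> r by auto
  define K' where "K' = r * (measure lborel \<Omega> + K)"
  have m0: "0 \<le> measure lborel \<Omega> + K" using K(1) by simp
  have "b u \<le> \<eta> * E u + K' \<and> Gam u \<le> \<eta> * E u + K'" if u: "u \<in> P" for u
  proof -
    have u0: "0 \<le> u x" for x using P_nonneg[OF u] .
    have iu: "integrable lborel u" using W_integrable1[OF P_W[OF u]] .
    have int: "(\<integral>x. u x \<partial>lborel) \<le> (\<eta> / r) * E u + K" using K(2)[OF P_W[OF u]] u0 by simp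
    have "b u \<le> (\<integral>x. indicator \<Omega> x + u x \<partial>lborel)"
      unfolding b_def using integrable_\<Omega> iu powr_le_indicator[OF P_W[OF u] u0]
      by (intro integral_mono b_integrable P_W u u0) auto
    also have "\<dots> = measure lborel \<Omega> + (\<integral>x. u x \<partial>lborel)" using integrable_\<Omega> iu by simp
    finally have b1: "b u \<le> (\<eta> / r) * E u + (measure lborel \<Omega> + K)" using int by linarith
    have rr: "r * ((\<eta> / r) * E u + (measure lborel \<Omega> + K)) = \<eta> * E u + K'"
      using r by (simp add: K'_def distrib_left)
    have nn: "0 \<le> (\<eta> / r) * E u + (measure lborel \<Omega> + K)" using \<eta> r E_nonneg[of u] m0 by simp
    have up: "(\<eta> / r) * E u + (measure lborel \<Omega> + K) \<le> \<eta> * E u + K'"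
      using mult_right_mono[OF r nn] rr by simp
    have "Gam u \<le> \<eta> * E u + K'"
    proof (cases "q = 1")
      case True
      have "Gam u \<le> (\<integral>x. u x \<partial>lborel)"
        unfolding Gam_def using iu Gam_integrable[OF u]
      proof (rule_tac integral_mono)
        show "g (u x) \<le> u x" for x
          using u0[of x] ln_le_minus_one[of "u x"] unfolding g_ln[OF True] by (cases "u x = 0") auto
      qed auto
      also have "\<dots> \<le> (\<eta> / r) * E u + (measure lborel \<Omega> + K)"
        using int measure_nonneg[of lborel \<Omega>] by linarith
      finally show ?thesis using up by linarith
    next
      case False
      hence "Gam u = r * b u" by (simp add: Gam_eq r_def)
      also have "\<dots> \<le> r * ((\<eta> / r) * E u + (measure lborel \<Omega> + K))" using b1 r by (intro mult_left_mono) auto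
      finally show ?thesis using rr by simp
    qed
    thus ?thesis using b1 up by linarith
  qed
  moreover have "0 \<le> K'" using r m0 by (simp add: K'_def)
  ultimately show ?thesis using that by blast
qed

end

subsection \<open>Fibre maps\<close>

lemma eventually_less_lim:
  fixes f g :: "'b \<Rightarrow> real"
  assumes "l < l'" "(f \<longlongrightarrow> l) F" "(g \<longlongrightarrow> l') F"
  shows "eventually (\<lambda>x. f x < g x) F"
proof -
  have "((\<lambda>x. g x - f x) \<longlongrightarrow> l' - l) F" using assms by (intro tendsto_diff)
  from order_tendstoD(1)[OF this, of 0] assms(1) show ?thesis by simp
qed

text \<open>The last two assumptions are what is drawn from the definition of
  \<open>Lambda1\<close>: integrability of the power, even at the critical exponent, and one zero of
  the fibre derivative at the larger parameter \<open>lam'\<close>.\<close>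

locale problem = singular p s \<Omega> q for p s :: real and \<Omega> :: "'a::euclidean_space set" and q :: real +
  fixes \<alpha> lam lam' :: real
  assumes \<alpha>: "p - 1 < \<alpha>" and lam: "0 < lam" "lam < lam'"
    and power_integrable: "\<And>u. u \<in> P \<Longrightarrow> integrable lborel (\<lambda>x. \<bar>u x\<bar> powr (\<alpha> + 1))"
    and critical_point: "\<And>u. u \<in> P \<Longrightarrow> \<exists>t>0. E u * t powr (p - 1) - lam' * b u * t powr (- q)
      - (\<integral>x. \<bar>u x\<bar> powr (\<alpha> + 1) \<partial>lborel) * t powr \<alpha> = 0"
begin

definition c :: "('a \<Rightarrow> real) \<Rightarrow> real" where "c u = (\<integral>x. \<bar>u x\<bar> powr (\<alpha> + 1) \<partial>lborel)"

definition I :: "('a \<Rightarrow> real) \<Rightarrow> real" where "I u = E u / p - lam * Gam u - c u / (\<alpha> + 1)"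

definition e1 :: real where "e1 = p - 1 + q"
definition e2 :: real where "e2 = \<alpha> + q"

lemma e12: "0 < e1" "e1 < e2" "0 < e2"
  using p q \<alpha> by (auto simp: e1_def e2_def)

lemma \<alpha>1: "p < \<alpha> + 1" "1 < \<alpha> + 1" "0 < \<alpha>"
  using p \<alpha> by auto

text \<open>Integrability is assumed on the cone only; every element of \<open>W\<close> is
  dominated by \<open>\<bar>u x\<bar> + bdist x\<close>, which lies in the cone.\<close>

lemma c_integrable:
  assumes u: "u \<in> W" shows "integrable lborel (\<lambda>x. \<bar>u x\<bar> powr (\<alpha> + 1))"
proof (rule Bochner_Integration.integrable_bound)
  have "(\<lambda>x. \<bar>u x\<bar> + bdist x) \<in> P"
    using W_add[OF W_abs(1)[OF u] bdist_W] by (intro P_mono(1)[OF bdist_P]) auto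
  thus "integrable lborel (\<lambda>x. \<bar>\<bar>u x\<bar> + bdist x\<bar> powr (\<alpha> + 1))" by (rule power_integrable)
  show "AE x in lborel. norm (\<bar>u x\<bar> powr (\<alpha> + 1)) \<le> norm (\<bar>\<bar>u x\<bar> + bdist x\<bar> powr (\<alpha> + 1))"
    using bdist_nonneg \<alpha>1 by (intro AE_I2) (auto intro!: powr_mono2)
  show "(\<lambda>x. \<bar>u x\<bar> powr (\<alpha> + 1)) \<in> borel_measurable lborel" using W_measurable[OF u] by measurable
qed

lemma c_nonneg: "0 \<le> c u"
  unfolding c_def by (intro integral_nonneg_AE) auto

lemma c_scale: "u \<in> W \<Longrightarrow> c (\<lambda>x. t * u x) = \<bar>t\<bar> powr (\<alpha> + 1) * c u"
  unfolding c_def by (rule integrable_powr_cmult(2)[OF c_integrable])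

lemma c_mono:
  assumes "u \<in> W" "w \<in> W" "\<And>x. \<bar>u x\<bar> \<le> \<bar>w x\<bar>" shows "c u \<le> c w"
  unfolding c_def using assms \<alpha>1 by (intro integral_mono c_integrable) (auto intro!: powr_mono2)

lemma c_pos:
  assumes "u \<in> P" shows "0 < c u"
proof -
  have "c u \<noteq> 0"
  proof
    assume "c u = 0"
    hence "AE x in lborel. \<bar>u x\<bar> powr (\<alpha> + 1) = 0"
      unfolding c_def using integral_nonneg_eq_0_iff_AE[OF c_integrable[OF P_W[OF assms]]] by simp
    thus False using P_nontrivial[OF assms] by simp
  qed
  thus ?thesis using c_nonneg[of u] by simp
qed

lemma Nehari_point:
  assumes "u \<in> P" obtains t where "0 < t" "E u * t powr e1 - c u * t powr e2 = lam' * b u"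
proof -
  obtain t where t: "0 < t" "E u * t powr (p - 1) - lam' * b u * t powr (- q) - c u * t powr \<alpha> = 0"
    using critical_point[OF assms] by (auto simp: c_def)
  have "(E u * t powr (p - 1) - lam' * b u * t powr (- q) - c u * t powr \<alpha>) * t powr q =
      E u * (t powr (p - 1) * t powr q) - lam' * b u * (t powr (- q) * t powr q) - c u * (t powr \<alpha> * t powr q)"
    by (simp add: algebra_simps)
  also have "\<dots> = E u * t powr e1 - lam' * b u - c u * t powr e2"
    using t(1) by (simp add: e1_def e2_def flip: powr_add)
  finally show ?thesis using t that[of t] by simp
qed

lemma E_pos: assumes "u \<in> P" shows "0 < E u"
proof -
  obtain t where t: "0 < t" "E u * t powr e1 - c u * t powr e2 = lam' * b u"
    using Nehari_point[OF assms] by blast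
  have "0 < lam' * b u" "0 < c u * t powr e2" using lam b_pos[OF assms] c_pos[OF assms] t by auto
  hence "0 < E u * t powr e1" using t(2) by linarith
  thus ?thesis using t(1) by (simp add: zero_less_mult_iff)
qed

text \<open>As a function of \<open>t\<^bsup>e2\<^esup>\<close>, the map \<open>x t\<^bsup>e1\<^esup> - y t\<^bsup>e2\<^esup>\<close> is concave; this is the tangent inequality at \<open>r\<close>.\<close>

lemma psi_tangent:
  fixes x y r t :: real
  assumes "0 \<le> x" "0 < r" "0 < t"
  shows "(e1 / e2 * x * r powr e1 - y * r powr e2) * (1 - (t / r) powr e2)
    \<le> (x * r powr e1 - y * r powr e2) - (x * t powr e1 - y * t powr e2)"
proof -
  define \<theta> where "\<theta> = e1 / e2"
  have \<theta>: "0 \<le> \<theta>" "0 \<le> 1 - \<theta>" using e12 by (auto simp: \<theta>_def)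
  define z where "z = (t / r) powr e2"
  have z: "0 < z" using assms by (simp add: z_def)
  have "z powr \<theta> * 1 powr (1 - \<theta>) \<le> \<theta> * z + (1 - \<theta>) * 1"
    using z \<theta> by (intro Youngs_inequality_0) auto
  hence zz: "z powr \<theta> \<le> \<theta> * z + (1 - \<theta>)" by simp
  have t1: "t powr e1 = r powr e1 * z powr \<theta>"
    using assms e12 by (simp add: z_def \<theta>_def powr_powr powr_divide)
  have t2: "t powr e2 = r powr e2 * z" using assms by (simp add: z_def powr_divide)
  have "x * r powr e1 * z powr \<theta> \<le> x * r powr e1 * (\<theta> * z + (1 - \<theta>))"
    using zz assms by (intro mult_left_mono) auto
  thus ?thesis unfolding t1 t2 \<theta>_def[symmetric] z_def[symmetric] by (simp add: algebra_simps)
qed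

lemma psi_up:
  assumes "0 \<le> x" "0 < t" "t \<le> r" "e2 * y * r powr e2 \<le> e1 * x * r powr e1"
  shows "x * t powr e1 - y * t powr e2 \<le> x * r powr e1 - y * r powr e2"
proof -
  have "0 \<le> e1 / e2 * x * r powr e1 - y * r powr e2" using assms e12 by (simp add: field_simps)
  moreover have "(t / r) powr e2 \<le> 1" using assms e12 by (intro powr_le1) auto
  ultimately have "0 \<le> (e1 / e2 * x * r powr e1 - y * r powr e2) * (1 - (t / r) powr e2)" by simp
  thus ?thesis using psi_tangent[of x r t y] assms by linarith
qed

lemma psi_down:
  assumes "0 \<le> x" "0 < r" "r \<le> t" "e1 * x * r powr e1 \<le> e2 * y * r powr e2"
  shows "x * t powr e1 - y * t powr e2 \<le> x * r powr e1 - y * r powr e2"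
proof -
  have "e1 / e2 * x * r powr e1 - y * r powr e2 \<le> 0" using assms e12 by (simp add: field_simps)
  moreover have "1 \<le> (t / r) powr e2" using assms e12 by (intro ge_one_powr_ge_zero) auto
  ultimately have "0 \<le> (e1 / e2 * x * r powr e1 - y * r powr e2) * (1 - (t / r) powr e2)"
    by (intro mult_nonpos_nonpos) auto
  thus ?thesis using psi_tangent[of x r t y] assms by linarith
qed

text \<open>Quasi-concavity: at \<open>r\<close> the map is either still on its rising side,
  compared with \<open>t\<close>, or already on its falling side, compared with
  \<open>v\<close>.\<close>

lemma psi_between:
  assumes "0 \<le> x" "0 < t" "t \<le> r" "r \<le> v"
    "L \<le> x * t powr e1 - y * t powr e2" "L \<le> x * v powr e1 - y * v powr e2"
  shows "L \<le> x * r powr e1 - y * r powr e2"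
proof (cases "e2 * y * r powr e2 \<le> e1 * x * r powr e1")
  case True
  thus ?thesis using psi_up[of x t r y] assms by linarith
next
  case False
  thus ?thesis using psi_down[of x r v y] assms by linarith
qed

text \<open>The equation says that the bracket is maximal at scale 1, and the maximum is at least
  the value \<open>lam' * b u\<close> attained at the critical point for \<open>lam'\<close>. This
  is how the gap between \<open>lam\<close> and \<open>lam'\<close> is used.\<close>

lemma boundary_estimate:
  assumes u: "u \<in> P" and eq: "e1 * E u = e2 * c u"
  shows "lam' * b u \<le> E u - c u"
proof -
  obtain t where t: "0 < t" "E u * t powr e1 - c u * t powr e2 = lam' * b u"
    using Nehari_point[OF u] by blast
  have "e1 / e2 * E u - c u = 0" using eq e12 by (simp add: field_simps)
  thus ?thesis using psi_tangent[of "E u" 1 t "c u"] E_nonneg[of u] t by simp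
qed

text \<open>The functional along the ray through \<open>u\<close>, with energy \<open>x\<close> and
  power \<open>y\<close> decoupled from \<open>u\<close>. For a minimising sequence these are limits
  of energies and powers, which may exceed those of the limit function, while the singular term is
  taken at the limit.\<close>

definition Fi :: "('a \<Rightarrow> real) \<Rightarrow> real \<Rightarrow> real \<Rightarrow> real \<Rightarrow> real" where
  "Fi u x y r = x * r powr p / p - lam * Gam (\<lambda>z. r * u z) - y * r powr (\<alpha> + 1) / (\<alpha> + 1)"

lemma Fi_derivative:
  assumes u: "u \<in> P" and r: "0 < r"
  shows "(Fi u x y has_real_derivative r powr (- q) * (x * r powr e1 - y * r powr e2 - lam * b u)) (at r)"
proof -
  have "(Fi u x y has_real_derivative x * (p * r powr (p - 1)) / p - lam * (r powr (- q) * b u)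
      - y * ((\<alpha> + 1) * r powr (\<alpha> + 1 - 1)) / (\<alpha> + 1)) (at r)"
    unfolding Fi_def[abs_def] using r
    by (intro DERIV_diff DERIV_cdivide DERIV_cmult has_real_derivative_powr Gam_derivative u)
  moreover have "r powr (p - 1) = r powr (- q) * r powr e1" "r powr \<alpha> = r powr (- q) * r powr e2"
    by (simp_all add: e1_def e2_def flip: powr_add)
  moreover have "y * ((\<alpha> + 1) * r powr (\<alpha> + 1 - 1)) / (\<alpha> + 1) = y * r powr \<alpha>"
    "x * (p * r powr (p - 1)) / p = x * r powr (p - 1)" using p \<alpha>1 by simp_all
  ultimately show ?thesis by (simp add: algebra_simps)
qed

lemma Fi_I:
  assumes "u \<in> W" "0 < r" shows "I (\<lambda>x. r * u x) = Fi u (E u) (c u) r"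
  using assms by (simp add: I_def Fi_def W_cmult c_scale mult.commute)

lemma Fi_increasing:
  assumes u: "u \<in> P" and r: "0 < r" "r \<le> v"
    and le: "\<And>t. r \<le> t \<Longrightarrow> t \<le> v \<Longrightarrow> lam * b u \<le> x * t powr e1 - y * t powr e2"
  shows "Fi u x y r \<le> Fi u x y v"
proof (rule DERIV_nonneg_imp_nondecreasing[OF r(2)])
  fix t assume t: "r \<le> t" "t \<le> v"
  have "0 \<le> t powr (- q) * (x * t powr e1 - y * t powr e2 - lam * b u)"
    using le[OF t] by (intro mult_nonneg_nonneg) auto
  thus "\<exists>z. (Fi u x y has_real_derivative z) (at t) \<and> 0 \<le> z"
    using Fi_derivative[OF u, of t x y] t r by fastforce
qed

lemma Fi_decreasing:
  assumes u: "u \<in> P" and r: "0 < r" "r \<le> v"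
    and le: "\<And>t. r \<le> t \<Longrightarrow> t \<le> v \<Longrightarrow> x * t powr e1 - y * t powr e2 \<le> lam * b u"
  shows "Fi u x y v \<le> Fi u x y r"
proof (rule DERIV_nonpos_imp_nonincreasing[OF r(2)])
  fix t assume t: "r \<le> t" "t \<le> v"
  have "t powr (- q) * (x * t powr e1 - y * t powr e2 - lam * b u) \<le> 0"
    using le[OF t] by (intro mult_nonneg_nonpos) auto
  thus "\<exists>z. (Fi u x y has_real_derivative z) (at t) \<and> z \<le> 0"
    using Fi_derivative[OF u, of t x y] t r by fastforce
qed

text \<open>The scale at which \<open>x * r powr e1 - y * r powr e2\<close> is maximal, that is,
  where a ray crosses the boundary of \<open>D\<close>.\<close>

definition rmax :: "real \<Rightarrow> real \<Rightarrow> real" where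
  "rmax x y = (e1 * x / (e2 * y)) powr (1 / (\<alpha> + 1 - p))"

lemma rmax:
  assumes "0 < x" "0 < y"
  shows "0 < rmax x y" "e1 * x * rmax x y powr p = e2 * y * rmax x y powr (\<alpha> + 1)"
    "e1 * x \<le> e2 * y \<Longrightarrow> rmax x y \<le> 1"
proof -
  define z where "z = e1 * x / (e2 * y)"
  have z: "0 < z" using assms e12 by (simp add: z_def)
  thus r: "0 < rmax x y" unfolding rmax_def z_def[symmetric] by simp
  have "rmax x y powr (\<alpha> + 1) = rmax x y powr p * rmax x y powr (\<alpha> + 1 - p)" by (simp flip: powr_add)
  also have "rmax x y powr (\<alpha> + 1 - p) = z" using z \<alpha>1 by (simp add: rmax_def z_def[symmetric] powr_powr)
  finally show "e1 * x * rmax x y powr p = e2 * y * rmax x y powr (\<alpha> + 1)"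
    using assms e12 by (simp add: z_def)
  show "rmax x y \<le> 1" if "e1 * x \<le> e2 * y"
    using that z assms e12 \<alpha>1 unfolding rmax_def z_def[symmetric] by (intro powr_le1) (auto simp: z_def)
qed

lemma powr_p_e:
  assumes "0 < r" shows "r powr p = r powr (1 - q) * r powr e1" "r powr (\<alpha> + 1) = r powr (1 - q) * r powr e2"
  by (simp_all add: e1_def e2_def add.commute flip: powr_add)

subsection \<open>Minimisation inside the Nehari set\<close>

text \<open>The inequality says that scale 1 is not beyond the maximum of the bracket. No Nehari
  identity is imposed: it follows once the minimiser is known to satisfy the inequality strictly, by
  varying the scale freely.\<close>

definition D :: "('a \<Rightarrow> real) set" where "D = {u \<in> P. e2 * c u \<le> e1 * E u}"

lemma coercive_const:
  obtains \<kappa> where "0 < \<kappa>" "\<And>x y. 0 \<le> x \<Longrightarrow> e2 * y \<le> e1 * x \<Longrightarrow> \<kappa> * x \<le> x / p - y / (\<alpha> + 1)"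
proof -
  \<comment> \<open>What remains of the energy coefficient after inserting
    \<open>y \<le> e1 * x / e2\<close>; it is positive as \<open>e1 < e2\<close> and
    \<open>p < \<alpha> + 1\<close>.\<close>
  define \<kappa> where "\<kappa> = 1 / p - e1 / (e2 * (\<alpha> + 1))"
  have "e1 * p < e2 * (\<alpha> + 1)" using e12 \<alpha>1 p by (intro mult_strict_mono) auto
  moreover have Z: "0 < e2 * (\<alpha> + 1)" using e12 \<alpha>1 by simp
  ultimately have "e1 < 1 / p * (e2 * (\<alpha> + 1))" using p by (simp add: pos_less_divide_eq)
  hence "0 < \<kappa>" unfolding \<kappa>_def using pos_divide_less_eq[OF Z, of e1 "1 / p"] by simp
  moreover have "\<kappa> * x \<le> x / p - y / (\<alpha> + 1)" if "0 \<le> x" "e2 * y \<le> e1 * x" for x y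
  proof -
    have "y \<le> e1 * x / e2" using that e12 by (simp add: field_simps)
    hence "y / (\<alpha> + 1) \<le> (e1 * x / e2) / (\<alpha> + 1)" using \<alpha>1 by (intro divide_right_mono) auto
    thus ?thesis by (simp add: \<kappa>_def left_diff_distrib)
  qed
  ultimately show ?thesis using that by blast
qed

lemma D_coercive:
  obtains \<kappa> K where "0 < \<kappa>" "\<And>u. u \<in> D \<Longrightarrow> \<kappa> * E u \<le> I u + K"
proof -
  obtain \<kappa> where \<kappa>: "0 < \<kappa>" "\<And>x y. 0 \<le> x \<Longrightarrow> e2 * y \<le> e1 * x \<Longrightarrow> \<kappa> * x \<le> x / p - y / (\<alpha> + 1)"
    using coercive_const by blast
  obtain K where K: "0 \<le> K" "\<And>u. u \<in> P \<Longrightarrow> Gam u \<le> \<kappa> / (2 * lam) * E u + K"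
    using b_Gam_sublinear[of "\<kappa> / (2 * lam)"] \<kappa> lam by (metis divide_pos_pos mult_pos_pos zero_less_numeral)
  have "\<kappa> / 2 * E u \<le> I u + lam * K" if u: "u \<in> D" for u
  proof -
    have "lam * Gam u \<le> lam * (\<kappa> / (2 * lam) * E u + K)"
      using K(2)[of u] u lam by (intro mult_left_mono) (auto simp: D_def)
    also have "\<dots> = \<kappa> / 2 * E u + lam * K" using lam by (simp add: distrib_left)
    finally have "lam * Gam u \<le> \<kappa> / 2 * E u + lam * K" .
    moreover have "\<kappa> * E u \<le> E u / p - c u / (\<alpha> + 1)"
      using u by (intro \<kappa>(2) E_nonneg) (auto simp: D_def)
    ultimately show ?thesis unfolding I_def by linarith
  qed
  thus ?thesis using that[of "\<kappa> / 2" "lam * K"] \<kappa> by simp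
qed

lemma Brezis_Lieb_E:
  assumes u: "u \<in> W" and v: "\<And>k. v k \<in> W" "\<And>k. E (v k) \<le> K" and lim: "AE x in lborel. (\<lambda>k. v k x) \<longlonglongrightarrow> 0"
  shows "(\<lambda>k. E (\<lambda>x. u x + v k x) - E (v k)) \<longlonglongrightarrow> E u"
proof -
  have "(\<lambda>k. (\<integral>z. \<bar>dif u z + dif (v k) z\<bar> powr p \<partial>\<mu>) - (\<integral>z. \<bar>dif (v k) z\<bar> powr p \<partial>\<mu>)) \<longlonglongrightarrow> (\<integral>z. \<bar>dif u z\<bar> powr p \<partial>\<mu>)"
  proof (rule brezis_lieb)
    show "AE z in \<mu>. (\<lambda>k. dif (v k) z) \<longlonglongrightarrow> 0"
      using AE_\<mu>[OF lim] unfolding dif_def by eventually_elim (auto intro: tendsto_eq_intros)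
    show "(\<integral>z. \<bar>dif (v k) z\<bar> powr p \<partial>\<mu>) \<le> K" for k using v(2)[of k] by (simp add: E_def)
  qed (use p u v in \<open>auto intro!: dif_measurable_\<mu> W_measurable W_integrable\<close>)
  moreover have "dif u z + dif (v k) z = dif (\<lambda>x. u x + v k x) z" for k z by (simp add: dif_def)
  ultimately show ?thesis by (simp add: E_def)
qed

lemma Brezis_Lieb_c:
  assumes u: "u \<in> W" and v: "\<And>k. v k \<in> W" "\<And>k. c (v k) \<le> K" and lim: "AE x in lborel. (\<lambda>k. v k x) \<longlonglongrightarrow> 0"
  shows "(\<lambda>k. c (\<lambda>x. u x + v k x) - c (v k)) \<longlonglongrightarrow> c u"
  unfolding c_def using W_measurable u v \<alpha>1
  by (intro brezis_lieb[where K = K] lim c_integrable) (auto simp: c_def)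

text \<open>The strict inequality \<open>lam < lam'\<close> keeps the infimum over \<open>D\<close> away from the boundary of \<open>D\<close>, even
  in the limit along sequences for which compactness fails.\<close>

lemma D_boundary:
  assumes m: "\<And>w. w \<in> D \<Longrightarrow> m \<le> I w" and u: "u \<in> P" and w: "\<And>k. w k \<in> W" "\<And>k x. u x \<le> w k x"
    and x: "(\<lambda>k. E (w k)) \<longlonglongrightarrow> x" and y: "(\<lambda>k. c (w k)) \<longlonglongrightarrow> y" and eq: "e1 * x = e2 * y"
  shows "lam' * b u \<le> x - y" "m < Fi u x y 1"
proof -
  have wP: "w k \<in> P" for k using P_mono(1)[OF u w(1) w(2)] .
  have u0: "0 \<le> u z" for z using P_nonneg[OF u] .
  have w0: "0 \<le> w k z" for k z using P_nonneg[OF wP] .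
  have "c u \<le> c (w k)" for k using u0 w by (intro c_mono P_W[OF u]) (metis abs_of_nonneg order_trans)+
  hence "c u \<le> y" using y by (intro LIMSEQ_le_const) auto
  hence yp: "0 < y" using c_pos[OF u] by simp
  hence xp: "0 < x" using eq e12 by (metis mult_pos_pos zero_less_mult_pos)
  \<comment> \<open>Each \<open>w k\<close> is rescaled exactly onto the boundary of
    \<open>D\<close>, where \<open>boundary_estimate\<close> applies. The factors tend to 1 because
    the limit pair already satisfies the boundary equation.\<close>
  define r where "r k = rmax (E (w k)) (c (w k))" for k
  have r: "0 < r k" "e1 * E (w k) * r k powr p = e2 * c (w k) * r k powr (\<alpha> + 1)" for k
    unfolding r_def using rmax E_pos[OF wP] c_pos[OF wP] by auto
  have "(\<lambda>k. (e1 * E (w k) / (e2 * c (w k))) powr (1 / (\<alpha> + 1 - p))) \<longlonglongrightarrow> (e1 * x / (e2 * y)) powr (1 / (\<alpha> + 1 - p))"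
    using x y xp yp e12 by (intro tendsto_powr tendsto_divide tendsto_mult tendsto_const) auto
  moreover have "(e1 * x / (e2 * y)) powr (1 / (\<alpha> + 1 - p)) = 1" using eq yp e12 by simp
  ultimately have rl: "r \<longlonglongrightarrow> 1" unfolding r_def rmax_def by simp
  have "lam' * (r k powr (1 - q) * b u) \<le> r k powr p * E (w k) - r k powr (\<alpha> + 1) * c (w k)" for k
  proof -
    have E: "E (\<lambda>z. r k * w k z) = r k powr p * E (w k)" using W_cmult(2)[OF w(1)[of k]] r(1)[of k] by simp
    have c: "c (\<lambda>z. r k * w k z) = r k powr (\<alpha> + 1) * c (w k)" using c_scale[OF w(1)[of k]] r(1)[of k] by simp
    have "lam' * b (\<lambda>z. r k * w k z) \<le> E (\<lambda>z. r k * w k z) - c (\<lambda>z. r k * w k z)"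
      using r(2)[of k] by (intro boundary_estimate P_scale wP r) (simp add: E c mult_ac)
    hence "lam' * (r k powr (1 - q) * b (w k)) \<le> r k powr p * E (w k) - r k powr (\<alpha> + 1) * c (w k)"
      unfolding E c P_scale(2)[OF wP r(1)] .
    moreover have "lam' * (r k powr (1 - q) * b u) \<le> lam' * (r k powr (1 - q) * b (w k))"
      using lam P_mono(3)[OF u w(1) w(2)] by (intro mult_left_mono) auto
    ultimately show ?thesis by linarith
  qed
  moreover have "(\<lambda>k. lam' * (r k powr (1 - q) * b u)) \<longlonglongrightarrow> lam' * (1 powr (1 - q) * b u)"
    by (intro tendsto_intros rl) auto
  moreover have "(\<lambda>k. r k powr p * E (w k) - r k powr (\<alpha> + 1) * c (w k)) \<longlonglongrightarrow> 1 powr p * x - 1 powr (\<alpha> + 1) * y"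
    by (intro tendsto_intros rl x y) auto
  ultimately show est: "lam' * b u \<le> x - y" using LIMSEQ_le by fastforce
  \<comment> \<open>Shrinking by \<open>t < 1\<close> moves the limit pair strictly inside
    \<open>D\<close>, hence also \<open>t * w k\<close> for large \<open>k\<close>; the bound by
    \<open>m\<close> then passes to the limit, with \<open>u \<le> w k\<close> controlling the
    singular term.\<close>
  have m_le: "m \<le> Fi u x y t" if t: "0 < t" "t < 1" for t
  proof -
    have "t powr (\<alpha> + 1) < t powr p" using t \<alpha>1 by (simp add: powr_less_mono')
    hence "e2 * (t powr (\<alpha> + 1) * y) < e1 * (t powr p * x)"
      using eq yp xp e12 by (simp add: mult.left_commute[of e2] mult.left_commute[of e1] flip: eq)
    moreover have "(\<lambda>k. e2 * (t powr (\<alpha> + 1) * c (w k))) \<longlonglongrightarrow> e2 * (t powr (\<alpha> + 1) * y)"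
      "(\<lambda>k. e1 * (t powr p * E (w k))) \<longlonglongrightarrow> e1 * (t powr p * x)"
      by (intro tendsto_intros x y)+
    ultimately have ev: "eventually (\<lambda>k. e2 * (t powr (\<alpha> + 1) * c (w k)) < e1 * (t powr p * E (w k))) sequentially"
      by (rule_tac eventually_less_lim)
    have "eventually (\<lambda>k. m \<le> E (w k) * t powr p / p - lam * Gam (\<lambda>z. t * u z) - c (w k) * t powr (\<alpha> + 1) / (\<alpha> + 1)) sequentially"
      using ev
    proof eventually_elim
      case (elim k)
      have "(\<lambda>z. t * w k z) \<in> D"
        using elim t P_scale(1)[OF wP t(1)] by (simp add: D_def W_cmult(2)[OF w(1)] c_scale[OF w(1)])
      hence "m \<le> I (\<lambda>z. t * w k z)" by (rule m)
      also have "\<dots> = Fi (w k) (E (w k)) (c (w k)) t" by (rule Fi_I[OF w(1) t(1)])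
      also have "\<dots> \<le> E (w k) * t powr p / p - lam * Gam (\<lambda>z. t * u z) - c (w k) * t powr (\<alpha> + 1) / (\<alpha> + 1)"
      proof -
        have "Gam (\<lambda>z. t * u z) \<le> Gam (\<lambda>z. t * w k z)"
          using w t by (intro P_mono(2)[OF P_scale(1)[OF u t(1)]] W_cmult(1)) auto
        thus ?thesis unfolding Fi_def using lam by (simp add: mult_left_mono)
      qed
      finally show ?case .
    qed
    moreover have "(\<lambda>k. E (w k) * t powr p / p - lam * Gam (\<lambda>z. t * u z) - c (w k) * t powr (\<alpha> + 1) / (\<alpha> + 1)) \<longlonglongrightarrow> Fi u x y t"
      unfolding Fi_def using p \<alpha>1 by (intro tendsto_intros x y) auto
    ultimately show ?thesis by (intro tendsto_lowerbound[OF _ _ trivial_limit_sequentially])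
  qed
  \<comment> \<open>The derivative at 1 is at least \<open>(lam' - lam) * b u > 0\<close>, so the
    value at 1 strictly exceeds a value slightly to the left, which is at least
    \<open>m\<close>.\<close>
  have "(Fi u x y has_real_derivative x - y - lam * b u) (at 1)"
    using Fi_derivative[OF u, of 1 x y] by simp
  moreover have "0 < x - y - lam * b u"
  proof -
    have "lam * b u < lam' * b u" using lam b_pos[OF u] by (intro mult_strict_right_mono) auto
    thus ?thesis using est by linarith
  qed
  ultimately obtain d where d: "0 < d" "\<And>h. 0 < h \<Longrightarrow> h < d \<Longrightarrow> Fi u x y (1 - h) < Fi u x y 1"
    using DERIV_pos_inc_left by blast
  define h where "h = min d 1 / 2"
  have h: "0 < h" "h < d" "h < 1" using d(1) by (auto simp: h_def)
  show "m < Fi u x y 1" using d(2)[OF h(1,2)] m_le[of "1 - h"] h by simp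
qed

lemma bounded_extraction:
  fixes u :: "nat \<Rightarrow> 'a \<Rightarrow> real"
  assumes u: "\<And>k. u k \<in> P" and E: "\<And>k. E (u k) \<le> K" and c: "\<And>k. c (u k) \<le> K" and G: "\<And>k. \<bar>Gam (u k)\<bar> \<le> K"
  obtains r w x y L where "strict_mono r" "w \<in> W" "\<And>z. 0 \<le> w z" "AE z in lborel. (\<lambda>k. u (r k) z) \<longlonglongrightarrow> w z"
    "(\<lambda>k. E (u (r k))) \<longlonglongrightarrow> x" "(\<lambda>k. c (u (r k))) \<longlonglongrightarrow> y" "(\<lambda>k. Gam (u (r k))) \<longlonglongrightarrow> L"
proof -
  obtain r1 w where r1: "strict_mono r1" "w \<in> W" "AE z in lborel. (\<lambda>k. u (r1 k) z) \<longlonglongrightarrow> w z"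
    using W_compact[of u K] P_W[OF u] E by blast
  \<comment> \<open>The three numerical sequences are packed into one family, so that a single
    diagonal extraction serves all of them.\<close>
  define f where "f i k = (if i = 0 then E (u (r1 k)) else if i = 1 then c (u (r1 k)) else Gam (u (r1 k)))" for i :: nat and k
  have "\<bar>f i k\<bar> \<le> K" for i k
    using E[of "r1 k"] c[of "r1 k"] G[of "r1 k"] E_nonneg[of "u (r1 k)"] c_nonneg[of "u (r1 k)"] by (simp add: f_def)
  then obtain r2 where r2: "strict_mono r2" "\<And>i. i \<in> UNIV \<Longrightarrow> convergent (\<lambda>k. f i (r2 k))"
    using countable_bounded_subsequence[of UNIV f "\<lambda>_. K"] by auto
  obtain x y L where "(\<lambda>k. f 0 (r2 k)) \<longlonglongrightarrow> x" "(\<lambda>k. f 1 (r2 k)) \<longlonglongrightarrow> y" "(\<lambda>k. f 2 (r2 k)) \<longlonglongrightarrow> L"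
    using r2(2)[of 0] r2(2)[of 1] r2(2)[of 2] by (auto simp: convergent_def)
  hence l: "(\<lambda>k. E (u (r1 (r2 k)))) \<longlonglongrightarrow> x" "(\<lambda>k. c (u (r1 (r2 k)))) \<longlonglongrightarrow> y" "(\<lambda>k. Gam (u (r1 (r2 k)))) \<longlonglongrightarrow> L"
    by (simp_all add: f_def)
  have lim: "AE z in lborel. (\<lambda>k. u (r1 (r2 k)) z) \<longlonglongrightarrow> max 0 (w z)"
    using r1(3)
  proof eventually_elim
    case (elim z)
    hence lz: "(\<lambda>k. u (r1 (r2 k)) z) \<longlonglongrightarrow> w z" using LIMSEQ_subseq_LIMSEQ[OF _ r2(1)] by (auto simp: o_def)
    moreover have "0 \<le> w z" using lz P_nonneg[OF u] by (intro LIMSEQ_le_const) auto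
    ultimately show ?case by (simp add: max_def)
  qed
  show ?thesis
  proof (rule that[of "r1 \<circ> r2" "\<lambda>z. max 0 (w z)" x y L])
    show "strict_mono (r1 \<circ> r2)" using r1(1) r2(1) by (rule strict_mono_o)
  qed (use W_pos_part[OF r1(2)] lim l in \<open>auto simp: o_def\<close>)
qed

text \<open>Small multiples of \<open>bdist\<close> qualify. For \<open>q < 1\<close> the singular
  term of order \<open>t powr (1 - q)\<close> beats the energy as \<open>t\<close> tends to 0; the
  resulting negative infimum later rules out a vanishing minimising sequence.\<close>

lemma D_nonempty:
  obtains w where "w \<in> D" "q < 1 \<Longrightarrow> I w < 0"
proof -
  define x where "x = E bdist"
  define y where "y = c bdist"
  have xy: "0 < x" "0 < y" using E_pos[OF bdist_P] c_pos[OF bdist_P] by (auto simp: x_def y_def)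
  define \<rho> where "\<rho> = rmax x y"
  have \<rho>: "0 < \<rho>" "e1 * x * \<rho> powr p = e2 * y * \<rho> powr (\<alpha> + 1)" using rmax[OF xy] by (auto simp: \<rho>_def)
  have inD: "(\<lambda>z. t * bdist z) \<in> D" if t: "0 < t" "t \<le> \<rho>" for t
  proof -
    have "t powr (\<alpha> + 1) = t powr p * t powr (\<alpha> + 1 - p)" by (simp flip: powr_add)
    also have "\<dots> \<le> t powr p * \<rho> powr (\<alpha> + 1 - p)" using t \<alpha>1 by (intro mult_left_mono powr_mono2) auto
    finally have "e2 * y * t powr (\<alpha> + 1) \<le> e2 * y * (t powr p * \<rho> powr (\<alpha> + 1 - p))"
      using xy e12 by (intro mult_left_mono) auto
    also have "\<dots> = e1 * x * t powr p"
    proof -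
      have "\<rho> powr (\<alpha> + 1) = \<rho> powr (\<alpha> + 1 - p) * \<rho> powr p" by (simp flip: powr_add)
      hence "(e2 * y * \<rho> powr (\<alpha> + 1 - p)) * \<rho> powr p = (e1 * x) * \<rho> powr p" using \<rho>(2) by (metis mult.assoc)
      hence "e2 * y * \<rho> powr (\<alpha> + 1 - p) = e1 * x" using \<rho>(1) by simp
      thus ?thesis by (metis mult.assoc mult.commute)
    qed
    finally show ?thesis
      using P_scale(1)[OF bdist_P t(1)] t by (simp add: D_def W_cmult(2)[OF bdist_W] c_scale[OF bdist_W] x_def y_def mult_ac)
  qed
  show ?thesis
  proof (cases "q < 1")
    case False
    thus ?thesis using that[OF inD[of \<rho>]] \<rho> by simp
  next
    case True
    define G where "G = Gam bdist"
    have G: "0 < G" using b_pos[OF bdist_P] True by (simp add: G_def Gam_eq)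
    \<comment> \<open>Chosen so that the energy part \<open>x * t powr e1 / p\<close> does not
      exceed \<open>lam * G\<close>; the power term then makes the value strictly negative.\<close>
    define t where "t = min \<rho> ((p * lam * G / x) powr (1 / e1))"
    have t: "0 < t" "t \<le> \<rho>" using \<rho> p lam G xy by (auto simp: t_def)
    have "t powr e1 \<le> ((p * lam * G / x) powr (1 / e1)) powr e1" using t e12 by (intro powr_mono2) (auto simp: t_def)
    also have "\<dots> = p * lam * G / x" using e12 p lam G xy by (simp add: powr_powr)
    finally have "x * t powr e1 / p \<le> lam * G" using xy p by (simp add: field_simps)
    hence "t powr (1 - q) * (x * t powr e1 / p) \<le> t powr (1 - q) * (lam * G)" by (intro mult_left_mono) auto
    hence le: "x * t powr p / p \<le> lam * (t powr (1 - q) * G)"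
      using powr_p_e(1)[OF t(1)] by (simp add: mult_ac)
    have "I (\<lambda>z. t * bdist z) = x * t powr p / p - lam * (t powr (1 - q) * G) - y * t powr (\<alpha> + 1) / (\<alpha> + 1)"
      using P_scale(3)[OF bdist_P t(1)] True t by (simp add: Fi_I[OF bdist_W t(1)] Fi_def x_def y_def G_def)
    also have "\<dots> < 0"
    proof -
      have "0 < y * t powr (\<alpha> + 1) / (\<alpha> + 1)" using xy t \<alpha>1 by simp
      thus ?thesis using le by linarith
    qed
    finally show ?thesis using that[OF inD[OF t]] by blast
  qed
qed

end

context problem
begin

text \<open>The negative part of \<open>u k - w\<close> is dominated by \<open>w\<close>, so its
  power integral vanishes in the limit: lost mass sits entirely in the positive part, which may be
  added to \<open>w\<close> without leaving the cone.\<close>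

lemma c_pos_part_tendsto:
  assumes u: "\<And>k. u k \<in> W" "\<And>k x. 0 \<le> u k x" and w: "w \<in> W" "\<And>x. 0 \<le> w x"
    and lim: "AE x in lborel. (\<lambda>k. u k x) \<longlonglongrightarrow> w x"
    and C: "(\<lambda>k. c (\<lambda>x. u k x - w x)) \<longlonglongrightarrow> C"
  shows "(\<lambda>k. c (\<lambda>x. max 0 (u k x - w x))) \<longlonglongrightarrow> C"
proof -
  have v: "(\<lambda>x. u k x - w x) \<in> W" for k by (intro W_diff u w)
  have vp: "(\<lambda>x. max 0 (u k x - w x)) \<in> W" for k by (rule W_pos_part[OF v])
  have vm: "(\<lambda>x. max 0 (w x - u k x)) \<in> W" for k by (rule W_pos_part[OF W_diff[OF w(1) u(1)]])
  have split: "\<bar>u k x - w x\<bar> powr (\<alpha> + 1) = \<bar>max 0 (u k x - w x)\<bar> powr (\<alpha> + 1) + \<bar>max 0 (w x - u k x)\<bar> powr (\<alpha> + 1)" for k x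
    by (auto simp: max_def)
  have eq: "c (\<lambda>x. u k x - w x) - c (\<lambda>x. max 0 (w x - u k x)) = c (\<lambda>x. max 0 (u k x - w x))" for k
    unfolding c_def split using c_integrable[OF vp] c_integrable[OF vm] by simp
  have "(\<lambda>k. c (\<lambda>x. max 0 (w x - u k x))) \<longlonglongrightarrow> integral\<^sup>L lborel (\<lambda>x::'a. 0)"
    unfolding c_def
  proof (rule integral_dominated_convergence[where w = "\<lambda>x. \<bar>w x\<bar> powr (\<alpha> + 1)"])
    show "integrable lborel (\<lambda>x. \<bar>w x\<bar> powr (\<alpha> + 1))" by (rule c_integrable[OF w(1)])
    show "AE x in lborel. (\<lambda>k. \<bar>max 0 (w x - u k x)\<bar> powr (\<alpha> + 1)) \<longlonglongrightarrow> 0"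
      using lim
    proof eventually_elim
      case (elim x)
      have "(\<lambda>k. \<bar>max 0 (w x - u k x)\<bar> powr (\<alpha> + 1)) \<longlonglongrightarrow> \<bar>max 0 (w x - w x)\<bar> powr (\<alpha> + 1)"
        using elim \<alpha>1 by (intro tendsto_abs_powr tendsto_max tendsto_const tendsto_diff) auto
      thus ?case by simp
    qed
    show "AE x in lborel. norm (\<bar>max 0 (w x - u k x)\<bar> powr (\<alpha> + 1)) \<le> \<bar>w x\<bar> powr (\<alpha> + 1)" for k
      using u(2) w(2) \<alpha>1 by (intro AE_I2) (auto intro!: powr_mono2)
  qed (use W_measurable[OF vm] in measurable)
  hence "(\<lambda>k. c (\<lambda>x. u k x - w x) - c (\<lambda>x. max 0 (w x - u k x))) \<longlonglongrightarrow> C - 0"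
    using C by (intro tendsto_diff) auto
  thus ?thesis unfolding eq by simp
qed

text \<open>If the limiting pair \<open>(x', y')\<close> left \<open>D\<close>, the fibre map would increase from the boundary of \<open>D\<close> up to
  the value \<open>Fi u x y 1 \<le> m\<close>, against the previous lemma.\<close>

lemma limit_in_D:
  assumes m: "\<And>w. w \<in> D \<Longrightarrow> m \<le> I w" and u: "u \<in> P" and w: "\<And>k. w k \<in> W" "\<And>k z. u z \<le> w k z"
    and x': "(\<lambda>k. E (w k)) \<longlonglongrightarrow> x'" and y': "(\<lambda>k. c (w k)) \<longlonglongrightarrow> y'"
    and xy: "e2 * y \<le> e1 * x" "0 \<le> y - y'" "y - y' \<le> x - x'" and le: "Fi u x y 1 \<le> m"
  shows "e2 * y' \<le> e1 * x'"
proof (rule ccontr)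
  assume nle: "\<not> e2 * y' \<le> e1 * x'"
  have u0: "0 \<le> u z" for z using P_nonneg[OF u] .
  have wP: "w k \<in> P" for k using P_mono(1)[OF u w(1) w(2)] .
  have "0 \<le> x'" using x' E_nonneg by (intro LIMSEQ_le_const) auto
  have "0 \<le> e1 * x'" using \<open>0 \<le> x'\<close> e12 by simp
  hence "0 < e2 * y'" using nle by linarith
  hence y'p: "0 < y'" using e12(3) by (simp add: zero_less_mult_iff)
  \<comment> \<open>Keeps the limit energy \<open>x'\<close> away from 0, so that
    \<open>rmax x' y'\<close> is meaningful. If the critical scale \<open>t\<close> of
    \<open>w k\<close> is at most 1, the energy exceeds \<open>lam' * b u\<close>; otherwise it
    exceeds \<open>c u\<close>.\<close>
  have lower: "min (lam' * b u) (c u) \<le> E (w k)" for k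
  proof -
    obtain t where t: "0 < t" "E (w k) * t powr e1 - c (w k) * t powr e2 = lam' * b (w k)"
      using Nehari_point[OF wP] by blast
    have bw: "lam' * b u \<le> lam' * b (w k)" using lam P_mono(3)[OF u w(1) w(2)] by (intro mult_left_mono) auto
    have "0 \<le> w k z" for z using P_nonneg[OF wP] .
    hence cw: "c u \<le> c (w k)" using u0 w by (intro c_mono P_W[OF u]) simp_all
    show ?thesis
    proof (cases "t \<le> 1")
      case True
      have "lam' * b u \<le> E (w k) * t powr e1"
        using bw t c_nonneg[of "w k"] by (smt (verit) mult_nonneg_nonneg powr_ge_zero)
      also have "\<dots> \<le> E (w k) * 1" using True t e12 E_nonneg by (intro mult_left_mono powr_le1) auto
      finally show ?thesis by simp
    next
      case False
      have "0 < lam' * b (w k)" using lam b_pos[OF wP] by simp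
      hence "c (w k) * t powr e2 \<le> E (w k) * t powr e1" using t by linarith
      moreover have "c (w k) * t powr e1 \<le> c (w k) * t powr e2"
        using False e12 c_nonneg by (intro mult_left_mono powr_mono) auto
      ultimately have "c (w k) * t powr e1 \<le> E (w k) * t powr e1" by linarith
      hence "c (w k) \<le> E (w k)" using t by simp
      thus ?thesis using cw by simp
    qed
  qed
  have "min (lam' * b u) (c u) \<le> x'" using x' lower by (intro LIMSEQ_le_const) auto
  moreover have "0 < min (lam' * b u) (c u)" using lam b_pos[OF u] c_pos[OF u] by simp
  ultimately have x'p: "0 < x'" by linarith
  \<comment> \<open>Scaling by \<rho> brings the pair back to the boundary of \<open>D\<close>. The
    contradiction is the chain \<open>m < Fi u x' y' \<rho> \<le> Fi u x y \<rho> \<le> Fi u x y 1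
    \<le> m\<close>.\<close>
  define \<rho> where "\<rho> = rmax x' y'"
  have \<rho>: "0 < \<rho>" "e1 * x' * \<rho> powr p = e2 * y' * \<rho> powr (\<alpha> + 1)" "\<rho> \<le> 1"
    using rmax[OF x'p y'p] nle by (auto simp: \<rho>_def)
  have Eq: "(\<lambda>k. E (\<lambda>z. \<rho> * w k z)) \<longlonglongrightarrow> \<rho> powr p * x'"
    using tendsto_mult[OF tendsto_const x', of "\<rho> powr p"] \<rho>(1) by (simp add: W_cmult(2)[OF w(1)])
  have cq: "(\<lambda>k. c (\<lambda>z. \<rho> * w k z)) \<longlonglongrightarrow> \<rho> powr (\<alpha> + 1) * y'"
    using tendsto_mult[OF tendsto_const y', of "\<rho> powr (\<alpha> + 1)"] \<rho>(1) by (simp add: c_scale[OF w(1)])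
  have eqb: "e1 * (\<rho> powr p * x') = e2 * (\<rho> powr (\<alpha> + 1) * y')" using \<rho>(2) by (simp add: mult_ac)
  note L = D_boundary[OF m P_scale(1)[OF u \<rho>(1)] W_cmult(1)[OF w(1)] _ Eq cq eqb]
  have L1: "lam' * b (\<lambda>z. \<rho> * u z) \<le> \<rho> powr p * x' - \<rho> powr (\<alpha> + 1) * y'"
    and L2: "m < Fi (\<lambda>z. \<rho> * u z) (\<rho> powr p * x') (\<rho> powr (\<alpha> + 1) * y') 1"
    using L w(2) \<rho>(1) by (auto intro: mult_left_mono)
  have x0: "0 \<le> x" using xy x'p by linarith
  have "lam' * (\<rho> powr (1 - q) * b u) \<le> \<rho> powr (1 - q) * (x' * \<rho> powr e1 - y' * \<rho> powr e2)"
    using L1 unfolding P_scale(2)[OF u \<rho>(1)] powr_p_e[OF \<rho>(1)] by (simp add: algebra_simps)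
  hence "\<rho> powr (1 - q) * (lam' * b u) \<le> \<rho> powr (1 - q) * (x' * \<rho> powr e1 - y' * \<rho> powr e2)"
    by (simp add: mult_ac)
  hence 1: "lam' * b u \<le> x' * \<rho> powr e1 - y' * \<rho> powr e2" using \<rho>(1) by simp
  have 2: "lam * b u \<le> lam' * b u" using lam b_pos[OF u] by (intro mult_right_mono) auto
  \<comment> \<open>Passing from the primed pair to \<open>(x, y)\<close> adds at least as much
    energy as power, and \<open>\<rho> \<le> 1\<close> makes the larger exponent \<open>e2\<close>
    weigh less.\<close>
  have 3: "x' * \<rho> powr e1 - y' * \<rho> powr e2 \<le> x * \<rho> powr e1 - y * \<rho> powr e2"
  proof -
    have "(y - y') * \<rho> powr e2 \<le> (x - x') * \<rho> powr e1"
      using xy \<rho> e12 by (intro mult_mono powr_mono') auto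
    thus ?thesis by (simp add: algebra_simps)
  qed
  have "Fi u x y \<rho> \<le> Fi u x y 1"
  proof (rule Fi_increasing[OF u \<rho>(1,3)])
    fix t assume t: "\<rho> \<le> t" "t \<le> 1"
    have "e2 * y * t powr e2 \<le> e1 * x * t powr e1"
    proof (cases "0 \<le> y")
      case True
      have "t powr e2 \<le> t powr e1" using t \<rho>(1) e12 by (intro powr_mono') auto
      hence "e2 * y * t powr e2 \<le> e2 * y * t powr e1" using True e12 by (intro mult_left_mono) auto
      also have "\<dots> \<le> e1 * x * t powr e1" using xy by (intro mult_right_mono) auto
      finally show ?thesis .
    next
      case False
      thus ?thesis using xy y'p by linarith
    qed
    hence "x * \<rho> powr e1 - y * \<rho> powr e2 \<le> x * t powr e1 - y * t powr e2"
      by (intro psi_up x0 \<rho>(1) t(1))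
    thus "lam * b u \<le> x * t powr e1 - y * t powr e2" using 1 2 3 by linarith
  qed
  moreover have "Fi (\<lambda>z. \<rho> * u z) (\<rho> powr p * x') (\<rho> powr (\<alpha> + 1) * y') 1 = Fi u x' y' \<rho>"
    by (simp add: Fi_def mult.commute)
  moreover have "Fi u x' y' \<rho> \<le> Fi u x y \<rho>"
  proof -
    have "(y - y') * (\<rho> powr (\<alpha> + 1) / (\<alpha> + 1)) \<le> (x - x') * (\<rho> powr p / p)"
      using xy \<rho> \<alpha>1 p by (intro mult_mono frac_le powr_mono') auto
    thus ?thesis by (simp add: Fi_def algebra_simps diff_divide_distrib)
  qed
  ultimately show False using L2 le by linarith
qed

text \<open>The weak limit \<open>u\<close> may miss energy \<open>A\<close> and power
  \<open>C\<close> of the sequence, and its value is at most the infimum as soon as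
  \<open>C / (\<alpha> + 1) \<le> A / p\<close>. The opposite inequality is refuted by adding an
  amplified remainder to \<open>u\<close> until the boundary of \<open>D\<close> is met.\<close>

lemma first_minimizer:
  obtains u where "u \<in> D" "\<And>w. w \<in> D \<Longrightarrow> I u \<le> I w"
proof -
  obtain \<kappa> K where \<kappa>: "0 < \<kappa>" "\<And>u. u \<in> D \<Longrightarrow> \<kappa> * E u \<le> I u + K" using D_coercive by blast
  obtain w0 where w0: "w0 \<in> D" "q < 1 \<Longrightarrow> I w0 < 0" using D_nonempty by blast
  have bdd: "bdd_below (I ` D)"
  proof (rule bdd_belowI2)
    fix u assume "u \<in> D"
    thus "- K \<le> I u" using \<kappa>(2)[of u] \<kappa>(1) E_nonneg[of u] by (smt (verit) mult_nonneg_nonneg)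
  qed
  define m where "m = Inf (I ` D)"
  have m: "m \<le> I w" if "w \<in> D" for w unfolding m_def using bdd that by (intro cInf_lower) auto
  have m0: "m < 0" if "q < 1" using m[OF w0(1)] w0(2)[OF that] by linarith
  have "\<exists>v. v \<in> D \<and> I v < m + 1 / (real k + 1)" for k :: nat
  proof -
    have "Inf (I ` D) < m + 1 / (real k + 1)" unfolding m_def by simp
    thus ?thesis using w0(1) bdd by (subst (asm) cInf_less_iff) auto
  qed
  then obtain v where v: "\<And>k::nat. v k \<in> D" "\<And>k::nat. I (v k) < m + 1 / (real k + 1)" by metis
  have vP: "v k \<in> P" for k using v(1)[of k] by (simp add: D_def)
  have Iv: "I (v k) \<le> m + 1" for k
  proof -
    have "1 / (real k + 1) \<le> 1" by simp
    thus ?thesis using v(2)[of k] by linarith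
  qed
  define K1 where "K1 = (m + 1 + K) / \<kappa>"
  have E1: "E (v k) \<le> K1" for k
    using \<kappa>(2)[OF v(1)[of k]] Iv[of k] \<kappa>(1) by (simp add: K1_def pos_le_divide_eq mult.commute)
  have c1: "c (v k) \<le> K1" for k
  proof -
    have "e2 * c (v k) \<le> e1 * E (v k)" using v(1)[of k] by (simp add: D_def)
    also have "\<dots> \<le> e2 * E (v k)" using e12 E_nonneg by (intro mult_right_mono) auto
    finally show ?thesis using e12 E1[of k] by simp
  qed
  obtain K2 where K2: "0 \<le> K2" "\<And>u. u \<in> P \<Longrightarrow> Gam u \<le> 1 * E u + K2" using b_Gam_sublinear[of 1] by (metis zero_less_one)
  have GL: "- ((m + 1 + K1 / (\<alpha> + 1)) / lam) \<le> Gam (v k)" for k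
  proof -
    have "0 \<le> E (v k) / p" using E_nonneg p by simp
    moreover have "c (v k) / (\<alpha> + 1) \<le> K1 / (\<alpha> + 1)" using c1 \<alpha>1 by (intro divide_right_mono) auto
    ultimately have "- (m + 1 + K1 / (\<alpha> + 1)) \<le> lam * Gam (v k)" using Iv[of k] unfolding I_def by linarith
    hence "(- (m + 1 + K1 / (\<alpha> + 1))) / lam \<le> Gam (v k)"
      by (subst pos_divide_le_eq[OF lam(1)]) (simp only: mult.commute)
    thus ?thesis by (simp only: minus_divide_left)
  qed
  define K3 where "K3 = max (max K1 (K1 + K2)) ((m + 1 + K1 / (\<alpha> + 1)) / lam)"
  have G3: "\<bar>Gam (v k)\<bar> \<le> K3" for k
    using GL[of k] K2(2)[OF vP[of k]] E1[of k] by (auto simp: K3_def abs_le_iff)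
  have E3: "E (v k) \<le> K3" and c3: "c (v k) \<le> K3" for k using E1[of k] c1[of k] by (auto simp: K3_def)
  from bounded_extraction[of v K3, OF vP E3 c3 G3] obtain r u x y L where r: "strict_mono r" and u: "u \<in> W" "\<And>z. 0 \<le> u z"
    and lim: "AE z in lborel. (\<lambda>k. v (r k) z) \<longlonglongrightarrow> u z"
    and x: "(\<lambda>k. E (v (r k))) \<longlonglongrightarrow> x" and y: "(\<lambda>k. c (v (r k))) \<longlonglongrightarrow> y" and L: "(\<lambda>k. Gam (v (r k))) \<longlonglongrightarrow> L"
    by blast
  have Il: "(\<lambda>k. I (v (r k))) \<longlonglongrightarrow> x / p - lam * L - y / (\<alpha> + 1)"
    unfolding I_def using p \<alpha>1 by (intro tendsto_intros x y L) auto
  have Iu: "I (v (r k)) \<le> m + 1 / (real k + 1)" for k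
  proof -
    have "1 / (real (r k) + 1) \<le> 1 / (real k + 1)" using seq_suble[OF r, of k] by (intro divide_left_mono) auto
    thus ?thesis using v(2)[of "r k"] by linarith
  qed
  have ml: "(\<lambda>k. m + 1 / (real k + 1)) \<longlonglongrightarrow> m + 0"
    by (intro tendsto_add tendsto_const) (use LIMSEQ_inverse_real_of_nat in \<open>simp add: inverse_eq_divide add.commute\<close>)
  have Ilim: "x / p - lam * L - y / (\<alpha> + 1) \<le> m" using LIMSEQ_le[OF Il ml] Iu by simp
  have xy: "e2 * y \<le> e1 * x"
  proof (rule LIMSEQ_le)
    show "(\<lambda>k. e2 * c (v (r k))) \<longlonglongrightarrow> e2 * y" "(\<lambda>k. e1 * E (v (r k))) \<longlonglongrightarrow> e1 * x"
      by (intro tendsto_intros x y)+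
    show "\<exists>N. \<forall>n\<ge>N. e2 * c (v (r n)) \<le> e1 * E (v (r n))" using v(1) by (auto simp: D_def)
  qed
  have x0: "0 \<le> x" using x E_nonneg by (intro LIMSEQ_le_const) auto
  \<comment> \<open>A vanishing limit would kill the singular term, and coercivity on
    \<open>D\<close> would make the infimum nonnegative, against \<open>m0\<close>.\<close>
  have nt: "\<not> (AE z in lborel. u z = 0)" if q1: "q < 1"
  proof
    assume ae: "AE z in lborel. u z = 0"
    have "(\<lambda>k. b (v (r k))) \<longlonglongrightarrow> b u"
      using P_W[OF vP] P_nonneg[OF vP] E1 u lim q1 by (intro b_tendsto[where K = K1]) auto
    moreover have "b u = 0"
    proof -
      have "AE z in lborel. u z powr (1 - q) = 0" using ae by eventually_elim simp
      thus ?thesis unfolding b_def by (rule integral_eq_zero_AE)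
    qed
    ultimately have "(\<lambda>k. b (v (r k)) / (1 - q)) \<longlonglongrightarrow> 0 / (1 - q)" using q1 by (intro tendsto_divide tendsto_const) auto
    hence "(\<lambda>k. Gam (v (r k))) \<longlonglongrightarrow> 0" using q1 by (simp add: Gam_eq)
    hence "L = 0" using L LIMSEQ_unique by blast
    moreover obtain \<kappa>' where \<kappa>': "0 < \<kappa>'" "\<And>x y. 0 \<le> x \<Longrightarrow> e2 * y \<le> e1 * x \<Longrightarrow> \<kappa>' * x \<le> x / p - y / (\<alpha> + 1)"
      using coercive_const by blast
    ultimately have "\<kappa>' * x \<le> m" using \<kappa>'(2)[OF x0 xy] Ilim by simp
    moreover have "0 \<le> \<kappa>' * x" using \<kappa>'(1) x0 by simp
    ultimately show False using m0[OF q1] by linarith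
  qed
  have uP: "u \<in> P" and LG: "L \<le> Gam u"
    using P_limit[of "\<lambda>k. v (r k)" K1 u L] vP E1 u lim L nt by auto
  have FI: "Fi u x y 1 \<le> m"
  proof -
    have "lam * L \<le> lam * Gam u" using LG lam by (intro mult_left_mono) auto
    thus ?thesis using Ilim by (simp add: Fi_def)
  qed
  define d where "d k z = v (r k) z - u z" for k z
  have dW: "d k \<in> W" for k unfolding d_def by (intro W_diff P_W vP u)
  have vd: "(\<lambda>z. u z + d k z) = v (r k)" for k by (simp add: d_def)
  have dlim: "AE z in lborel. (\<lambda>k. d k z) \<longlonglongrightarrow> 0"
    using lim by eventually_elim (auto simp: d_def intro: tendsto_eq_intros)
  define K4 where "K4 = 2 powr p * (K1 + E u)"
  have dE: "E (d k) \<le> K4" for k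
  proof -
    have "E (d k) \<le> 2 powr p * (E (v (r k)) + E u)" unfolding d_def by (intro E_diff_le P_W vP u)
    also have "\<dots> \<le> K4" unfolding K4_def using E1 by (intro mult_left_mono add_right_mono) auto
    finally show ?thesis .
  qed
  define K5 where "K5 = 2 powr (\<alpha> + 1) * (K1 + c u)"
  have dc: "c (d k) \<le> K5" for k
  proof -
    have "c (d k) \<le> (\<integral>z. 2 powr (\<alpha> + 1) * (\<bar>v (r k) z\<bar> powr (\<alpha> + 1) + \<bar>u z\<bar> powr (\<alpha> + 1)) \<partial>lborel)"
      unfolding c_def
    proof (rule integral_mono)
      show "integrable lborel (\<lambda>z. \<bar>d k z\<bar> powr (\<alpha> + 1))" by (intro c_integrable dW)
      show "integrable lborel (\<lambda>z. 2 powr (\<alpha> + 1) * (\<bar>v (r k) z\<bar> powr (\<alpha> + 1) + \<bar>u z\<bar> powr (\<alpha> + 1)))"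
        using c_integrable[OF P_W[OF vP]] c_integrable[OF u(1)] by auto
      show "\<bar>d k z\<bar> powr (\<alpha> + 1) \<le> 2 powr (\<alpha> + 1) * (\<bar>v (r k) z\<bar> powr (\<alpha> + 1) + \<bar>u z\<bar> powr (\<alpha> + 1))" for z
        using abs_add_powr_le[of "\<alpha> + 1" "v (r k) z" "- u z"] \<alpha>1 by (simp add: d_def)
    qed
    also have "\<dots> = 2 powr (\<alpha> + 1) * (c (v (r k)) + c u)"
      unfolding c_def using c_integrable[OF P_W[OF vP]] c_integrable[OF u(1)] by simp
    also have "\<dots> \<le> K5" unfolding K5_def using c1 by (intro mult_left_mono add_right_mono) auto
    finally show ?thesis .
  qed
  \<comment> \<open>By the Brezis--Lieb lemma these are the limits of the energy and of the power of
    the remainder, hence nonnegative.\<close>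
  define A where "A = x - E u"
  define C where "C = y - c u"
  have Alim: "(\<lambda>k. E (d k)) \<longlonglongrightarrow> A"
    using tendsto_diff[OF x Brezis_Lieb_E[OF u(1) dW dE dlim]] by (simp add: vd A_def)
  have Clim: "(\<lambda>k. c (d k)) \<longlonglongrightarrow> C"
    using tendsto_diff[OF y Brezis_Lieb_c[OF u(1) dW dc dlim]] by (simp add: vd C_def)
  have A0: "0 \<le> A" using Alim E_nonneg by (intro LIMSEQ_le_const) auto
  have C0: "0 \<le> C" using Clim c_nonneg by (intro LIMSEQ_le_const) auto
  \<comment> \<open>If \<open>C \<le> A\<close>, the constant sequence \<open>u\<close> is
    admissible in \<open>limit_in_D\<close>. If not, then \<open>e1 * A \<le> e2 * C\<close>, and
    subtracting this from the limit inequality leaves the one for \<open>u\<close>.\<close>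
  have uD: "u \<in> D"
  proof -
    have "e2 * c u \<le> e1 * E u"
    proof (cases "C \<le> A")
      case True
      show ?thesis
        by (rule limit_in_D[OF m uP u(1) order_refl tendsto_const tendsto_const xy _ _ FI])
          (use True C0 in \<open>simp_all add: A_def C_def\<close>)
    next
      case False
      have "e1 * A \<le> e2 * C" using False A0 e12 by (intro mult_mono) auto
      thus ?thesis using xy by (simp add: A_def C_def right_diff_distrib)
    qed
    thus ?thesis using uP by (simp add: D_def)
  qed
  have "C / (\<alpha> + 1) \<le> A / p"
  proof (rule ccontr)
    assume "\<not> C / (\<alpha> + 1) \<le> A / p"
    hence neg: "A / p < C / (\<alpha> + 1)" by simp
    hence Cp: "0 < C" using A0 p \<alpha>1 by (smt (verit) divide_nonneg_pos divide_nonpos_pos)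
    \<comment> \<open>Only the positive part of the remainder is used, so that
      \<open>u + \<tau> * dp\<close> stays above \<open>u\<close> and in the cone. Its power has the
      same limit \<open>C\<close>, and its energy does not increase.\<close>
    define dp where "dp k z = max 0 (d k z)" for k z
    have dpW: "dp k \<in> W" and dpE: "E (dp k) \<le> E (d k)" for k unfolding dp_def using W_pos_part[OF dW] by auto
    have "bounded (range (\<lambda>k. E (dp k)))"
      using dpE dE E_nonneg by (auto simp: bounded_iff intro!: exI[of _ K4]) (meson order_trans)
    then obtain r' A' where r': "strict_mono r'" "((\<lambda>k. E (dp k)) \<circ> r') \<longlonglongrightarrow> A'"
      using bounded_imp_convergent_subsequence by blast
    define h where "h k = dp (r' k)" for k
    have hW: "h k \<in> W" for k unfolding h_def by (rule dpW)
    have h0: "0 \<le> h k z" for k z by (simp add: h_def dp_def)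
    have A'lim: "(\<lambda>k. E (h k)) \<longlonglongrightarrow> A'" using r'(2) by (simp add: o_def h_def)
    have A'0: "0 \<le> A'" using A'lim E_nonneg by (intro LIMSEQ_le_const) auto
    have A'A: "A' \<le> A"
    proof (rule LIMSEQ_le[OF A'lim])
      show "(\<lambda>k. E (d (r' k))) \<longlonglongrightarrow> A" using LIMSEQ_subseq_LIMSEQ[OF Alim r'(1)] by (simp add: o_def)
      show "\<exists>N. \<forall>n\<ge>N. E (h n) \<le> E (d (r' n))" using dpE by (auto simp: h_def)
    qed
    have "(\<lambda>k. c (dp k)) \<longlonglongrightarrow> C"
      unfolding dp_def d_def using P_W[OF vP] P_nonneg[OF vP] u lim Clim
      by (intro c_pos_part_tendsto) (auto simp: d_def[abs_def])
    hence hc: "(\<lambda>k. c (h k)) \<longlonglongrightarrow> C" unfolding h_def using LIMSEQ_subseq_LIMSEQ[OF _ r'(1)] by (fastforce simp: o_def)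
    have hlim: "AE z in lborel. (\<lambda>k. h k z) \<longlonglongrightarrow> 0"
      using dlim
    proof eventually_elim
      case (elim z)
      have "(\<lambda>k. d (r' k) z) \<longlonglongrightarrow> 0" using LIMSEQ_subseq_LIMSEQ[OF elim r'(1)] by (simp add: o_def)
      hence "(\<lambda>k. max 0 (d (r' k) z)) \<longlonglongrightarrow> max 0 0" by (intro tendsto_max tendsto_const)
      thus ?case by (simp add: h_def dp_def)
    qed
    have wE: "(\<lambda>k. E (\<lambda>z. u z + \<tau> * h k z)) \<longlonglongrightarrow> E u + \<tau> powr p * A'"
      and wc: "(\<lambda>k. c (\<lambda>z. u z + \<tau> * h k z)) \<longlonglongrightarrow> c u + \<tau> powr (\<alpha> + 1) * C" if \<tau>: "0 < \<tau>" for \<tau>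
    proof -
      have hl: "AE z in lborel. (\<lambda>k. \<tau> * h k z) \<longlonglongrightarrow> 0" using hlim by eventually_elim (auto intro: tendsto_eq_intros)
      have 1: "(\<lambda>k. E (\<lambda>z. \<tau> * h k z)) \<longlonglongrightarrow> \<tau> powr p * A'"
        using tendsto_mult[OF tendsto_const A'lim, of "\<tau> powr p"] \<tau> by (simp add: W_cmult(2)[OF hW])
      have 2: "(\<lambda>k. c (\<lambda>z. \<tau> * h k z)) \<longlonglongrightarrow> \<tau> powr (\<alpha> + 1) * C"
        using tendsto_mult[OF tendsto_const hc, of "\<tau> powr (\<alpha> + 1)"] \<tau> by (simp add: c_scale[OF hW])
      obtain B1 where B1: "\<And>k. E (\<lambda>z. \<tau> * h k z) \<le> B1"
        using convergent_imp_bounded[OF 1] by (force simp: bounded_iff abs_le_iff)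
      obtain B2 where B2: "\<And>k. c (\<lambda>z. \<tau> * h k z) \<le> B2"
        using convergent_imp_bounded[OF 2] by (force simp: bounded_iff abs_le_iff)
      show "(\<lambda>k. E (\<lambda>z. u z + \<tau> * h k z)) \<longlonglongrightarrow> E u + \<tau> powr p * A'"
        using tendsto_add[OF Brezis_Lieb_E[OF u(1) W_cmult(1)[OF hW] B1 hl] 1] by simp
      show "(\<lambda>k. c (\<lambda>z. u z + \<tau> * h k z)) \<longlonglongrightarrow> c u + \<tau> powr (\<alpha> + 1) * C"
        using tendsto_add[OF Brezis_Lieb_c[OF u(1) W_cmult(1)[OF hW] B2 hl] 2] by simp
    qed
    have wW: "(\<lambda>z. u z + \<tau> * h k z) \<in> W" for \<tau> k by (intro W_add W_cmult u hW)
    have wu: "u z \<le> u z + \<tau> * h k z" if "0 < \<tau>" for \<tau> k z using h0 that by simp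
    \<comment> \<open>The defect of the limit pair of \<open>u + \<tau> * h\<close> in the
      inequality defining \<open>D\<close>: nonnegative at 1 by \<open>limit_in_D\<close>, and
      eventually nonpositive because \<open>\<alpha> + 1 > p\<close>.\<close>
    define F where "F \<tau> = e1 * (E u + \<tau> powr p * A') - e2 * (c u + \<tau> powr (\<alpha> + 1) * C)" for \<tau>
    have F1: "0 \<le> F 1"
    proof -
      have "e2 * (c u + 1 powr (\<alpha> + 1) * C) \<le> e1 * (E u + 1 powr p * A')"
        by (rule limit_in_D[OF m uP wW wu wE wc xy _ _ FI]) (use A'A in \<open>simp_all add: A_def C_def\<close>)
      thus ?thesis by (simp add: F_def)
    qed
    obtain \<tau> where \<tau>: "1 \<le> \<tau>" "F \<tau> = 0"
    proof -
      define Z where "Z = e1 * (E u + A') / (e2 * C)"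
      \<comment> \<open>Here \<open>T powr (\<alpha> + 1 - p) \<ge> Z\<close>, so the power of the
        amplified remainder outweighs its energy together with that of \<open>u\<close>.\<close>
      define T where "T = max 1 (Z powr (1 / (\<alpha> + 1 - p)))"
      have T: "1 \<le> T" by (simp add: T_def)
      have nn: "0 \<le> Z" using e12 E_nonneg[of u] A'0 Cp by (simp add: Z_def)
      have "Z = (Z powr (1 / (\<alpha> + 1 - p))) powr (\<alpha> + 1 - p)"
        using nn \<alpha>1 by (simp add: powr_powr)
      also have "\<dots> \<le> T powr (\<alpha> + 1 - p)" using \<alpha>1 by (intro powr_mono2) (auto simp: T_def)
      finally have "e1 * (E u + A') \<le> T powr (\<alpha> + 1 - p) * (e2 * C)" using e12 Cp by (simp add: pos_divide_le_eq Z_def)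
      hence "T powr p * (e1 * (E u + A')) \<le> T powr p * (T powr (\<alpha> + 1 - p) * (e2 * C))" by (intro mult_left_mono) auto
      also have "\<dots> = e2 * (T powr (\<alpha> + 1) * C)"
        by (simp add: mult.assoc[symmetric] flip: powr_add)
      finally have 1: "e1 * (T powr p * E u) + e1 * (T powr p * A') \<le> e2 * (T powr (\<alpha> + 1) * C)"
        by (simp add: algebra_simps)
      have "1 \<le> T powr p" using T p by (intro ge_one_powr_ge_zero) auto
      hence "E u \<le> T powr p * E u" using E_nonneg[of u] mult_right_mono[of 1 "T powr p" "E u"] by simp
      hence "e1 * E u \<le> e1 * (T powr p * E u)" using e12 by simp
      moreover have "0 \<le> e2 * c u" using e12 c_nonneg by simp
      ultimately have FT: "F T \<le> 0" using 1 by (simp add: F_def distrib_left)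
      have "\<forall>t. 1 \<le> t \<and> t \<le> T \<longrightarrow> isCont F t"
        unfolding F_def using p \<alpha>1 by (auto intro!: continuous_intros)
      then obtain \<tau> where "1 \<le> \<tau>" "F \<tau> = 0" using IVT2[OF FT F1 T] by blast
      thus ?thesis using that by blast
    qed
    have "e1 * (E u + \<tau> powr p * A') = e2 * (c u + \<tau> powr (\<alpha> + 1) * C)" using \<tau>(2) by (simp add: F_def)
    hence "m < Fi u (E u + \<tau> powr p * A') (c u + \<tau> powr (\<alpha> + 1) * C) 1"
      using \<tau>(1) by (intro D_boundary(2)[OF m uP wW wu wE wc]) auto
    \<comment> \<open>By \<open>A' \<le> A\<close> and \<open>p < \<alpha> + 1\<close> the
      contribution of the amplified remainder is at most
      \<open>\<tau> powr p * (A / p - C / (\<alpha> + 1))\<close>. The bracket is negative, so the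
      factor \<open>\<tau> powr p \<ge> 1\<close> can only lower it.\<close>
    also have "\<dots> \<le> Fi u x y 1"
    proof -
      have "\<tau> powr p * A' / p \<le> \<tau> powr p * (A / p)" using A'A p by (simp add: divide_right_mono mult_left_mono)
      moreover have "\<tau> powr p * (C / (\<alpha> + 1)) \<le> \<tau> powr (\<alpha> + 1) * (C / (\<alpha> + 1))"
        using \<tau>(1) \<alpha>1 Cp by (intro mult_right_mono powr_mono) auto
      moreover have "1 * (C / (\<alpha> + 1) - A / p) \<le> \<tau> powr p * (C / (\<alpha> + 1) - A / p)"
        using neg \<tau>(1) p by (intro mult_right_mono ge_one_powr_ge_zero) auto
      ultimately have "\<tau> powr p * A' / p - \<tau> powr (\<alpha> + 1) * C / (\<alpha> + 1) \<le> A / p - C / (\<alpha> + 1)"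
        by (simp add: right_diff_distrib)
      thus ?thesis by (simp add: Fi_def A_def C_def add_divide_distrib diff_divide_distrib)
    qed
    finally show False using FI by linarith
  qed
  hence "I u \<le> Fi u x y 1" by (simp add: I_def Fi_def A_def C_def diff_divide_distrib)
  hence "I u \<le> m" using FI by linarith
  thus ?thesis using that[OF uD] m by (meson order_trans)
qed

end

context problem
begin

section \<open>First variation and stability\<close>

definition ek :: "nat \<Rightarrow> real" where "ek k = 1 / (real k + 1)"

lemma ek: "0 < ek k" "ek k \<le> 1" "ek \<longlonglongrightarrow> 0"
proof -
  show "0 < ek k" "ek k \<le> 1" by (auto simp: ek_def)
  show "ek \<longlonglongrightarrow> 0"
    unfolding ek_def[abs_def] using LIMSEQ_inverse_real_of_nat by (simp add: inverse_eq_divide add.commute)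
qed

definition form :: "('a \<Rightarrow> real) \<Rightarrow> ('a \<Rightarrow> real) \<Rightarrow> real" where
  "form u \<psi> = (\<integral>z. \<bar>dif u z\<bar> powr (p - 2) * dif u z * dif \<psi> z \<partial>\<mu>)"

definition pairing :: "('a \<Rightarrow> real) \<Rightarrow> ('a \<Rightarrow> real) \<Rightarrow> real" where
  "pairing u \<psi> = (\<integral>x. \<bar>u x\<bar> powr (\<alpha> - 1) * u x * \<psi> x \<partial>lborel)"

lemma E_derivative:
  assumes u: "u \<in> W" and \<psi>: "\<psi> \<in> W"
  shows "(\<lambda>k. (E (\<lambda>x. u x + ek k * \<psi> x) - E u) / ek k) \<longlonglongrightarrow> p * form u \<psi>"
proof -
  have d: "dif u z + t * dif \<psi> z = dif (\<lambda>x. u x + t * \<psi> x) z" for t z by (simp add: dif_def algebra_simps)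
  show ?thesis
    using integral_powr_derivative[OF p dif_measurable_\<mu>[OF W_measurable[OF u]] dif_measurable_\<mu>[OF W_measurable[OF \<psi>]]
      W_integrable[OF u] W_integrable[OF \<psi>] ek]
    by (simp add: d E_def form_def)
qed

lemma c_derivative:
  assumes u: "u \<in> W" and \<psi>: "\<psi> \<in> W"
  shows "(\<lambda>k. (c (\<lambda>x. u x + ek k * \<psi> x) - c u) / ek k) \<longlonglongrightarrow> (\<alpha> + 1) * pairing u \<psi>"
  using integral_powr_derivative[OF \<alpha>1(2) _ _ c_integrable[OF u] c_integrable[OF \<psi>] ek] W_measurable[OF u] W_measurable[OF \<psi>]
  by (simp add: c_def pairing_def)

lemma difference_quotient_tendsto:
  assumes "(\<lambda>k. (f k - l) / ek k) \<longlonglongrightarrow> d" shows "f \<longlonglongrightarrow> (l :: real)"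
proof -
  have "(\<lambda>k. l + (f k - l) / ek k * ek k) \<longlonglongrightarrow> l + d * 0"
    by (intro tendsto_intros assms ek)
  moreover have "l + (f k - l) / ek k * ek k = f k" for k using ek(1)[of k] by simp
  ultimately show ?thesis by simp
qed

lemma perturb:
  assumes u: "u \<in> P" and \<psi>: "\<psi> \<in> W" "\<And>x. 0 \<le> \<psi> x"
  shows "(\<lambda>x. u x + ek k * \<psi> x) \<in> P" "(\<lambda>k. E (\<lambda>x. u x + ek k * \<psi> x)) \<longlonglongrightarrow> E u"
    "(\<lambda>k. c (\<lambda>x. u x + ek k * \<psi> x)) \<longlonglongrightarrow> c u" "(\<lambda>k. b (\<lambda>x. u x + ek k * \<psi> x)) \<longlonglongrightarrow> b u"
proof -
  have W: "(\<lambda>x. u x + ek k * \<psi> x) \<in> W" for k by (intro W_add W_cmult P_W[OF u] \<psi>)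
  have ge: "u x \<le> u x + ek k * \<psi> x" for x k using ek(1)[of k] \<psi>(2)[of x] by simp
  show PP: "(\<lambda>x. u x + ek k * \<psi> x) \<in> P" for k by (rule P_mono(1)[OF u W ge])
  show El: "(\<lambda>k. E (\<lambda>x. u x + ek k * \<psi> x)) \<longlonglongrightarrow> E u"
    by (rule difference_quotient_tendsto[OF E_derivative[OF P_W[OF u] \<psi>(1)]])
  show "(\<lambda>k. c (\<lambda>x. u x + ek k * \<psi> x)) \<longlonglongrightarrow> c u"
    by (rule difference_quotient_tendsto[OF c_derivative[OF P_W[OF u] \<psi>(1)]])
  show "(\<lambda>k. b (\<lambda>x. u x + ek k * \<psi> x)) \<longlonglongrightarrow> b u"
  proof (cases "q = 1")
    case True
    thus ?thesis using b_eq_measure[OF PP True] b_eq_measure[OF u True] by simp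
  next
    case False
    obtain K where K: "\<And>k. E (\<lambda>x. u x + ek k * \<psi> x) \<le> K"
      using convergent_imp_bounded[OF El] by (force simp: bounded_iff abs_le_iff)
    have lim: "(\<lambda>k. u x + ek k * \<psi> x) \<longlonglongrightarrow> u x" for x
      using tendsto_add[OF tendsto_const tendsto_mult[OF ek(3) tendsto_const], of "u x" "\<psi> x"] by simp
    show ?thesis
      using q False lim by (intro b_tendsto[OF W P_nonneg[OF PP] K P_W[OF u] P_nonneg[OF u]]) auto
  qed
qed

text \<open>The second variation of the functional along fibres enters only through this property: after a
  small rescaling \<open>t\<close>, adding a nonnegative perturbation does not decrease \<open>I\<close>.\<close>

definition stable :: "('a \<Rightarrow> real) \<Rightarrow> bool" where
  "stable u \<longleftrightarrow> u \<in> P \<and> E u - c u = lam * b u \<and>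
     (\<forall>\<psi>\<in>W. (\<forall>x. 0 \<le> \<psi> x) \<longrightarrow> (\<forall>\<delta>>0. eventually (\<lambda>k. \<exists>t. \<bar>t - 1\<bar> < \<delta> \<and>
        I (\<lambda>x. t * u x) \<le> I (\<lambda>x. t * (u x + ek k * \<psi> x))) sequentially))"

lemma I_one: "u \<in> W \<Longrightarrow> I u = Fi u (E u) (c u) 1"
  using Fi_I[of u 1] by simp

text \<open>Equality in the definition of \<open>D\<close> is excluded by \<open>D_boundary\<close>
  along the constant sequence. So the minimiser is interior: nearby scales give the Nehari identity,
  and small upward perturbations remain in \<open>D\<close>, so that the scale \<open>t = 1\<close>
  suffices for stability.\<close>

lemma first_stable:
  obtains u where "stable u" "e2 * c u < e1 * E u"
proof -
  obtain u where u: "u \<in> D" "\<And>w. w \<in> D \<Longrightarrow> I u \<le> I w" using first_minimizer by blast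
  have uP: "u \<in> P" using u(1) by (simp add: D_def)
  note uW = P_W[OF uP]
  have lt: "e2 * c u < e1 * E u"
  proof (rule ccontr)
    assume "\<not> e2 * c u < e1 * E u"
    hence "e1 * E u = e2 * c u" using u(1) by (simp add: D_def)
    hence "I u < Fi u (E u) (c u) 1"
      by (intro D_boundary(2)[OF u(2) uP uW order_refl tendsto_const tendsto_const])
    thus False using I_one[OF uW] by simp
  qed
  have "E u - c u = lam * b u"
  proof -
    define d where "d = E u - c u - lam * b u"
    have der: "(Fi u (E u) (c u) has_real_derivative d) (at 1)"
      using Fi_derivative[OF uP, of 1 "E u" "c u"] by (simp add: d_def)
    have "((\<lambda>t. e2 * (t powr (\<alpha> + 1) * c u)) \<longlongrightarrow> e2 * (1 powr (\<alpha> + 1) * c u)) (at 1)"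
      "((\<lambda>t. e1 * (t powr p * E u)) \<longlongrightarrow> e1 * (1 powr p * E u)) (at 1)"
      by (intro tendsto_intros; simp)+
    hence "eventually (\<lambda>t. e2 * (t powr (\<alpha> + 1) * c u) < e1 * (t powr p * E u)) (at 1)"
      using lt by (intro eventually_less_lim) auto
    then obtain \<delta> where \<delta>: "0 < \<delta>" "\<And>t. t \<noteq> 1 \<Longrightarrow> dist t 1 < \<delta> \<Longrightarrow> e2 * (t powr (\<alpha> + 1) * c u) < e1 * (t powr p * E u)"
      by (auto simp: eventually_at)
    have min: "Fi u (E u) (c u) 1 \<le> Fi u (E u) (c u) t" if t: "\<bar>1 - t\<bar> < min \<delta> 1" for t
    proof (cases "t = 1")
      case False
      have t0: "0 < t" using t by auto
      have "(\<lambda>x. t * u x) \<in> D"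
      proof -
        have "dist t 1 < \<delta>" using t by (simp add: dist_real_def abs_minus_commute)
        from \<delta>(2)[OF False this] show ?thesis
          using P_scale(1)[OF uP t0] t0 by (simp add: D_def W_cmult(2)[OF uW] c_scale[OF uW])
      qed
      hence "I u \<le> I (\<lambda>x. t * u x)" by (rule u(2))
      thus ?thesis using I_one[OF uW] Fi_I[OF uW t0] by simp
    qed simp
    have "d = 0" using DERIV_local_min[OF der, of "min \<delta> 1"] \<delta>(1) min by auto
    thus ?thesis by (simp add: d_def)
  qed
  moreover have "eventually (\<lambda>k. \<exists>t. \<bar>t - 1\<bar> < \<delta> \<and> I (\<lambda>x. t * u x) \<le> I (\<lambda>x. t * (u x + ek k * \<psi> x))) sequentially"
    if \<psi>: "\<psi> \<in> W" "\<forall>x. 0 \<le> \<psi> x" and \<delta>: "0 < \<delta>" for \<psi> \<delta>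
  proof -
    note pt = perturb[OF uP \<psi>(1) \<psi>(2)[rule_format]]
    have "eventually (\<lambda>k. e2 * c (\<lambda>x. u x + ek k * \<psi> x) < e1 * E (\<lambda>x. u x + ek k * \<psi> x)) sequentially"
      by (rule eventually_less_lim[OF lt]) (intro tendsto_intros pt)+
    thus ?thesis
    proof eventually_elim
      case (elim k)
      have "I u \<le> I (\<lambda>x. u x + ek k * \<psi> x)" using elim pt(1) by (intro u(2)) (simp add: D_def)
      thus ?case using \<delta> by (intro exI[of _ 1]) simp
    qed
  qed
  ultimately have "stable u" using uP by (simp add: stable_def)
  thus ?thesis using that lt by blast
qed

subsection \<open>Minimisation on the outer part of the Nehari set\<close>

text \<open>The non-strict inequality makes the condition stable under limits; equality is excluded
  for the minimiser by the gap between \<open>lam\<close> and \<open>lam'\<close>.\<close>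

definition Nm :: "('a \<Rightarrow> real) set" where
  "Nm = {u \<in> P. E u - c u = lam * b u \<and> e1 * E u \<le> e2 * c u}"

lemma Nm_scale_iff:
  assumes u: "u \<in> P" and t: "0 < t"
  shows "(\<lambda>x. t * u x) \<in> Nm \<longleftrightarrow> E u * t powr e1 - c u * t powr e2 = lam * b u \<and> e1 * E u * t powr e1 \<le> e2 * c u * t powr e2"
proof -
  have s: "E (\<lambda>x. t * u x) = t powr (1 - q) * (E u * t powr e1)" "c (\<lambda>x. t * u x) = t powr (1 - q) * (c u * t powr e2)"
    using t by (simp_all add: W_cmult(2)[OF P_W[OF u]] c_scale[OF P_W[OF u]] powr_p_e[OF t] mult_ac)
  have pos: "0 < t powr (1 - q)" using t by simp
  have "E (\<lambda>x. t * u x) - c (\<lambda>x. t * u x) = lam * b (\<lambda>x. t * u x) \<longleftrightarrow>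
      t powr (1 - q) * (E u * t powr e1 - c u * t powr e2) = t powr (1 - q) * (lam * b u)"
    unfolding s P_scale(2)[OF u t] by (simp only: right_diff_distrib mult.left_commute[of lam])
  also have "\<dots> \<longleftrightarrow> E u * t powr e1 - c u * t powr e2 = lam * b u" using pos by simp
  finally have 1: "E (\<lambda>x. t * u x) - c (\<lambda>x. t * u x) = lam * b (\<lambda>x. t * u x) \<longleftrightarrow>
    E u * t powr e1 - c u * t powr e2 = lam * b u" .
  have "e1 * E (\<lambda>x. t * u x) \<le> e2 * c (\<lambda>x. t * u x) \<longleftrightarrow>
      t powr (1 - q) * (e1 * E u * t powr e1) \<le> t powr (1 - q) * (e2 * c u * t powr e2)"
    unfolding s by (simp only: mult_ac)
  also have "\<dots> \<longleftrightarrow> e1 * E u * t powr e1 \<le> e2 * c u * t powr e2" using pos by (simp add: mult.assoc)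
  finally show ?thesis using 1 P_scale(1)[OF u t] by (simp add: Nm_def)
qed

lemma rmax_e:
  assumes "0 < x" "0 < y" "rmax x y \<le> t"
  shows "e1 * x * t powr e1 \<le> e2 * y * t powr e2"
proof -
  define \<rho> where "\<rho> = rmax x y"
  have \<rho>: "0 < \<rho>" "e1 * x * \<rho> powr p = e2 * y * \<rho> powr (\<alpha> + 1)" "\<rho> \<le> t"
    using rmax[OF assms(1,2)] assms(3) by (auto simp: \<rho>_def)
  have "\<rho> powr (1 - q) * (e1 * x * \<rho> powr e1) = \<rho> powr (1 - q) * (e2 * y * \<rho> powr e2)"
    using \<rho>(2) unfolding powr_p_e[OF \<rho>(1)] by (simp only: mult_ac)
  hence eq: "e1 * x * \<rho> powr e1 = e2 * y * \<rho> powr e2" using \<rho>(1) by simp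
  have t: "0 < t" using \<rho> by linarith
  have "\<rho> powr e2 = \<rho> powr e1 * \<rho> powr (e2 - e1)" by (simp flip: powr_add)
  hence "\<rho> powr e1 * (e1 * x) = \<rho> powr e1 * (e2 * y * \<rho> powr (e2 - e1))" using eq by (simp add: mult_ac)
  hence "e1 * x = e2 * y * \<rho> powr (e2 - e1)" using \<rho>(1) by simp
  also have "\<dots> \<le> e2 * y * t powr (e2 - e1)" using \<rho> e12 assms by (intro mult_left_mono powr_mono2) auto
  finally have "e1 * x * t powr e1 \<le> e2 * y * t powr (e2 - e1) * t powr e1" by (intro mult_right_mono) auto
  also have "\<dots> = e2 * y * t powr e2" by (simp add: mult.assoc flip: powr_add)
  finally show ?thesis .
qed

text \<open>At its maximum the bracket is at least \<open>lam' * b u \<ge> lam * b u\<close>, and it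
  is nonpositive at \<open>T\<close>, where the power has overtaken the energy; the intermediate
  value theorem gives a point on the falling side.\<close>

lemma Nm_fibre:
  assumes u: "u \<in> P" obtains t where "0 < t" "(\<lambda>x. t * u x) \<in> Nm"
proof -
  define \<rho> where "\<rho> = rmax (E u) (c u)"
  have \<rho>: "0 < \<rho>" "e1 * E u * \<rho> powr p = e2 * c u * \<rho> powr (\<alpha> + 1)"
    using rmax[OF E_pos[OF u] c_pos[OF u]] by (auto simp: \<rho>_def)
  define F where "F t = E u * t powr e1 - c u * t powr e2" for t
  have Ec: "E (\<lambda>x. \<rho> * u x) = \<rho> powr p * E u" "c (\<lambda>x. \<rho> * u x) = \<rho> powr (\<alpha> + 1) * c u"
    using \<rho>(1) W_cmult(2)[OF P_W[OF u], of \<rho>] c_scale[OF P_W[OF u], of \<rho>] by simp_all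
  have "lam' * b (\<lambda>x. \<rho> * u x) \<le> E (\<lambda>x. \<rho> * u x) - c (\<lambda>x. \<rho> * u x)"
  proof (rule boundary_estimate[OF P_scale(1)[OF u \<rho>(1)]])
    show "e1 * E (\<lambda>x. \<rho> * u x) = e2 * c (\<lambda>x. \<rho> * u x)" unfolding Ec using \<rho>(2) by (simp only: mult_ac)
  qed
  hence "\<rho> powr (1 - q) * (lam' * b u) \<le> \<rho> powr (1 - q) * F \<rho>"
    unfolding P_scale(2)[OF u \<rho>(1)] F_def Ec powr_p_e[OF \<rho>(1)] by (simp add: algebra_simps)
  hence F\<rho>: "lam' * b u \<le> F \<rho>" using \<rho>(1) by simp
  have "lam * b u \<le> lam' * b u" using lam b_pos[OF u] by (intro mult_right_mono) auto
  hence F1: "lam * b u \<le> F \<rho>" using F\<rho> by linarith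
  define T where "T = max \<rho> ((E u / c u) powr (1 / (e2 - e1)))"
  have T: "\<rho> \<le> T" "0 < T" using \<rho>(1) by (auto simp: T_def)
  have "E u / c u = ((E u / c u) powr (1 / (e2 - e1))) powr (e2 - e1)"
    using E_pos[OF u] c_pos[OF u] e12 by (simp add: powr_powr)
  also have "\<dots> \<le> T powr (e2 - e1)" using e12 by (intro powr_mono2) (auto simp: T_def)
  finally have "E u \<le> c u * T powr (e2 - e1)" using c_pos[OF u] by (simp add: pos_divide_le_eq mult.commute)
  hence "E u * T powr e1 \<le> c u * T powr (e2 - e1) * T powr e1" by (intro mult_right_mono) auto
  also have "\<dots> = c u * T powr e2" by (simp add: mult.assoc flip: powr_add)
  finally have "F T \<le> 0" by (simp add: F_def)
  also have "0 \<le> lam * b u" using lam b_pos[OF u] by simp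
  finally have FT: "F T \<le> lam * b u" .
  have "\<forall>t. \<rho> \<le> t \<and> t \<le> T \<longrightarrow> isCont F t"
    unfolding F_def using \<rho>(1) by (auto intro!: continuous_intros)
  then obtain t where t: "\<rho> \<le> t" "F t = lam * b u" using IVT2[OF FT F1 T(1)] by blast
  have "0 < t" using t \<rho> by linarith
  moreover have "(\<lambda>x. t * u x) \<in> Nm"
    unfolding Nm_scale_iff[OF u \<open>0 < t\<close>] using t(2) rmax_e[OF E_pos[OF u] c_pos[OF u], of t] t(1)
    by (simp add: F_def \<rho>_def)
  ultimately show ?thesis using that by blast
qed

lemma Nm_coercive:
  obtains \<kappa> K where "0 < \<kappa>" "\<And>u. u \<in> Nm \<Longrightarrow> \<kappa> * E u \<le> I u + K"
proof -
  define \<kappa> where "\<kappa> = 1 / p - 1 / (\<alpha> + 1)"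
  have \<kappa>: "0 < \<kappa>" using \<alpha>1 p by (simp add: \<kappa>_def frac_less2)
  obtain K where K: "0 \<le> K" "\<And>u. u \<in> P \<Longrightarrow> Gam u \<le> \<kappa> / (2 * lam) * E u + K"
    using b_Gam_sublinear[of "\<kappa> / (2 * lam)"] \<kappa> lam by (metis divide_pos_pos mult_pos_pos zero_less_numeral)
  have "\<kappa> / 2 * E u \<le> I u + lam * K" if u: "u \<in> Nm" for u
  proof -
    have uP: "u \<in> P" using u by (simp add: Nm_def)
    have "lam * Gam u \<le> lam * (\<kappa> / (2 * lam) * E u + K)"
      using K(2)[OF uP] lam by (intro mult_left_mono) auto
    also have "\<dots> = \<kappa> / 2 * E u + lam * K" using lam by (simp add: distrib_left)
    finally have 1: "lam * Gam u \<le> \<kappa> / 2 * E u + lam * K" .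
    have "c u \<le> E u" using u lam b_pos[OF uP] by (simp add: Nm_def) (smt (verit) mult_pos_pos)
    hence "c u / (\<alpha> + 1) \<le> E u / (\<alpha> + 1)" using \<alpha>1 by (intro divide_right_mono) auto
    hence "\<kappa> * E u \<le> E u / p - c u / (\<alpha> + 1)" by (simp add: \<kappa>_def left_diff_distrib)
    thus ?thesis using 1 unfolding I_def by linarith
  qed
  thus ?thesis using that[of "\<kappa> / 2" "lam * K"] \<kappa> by simp
qed

text \<open>By the subcritical embedding and scaling,
  \<open>e1 * E u \<le> e2 * S * E u powr ((\<alpha> + 1) / p)\<close>. The exponent exceeds 1, so
  the energy cannot be small, and hence neither can the power; minimising sequences do not
  vanish.\<close>

lemma Nm_c_bound:
  assumes sub: "\<alpha> + 1 < pstar"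
  obtains c0 where "0 < c0" "\<And>u. u \<in> Nm \<Longrightarrow> c0 \<le> c u"
proof -
  have "0 < \<alpha> + 1" using \<alpha>1 by simp
  then obtain S0 where S0: "\<And>u. u \<in> W \<Longrightarrow> E u \<le> 1 \<Longrightarrow> c u \<le> S0"
    unfolding c_def using Lr_bound[OF _ sub, of 1] by metis
  define S where "S = max S0 1"
  have S: "0 < S" "\<And>u. u \<in> W \<Longrightarrow> E u \<le> 1 \<Longrightarrow> c u \<le> S" using S0 by (auto simp: S_def le_max_iff_disj)
  define \<beta> where "\<beta> = (\<alpha> + 1) / p - 1"
  have \<beta>: "0 < \<beta>" using \<alpha>1 p by (simp add: \<beta>_def)
  define E0 where "E0 = (e1 / (e2 * S)) powr (1 / \<beta>)"
  have E0: "0 < E0" using e12 S by (simp add: E0_def)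
  have "e1 * E0 / e2 \<le> c u" if u: "u \<in> Nm" for u
  proof -
    have uP: "u \<in> P" and le: "e1 * E u \<le> e2 * c u" using u by (auto simp: Nm_def)
    have Ep: "0 < E u" using E_pos[OF uP] .
    define t where "t = E u powr (- 1 / p)"
    have t: "0 < t" "t powr p = 1 / E u" "t powr (\<alpha> + 1) = 1 / (E u powr ((\<alpha> + 1) / p))"
    proof -
      show "0 < t" using Ep by (simp add: t_def)
      have "t powr p = E u powr (- 1)" "t powr (\<alpha> + 1) = E u powr (- ((\<alpha> + 1) / p))"
        unfolding t_def powr_powr using p by simp_all
      thus "t powr p = 1 / E u" "t powr (\<alpha> + 1) = 1 / (E u powr ((\<alpha> + 1) / p))"
        using Ep by (simp_all add: powr_minus_divide)
    qed
    have "c (\<lambda>x. t * u x) \<le> S"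
      using t Ep by (intro S(2) W_cmult P_W[OF uP]) (simp add: W_cmult(2)[OF P_W[OF uP]])
    hence cu: "c u \<le> S * E u powr ((\<alpha> + 1) / p)" using t Ep by (simp add: c_scale[OF P_W[OF uP]] pos_divide_le_eq)
    have "e1 * E u \<le> e2 * (S * E u powr ((\<alpha> + 1) / p))"
      using le cu e12 by (meson less_imp_le mult_left_mono order_trans)
    also have "E u powr ((\<alpha> + 1) / p) = E u powr \<beta> * E u" using Ep by (simp add: \<beta>_def powr_diff)
    finally have "e1 * E u \<le> (e2 * S * E u powr \<beta>) * E u" by (simp add: mult_ac)
    hence "e1 \<le> e2 * S * E u powr \<beta>" using Ep by simp
    hence "e1 / (e2 * S) \<le> E u powr \<beta>" using e12 S by (simp add: pos_divide_le_eq mult.commute)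
    hence "E0 \<le> (E u powr \<beta>) powr (1 / \<beta>)" unfolding E0_def using e12 S \<beta> by (intro powr_mono2) auto
    hence "E0 \<le> E u" using Ep \<beta> by (simp add: powr_powr)
    hence "e1 * E0 \<le> e1 * E u" using e12 by simp
    hence "e1 * E0 \<le> e2 * c u" using le by linarith
    thus ?thesis using e12 by (simp add: pos_divide_le_eq mult.commute)
  qed
  moreover have "0 < e1 * E0 / e2" using e12 E0 by simp
  ultimately show ?thesis using that by blast
qed

lemma E_lower_semicontinuous:
  assumes v: "\<And>k. v k \<in> W" and u: "u \<in> W" and lim: "AE x in lborel. (\<lambda>k. v k x) \<longlonglongrightarrow> u x"
    and x: "(\<lambda>k. E (v k)) \<longlonglongrightarrow> x"
  shows "E u \<le> x"
  unfolding E_def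
proof (rule Fatou_integral_lim(2))
  show "(\<lambda>z. \<bar>dif u z\<bar> powr p) \<in> borel_measurable \<mu>" using dif_measurable_\<mu>[OF W_measurable[OF u]] by measurable
  show "AE z in \<mu>. (\<lambda>k. \<bar>dif (v k) z\<bar> powr p) \<longlonglongrightarrow> \<bar>dif u z\<bar> powr p"
    using AE_\<mu>[OF lim] unfolding dif_def by eventually_elim (use p in \<open>auto intro!: tendsto_abs_powr tendsto_diff\<close>)
  show "(\<lambda>k. \<integral>z. \<bar>dif (v k) z\<bar> powr p \<partial>\<mu>) \<longlonglongrightarrow> x" using x by (simp add: E_def)
qed (auto intro: W_integrable v)

text \<open>The power passes to the limit and only energy can be lost. Rescaling the limit back to
  \<open>Nm\<close> by some \<open>t\<close> costs nothing: the fibre map with the limit energy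
  \<open>x\<close> is at least as large at 1 as at \<open>t\<close>, and replacing \<open>x\<close>
  by the smaller \<open>E u\<close> lowers it further.\<close>

lemma second_minimizer:
  assumes sub: "\<alpha> + 1 < pstar"
  obtains u where "u \<in> Nm" "\<And>w. w \<in> Nm \<Longrightarrow> I u \<le> I w"
proof -
  obtain \<kappa> K where \<kappa>: "0 < \<kappa>" "\<And>u. u \<in> Nm \<Longrightarrow> \<kappa> * E u \<le> I u + K" using Nm_coercive by blast
  obtain c0 where c0: "0 < c0" "\<And>u. u \<in> Nm \<Longrightarrow> c0 \<le> c u" using Nm_c_bound[OF sub] by blast
  obtain w0 where w0: "w0 \<in> Nm" using Nm_fibre[OF bdist_P] by blast
  have bdd: "bdd_below (I ` Nm)"
  proof (rule bdd_belowI2)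
    fix u assume "u \<in> Nm"
    thus "- K \<le> I u" using \<kappa>(2)[of u] \<kappa>(1) E_nonneg[of u] by (smt (verit) mult_nonneg_nonneg)
  qed
  define m where "m = Inf (I ` Nm)"
  have m: "m \<le> I w" if "w \<in> Nm" for w unfolding m_def using bdd that by (intro cInf_lower) auto
  have "\<exists>v. v \<in> Nm \<and> I v < m + 1 / (real k + 1)" for k :: nat
  proof -
    have "Inf (I ` Nm) < m + 1 / (real k + 1)" unfolding m_def by simp
    thus ?thesis using w0(1) bdd by (subst (asm) cInf_less_iff) auto
  qed
  then obtain v where v: "\<And>k::nat. v k \<in> Nm" "\<And>k::nat. I (v k) < m + 1 / (real k + 1)" by metis
  have vP: "v k \<in> P" and vN: "E (v k) - c (v k) = lam * b (v k)" and vle: "e1 * E (v k) \<le> e2 * c (v k)" for k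
    using v(1)[of k] by (auto simp: Nm_def)
  have Iv: "I (v k) \<le> m + 1" for k
  proof -
    have "1 / (real k + 1) \<le> 1" by simp
    thus ?thesis using v(2)[of k] by linarith
  qed
  define K1 where "K1 = (m + 1 + K) / \<kappa>"
  have E1: "E (v k) \<le> K1" for k
    using \<kappa>(2)[OF v(1)[of k]] Iv[of k] \<kappa>(1) by (simp add: K1_def pos_le_divide_eq mult.commute)
  have c1: "c (v k) \<le> K1" for k
  proof -
    have "0 < lam * b (v k)" using lam b_pos[OF vP] by simp
    thus ?thesis using vN[of k] E1[of k] by linarith
  qed
  obtain K2 where K2: "0 \<le> K2" "\<And>u. u \<in> P \<Longrightarrow> Gam u \<le> 1 * E u + K2" using b_Gam_sublinear[of 1] by (metis zero_less_one)
  have GL: "- ((m + 1 + K1 / (\<alpha> + 1)) / lam) \<le> Gam (v k)" for k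
  proof -
    have "0 \<le> E (v k) / p" using E_nonneg p by simp
    moreover have "c (v k) / (\<alpha> + 1) \<le> K1 / (\<alpha> + 1)" using c1 \<alpha>1 by (intro divide_right_mono) auto
    ultimately have "- (m + 1 + K1 / (\<alpha> + 1)) \<le> lam * Gam (v k)" using Iv[of k] unfolding I_def by linarith
    hence "(- (m + 1 + K1 / (\<alpha> + 1))) / lam \<le> Gam (v k)"
      by (subst pos_divide_le_eq[OF lam(1)]) (simp only: mult.commute)
    thus ?thesis by (simp only: minus_divide_left)
  qed
  define K3 where "K3 = max (max K1 (K1 + K2)) ((m + 1 + K1 / (\<alpha> + 1)) / lam)"
  have G3: "\<bar>Gam (v k)\<bar> \<le> K3" for k
    using GL[of k] K2(2)[OF vP[of k]] E1[of k] by (auto simp: K3_def abs_le_iff)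
  have E3: "E (v k) \<le> K3" and c3: "c (v k) \<le> K3" for k using E1[of k] c1[of k] by (auto simp: K3_def)
  from bounded_extraction[of v K3, OF vP E3 c3 G3] obtain r u x y L where r: "strict_mono r" and u: "u \<in> W" "\<And>z. 0 \<le> u z"
    and lim: "AE z in lborel. (\<lambda>k. v (r k) z) \<longlonglongrightarrow> u z"
    and x: "(\<lambda>k. E (v (r k))) \<longlonglongrightarrow> x" and y: "(\<lambda>k. c (v (r k))) \<longlonglongrightarrow> y" and L: "(\<lambda>k. Gam (v (r k))) \<longlonglongrightarrow> L"
    by blast
  have Il: "(\<lambda>k. I (v (r k))) \<longlonglongrightarrow> x / p - lam * L - y / (\<alpha> + 1)"
    unfolding I_def using p \<alpha>1 by (intro tendsto_intros x y L) auto
  have Iu: "I (v (r k)) \<le> m + 1 / (real k + 1)" for k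
  proof -
    have "1 / (real (r k) + 1) \<le> 1 / (real k + 1)" using seq_suble[OF r, of k] by (intro divide_left_mono) auto
    thus ?thesis using v(2)[of "r k"] by linarith
  qed
  have ml: "(\<lambda>k. m + 1 / (real k + 1)) \<longlonglongrightarrow> m + 0"
    using ek(3) by (intro tendsto_add tendsto_const) (simp add: ek_def[abs_def])
  have Ilim: "x / p - lam * L - y / (\<alpha> + 1) \<le> m" using LIMSEQ_le[OF Il ml] Iu by simp
  \<comment> \<open>An exponent strictly between \<open>\<alpha> + 1\<close> and
    \<open>pstar\<close> supplies the uniform bound needed for convergence of the power
    integrals.\<close>
  have yc: "y = c u"
  proof -
    obtain r' where r': "\<alpha> + 1 < r'" "r' < pstar" using sub dense by blast
    have "0 < r'" using r' \<alpha>1 by linarith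
    then obtain C where C: "\<And>u. u \<in> W \<Longrightarrow> E u \<le> K1 \<Longrightarrow> integrable lborel (\<lambda>x. \<bar>u x\<bar> powr r')"
      "\<And>u. u \<in> W \<Longrightarrow> E u \<le> K1 \<Longrightarrow> (\<integral>x. \<bar>u x\<bar> powr r' \<partial>lborel) \<le> C"
      using Lr_bound[OF _ r'(2), of K1] by metis
    have "(\<lambda>k. c (v (r k))) \<longlonglongrightarrow> c u"
      unfolding c_def
    proof (rule integral_powr_tendsto(1)[of "\<alpha> + 1" r' \<Omega>])
      show "integrable lborel (\<lambda>x. \<bar>v (r k) x\<bar> powr r')" "(\<integral>x. \<bar>v (r k) x\<bar> powr r' \<partial>lborel) \<le> C" for k
        using C P_W[OF vP] E1 by auto
      show "AE z in lborel. (\<lambda>k. v (r k) z) \<longlonglongrightarrow> u z" by (rule lim)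
    qed (use \<alpha>1 r' finite_\<Omega> W_zero[OF P_W[OF vP]] W_zero[OF u(1)] W_measurable[OF P_W[OF vP]] W_measurable[OF u(1)] in auto)
    thus ?thesis using y LIMSEQ_unique by blast
  qed
  have "c0 \<le> y" using y c0(2)[OF v(1)] by (intro LIMSEQ_le_const) auto
  hence cu: "0 < c u" using c0(1) yc by simp
  have nt: "\<not> (AE z in lborel. u z = 0)"
  proof
    assume "AE z in lborel. u z = 0"
    hence "AE z in lborel. \<bar>u z\<bar> powr (\<alpha> + 1) = 0" by eventually_elim simp
    hence "c u = 0" unfolding c_def by (rule integral_eq_zero_AE)
    thus False using cu by simp
  qed
  have uP: "u \<in> P" and bl: "(\<lambda>k. b (v (r k))) \<longlonglongrightarrow> b u" and LG: "L \<le> Gam u"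
    using P_limit[of "\<lambda>k. v (r k)" K1 u L] vP E1 u lim L nt by auto
  have FI: "Fi u x y 1 \<le> m"
  proof -
    have "lam * L \<le> lam * Gam u" using LG lam by (intro mult_left_mono) auto
    thus ?thesis using Ilim by (simp add: Fi_def)
  qed
  have xE: "E u \<le> x" using P_W[OF vP] u(1) lim x by (intro E_lower_semicontinuous) auto
  have x0: "0 \<le> x" using xE E_nonneg[of u] by linarith
  have xyb: "x - y = lam * b u"
  proof -
    have "(\<lambda>k. E (v (r k)) - c (v (r k))) \<longlonglongrightarrow> x - y" by (intro tendsto_intros x y)
    moreover have "(\<lambda>k. E (v (r k)) - c (v (r k))) \<longlonglongrightarrow> lam * b u" unfolding vN by (intro tendsto_intros bl)
    ultimately show ?thesis by (rule LIMSEQ_unique)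
  qed
  have xy: "e1 * x \<le> e2 * y"
  proof (rule LIMSEQ_le)
    show "(\<lambda>k. e1 * E (v (r k))) \<longlonglongrightarrow> e1 * x" "(\<lambda>k. e2 * c (v (r k))) \<longlonglongrightarrow> e2 * y"
      by (intro tendsto_intros x y)+
  qed (use vle in auto)
  obtain t where t: "0 < t" "(\<lambda>z. t * u z) \<in> Nm" using Nm_fibre[OF uP] by blast
  \<comment> \<open>The bracket with energy \<open>x\<close> is thus at least
    \<open>lam * b u\<close> at both \<open>t\<close> and 1; for \<open>t \<le> 1\<close>
    quasi-concavity extends this to the whole interval between them.\<close>
  have psi_t: "lam * b u \<le> x * t powr e1 - y * t powr e2"
  proof -
    have "E u * t powr e1 - c u * t powr e2 = lam * b u" using t(2) Nm_scale_iff[OF uP t(1)] by simp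
    moreover have "E u * t powr e1 \<le> x * t powr e1" using xE by (intro mult_right_mono) auto
    ultimately show ?thesis using yc by simp
  qed
  have down: "x * v powr e1 - y * v powr e2 \<le> lam * b u" if "1 \<le> v" for v
    using psi_down[of x 1 v y] x0 that xy xyb by simp
  have "Fi u x y t \<le> Fi u x y 1"
  proof (cases "t \<le> 1")
    case True
    thus ?thesis
    proof (rule Fi_increasing[OF uP t(1)])
      fix v assume "t \<le> v" "v \<le> 1"
      thus "lam * b u \<le> x * v powr e1 - y * v powr e2"
        using psi_between[OF x0 t(1), of v 1 "lam * b u" y] psi_t xyb by simp
    qed
  next
    case False
    thus ?thesis using down by (intro Fi_decreasing[OF uP]) auto
  qed
  moreover have "I (\<lambda>z. t * u z) \<le> Fi u x y t"
  proof -
    have "E u * t powr p / p \<le> x * t powr p / p" using xE p by (intro divide_right_mono mult_right_mono) auto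
    thus ?thesis unfolding Fi_I[OF u(1) t(1)] by (simp add: Fi_def yc)
  qed
  ultimately have "I (\<lambda>z. t * u z) \<le> m" using FI by linarith
  thus ?thesis using that[OF t(2)] m by (meson order_trans)
qed

text \<open>A perturbed function is returned to \<open>Nm\<close> by a factor near 1, and there its
  value is at least \<open>I u\<close>; since \<open>u\<close> maximises its own fibre map near 1,
  \<open>I u\<close> in turn is at least the value at the same multiple of \<open>u\<close>.\<close>

lemma second_stable:
  assumes sub: "\<alpha> + 1 < pstar"
  obtains u where "stable u" "e1 * E u < e2 * c u"
proof -
  obtain u where u: "u \<in> Nm" "\<And>w. w \<in> Nm \<Longrightarrow> I u \<le> I w" using second_minimizer[OF sub] by blast
  have uP: "u \<in> P" and Neh: "E u - c u = lam * b u" and le: "e1 * E u \<le> e2 * c u" using u(1) by (auto simp: Nm_def)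
  note uW = P_W[OF uP]
  have lt: "e1 * E u < e2 * c u"
  proof (rule ccontr)
    assume "\<not> e1 * E u < e2 * c u"
    hence "lam' * b u \<le> E u - c u" using le by (intro boundary_estimate uP) simp
    moreover have "lam * b u < lam' * b u" using lam b_pos[OF uP] by (intro mult_strict_right_mono) auto
    ultimately show False using Neh by linarith
  qed
  define F where "F t = E u * t powr e1 - c u * t powr e2" for t
  have F1: "F 1 = lam * b u" using Neh by (simp add: F_def)
  have "(F has_real_derivative E u * (e1 * 1 powr (e1 - 1)) - c u * (e2 * 1 powr (e2 - 1))) (at 1)"
    unfolding F_def[abs_def] by (intro DERIV_diff DERIV_cmult has_real_derivative_powr) auto
  hence dF: "(F has_real_derivative e1 * E u - e2 * c u) (at 1)" by (simp add: mult.commute)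
  obtain d1 where d1: "0 < d1" "\<And>h. 0 < h \<Longrightarrow> h < d1 \<Longrightarrow> F 1 < F (1 - h)"
    using DERIV_neg_dec_left[OF dF] lt by auto
  obtain d2 where d2: "0 < d2" "\<And>h. 0 < h \<Longrightarrow> h < d2 \<Longrightarrow> F (1 + h) < F 1"
    using DERIV_neg_dec_right[OF dF] lt by auto
  have "((\<lambda>h. e1 * E u) \<longlongrightarrow> e1 * E u) (at 0)" "((\<lambda>h. e2 * c u * (1 - h) powr (e2 - e1)) \<longlongrightarrow> e2 * c u * (1 - 0) powr (e2 - e1)) (at (0::real))"
    by (intro tendsto_intros; simp)+
  hence "eventually (\<lambda>h. e1 * E u < e2 * c u * (1 - h) powr (e2 - e1)) (at (0::real))"
    using lt by (intro eventually_less_lim) auto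
  then obtain d3 where d3: "0 < d3" "\<And>h::real. h \<noteq> 0 \<Longrightarrow> dist h 0 < d3 \<Longrightarrow> e1 * E u < e2 * c u * (1 - h) powr (e2 - e1)"
    by (auto simp: eventually_at)
  have "eventually (\<lambda>k. \<exists>t. \<bar>t - 1\<bar> < \<delta> \<and> I (\<lambda>x. t * u x) \<le> I (\<lambda>x. t * (u x + ek k * \<psi> x))) sequentially"
    if \<psi>: "\<psi> \<in> W" "\<forall>x. 0 \<le> \<psi> x" and \<delta>: "0 < \<delta>" for \<psi> \<delta>
  proof -
    \<comment> \<open>Small enough that the bracket of \<open>u\<close> is above its Nehari level at
      \<open>1 - h\<close> and below it at \<open>1 + h\<close>, and that the falling-side
      inequality is strict already at \<open>1 - h\<close>. All three strict inequalities persist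
      for \<open>w k\<close> with \<open>k\<close> large.\<close>
    define h where "h = min (min d1 d2) (min (min d3 1) \<delta>) / 2"
    have h: "0 < h" "h < d1" "h < d2" "h < d3" "h < 1" "h < \<delta>" using d1 d2 d3 \<delta> by (auto simp: h_def)
    define w where "w k x = u x + ek k * \<psi> x" for k x
    have wP: "w k \<in> P" and wE: "(\<lambda>k. E (w k)) \<longlonglongrightarrow> E u" and wc: "(\<lambda>k. c (w k)) \<longlonglongrightarrow> c u" and wb: "(\<lambda>k. b (w k)) \<longlonglongrightarrow> b u" for k
      unfolding w_def[abs_def] using perturb[OF uP \<psi>(1) \<psi>(2)[rule_format]] by auto
    have A: "eventually (\<lambda>k. lam * b (w k) < E (w k) * (1 - h) powr e1 - c (w k) * (1 - h) powr e2) sequentially"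
    proof (rule eventually_less_lim)
      show "lam * b u < F (1 - h)" using d1(2)[OF h(1,2)] F1 by simp
    qed (auto simp: F_def intro!: tendsto_intros wE wc wb)
    have B: "eventually (\<lambda>k. E (w k) * (1 + h) powr e1 - c (w k) * (1 + h) powr e2 < lam * b (w k)) sequentially"
    proof (rule eventually_less_lim)
      show "F (1 + h) < lam * b u" using d2(2)[OF h(1,3)] F1 by simp
    qed (auto simp: F_def intro!: tendsto_intros wE wc wb)
    have C: "eventually (\<lambda>k. e1 * E (w k) < e2 * c (w k) * (1 - h) powr (e2 - e1)) sequentially"
    proof (rule eventually_less_lim)
      show "e1 * E u < e2 * c u * (1 - h) powr (e2 - e1)" using h by (intro d3(2)) auto
    qed (intro tendsto_intros wE wc)+
    from A B C show ?thesis
    proof eventually_elim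
      case (elim k)
      define H where "H t = E (w k) * t powr e1 - c (w k) * t powr e2" for t
      have "\<forall>t. 1 - h \<le> t \<and> t \<le> 1 + h \<longrightarrow> isCont H t"
        unfolding H_def using h by (auto intro!: continuous_intros)
      then obtain t where t: "1 - h \<le> t" "t \<le> 1 + h" "H t = lam * b (w k)"
        using IVT2[of H "1 + h" "lam * b (w k)" "1 - h"] elim h by (auto simp: H_def)
      have t0: "0 < t" using t h by linarith
      have "e1 * E (w k) * t powr e1 \<le> e2 * c (w k) * t powr e2"
      proof -
        have "e2 * c (w k) * (1 - h) powr (e2 - e1) \<le> e2 * c (w k) * t powr (e2 - e1)"
          using t h e12 c_nonneg by (intro mult_left_mono powr_mono2) auto
        hence "e1 * E (w k) \<le> e2 * c (w k) * t powr (e2 - e1)" using elim(3) by linarith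
        hence "e1 * E (w k) * t powr e1 \<le> e2 * c (w k) * t powr (e2 - e1) * t powr e1" by (intro mult_right_mono) auto
        also have "\<dots> = e2 * c (w k) * t powr e2" by (simp add: mult.assoc flip: powr_add)
        finally show ?thesis .
      qed
      hence "(\<lambda>x. t * w k x) \<in> Nm" using t(3) unfolding Nm_scale_iff[OF wP t0] by (simp add: H_def)
      hence "I u \<le> I (\<lambda>x. t * w k x)" by (rule u(2))
      \<comment> \<open>Left of 1 the bracket stays above the Nehari level by quasi-concavity, right
        of 1 it stays below; so the fibre map of \<open>u\<close> rises up to 1 and falls
        afterwards.\<close>
      moreover have "I (\<lambda>x. t * u x) \<le> I u"
      proof -
        have "Fi u (E u) (c u) t \<le> Fi u (E u) (c u) 1"
        proof (cases "t \<le> 1")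
          case True
          thus ?thesis
          proof (rule Fi_increasing[OF uP t0])
            fix v assume v: "t \<le> v" "v \<le> 1"
            have "lam * b u \<le> F (1 - h)" using d1(2)[OF h(1,2)] F1 by simp
            thus "lam * b u \<le> E u * v powr e1 - c u * v powr e2"
              using v t h F1 by (intro psi_between[of "E u" "1 - h" v 1] E_nonneg) (auto simp: F_def)
          qed
        next
          case False
          show ?thesis
          proof (rule Fi_decreasing[OF uP])
            fix v assume v: "1 \<le> v" "v \<le> t"
            thus "E u * v powr e1 - c u * v powr e2 \<le> lam * b u"
              using psi_down[of "E u" 1 v "c u"] E_nonneg le Neh by simp
          qed (use False in auto)
        qed
        thus ?thesis using Fi_I[OF uW t0] I_one[OF uW] by simp
      qed
      ultimately show ?case using t h by (intro exI[of _ t]) (auto simp: w_def)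
    qed
  qed
  hence "stable u" using uP Neh by (simp add: stable_def)
  thus ?thesis using that lt by blast
qed

end

subsection \<open>Euler--Lagrange equation\<close>

text \<open>Without the perturbation the product is nonpositive, since the negative part is a
  decreasing function. The perturbation can spoil this by at most
  \<open>e * \<bar>v - w\<bar>\<close>, and only where one of the two negative parts is
  active.\<close>

lemma neg_part_product_le:
  fixes a b v w e :: real
  assumes "0 \<le> e"
  shows "(a - b) * (max 0 (- (a + e * v)) - max 0 (- (b + e * w))) \<le>
    e * (\<bar>a - b\<bar> * \<bar>v - w\<bar>) * (if a + e * v < 0 \<or> b + e * w < 0 then 1 else 0)"
proof (cases "a + e * v < 0 \<or> b + e * w < 0")
  case True
  define A where "A = a + e * v"
  define B where "B = b + e * w"
  define d where "d = e * (v - w)"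
  have AB: "A - B = (a - b) + d" by (simp add: A_def B_def d_def algebra_simps)
  define K where "K = e * \<bar>v - w\<bar>"
  have "\<bar>e * (v - w)\<bar> = K" using assms by (simp add: K_def abs_mult)
  hence K: "0 \<le> K" "d \<le> K" "- K \<le> d" unfolding d_def by linarith+
  have "(a - b) * (max 0 (- A) - max 0 (- B)) \<le> \<bar>a - b\<bar> * K"
  proof (cases "0 \<le> a - b")
    case True
    have "max 0 (- A) - max 0 (- B) \<le> K" using True AB K by (auto simp: max_def)
    hence "(a - b) * (max 0 (- A) - max 0 (- B)) \<le> (a - b) * K" using True by (rule mult_left_mono)
    thus ?thesis using True by simp
  next
    case False
    have "max 0 (- B) - max 0 (- A) \<le> K" using False AB K by (auto simp: max_def)
    hence "(b - a) * (max 0 (- B) - max 0 (- A)) \<le> (b - a) * K" using False by (intro mult_left_mono) auto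
    thus ?thesis using False by (simp add: algebra_simps)
  qed
  thus ?thesis using True by (simp add: A_def B_def K_def mult_ac)
next
  case False
  hence "max 0 (- (a + e * v)) = 0" "max 0 (- (b + e * w)) = 0" by linarith+
  thus ?thesis using False by simp
qed

context problem
begin

lemma g_mono:
  assumes "0 < x" "x \<le> y" shows "g x \<le> g y"
proof (cases "q = 1")
  case True
  show ?thesis unfolding g_ln[OF True] using assms by (simp add: ln_le_cancel_iff)
next
  case False
  thus ?thesis using q assms by (auto simp: g_def intro!: divide_right_mono powr_mono2)
qed

lemma g_has_derivative:
  assumes "0 < x" shows "(g has_real_derivative x powr (- q)) (at x)"
proof (cases "q = 1")
  case True
  have "g = ln" using g_ln[OF True] by auto
  moreover have "(ln has_real_derivative 1 / x) (at x)" using assms by (auto intro!: derivative_eq_intros)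
  ultimately show ?thesis using True assms by (simp add: powr_minus divide_inverse)
next
  case False
  have "g = (\<lambda>x. x powr (1 - q) / (1 - q))" using False by (auto simp: g_def)
  moreover have "((\<lambda>x. x powr (1 - q) / (1 - q)) has_real_derivative ((1 - q) * x powr (1 - q - 1)) / (1 - q)) (at x)"
    using has_real_derivative_powr[OF assms, of "1 - q"] by (rule DERIV_cdivide)
  ultimately show ?thesis using False by simp
qed

lemma form_integrable:
  assumes "u \<in> W" "\<psi> \<in> W"
  shows "integrable \<mu> (\<lambda>z. \<bar>dif u z\<bar> powr (p - 2) * dif u z * dif \<psi> z)"
    "integrable \<mu> (\<lambda>z. \<bar>dif u z\<bar> powr (p - 1) * \<bar>dif \<psi> z\<bar>)"
  using integrable_powr_prod[OF p dif_measurable_\<mu>[OF W_measurable] dif_measurable_\<mu>[OF W_measurable] W_integrable W_integrable]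
    assms by auto

lemma pairing_integrable:
  assumes "u \<in> W" "\<psi> \<in> W"
  shows "integrable lborel (\<lambda>x. \<bar>u x\<bar> powr (\<alpha> - 1) * u x * \<psi> x)"
  using integrable_powr_prod(2)[OF \<alpha>1(2) _ _ c_integrable c_integrable, of u \<psi>] assms W_measurable by auto

lemma form_add:
  assumes "u \<in> W" "\<psi> \<in> W" "\<phi> \<in> W"
  shows "form u (\<lambda>x. \<psi> x + t * \<phi> x) = form u \<psi> + t * form u \<phi>"
proof -
  have "\<bar>dif u z\<bar> powr (p - 2) * dif u z * dif (\<lambda>x. \<psi> x + t * \<phi> x) z =
      \<bar>dif u z\<bar> powr (p - 2) * dif u z * dif \<psi> z + t * (\<bar>dif u z\<bar> powr (p - 2) * dif u z * dif \<phi> z)" for z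
    by (simp add: dif_def algebra_simps)
  thus ?thesis unfolding form_def using form_integrable(1)[OF assms(1)] assms by simp
qed

lemma pairing_add:
  assumes "u \<in> W" "\<psi> \<in> W" "\<phi> \<in> W"
  shows "pairing u (\<lambda>x. \<psi> x + t * \<phi> x) = pairing u \<psi> + t * pairing u \<phi>"
proof -
  have "\<bar>u x\<bar> powr (\<alpha> - 1) * u x * (\<psi> x + t * \<phi> x) =
      \<bar>u x\<bar> powr (\<alpha> - 1) * u x * \<psi> x + t * (\<bar>u x\<bar> powr (\<alpha> - 1) * u x * \<phi> x)" for x
    by (simp add: algebra_simps)
  thus ?thesis unfolding pairing_def using pairing_integrable[OF assms(1)] assms by simp
qed

lemma form_self: "form u u = E u"
  unfolding form_def E_def using abs_powr_mult_abs(2)[OF p] by simp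

lemma pairing_self: "pairing u u = c u"
  unfolding pairing_def c_def using abs_powr_mult_abs(2)[OF \<alpha>1(2)] by simp

lemma pairing_nonneg: "(\<And>x. 0 \<le> u x) \<Longrightarrow> (\<And>x. 0 \<le> \<psi> x) \<Longrightarrow> 0 \<le> pairing u \<psi>"
  unfolding pairing_def by (intro integral_nonneg_AE AE_I2) simp

text \<open>The factor \<open>t\<close> from stability depends on \<open>k\<close> and need not tend
  to 1 along the sequence, but it may be kept as close to 1 as desired while the quotients of
  \<open>E\<close> and \<open>c\<close> are bounded. Dividing by \<open>t powr (1 - q)\<close>
  leaves an arbitrarily small error.\<close>

lemma stable_quotient:
  assumes st: "stable u" and \<psi>: "\<psi> \<in> W" "\<And>x. 0 \<le> \<psi> x" and \<epsilon>: "0 < \<epsilon>"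
  shows "eventually (\<lambda>k. lam * ((Gam (\<lambda>x. u x + ek k * \<psi> x) - Gam u) / ek k) \<le> form u \<psi> - pairing u \<psi> + \<epsilon>) sequentially"
proof -
  have uP: "u \<in> P" using st by (simp add: stable_def)
  note uW = P_W[OF uP]
  define w where "w k x = u x + ek k * \<psi> x" for k x
  have wP: "w k \<in> P" for k unfolding w_def[abs_def] using perturb(1)[OF uP \<psi>] .
  define X where "X k = (E (w k) - E u) / ek k / p" for k
  define Y where "Y k = (c (w k) - c u) / ek k / (\<alpha> + 1)" for k
  define Z where "Z k = (Gam (w k) - Gam u) / ek k" for k
  have "(\<lambda>k. (E (w k) - E u) / ek k / p) \<longlonglongrightarrow> p * form u \<psi> / p"
    unfolding w_def[abs_def] using E_derivative[OF uW \<psi>(1)] p by (intro tendsto_divide tendsto_const) auto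
  hence X: "X \<longlonglongrightarrow> form u \<psi>" using p by (simp add: X_def[abs_def])
  have "(\<lambda>k. (c (w k) - c u) / ek k / (\<alpha> + 1)) \<longlonglongrightarrow> (\<alpha> + 1) * pairing u \<psi> / (\<alpha> + 1)"
    unfolding w_def[abs_def] using c_derivative[OF uW \<psi>(1)] \<alpha>1 by (intro tendsto_divide tendsto_const) auto
  hence Y: "Y \<longlonglongrightarrow> pairing u \<psi>" using \<alpha>1 by (simp add: Y_def[abs_def])
  obtain B1 where B1: "\<And>k. \<bar>X k\<bar> \<le> B1" using convergent_imp_bounded[OF X] by (auto simp: bounded_iff)
  obtain B2 where B2: "\<And>k. \<bar>Y k\<bar> \<le> B2" using convergent_imp_bounded[OF Y] by (auto simp: bounded_iff)
  define B where "B = max (max B1 B2) 1"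
  have B: "0 < B" "\<And>k. \<bar>X k\<bar> \<le> B" "\<And>k. \<bar>Y k\<bar> \<le> B" using B1 B2 by (auto simp: B_def le_max_iff_disj)
  \<comment> \<open>Energy and power each contribute an error \<open>B * \<eta>\<close>, together
    \<open>\<epsilon> / 2\<close>; the other half is spent on the convergence of the
    quotients.\<close>
  define \<eta> where "\<eta> = \<epsilon> / (4 * B)"
  have \<eta>: "0 < \<eta>" "\<eta> * B = \<epsilon> / 4" using \<epsilon> B by (auto simp: \<eta>_def)
  have cont: "((\<lambda>t. t powr r) \<longlongrightarrow> 1 powr r) (at (1::real))" for r by (intro tendsto_intros) auto
  have "eventually (\<lambda>t. dist (t powr e1) (1 powr e1) < \<eta> \<and> dist (t powr e2) (1 powr e2) < \<eta>) (at (1::real))"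
    using tendstoD[OF cont \<eta>(1)] tendstoD[OF cont \<eta>(1)] by (intro eventually_conj)
  then obtain \<delta> where \<delta>: "0 < \<delta>" "\<And>t::real. t \<noteq> 1 \<Longrightarrow> dist t 1 < \<delta> \<Longrightarrow> \<bar>t powr e1 - 1\<bar> < \<eta> \<and> \<bar>t powr e2 - 1\<bar> < \<eta>"
    by (auto simp: eventually_at dist_real_def)
  have "0 < min \<delta> 1" using \<delta> by simp
  with st \<psi> have ev: "eventually (\<lambda>k. \<exists>t. \<bar>t - 1\<bar> < min \<delta> 1 \<and> I (\<lambda>x. t * u x) \<le> I (\<lambda>x. t * (u x + ek k * \<psi> x))) sequentially"
    unfolding stable_def by blast
  have ev2: "eventually (\<lambda>k. X k - Y k < form u \<psi> - pairing u \<psi> + \<epsilon> / 2) sequentially"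
    using \<epsilon> by (intro order_tendstoD(2)[OF tendsto_diff[OF X Y]]) auto
  from ev ev2 show ?thesis
  proof eventually_elim
    case (elim k)
    then obtain t where t: "\<bar>t - 1\<bar> < \<delta>" "\<bar>t - 1\<bar> < 1" "I (\<lambda>x. t * u x) \<le> I (\<lambda>x. t * w k x)" by (auto simp: w_def)
    have t0: "0 < t" using t by linarith
    have tt: "\<bar>t powr e1 - 1\<bar> \<le> \<eta>" "\<bar>t powr e2 - 1\<bar> \<le> \<eta>"
      using \<delta>(2)[of t] t \<eta> by (cases "t = 1"; force simp: dist_real_def)+
    have e0: "0 < ek k" by (rule ek)
    have "Fi u (E u) (c u) t \<le> Fi (w k) (E (w k)) (c (w k)) t"
      using t(3) by (simp add: Fi_I[OF uW t0] Fi_I[OF P_W[OF wP] t0])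
    hence "lam * (Gam (\<lambda>x. t * w k x) - Gam (\<lambda>x. t * u x)) \<le>
        (E (w k) - E u) * t powr p / p - (c (w k) - c u) * t powr (\<alpha> + 1) / (\<alpha> + 1)"
      by (simp add: Fi_def algebra_simps diff_divide_distrib)
    hence "lam * (t powr (1 - q) * (Gam (w k) - Gam u)) \<le>
        (E (w k) - E u) * t powr p / p - (c (w k) - c u) * t powr (\<alpha> + 1) / (\<alpha> + 1)"
      by (simp add: Gam_scale_diff[OF uP wP t0])
    moreover have "Gam (w k) - Gam u = Z k * ek k" "E (w k) - E u = X k * p * ek k" "c (w k) - c u = Y k * (\<alpha> + 1) * ek k"
      using e0 p \<alpha>1 by (simp_all add: Z_def X_def Y_def)
    ultimately have "lam * (t powr (1 - q) * (Z k * ek k)) \<le>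
        (X k * p * ek k) * (t powr (1 - q) * t powr e1) / p - (Y k * (\<alpha> + 1) * ek k) * (t powr (1 - q) * t powr e2) / (\<alpha> + 1)"
      by (simp add: powr_p_e[OF t0])
    also have "\<dots> = (t powr (1 - q) * ek k) * (X k * t powr e1 - Y k * t powr e2)"
    proof -
      have "(X k * p * ek k) * (t powr (1 - q) * t powr e1) / p = X k * ek k * (t powr (1 - q) * t powr e1)"
        "(Y k * (\<alpha> + 1) * ek k) * (t powr (1 - q) * t powr e2) / (\<alpha> + 1) = Y k * ek k * (t powr (1 - q) * t powr e2)"
        using p \<alpha>1 by simp_all
      thus ?thesis by (simp add: algebra_simps)
    qed
    finally have "(t powr (1 - q) * ek k) * (lam * Z k) \<le> (t powr (1 - q) * ek k) * (X k * t powr e1 - Y k * t powr e2)"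
      by (simp add: mult_ac)
    hence 1: "lam * Z k \<le> X k * t powr e1 - Y k * t powr e2" using t0 e0 by simp
    have "\<bar>X k * (t powr e1 - 1)\<bar> \<le> B * \<eta>" unfolding abs_mult using B tt by (intro mult_mono) auto
    moreover have "\<bar>Y k * (t powr e2 - 1)\<bar> \<le> B * \<eta>" unfolding abs_mult using B tt by (intro mult_mono) auto
    ultimately have "X k * t powr e1 - Y k * t powr e2 \<le> X k - Y k + 2 * (B * \<eta>)"
      by (simp add: right_diff_distrib abs_le_iff)
    also have "2 * (B * \<eta>) = \<epsilon> / 2" using \<eta>(2) by (simp add: mult.commute)
    finally have "lam * Z k \<le> form u \<psi> - pairing u \<psi> + \<epsilon>" using 1 elim(2) by linarith
    thus ?case by (simp add: Z_def w_def[abs_def])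
  qed
qed

text \<open>For \<open>q < 1\<close>, raising \<open>u\<close> by \<open>ek k * bdist\<close> on its
  zero set gains at least a multiple of \<open>ek k powr (- q)\<close> in the quotient of the
  singular integral, whereas \<open>stable_quotient\<close> bounds that quotient. So the zero set in
  \<Omega> is null.\<close>

lemma stable_positive:
  assumes st: "stable u" shows "AE x in lborel. x \<in> \<Omega> \<longrightarrow> 0 < u x"
proof (cases "q = 1")
  case True
  have "u \<in> P" using st by (simp add: stable_def)
  thus ?thesis using True by (rule P_pos)
next
  case False
  hence q1: "q < 1" using q by simp
  have uP: "u \<in> P" using st by (simp add: stable_def)
  have u0: "0 \<le> u x" for x using P_nonneg[OF uP] .
  have [measurable]: "u \<in> borel_measurable borel" "bdist \<in> borel_measurable borel" "\<Omega> \<in> sets borel"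
    using W_measurable P_W[OF uP] bdist_W finite_\<Omega> by auto
  define N where "N = {x \<in> \<Omega>. u x = 0}"
  have [measurable]: "N \<in> sets borel" unfolding N_def by measurable
  define f where "f x = indicator N x * bdist x powr (1 - q)" for x
  have fi: "integrable lborel f"
  proof (rule Bochner_Integration.integrable_bound[OF b_integrable[OF bdist_W bdist_nonneg]])
    show "f \<in> borel_measurable lborel" unfolding f_def by measurable
    show "AE x in lborel. norm (f x) \<le> norm (bdist x powr (1 - q))" by (simp add: f_def indicator_def)
  qed
  define J where "J = (\<integral>x. f x \<partial>lborel)"
  have J0: "0 \<le> J" unfolding J_def by (intro integral_nonneg_AE) (simp add: f_def)
  have lower: "ek k powr (- q) * (J / (1 - q)) \<le> (Gam (\<lambda>x. u x + ek k * bdist x) - Gam u) / ek k" for k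
  proof -
    have e0: "0 < ek k" by (rule ek)
    define w where "w x = u x + ek k * bdist x" for x
    have wP: "w \<in> P" unfolding w_def[abs_def] by (rule perturb(1)[OF uP bdist_W bdist_nonneg])
    have "(ek k powr (1 - q) / (1 - q)) * J = (\<integral>x. (ek k powr (1 - q) / (1 - q)) * f x \<partial>lborel)"
      unfolding J_def by simp
    also have "\<dots> \<le> (\<integral>x. g (w x) - g (u x) \<partial>lborel)"
    proof (rule integral_mono)
      show "integrable lborel (\<lambda>x. (ek k powr (1 - q) / (1 - q)) * f x)" using fi by simp
      show "integrable lborel (\<lambda>x. g (w x) - g (u x))" using Gam_integrable[OF wP] Gam_integrable[OF uP] by simp
      fix x
      have le: "u x \<le> w x" using e0 bdist_nonneg[of x] by (simp add: w_def)
      show "(ek k powr (1 - q) / (1 - q)) * f x \<le> g (w x) - g (u x)"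
      proof (cases "x \<in> N")
        case True
        hence "u x = 0" by (simp add: N_def)
        thus ?thesis using True False e0 bdist_nonneg[of x] by (simp add: f_def w_def g_def powr_mult)
      next
        case xN: False
        have "u x powr (1 - q) \<le> w x powr (1 - q)" using le u0 q1 by (intro powr_mono2) auto
        thus ?thesis using xN False q1 by (simp add: f_def g_def divide_right_mono)
      qed
    qed
    also have "\<dots> = Gam w - Gam u" unfolding Gam_def using Gam_integrable[OF wP] Gam_integrable[OF uP] by simp
    finally have "(ek k powr (1 - q) / (1 - q)) * J / ek k \<le> (Gam w - Gam u) / ek k" using e0 by (intro divide_right_mono) auto
    moreover have "ek k powr (1 - q) / ek k = ek k powr (- q)" using e0 by (simp add: powr_diff powr_minus_divide)
    moreover have "(ek k powr (1 - q) / (1 - q)) * J / ek k = (ek k powr (1 - q) / ek k) * (J / (1 - q))" by simp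
    ultimately show ?thesis by (simp add: w_def[abs_def])
  qed
  define M where "M = form u bdist - pairing u bdist + 1"
  have "eventually (\<lambda>k. lam * ((Gam (\<lambda>x. u x + ek k * bdist x) - Gam u) / ek k) \<le> M) sequentially"
    unfolding M_def by (rule stable_quotient[OF st bdist_W bdist_nonneg]) simp
  \<comment> \<open>Multiplying by \<open>ek k powr q\<close> moves the blow-up to the right-hand
    side, which now tends to 0.\<close>
  hence ev: "eventually (\<lambda>k. lam * (J / (1 - q)) \<le> M * ek k powr q) sequentially"
  proof eventually_elim
    case (elim k)
    have e0: "0 < ek k" by (rule ek)
    have "lam * (ek k powr (- q) * (J / (1 - q))) \<le> M"
      using mult_left_mono[OF lower[of k], of lam] lam elim by linarith
    hence "lam * (ek k powr (- q) * (J / (1 - q))) * ek k powr q \<le> M * ek k powr q" by (intro mult_right_mono) auto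
    moreover have "ek k powr (- q) * ek k powr q = 1" using e0 by (simp flip: powr_add)
    ultimately show ?case by (metis mult.assoc mult.commute mult.right_neutral)
  qed
  have "(\<lambda>k. M * ek k powr q) \<longlonglongrightarrow> M * 0 powr q"
    using q ek by (intro tendsto_mult tendsto_const tendsto_powr') (auto intro: always_eventually less_imp_le)
  hence "lam * (J / (1 - q)) \<le> M * 0 powr q" using ev by (intro tendsto_lowerbound[OF _ _ trivial_limit_sequentially])
  hence "lam * (J / (1 - q)) \<le> 0" by simp
  hence "J = 0" using J0 lam q1 by (simp add: mult_le_0_iff divide_le_0_iff)
  hence "AE x in lborel. f x = 0"
    unfolding J_def using integral_nonneg_eq_0_iff_AE[OF fi] by (simp add: f_def)
  thus ?thesis
  proof eventually_elim
    case (elim x)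
    show ?case
    proof
      assume x: "x \<in> \<Omega>"
      hence "bdist x \<noteq> 0" using bdist_pos_iff[of x] by simp
      hence "x \<notin> N" using elim by (auto simp: f_def)
      thus "0 < u x" using x u0[of x] by (simp add: N_def less_le)
    qed
  qed
qed

text \<open>The difference quotients of \<open>g\<close> are nonnegative for an upward perturbation
  and converge pointwise where \<open>u > 0\<close>. Fatou with the bound of
  \<open>stable_quotient\<close> thus gives the inequality and the integrability of the singular
  integrand together.\<close>

lemma stable_inequality:
  assumes st: "stable u" and \<psi>: "\<psi> \<in> W" "\<And>x. 0 \<le> \<psi> x"
  shows "integrable lborel (\<lambda>x. u x powr (- q) * \<psi> x)"
    "lam * (\<integral>x. u x powr (- q) * \<psi> x \<partial>lborel) + pairing u \<psi> \<le> form u \<psi>"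
proof -
  have uP: "u \<in> P" using st by (simp add: stable_def)
  have u0: "0 \<le> u x" for x using P_nonneg[OF uP] .
  have [measurable]: "u \<in> borel_measurable borel" "\<psi> \<in> borel_measurable borel"
    using W_measurable P_W[OF uP] \<psi> by auto
  define Q where "Q k x = (g (u x + ek k * \<psi> x) - g (u x)) / ek k" for k x
  have wP: "(\<lambda>x. u x + ek k * \<psi> x) \<in> P" for k by (rule perturb(1)[OF uP \<psi>])
  have Qi: "integrable lborel (Q k)" for k
    unfolding Q_def using Gam_integrable[OF wP] Gam_integrable[OF uP] by simp
  have Qint: "(\<integral>x. Q k x \<partial>lborel) = (Gam (\<lambda>x. u x + ek k * \<psi> x) - Gam u) / ek k" for k
    unfolding Q_def Gam_def using Gam_integrable[OF wP] Gam_integrable[OF uP] by simp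
  have Qn: "AE x in lborel. 0 \<le> Q k x" for k
    using stable_positive[OF st]
  proof eventually_elim
    case (elim x)
    show ?case
    proof (cases "x \<in> \<Omega>")
      case True
      thus ?thesis using elim g_mono[of "u x" "u x + ek k * \<psi> x"] ek(1)[of k] \<psi>(2)[of x] by (simp add: Q_def)
    qed (simp add: Q_def W_zero[OF P_W[OF uP]] W_zero[OF \<psi>(1)])
  qed
  have Ql: "AE x in lborel. (\<lambda>k. Q k x) \<longlonglongrightarrow> u x powr (- q) * \<psi> x"
    using stable_positive[OF st]
  proof eventually_elim
    case (elim x)
    show ?case
    proof (cases "x \<in> \<Omega>")
      case True
      hence ux: "0 < u x" using elim by simp
      have "(g has_real_derivative u x powr (- q)) (at (u x + 0 * \<psi> x))" using g_has_derivative[OF ux] by simp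
      hence "((\<lambda>t. g (u x + t * \<psi> x)) has_real_derivative u x powr (- q) * \<psi> x) (at 0)"
        by (rule DERIV_chain2) (auto intro!: derivative_eq_intros)
      hence "((\<lambda>t. (g (u x + t * \<psi> x) - g (u x)) / t) \<longlongrightarrow> u x powr (- q) * \<psi> x) (at 0)"
        by (simp add: DERIV_def)
      moreover have "filterlim ek (at 0) sequentially"
        using ek by (auto simp: filterlim_at less_imp_neq[symmetric])
      ultimately show ?thesis unfolding Q_def by (rule filterlim_compose)
    qed (simp add: Q_def W_zero[OF P_W[OF uP]] W_zero[OF \<psi>(1)])
  qed
  have *: "integrable lborel (\<lambda>x. u x powr (- q) * \<psi> x) \<and>
      lam * (\<integral>x. u x powr (- q) * \<psi> x \<partial>lborel) \<le> form u \<psi> - pairing u \<psi> + \<epsilon>" if \<epsilon>: "0 < \<epsilon>" for \<epsilon>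
  proof -
    define L where "L = (form u \<psi> - pairing u \<psi> + \<epsilon>) / lam"
    obtain N where N: "\<And>k. k \<ge> N \<Longrightarrow> lam * (\<integral>x. Q k x \<partial>lborel) \<le> form u \<psi> - pairing u \<psi> + \<epsilon>"
      using stable_quotient[OF st \<psi> \<epsilon>] unfolding Qint eventually_sequentially by blast
    have bd: "(\<integral>x. Q (k + N) x \<partial>lborel) \<le> L" for k
      using N[of "k + N"] lam by (simp add: L_def pos_le_divide_eq mult.commute)
    have l: "AE x in lborel. (\<lambda>k. Q (k + N) x) \<longlonglongrightarrow> u x powr (- q) * \<psi> x"
      using Ql by eventually_elim (rule LIMSEQ_ignore_initial_segment)
    have me: "(\<lambda>x. u x powr (- q) * \<psi> x) \<in> borel_measurable lborel" by measurable
    note F = Fatou_integral[OF me Qi Qn l bd]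
    have "lam * (\<integral>x. u x powr (- q) * \<psi> x \<partial>lborel) \<le> lam * L" using F(2) lam by (intro mult_left_mono) auto
    also have "\<dots> = form u \<psi> - pairing u \<psi> + \<epsilon>" using lam by (simp add: L_def)
    finally show ?thesis using F(1) by simp
  qed
  show "integrable lborel (\<lambda>x. u x powr (- q) * \<psi> x)" using *[of 1] by simp
  have "lam * (\<integral>x. u x powr (- q) * \<psi> x \<partial>lborel) \<le> form u \<psi> - pairing u \<psi>"
  proof (rule field_le_epsilon)
    fix \<epsilon> :: real assume "0 < \<epsilon>"
    thus "lam * (\<integral>x. u x powr (- q) * \<psi> x \<partial>lborel) \<le> form u \<psi> - pairing u \<psi> + \<epsilon>" using * by blast
  qed
  thus "lam * (\<integral>x. u x powr (- q) * \<psi> x \<partial>lborel) + pairing u \<psi> \<le> form u \<psi>" by simp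
qed

lemma stable_singular_integrable:
  assumes st: "stable u" and \<phi>: "\<phi> \<in> W"
  shows "integrable lborel (\<lambda>x. u x powr (- q) * \<phi> x)"
proof (rule Bochner_Integration.integrable_bound[OF stable_inequality(1)[OF st W_abs(1)[OF \<phi>]]])
  have "u \<in> W" using st P_W by (simp add: stable_def)
  thus "(\<lambda>x. u x powr (- q) * \<phi> x) \<in> borel_measurable lborel"
    using W_measurable[of u] W_measurable[OF \<phi>] by measurable
qed (auto simp: abs_mult)

text \<open>Testing with \<open>max 0 (u + \<epsilon> \<phi>)\<close>: by the Nehari identity the terms of order one cancel, and the negative part of
  \<open>u + \<epsilon> \<phi>\<close> contributes \<open>o(\<epsilon>)\<close> because it lives where \<open>u < \<epsilon> \<bar>\<phi>\<bar>\<close>.\<close>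

lemma stable_one_sided:
  assumes st: "stable u" and \<phi>: "\<phi> \<in> W"
  shows "lam * (\<integral>x. u x powr (- q) * \<phi> x \<partial>lborel) + pairing u \<phi> \<le> form u \<phi>"
proof -
  have uP: "u \<in> P" and Neh: "E u - c u = lam * b u" using st by (auto simp: stable_def)
  note uW = P_W[OF uP]
  have u0: "0 \<le> u x" for x using P_nonneg[OF uP] .
  have [measurable]: "u \<in> borel_measurable borel" "\<phi> \<in> borel_measurable borel"
    using W_measurable uW \<phi> by auto
  define J where "J \<psi> = (\<integral>x. u x powr (- q) * \<psi> x \<partial>lborel)" for \<psi>
  have Ju: "J u = b u"
  proof -
    have "AE x in lborel. u x powr (- q) * u x = u x powr (1 - q)"
      using stable_positive[OF st]
    proof eventually_elim
      case (elim x)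
      show ?case
      proof (cases "x \<in> \<Omega>")
        case True
        thus ?thesis using elim powr_add[of "u x" "- q" 1] by simp
      qed (simp add: W_zero[OF uW])
    qed
    thus ?thesis unfolding J_def b_def by (intro integral_cong_AE) auto
  qed
  have Jadd: "J (\<lambda>x. \<psi> x + t * \<zeta> x) = J \<psi> + t * J \<zeta>" if "\<psi> \<in> W" "\<zeta> \<in> W" for \<psi> \<zeta> t
    unfolding J_def using stable_singular_integrable[OF st] that by (simp add: distrib_left mult.left_commute)
  \<comment> \<open>The indicator of the pairs at which the negative part of
    \<open>u + ek k * \<phi>\<close> can contribute.\<close>
  define S where "S k z = (if u (fst z) + ek k * \<phi> (fst z) < 0 \<or> u (snd z) + ek k * \<phi> (snd z) < 0 then 1 else 0 :: real)" for k z
  define R where "R k = (\<integral>z. \<bar>dif u z\<bar> powr (p - 1) * \<bar>dif \<phi> z\<bar> * S k z \<partial>\<mu>)" for k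
  have Sm: "S k \<in> borel_measurable \<mu>" for k
  proof -
    have fs: "fst \<in> borel_measurable (borel :: ('a \<times> 'a) measure)" "snd \<in> borel_measurable (borel :: ('a \<times> 'a) measure)"
      by (auto intro!: borel_measurable_continuous_onI continuous_intros)
    have m: "(\<lambda>x. u x + ek k * \<phi> x) \<in> borel_measurable borel" by measurable
    note [measurable] = measurable_compose[OF fs(1) m] measurable_compose[OF fs(2) m]
    have "S k \<in> borel_measurable borel" unfolding S_def by measurable
    thus ?thesis using measurable_cong_sets[OF sets_\<mu> refl] by blast
  qed
  have dm: "dif u \<in> borel_measurable \<mu>" "dif \<phi> \<in> borel_measurable \<mu>" by (intro dif_measurable_\<mu>; measurable)+
  have Rm: "(\<lambda>z. \<bar>dif u z\<bar> powr (p - 1) * \<bar>dif \<phi> z\<bar> * S k z) \<in> borel_measurable \<mu>" for k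
    using Sm dm by measurable
  have Rdom: "AE z in \<mu>. norm (\<bar>dif u z\<bar> powr (p - 1) * \<bar>dif \<phi> z\<bar> * S k z) \<le> \<bar>dif u z\<bar> powr (p - 1) * \<bar>dif \<phi> z\<bar>" for k
    by (intro AE_I2) (simp add: S_def abs_mult)
  have ev: "AE x in lborel. eventually (\<lambda>k. 0 \<le> u x + ek k * \<phi> x) sequentially"
    using stable_positive[OF st]
  proof eventually_elim
    case (elim x)
    show ?case
    proof (cases "x \<in> \<Omega>")
      case True
      have "(\<lambda>k. u x + ek k * \<phi> x) \<longlonglongrightarrow> u x + 0 * \<phi> x" by (intro tendsto_intros ek)
      hence "eventually (\<lambda>k. 0 < u x + ek k * \<phi> x) sequentially" using elim True by (intro order_tendstoD(1)) auto
      thus ?thesis by eventually_elim simp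
    qed (simp add: W_zero[OF uW] W_zero[OF \<phi>])
  qed
  \<comment> \<open>Positivity of \<open>u\<close> makes \<open>S k z\<close> eventually 0 for
    almost every pair, and the integrand is dominated independently of \<open>k\<close>.\<close>
  have "R \<longlonglongrightarrow> integral\<^sup>L \<mu> (\<lambda>z. 0)"
    unfolding R_def[abs_def]
  proof (rule integral_dominated_convergence[OF _ Rm form_integrable(2)[OF uW \<phi>] _ Rdom])
    show "AE z in \<mu>. (\<lambda>k. \<bar>dif u z\<bar> powr (p - 1) * \<bar>dif \<phi> z\<bar> * S k z) \<longlonglongrightarrow> 0"
      using AE_\<mu>[OF ev]
    proof eventually_elim
      case (elim z)
      from elim[THEN conjunct1] elim[THEN conjunct2]
      have "eventually (\<lambda>k. \<bar>dif u z\<bar> powr (p - 1) * \<bar>dif \<phi> z\<bar> * S k z = 0) sequentially"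
        by eventually_elim (simp add: S_def not_less)
      thus ?case by (rule tendsto_eventually)
    qed
  qed simp
  hence R0: "R \<longlonglongrightarrow> 0" by simp
  have "J (\<lambda>x. \<phi> x) * lam + pairing u \<phi> - form u \<phi> \<le> R k" for k
  proof -
    have e0: "0 < ek k" by (rule ek)
    define n where "n x = max 0 (- (u x + ek k * \<phi> x))" for x
    define v where "v x = u x + ek k * \<phi> x" for x
    have vW: "v \<in> W" unfolding v_def[abs_def] by (intro W_add W_cmult uW \<phi>)
    have nW: "n \<in> W"
      using W_pos_part(1)[OF W_cmult(1)[OF vW, of "- 1"]] by (simp add: n_def[abs_def] v_def[abs_def])
    have n0: "0 \<le> n x" for x by (simp add: n_def)
    \<comment> \<open>Adding its negative part turns \<open>v\<close> into \<open>max 0 v\<close>,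
      an admissible test function; the factor 1 matches the shape of the additivity lemmas.\<close>
    have \<Psi>: "(\<lambda>x. v x + 1 * n x) \<in> W" using W_add[OF vW nW] by simp
    have "lam * J (\<lambda>x. v x + 1 * n x) + pairing u (\<lambda>x. v x + 1 * n x) \<le> form u (\<lambda>x. v x + 1 * n x)"
      unfolding J_def by (rule stable_inequality(2)[OF st \<Psi>]) (simp add: n_def v_def max_def)
    hence 1: "lam * (J v + J n) + (pairing u v + pairing u n) \<le> form u v + form u n"
      unfolding Jadd[OF vW nW] pairing_add[OF uW vW nW] form_add[OF uW vW nW] by simp
    have "0 \<le> lam * J n" unfolding J_def using lam n0 by (intro mult_nonneg_nonneg integral_nonneg_AE) auto
    moreover have "0 \<le> pairing u n" by (intro pairing_nonneg u0 n0)
    moreover have "J v = b u + ek k * J \<phi>" unfolding v_def[abs_def] Jadd[OF uW \<phi>] Ju ..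
    moreover have "pairing u v = c u + ek k * pairing u \<phi>"
      unfolding v_def[abs_def] pairing_add[OF uW uW \<phi>] pairing_self ..
    moreover have "form u v = E u + ek k * form u \<phi>"
      unfolding v_def[abs_def] form_add[OF uW uW \<phi>] form_self ..
    ultimately have 2: "ek k * (J \<phi> * lam + pairing u \<phi> - form u \<phi>) \<le> form u n"
      using 1 Neh by (simp add: algebra_simps)
    have "form u n \<le> (\<integral>z. ek k * (\<bar>dif u z\<bar> powr (p - 1) * \<bar>dif \<phi> z\<bar> * S k z) \<partial>\<mu>)"
      unfolding form_def
    proof (rule integral_mono)
      show "integrable \<mu> (\<lambda>z. \<bar>dif u z\<bar> powr (p - 2) * dif u z * dif n z)" by (rule form_integrable[OF uW nW])
      show "integrable \<mu> (\<lambda>z. ek k * (\<bar>dif u z\<bar> powr (p - 1) * \<bar>dif \<phi> z\<bar> * S k z))"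
        using integrable_dominated_convergence2[OF _ Rm form_integrable(2)[OF uW \<phi>] _ Rdom, of "\<lambda>z. 0"]
          Bochner_Integration.integrable_bound[OF form_integrable(2)[OF uW \<phi>] Rm]
          Rdom[of k] by (intro integrable_mult_right) (auto elim!: eventually_mono)
      fix z
      have "dif u z * dif n z \<le> ek k * (\<bar>dif u z\<bar> * \<bar>dif \<phi> z\<bar>) * S k z"
        unfolding dif_def n_def S_def using neg_part_product_le[of "ek k"] e0 by simp
      hence "\<bar>dif u z\<bar> powr (p - 2) * (dif u z * dif n z) \<le> \<bar>dif u z\<bar> powr (p - 2) * (ek k * (\<bar>dif u z\<bar> * \<bar>dif \<phi> z\<bar>) * S k z)"
        by (intro mult_left_mono) auto
      also have "\<dots> = ek k * ((\<bar>dif u z\<bar> powr (p - 2) * \<bar>dif u z\<bar>) * \<bar>dif \<phi> z\<bar> * S k z)" by (simp add: mult_ac)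
      also have "\<bar>dif u z\<bar> powr (p - 2) * \<bar>dif u z\<bar> = \<bar>dif u z\<bar> powr (p - 1)" by (rule abs_powr_mult_abs(1)[OF p])
      finally show "\<bar>dif u z\<bar> powr (p - 2) * dif u z * dif n z \<le> ek k * (\<bar>dif u z\<bar> powr (p - 1) * \<bar>dif \<phi> z\<bar> * S k z)"
        by (simp add: mult.assoc)
    qed
    also have "\<dots> = ek k * R k" by (simp add: R_def)
    finally have "ek k * (J \<phi> * lam + pairing u \<phi> - form u \<phi>) \<le> ek k * R k" using 2 by linarith
    thus ?thesis using e0 by simp
  qed
  hence "J (\<lambda>x. \<phi> x) * lam + pairing u \<phi> - form u \<phi> \<le> 0" using R0 by (intro LIMSEQ_le_const) auto
  thus ?thesis by (simp add: J_def mult.commute)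
qed

lemma stable_equation:
  assumes st: "stable u" and \<phi>: "\<phi> \<in> W"
  shows "form u \<phi> = lam * (\<integral>x. u x powr (- q) * \<phi> x \<partial>lborel) + pairing u \<phi>"
proof (rule antisym)
  have uW: "u \<in> W" using st P_W by (simp add: stable_def)
  have "lam * (\<integral>x. u x powr (- q) * (- 1 * \<phi> x) \<partial>lborel) + pairing u (\<lambda>x. - 1 * \<phi> x) \<le> form u (\<lambda>x. - 1 * \<phi> x)"
    by (rule stable_one_sided[OF st W_cmult(1)[OF \<phi>]])
  moreover have "pairing u (\<lambda>x. - 1 * \<phi> x) = - pairing u \<phi>" by (simp add: pairing_def)
  moreover have "form u (\<lambda>x. - 1 * \<phi> x) = - form u \<phi>"
  proof -
    have "dif (\<lambda>x. - 1 * \<phi> x) z = - dif \<phi> z" for z by (simp add: dif_def)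
    thus ?thesis by (simp add: form_def)
  qed
  ultimately show "form u \<phi> \<le> lam * (\<integral>x. u x powr (- q) * \<phi> x \<partial>lborel) + pairing u \<phi>" by simp
qed (rule stable_one_sided[OF st \<phi>])

end

subsection \<open>Weak solutions\<close>

lemma AE_lebesgue: "(AE x in lebesgue. P x) \<longleftrightarrow> (AE x in lborel. P x)"
  for P :: "'a::euclidean_space \<Rightarrow> bool"
  by (rule AE_completion_iff)

lemma borel_measurable_lebesgue:
  fixes f :: "'a::euclidean_space \<Rightarrow> 'b::topological_space"
  shows "f \<in> borel_measurable borel \<Longrightarrow> f \<in> borel_measurable lebesgue"
  by (rule measurable_completion) simp

lemma G_measurable [measurable]: "G q \<in> borel_measurable borel"
proof (cases "q = 1")
  case True
  have "(\<lambda>x::real. if x = 0 then - \<infinity> else ereal (ln \<bar>x\<bar>)) \<in> borel_measurable borel" by measurable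
  thus ?thesis using True by (simp add: G_def[abs_def])
next
  case False
  have "(\<lambda>x::real. ereal (\<bar>x\<bar> powr (1 - q) / (1 - q))) \<in> borel_measurable borel" by measurable
  thus ?thesis using False by (simp add: G_def[abs_def])
qed

lemma nn_integral_ereal_eq:
  fixes F :: "'a::euclidean_space \<Rightarrow> ereal"
  assumes zero: "\<forall>x. x \<notin> A \<longrightarrow> f x = 0" and eq: "AE x in lborel. x \<in> A \<longrightarrow> F x = ereal (f x)"
  shows "(\<integral>\<^sup>+x\<in>A. e2ennreal (F x) \<partial>lebesgue) = (\<integral>\<^sup>+x. ennreal (f x) \<partial>lborel)"
    "(\<integral>\<^sup>+x\<in>A. e2ennreal (- F x) \<partial>lebesgue) = (\<integral>\<^sup>+x. ennreal (- f x) \<partial>lborel)"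
    "(\<integral>\<^sup>+x\<in>A. e2ennreal \<bar>F x\<bar> \<partial>lebesgue) = (\<integral>\<^sup>+x. ennreal \<bar>f x\<bar> \<partial>lborel)"
proof -
  have *: "AE x in lborel. h (F x) * indicator A x = h' (f x)"
    if "\<And>r. h (ereal r) = h' r" "h' 0 = 0"
    for h :: "ereal \<Rightarrow> ennreal" and h'
    using eq by eventually_elim (use that zero in \<open>auto simp: indicator_def\<close>)
  show "(\<integral>\<^sup>+x\<in>A. e2ennreal (F x) \<partial>lebesgue) = (\<integral>\<^sup>+x. ennreal (f x) \<partial>lborel)"
    unfolding nn_integral_completion by (rule nn_integral_cong_AE, rule *[of "\<lambda>x. e2ennreal (x)" "\<lambda>x. ennreal (x)"]) simp_all
  show "(\<integral>\<^sup>+x\<in>A. e2ennreal (- F x) \<partial>lebesgue) = (\<integral>\<^sup>+x. ennreal (- f x) \<partial>lborel)"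
    unfolding nn_integral_completion by (rule nn_integral_cong_AE, rule *[of "\<lambda>x. e2ennreal (- x)" "\<lambda>x. ennreal (- x)"]) simp_all
  show "(\<integral>\<^sup>+x\<in>A. e2ennreal \<bar>F x\<bar> \<partial>lebesgue) = (\<integral>\<^sup>+x. ennreal \<bar>f x\<bar> \<partial>lborel)"
    unfolding nn_integral_completion by (rule nn_integral_cong_AE, rule *[of "\<lambda>x. e2ennreal \<bar>x\<bar>" "\<lambda>x. ennreal \<bar>x\<bar>"]) simp_all
qed

lemma ext_integral_eq:
  fixes F :: "'a::euclidean_space \<Rightarrow> ereal"
  assumes f: "integrable lborel f" and zero: "\<forall>x. x \<notin> A \<longrightarrow> f x = 0"
    and eq: "AE x in lborel. x \<in> A \<longrightarrow> F x = ereal (f x)"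
  shows "ext_integral A F = ereal (\<integral>x. f x \<partial>lborel)"
proof -
  have 1: "(\<integral>\<^sup>+x. ennreal (f x) \<partial>lborel) \<noteq> \<infinity>" "(\<integral>\<^sup>+x. ennreal (- f x) \<partial>lborel) \<noteq> \<infinity>"
    using f unfolding real_integrable_def by blast+
  obtain x where x: "0 \<le> x" "(\<integral>\<^sup>+x. ennreal (f x) \<partial>lborel) = ennreal x" using 1(1) by (cases "\<integral>\<^sup>+x. ennreal (f x) \<partial>lborel") auto
  obtain y where y: "0 \<le> y" "(\<integral>\<^sup>+x. ennreal (- f x) \<partial>lborel) = ennreal y" using 1(2) by (cases "\<integral>\<^sup>+x. ennreal (- f x) \<partial>lborel") auto
  note xy = x(2,1) y(2,1)
  have "(\<integral>x. f x \<partial>lborel) = x - y" using real_lebesgue_integral_def[OF f] xy by simp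
  moreover have "ext_integral A F = ereal (x - y)"
    unfolding ext_integral_def nn_integral_ereal_eq(1,2)[of A f F, OF zero eq] xy(1,3) using xy(2,4) by (simp add: enn2ereal_ennreal)
  ultimately show ?thesis by simp
qed

lemma ext_integral_infinite:
  fixes f :: "'a::euclidean_space \<Rightarrow> real"
  assumes f: "f \<in> borel_measurable borel" "\<not> integrable lborel f" and zero: "\<forall>x. x \<notin> A \<longrightarrow> f x = 0" and nonneg: "\<And>x. 0 \<le> f x"
  shows "ext_integral A (\<lambda>x. ereal (f x)) = \<infinity>"
proof -
  have "AE x in lborel. x \<in> A \<longrightarrow> ereal (f x) = ereal (f x)" by simp
  note * = nn_integral_ereal_eq(1,2)[of A f "\<lambda>x. ereal (f x)", OF zero this]
  have z: "(\<integral>\<^sup>+x. ennreal (- f x) \<partial>lborel) = 0" using nonneg by (simp add: ennreal_neg)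
  have i: "(\<integral>\<^sup>+x. ennreal (f x) \<partial>lborel) = \<infinity>"
    using f z unfolding real_integrable_def by force
  show ?thesis unfolding ext_integral_def * i z by simp
qed

section \<open>Passage between the working spaces and the stated definitions\<close>

locale vector_singular = singular p s \<Omega> q for p s :: real and \<Omega> :: "(real^'n) set" and q :: real
begin

lemma crit_exp_eq: "crit_exp CARD('n) p s = pstar"
  by (simp add: crit_exp_def pstar_def)

text \<open>The function vanishes off \<open>Qset \<Omega>\<close>, so the indicator may be dropped,
  and a Borel function has the same integral for Lebesgue measure and its completion; the kernel is
  then the density of \<mu>.\<close>

lemma kernel_lebesgue:
  assumes f: "f \<in> borel_measurable borel" and zero: "\<And>z. z \<notin> Qset \<Omega> \<Longrightarrow> f z = 0"
  shows "integrable \<mu> f \<Longrightarrow> set_integrable lebesgue (Qset \<Omega>) (\<lambda>z. f z / norm (fst z - snd z) powr (real CARD('n) + s * p))"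
    "(LINT z:Qset \<Omega>|lebesgue. f z / norm (fst z - snd z) powr (real CARD('n) + s * p)) = (\<integral>z. f z \<partial>\<mu>)"
proof -
  define h where "h z = 1 / norm (fst z - snd z) powr (real CARD('n) + s * p)" for z :: "(real^'n) \<times> (real^'n)"
  have h: "h \<in> borel_measurable lborel" "\<And>z. 0 \<le> h z" and \<mu>h: "\<mu> = density lborel (\<lambda>z. ennreal (h z))"
    using kernel_measurable by (simp_all add: h_def[abs_def] \<mu>_def)
  have eq: "indicator (Qset \<Omega>) z *\<^sub>R (f z / norm (fst z - snd z) powr (real CARD('n) + s * p)) = h z *\<^sub>R f z" for z
    using zero[of z] by (cases "z \<in> Qset \<Omega>") (simp_all add: h_def)
  have m: "(\<lambda>z. h z *\<^sub>R f z) \<in> borel_measurable lborel" using f h by simp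
  have f': "f \<in> borel_measurable lborel" using f by simp
  show "set_integrable lebesgue (Qset \<Omega>) (\<lambda>z. f z / norm (fst z - snd z) powr (real CARD('n) + s * p))" if "integrable \<mu> f"
    unfolding set_integrable_def eq integrable_completion[OF m] using that unfolding \<mu>h
    by (subst (asm) integrable_density[OF f' h(1)]) (use h in auto)
  show "(LINT z:Qset \<Omega>|lebesgue. f z / norm (fst z - snd z) powr (real CARD('n) + s * p)) = (\<integral>z. f z \<partial>\<mu>)"
    unfolding set_lebesgue_integral_def eq integral_completion[OF m] \<mu>h
    by (subst integral_density[OF f' h(1)]) (use h in auto)
qed

lemma dif_Qset: "u \<in> W \<Longrightarrow> z \<notin> Qset \<Omega> \<Longrightarrow> dif u z = 0"
  by (cases z) (auto simp: Qset_def dif_def W_zero)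

lemma energy_eq:
  assumes u: "u \<in> W" shows "energy p s \<Omega> u = ennreal (E u)"
proof -
  define h where "h z = 1 / norm (fst z - snd z) powr (real CARD('n) + s * p)" for z :: "(real^'n) \<times> (real^'n)"
  have h: "(\<lambda>z. ennreal (h z)) \<in> borel_measurable lborel" and \<mu>h: "\<mu> = density lborel (\<lambda>z. ennreal (h z))"
    using kernel_measurable by (simp_all add: h_def[abs_def] \<mu>_def)
  have m: "(\<lambda>z. ennreal (\<bar>dif u z\<bar> powr p)) \<in> borel_measurable lborel"
    using dif_measurable[OF W_measurable[OF u]] by simp
  have "energy p s \<Omega> u = (\<integral>\<^sup>+z. ennreal (h z) * ennreal (\<bar>dif u z\<bar> powr p) \<partial>lborel)"
    unfolding energy_def nn_integral_completion
  proof (intro nn_integral_cong)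
    fix z :: "(real^'n) \<times> (real^'n)"
    show "ennreal (\<bar>u (fst z) - u (snd z)\<bar> powr p / norm (fst z - snd z) powr (real CARD('n) + s * p)) * indicator (Qset \<Omega>) z =
      ennreal (h z) * ennreal (\<bar>dif u z\<bar> powr p)"
      using dif_Qset[OF u, of z] p
      by (cases "z \<in> Qset \<Omega>") (auto simp: dif_def h_def ennreal_mult[symmetric])
  qed
  also have "\<dots> = (\<integral>\<^sup>+z. ennreal (\<bar>dif u z\<bar> powr p) \<partial>\<mu>)"
    unfolding \<mu>h by (rule nn_integral_density[OF h m, symmetric])
  finally show ?thesis using E_nn[OF u] by simp
qed

lemma X0_norm_eq:
  assumes u: "u \<in> W" shows "X0_norm p s \<Omega> u powr p = E u"
  using p E_nonneg[of u] by (simp add: X0_norm_def energy_eq[OF u] powr_powr)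

text \<open>Finite energy gives membership in L^p by \<open>Lr_bound\<close>, since
  \<open>p < pstar\<close>.\<close>

lemma W_X0:
  assumes u: "u \<in> W" shows "u \<in> X0 p s \<Omega>"
proof -
  obtain C where "\<And>v. v \<in> W \<Longrightarrow> E v \<le> E u \<Longrightarrow> integrable lborel (\<lambda>x. \<bar>v x\<bar> powr p)"
    using Lr_bound[of p "E u"] pstar_gt p by auto
  hence "integrable lborel (\<lambda>x. \<bar>u x\<bar> powr p)" using u by simp
  hence "integrable lebesgue (\<lambda>x. \<bar>u x\<bar> powr p)" by (subst integrable_completion) auto
  moreover have eq: "indicator \<Omega> x *\<^sub>R (\<bar>u x\<bar> powr p) = \<bar>u x\<bar> powr p" for x
    using W_zero[OF u, of x] p by (cases "x \<in> \<Omega>") simp_all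
  ultimately have "set_integrable lebesgue \<Omega> (\<lambda>x. \<bar>u x\<bar> powr p)" unfolding set_integrable_def eq by simp
  thus ?thesis using u energy_eq[OF u] borel_measurable_lebesgue[OF W_measurable[OF u]]
    by (simp add: X0_def W_zero)
qed

lemma G_eq:
  assumes u: "u \<in> P" shows "AE x in lborel. x \<in> \<Omega> \<longrightarrow> G q (u x) = ereal (g (u x))"
proof (cases "q = 1")
  case True
  have G1: "G q y = ereal (g y)" if "0 < y" for y unfolding g_ln[OF True] G_def using True that by simp
  from P_pos[OF u True] show ?thesis by eventually_elim (blast intro: G1)
next
  case False
  thus ?thesis using P_nonneg[OF u] by (simp add: G_def g_def)
qed

lemma g_zero_outside: "u \<in> P \<Longrightarrow> \<forall>x. x \<notin> \<Omega> \<longrightarrow> g (u x) = 0"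
  by (simp add: W_zero[OF P_W])

lemma P_Xplusq:
  assumes u: "u \<in> P" shows "u \<in> Xplusq p s q \<Omega>"
proof -
  have [measurable]: "u \<in> borel_measurable borel" by (rule W_measurable[OF P_W[OF u]])
  have [measurable]: "\<Omega> \<in> sets borel" using \<Omega> by simp
  have "(\<lambda>x. if x \<in> \<Omega> then G q (u x) else 0) \<in> borel_measurable borel" by measurable
  hence "(\<lambda>x. if x \<in> \<Omega> then G q (u x) else 0) \<in> borel_measurable lebesgue" by (rule borel_measurable_lebesgue)
  moreover have "(\<integral>\<^sup>+x\<in>\<Omega>. e2ennreal \<bar>G q (u x)\<bar> \<partial>lebesgue) < \<infinity>"
    using Gam_integrable[OF u] unfolding nn_integral_ereal_eq(3)[of \<Omega> "\<lambda>x. g (u x)" "\<lambda>x. G q (u x)", OF g_zero_outside[OF u] G_eq[OF u]]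
    by (simp add: integrable_iff_bounded)
  ultimately have "ext_L1 \<Omega> (\<lambda>x. G q (u x))" by (simp add: ext_L1_def)
  thus ?thesis using W_X0[OF P_W[OF u]] P_nontrivial[OF u] P_nonneg[OF u]
    by (simp add: Xplusq_def Xplus_def AE_lebesgue)
qed

lemma I_fun_eq:
  assumes u: "u \<in> P" and a: "0 < a"
  shows "integrable lborel (\<lambda>x. \<bar>u x\<bar> powr (a + 1)) \<Longrightarrow>
      I_fun p s q a \<Omega> l u = ereal (E u / p - l * Gam u - (\<integral>x. \<bar>u x\<bar> powr (a + 1) \<partial>lborel) / (a + 1))"
    "\<not> integrable lborel (\<lambda>x. \<bar>u x\<bar> powr (a + 1)) \<Longrightarrow> I_fun p s q a \<Omega> l u = - \<infinity>"
proof -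
  have G: "ext_integral \<Omega> (\<lambda>x. G q (u x)) = ereal (Gam u)"
    unfolding Gam_def by (rule ext_integral_eq[OF Gam_integrable[OF u] g_zero_outside[OF u] G_eq[OF u]])
  have zero: "\<forall>x. x \<notin> \<Omega> \<longrightarrow> \<bar>u x\<bar> powr (a + 1) = 0" using W_zero[OF P_W[OF u]] by simp
  show "I_fun p s q a \<Omega> l u = ereal (E u / p - l * Gam u - (\<integral>x. \<bar>u x\<bar> powr (a + 1) \<partial>lborel) / (a + 1))"
    if int: "integrable lborel (\<lambda>x. \<bar>u x\<bar> powr (a + 1))"
  proof -
    have "ext_integral \<Omega> (\<lambda>x. ereal (\<bar>u x\<bar> powr (a + 1))) = ereal (\<integral>x. \<bar>u x\<bar> powr (a + 1) \<partial>lborel)"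
      by (rule ext_integral_eq[OF int zero]) auto
    thus ?thesis unfolding I_fun_def X0_norm_eq[OF P_W[OF u]] G by simp
  qed
  show "I_fun p s q a \<Omega> l u = - \<infinity>" if "\<not> integrable lborel (\<lambda>x. \<bar>u x\<bar> powr (a + 1))"
  proof -
    have [measurable]: "u \<in> borel_measurable borel" by (rule W_measurable[OF P_W[OF u]])
    have "(\<lambda>x. \<bar>u x\<bar> powr (a + 1)) \<in> borel_measurable borel" by measurable
    hence "ext_integral \<Omega> (\<lambda>x. ereal (\<bar>u x\<bar> powr (a + 1))) = \<infinity>"
      by (rule ext_integral_infinite) (use that zero in auto)
    thus ?thesis unfolding I_fun_def G using a by simp
  qed
qed

lemma fiber_critical_points:
  assumes u: "u \<in> P" and a: "0 < a" and two: "card (critical_points (fiber_map p s q a \<Omega> l u)) = 2"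
  shows "integrable lborel (\<lambda>x. \<bar>u x\<bar> powr (a + 1))"
    "\<exists>t>0. E u * t powr (p - 1) - l * b u * t powr (- q) - (\<integral>x. \<bar>u x\<bar> powr (a + 1) \<partial>lborel) * t powr a = 0"
proof -
  define C where "C = (\<integral>x. \<bar>u x\<bar> powr (a + 1) \<partial>lborel)"
  have scale: "\<bar>t * u x\<bar> powr (a + 1) = t powr (a + 1) * \<bar>u x\<bar> powr (a + 1)" if "0 < t" for t x
    using that by (simp add: abs_mult powr_mult)
  show int: "integrable lborel (\<lambda>x. \<bar>u x\<bar> powr (a + 1))"
  proof (rule ccontr)
    assume n: "\<not> integrable lborel (\<lambda>x. \<bar>u x\<bar> powr (a + 1))"
    \<comment> \<open>Along the whole ray the functional is \<open>-\<infinity>\<close>, which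
      \<open>real_of_ereal\<close> sends to 0. All positive \<open>t\<close> are then critical, and
      an infinite set has cardinality 0 in HOL, not 2.\<close>
    have zero: "fiber_map p s q a \<Omega> l u t = 0" if t: "0 < t" for t
    proof -
      have "\<not> integrable lborel (\<lambda>x. \<bar>t * u x\<bar> powr (a + 1))" unfolding scale[OF t] using n t by simp
      thus ?thesis unfolding fiber_map_def using I_fun_eq(2)[OF P_scale(1)[OF u t] a] by simp
    qed
    have "t \<in> critical_points (fiber_map p s q a \<Omega> l u)" if t: "0 < t" for t
    proof -
      have "((\<lambda>_. 0) has_real_derivative 0) (at t)" by simp
      moreover have "eventually (\<lambda>x. 0 = fiber_map p s q a \<Omega> l u x) (nhds t)"
        using eventually_nhds_in_open[of "{0<..}" t] t by (auto elim!: eventually_mono simp: zero)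
      ultimately have "(fiber_map p s q a \<Omega> l u has_real_derivative 0) (at t)"
        by (subst (asm) DERIV_cong_ev) auto
      thus ?thesis using t by (simp add: critical_points_def)
    qed
    hence "{0<..} \<subseteq> critical_points (fiber_map p s q a \<Omega> l u)" by auto
    hence "infinite (critical_points (fiber_map p s q a \<Omega> l u))" using infinite_Ioi finite_subset by blast
    thus False using two by simp
  qed
  obtain t where t: "t \<in> critical_points (fiber_map p s q a \<Omega> l u)" using two by fastforce
  hence t0: "0 < t" and d0: "(fiber_map p s q a \<Omega> l u has_real_derivative 0) (at t)" by (auto simp: critical_points_def)
  define F where "F r = r powr p * E u / p - l * Gam (\<lambda>x. r * u x) - r powr (a + 1) * C / (a + 1)" for r
  have eq: "fiber_map p s q a \<Omega> l u r = F r" if r: "0 < r" for r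
  proof -
    have "integrable lborel (\<lambda>x. \<bar>r * u x\<bar> powr (a + 1))" unfolding scale[OF r] using int by simp
    from I_fun_eq(1)[OF P_scale(1)[OF u r] a this]
    show ?thesis unfolding fiber_map_def F_def C_def scale[OF r] using W_cmult(2)[OF P_W[OF u], of r] r by simp
  qed
  have "(F has_real_derivative (p * t powr (p - 1) * E u / p - l * (t powr (- q) * b u) - (a + 1) * t powr (a + 1 - 1) * C / (a + 1))) (at t)"
    unfolding F_def
    by (intro DERIV_diff DERIV_cdivide DERIV_cmult DERIV_cmult_right has_real_derivative_powr t0 Gam_derivative[OF u t0])
  moreover have "eventually (\<lambda>x. fiber_map p s q a \<Omega> l u x = F x) (nhds t)"
    using eventually_nhds_in_open[of "{0<..}" t] t0 by (auto elim!: eventually_mono simp: eq)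
  hence "(F has_real_derivative 0) (at t)" using d0 by (subst (asm) DERIV_cong_ev) auto
  ultimately have "p * t powr (p - 1) * E u / p - l * (t powr (- q) * b u) - (a + 1) * t powr (a + 1 - 1) * C / (a + 1) = 0"
    by (rule DERIV_unique)
  hence "E u * t powr (p - 1) - l * b u * t powr (- q) - C * t powr a = 0" using p a by (simp add: mult_ac)
  thus "\<exists>t>0. E u * t powr (p - 1) - l * b u * t powr (- q) - (\<integral>x. \<bar>u x\<bar> powr (a + 1) \<partial>lborel) * t powr a = 0"
    using t0 by (auto simp: C_def)
qed

end

section \<open>From stable functions to weak solutions\<close>

locale vector_problem = problem p s \<Omega> q \<alpha> lam lam'
  for p s :: real and \<Omega> :: "(real^'n) set" and q \<alpha> lam lam' :: real

sublocale vector_problem \<subseteq> vector_singular ..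

context vector_problem
begin

lemma stable_weak_solution:
  assumes st: "stable u" shows "positive_weak_solution p s q \<alpha> \<Omega> lam u"
proof -
  have uP: "u \<in> P" using st by (simp add: stable_def)
  note uW = P_W[OF uP]
  define A where "A \<psi> z = \<bar>u (fst z) - u (snd z)\<bar> powr (p - 2) * (u (fst z) - u (snd z)) * (\<psi> (fst z) - \<psi> (snd z))
    / norm (fst z - snd z) powr (real CARD('n) + s * p)" for \<psi> z
  define B where "B \<psi> x = (lam * u x powr (- q) + u x powr \<alpha>) * \<psi> x" for \<psi> x
  have "set_integrable lebesgue (Qset \<Omega>) (A \<psi>) \<and> set_integrable lebesgue \<Omega> (B \<psi>) \<and>
      (LINT z:Qset \<Omega>|lebesgue. A \<psi> z) - (LINT x:\<Omega>|lebesgue. B \<psi> x) = 0" if "\<psi> \<in> test_functions \<Omega>" for \<psi>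
  proof -
    have \<psi>: "\<psi> \<in> W" by (rule test_function_W[OF that])
    define f where "f z = \<bar>dif u z\<bar> powr (p - 2) * dif u z * dif \<psi> z" for z
    have [measurable]: "dif u \<in> borel_measurable borel" "dif \<psi> \<in> borel_measurable borel"
      using uW \<psi> W_measurable dif_measurable by blast+
    have fm: "f \<in> borel_measurable borel" unfolding f_def by measurable
    have f0: "f z = 0" if "z \<notin> Qset \<Omega>" for z using dif_Qset[OF \<psi> that] by (simp add: f_def)
    have A: "A \<psi> = (\<lambda>z. f z / norm (fst z - snd z) powr (real CARD('n) + s * p))"
      by (simp add: fun_eq_iff A_def f_def dif_def)
    have fi: "integrable \<mu> f" unfolding f_def using form_integrable(1)[OF uW \<psi>] .
    have "(\<integral>z. f z \<partial>\<mu>) = form u \<psi>" by (simp add: form_def f_def)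
    hence 1: "set_integrable lebesgue (Qset \<Omega>) (A \<psi>)" "(LINT z:Qset \<Omega>|lebesgue. A \<psi> z) = form u \<psi>"
      unfolding A using kernel_lebesgue[OF fm f0] fi by auto
    have eq: "indicator \<Omega> x *\<^sub>R B \<psi> x = lam * (u x powr (- q) * \<psi> x) + \<bar>u x\<bar> powr (\<alpha> - 1) * u x * \<psi> x" for x
    proof -
      have "u x powr \<alpha> = \<bar>u x\<bar> powr (\<alpha> - 1) * u x"
        using P_nonneg[OF uP, of x] powr_mult_base[of "u x" "\<alpha> - 1"] by (simp add: mult.commute)
      thus ?thesis using W_zero[OF \<psi>, of x] by (simp add: B_def indicator_def algebra_simps)
    qed
    have int: "integrable lborel (\<lambda>x. lam * (u x powr (- q) * \<psi> x) + \<bar>u x\<bar> powr (\<alpha> - 1) * u x * \<psi> x)"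
      using stable_singular_integrable[OF st \<psi>] pairing_integrable[OF uW \<psi>] by auto
    note m = borel_measurable_integrable[OF int]
    have "(\<integral>x. lam * (u x powr (- q) * \<psi> x) + \<bar>u x\<bar> powr (\<alpha> - 1) * u x * \<psi> x \<partial>lborel) = form u \<psi>"
      using stable_singular_integrable[OF st \<psi>] pairing_integrable[OF uW \<psi>] stable_equation[OF st \<psi>]
      by (simp add: pairing_def)
    hence "set_integrable lebesgue \<Omega> (B \<psi>)" "(LINT x:\<Omega>|lebesgue. B \<psi> x) = form u \<psi>"
      unfolding set_integrable_def set_lebesgue_integral_def eq integrable_completion[OF m] integral_completion[OF m]
      using int by auto
    thus ?thesis using 1 by simp
  qed
  thus ?thesis unfolding positive_weak_solution_def Let_def AE_lebesgue A_def[symmetric] B_def[symmetric]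
    using W_X0[OF uW] stable_positive[OF st] by blast
qed

text \<open>Lets the opposite strict inequalities between \<open>e1 * E\<close> and
  \<open>e2 * c\<close> separate the two solutions as classes modulo null sets.\<close>

lemma E_c_cong:
  assumes u: "u \<in> W" and v: "v \<in> W" and eq: "AE x in lborel. u x = v x"
  shows "E u = E v" "c u = c v"
proof -
  note [measurable] = W_measurable[OF u] W_measurable[OF v]
  have "AE z in \<mu>. \<bar>dif u z\<bar> powr p = \<bar>dif v z\<bar> powr p"
    using AE_\<mu>[OF eq] by eventually_elim (auto simp: dif_def)
  thus "E u = E v" unfolding E_def
    by (intro integral_cong_AE) (use dif_measurable_\<mu>[OF W_measurable[OF u]] dif_measurable_\<mu>[OF W_measurable[OF v]] in auto)
  show "c u = c v" unfolding c_def using eq by (intro integral_cong_AE) (auto elim: eventually_mono)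
qed

lemma stable_solution:
  assumes "stable u" shows "u \<in> Xplusq p s q \<Omega>" "positive_weak_solution p s q \<alpha> \<Omega> lam u"
proof -
  have "u \<in> P" using assms by (simp add: stable_def)
  thus "u \<in> Xplusq p s q \<Omega>" by (rule P_Xplusq)
qed (rule stable_weak_solution[OF assms])

lemma one_solution: "\<exists>u\<in>Xplusq p s q \<Omega>. positive_weak_solution p s q \<alpha> \<Omega> lam u"
proof -
  obtain u where u: "stable u" "e2 * c u < e1 * E u" by (rule first_stable)
  show ?thesis using stable_solution[OF u(1)] by (intro bexI) (assumption)+
qed

lemma two_solutions:
  assumes sub: "\<alpha> < crit_exp CARD('n) p s - 1"
  shows "\<exists>u\<in>Xplusq p s q \<Omega>. \<exists>v\<in>Xplusq p s q \<Omega>.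
    positive_weak_solution p s q \<alpha> \<Omega> lam u \<and> positive_weak_solution p s q \<alpha> \<Omega> lam v \<and>
    \<not> (AE x in lebesgue. u x = v x)"
proof -
  obtain u where u: "stable u" "e2 * c u < e1 * E u" by (rule first_stable)
  have "\<alpha> + 1 < pstar" using sub unfolding crit_exp_eq by simp
  then obtain v where v: "stable v" "e1 * E v < e2 * c v" by (rule second_stable)
  have W: "u \<in> W" "v \<in> W" using u(1) v(1) P_W unfolding stable_def by blast+
  have "\<not> (AE x in lebesgue. u x = v x)"
  proof
    assume "AE x in lebesgue. u x = v x"
    hence "AE x in lborel. u x = v x" unfolding AE_lebesgue .
    note E_c_cong[OF W this]
    thus False using u(2) v(2) by simp
  qed
  thus ?thesis
    by (intro bexI[OF _ stable_solution(1)[OF u(1)]] bexI[OF _ stable_solution(1)[OF v(1)]] conjI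
      stable_solution(2) u(1) v(1))
qed

end

theorem theorem2p4:
  fixes \<Omega> :: "(real^'n) set" and p s q \<alpha> :: real
  assumes "1 < p" and "0 < s" and "s < 1" and "real CARD('n) > s * p"
    and "bounded_smooth_domain \<Omega>"
    and "0 < q" and "q \<le> 1"
    and "p - 1 < \<alpha>" and "\<alpha> \<le> crit_exp CARD('n) p s - 1"
  shows "\<forall>lam::real. 0 < lam \<and> ereal lam < Lambda1 p s q \<alpha> \<Omega> \<longrightarrow>
    (\<alpha> < crit_exp CARD('n) p s - 1 \<longrightarrow>
       (\<exists>u\<in>Xplusq p s q \<Omega>. \<exists>v\<in>Xplusq p s q \<Omega>.
          positive_weak_solution p s q \<alpha> \<Omega> lam u \<and>
          positive_weak_solution p s q \<alpha> \<Omega> lam v \<and>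
          \<not> (AE x in lebesgue. u x = v x))) \<and>
    (\<alpha> = crit_exp CARD('n) p s - 1 \<longrightarrow>
       (\<exists>u\<in>Xplusq p s q \<Omega>. positive_weak_solution p s q \<alpha> \<Omega> lam u))"
proof (intro allI impI, elim conjE)
  fix lam :: real assume lam: "0 < lam" "ereal lam < Lambda1 p s q \<alpha> \<Omega>"
  have S: "vector_singular p s \<Omega> q"
    unfolding vector_singular_def singular_def singular_axioms_def fractional_def
    using assms by (auto simp: bounded_smooth_domain_def)
  have sing: "singular p s \<Omega> q" using S unfolding vector_singular_def .
  \<comment> \<open>A parameter from the defining set lies strictly above \<open>lam\<close>, also
    when the supremum is infinite. The two critical points at \<open>lam'\<close> bound the maximum
    of every bracket from below, which is the form in which the property is transferred to
    \<open>lam\<close>.\<close>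
  obtain lam' where lam': "lam < lam'" and
    two: "\<And>u. u \<in> Xplusq p s q \<Omega> \<Longrightarrow> card (critical_points (fiber_map p s q \<alpha> \<Omega> lam' u)) = 2"
    using lam(2) unfolding Lambda1_def less_Sup_iff by auto
  have \<alpha>0: "0 < \<alpha>" using assms(1,8) by linarith
  have "problem_axioms p s \<Omega> q \<alpha> lam lam'"
  proof (rule problem_axioms.intro)
    fix u assume u: "u \<in> singular.P p s \<Omega> q"
    note * = vector_singular.fiber_critical_points[OF S u \<alpha>0 two[OF vector_singular.P_Xplusq[OF S u]]]
    show "integrable lborel (\<lambda>x. \<bar>u x\<bar> powr (\<alpha> + 1))" by (rule *(1))
    show "\<exists>t>0. fractional.E p s u * t powr (p - 1) - lam' * singular.b q u * t powr (- q)
      - (\<integral>x. \<bar>u x\<bar> powr (\<alpha> + 1) \<partial>lborel) * t powr \<alpha> = 0"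
      by (rule *(2))
  qed (use assms(8) lam(1) lam' in auto)
  hence V: "vector_problem p s \<Omega> q \<alpha> lam lam'"
    unfolding vector_problem_def by (rule problem.intro[OF sing])
  show "(\<alpha> < crit_exp CARD('n) p s - 1 \<longrightarrow>
       (\<exists>u\<in>Xplusq p s q \<Omega>. \<exists>v\<in>Xplusq p s q \<Omega>.
          positive_weak_solution p s q \<alpha> \<Omega> lam u \<and>
          positive_weak_solution p s q \<alpha> \<Omega> lam v \<and>
          \<not> (AE x in lebesgue. u x = v x))) \<and>
    (\<alpha> = crit_exp CARD('n) p s - 1 \<longrightarrow>
       (\<exists>u\<in>Xplusq p s q \<Omega>. positive_weak_solution p s q \<alpha> \<Omega> lam u))"
    using vector_problem.two_solutions[OF V] vector_problem.one_solution[OF V] by blast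
qed

end
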